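(* Let $s,t\in\mathbb Z_+$ with $H_{s,t}\neq\{0\}$, let $R>0$ and let $1\le p<\infty$. Let $f$ be a function on $\mathbb C^n$ such that the function $z\mapsto e^{\frac14|z|^2}f(z)$ belongs to $L^p(\mathbb C^n)$. If $f\times\nu_{r,j}(z)=0$ for all $z$ with $|z|=R$, all $r>0$ and all $j$ with $1\le j\le d(s,t)$, then $f=0$ almost everywhere on $\mathbb C^n$.
   Context: $\mathbb Z_+$ is the set of non-negative integers. For $s,t\in\mathbb Z_+$, $P_{s,t}$ is the space of polynomials on $\mathbb C^n$ of the form $P(z)=\sum_{|\alpha|=s}\sum_{|\beta|=t}c_{\alpha\beta}z^\alpha\bar z^\beta$, and $H_{s,t}=\{P\in P_{s,t}:\Delta P=0\}$ with $\Delta$ the standard Laplacian on $\mathbb C^n$; $d(s,t)=\dim H_{s,t}$. Fix an orthonormal basis $\{P_{st}^j:1\le j\le d(s,t)\}$ of $H_{s,t}$ (orthonormal for restrictions to $S^{2n-1}$ in $L^2(S^{2n-1})$). For $r>0$, $\mu_r$ is the normalized surface measure on the sphere $S_r(o)=\{w\in\mathbb C^n:|w|=r\}$ and $d\nu_{r,j}=P_{st}^j\,d\mu_r$. The weighted twisted spherical mean of $f\in L^1_{\mathrm{loc}}(\mathbb C^n)$ is $$f\times\nu_{r,j}(z)=\int_{S_r(o)}f(z-w)\,e^{\frac i2\mathrm{Im}(z\cdot\bar w)}P_{st}^j(w)\,d\mu_r(w),\qquad z\cdot\bar w=\sum_{i=1}^n z_i\bar w_i.$$ *)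

theory Defs
  imports "HOL-Analysis.Analysis" "HOL-Library.Function_Algebras"
begin

text \<open>Complex-valued functions as a vector space over the complex numbers.\<close>

definition cscale :: "complex \<Rightarrow> ('a \<Rightarrow> complex) \<Rightarrow> 'a \<Rightarrow> complex" where
  "cscale c f = (\<lambda>z. c * f z)"

interpretation cfun: vector_space "cscale :: complex \<Rightarrow> ('a \<Rightarrow> complex) \<Rightarrow> 'a \<Rightarrow> complex"
  by unfold_locales (auto simp: cscale_def fun_eq_iff algebra_simps)

definition partial_deriv ::
    "'a::euclidean_space \<Rightarrow> ('a \<Rightarrow> complex) \<Rightarrow> 'a \<Rightarrow> complex" where
  "partial_deriv b u x = vector_derivative (\<lambda>h. u (x + h *\<^sub>R b)) (at 0)"

text \<open>
  On \<open>complex ^ 'n\<close> the set \<open>Basis\<close> consists of the \<open>2n\<close> real coordinate directions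
  \<open>axis i 1\<close> and \<open>axis i \<i>\<close>, so this is the Laplacian of the underlying real space.
\<close>
definition laplacian :: "('a::euclidean_space \<Rightarrow> complex) \<Rightarrow> 'a \<Rightarrow> complex" where
  "laplacian u x = (\<Sum>b\<in>Basis. partial_deriv b (partial_deriv b u) x)"

definition multi_indices :: "nat \<Rightarrow> ('n::finite \<Rightarrow> nat) set" where
  "multi_indices k = {\<alpha>. (\<Sum>i\<in>UNIV. \<alpha> i) = k}"

lemma finite_multi_indices: "finite (multi_indices k :: ('n::finite \<Rightarrow> nat) set)"
proof (rule finite_subset)
  show "multi_indices k \<subseteq> (Pi\<^sub>E UNIV (\<lambda>_. {..k}) :: ('n \<Rightarrow> nat) set)"
    by (auto simp: multi_indices_def PiE_UNIV_domain intro: member_le_sum)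
  show "finite (Pi\<^sub>E UNIV (\<lambda>_. {..k}) :: ('n \<Rightarrow> nat) set)"
    by (rule finite_PiE) auto
qed

definition bihomogeneous_polys ::
    "nat \<Rightarrow> nat \<Rightarrow> (complex ^ 'n \<Rightarrow> complex) set" where
  "bihomogeneous_polys s t =
     {P. \<exists>c. P = (\<lambda>z. \<Sum>\<alpha>\<in>multi_indices s. \<Sum>\<beta>\<in>multi_indices t.
            c \<alpha> \<beta> * (\<Prod>i\<in>UNIV. z $ i ^ \<alpha> i) * (\<Prod>i\<in>UNIV. cnj (z $ i) ^ \<beta> i))}"

definition bigraded_harmonics ::
    "nat \<Rightarrow> nat \<Rightarrow> (complex ^ 'n \<Rightarrow> complex) set" where
  "bigraded_harmonics s t = {P \<in> bihomogeneous_polys s t. \<forall>z. laplacian P z = 0}"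

text \<open>
  Normalized surface measure on the sphere of radius \<open>r\<close> about the origin, as in polar
  coordinates: the measure of \<open>E\<close> is the volume of the part of the unit ball lying in the
  cone over \<open>E\<close>, divided by the volume of the unit ball. (The centre, where the radial
  projection is undefined, is a null set.) The completion is taken so that restrictions of
  Lebesgue measurable functions to almost every sphere are measurable.
\<close>
definition sphere_measure :: "real \<Rightarrow> 'a::euclidean_space measure" where
  "sphere_measure r =
     completion (distr (uniform_measure lborel (ball 0 1)) borel (\<lambda>x. (r / norm x) *\<^sub>R x))"

text \<open>\<open>P 1, \<dots>, P d\<close>, where \<open>d\<close> is the complex dimension of the space of bigraded harmonics.
  The inner product is that of the normalized surface measure of the unit sphere.\<close>
definition orthonormal_basis_harmonics ::
    "nat \<Rightarrow> nat \<Rightarrow> (nat \<Rightarrow> complex ^ 'n \<Rightarrow> complex) \<Rightarrow> bool" where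
  "orthonormal_basis_harmonics s t P \<longleftrightarrow>
     (let d = cfun.dim (bigraded_harmonics s t :: (complex ^ 'n \<Rightarrow> complex) set) in
       (\<forall>j\<in>{1..d}. P j \<in> bigraded_harmonics s t) \<and>
       (\<forall>j\<in>{1..d}. \<forall>k\<in>{1..d}.
          (LINT w|sphere_measure 1. P j w * cnj (P k w)) = (if j = k then 1 else 0)) \<and>
       cfun.span (P ` {1..d}) = bigraded_harmonics s t)"

definition hermitian_dot :: "complex ^ 'n \<Rightarrow> complex ^ 'n \<Rightarrow> complex" where
  "hermitian_dot z w = (\<Sum>i\<in>UNIV. z $ i * cnj (w $ i))"

text \<open>
  For locally integrable \<open>f\<close> and fixed \<open>z\<close> the integrand is integrable for almost every
  \<open>r > 0\<close>. At the exceptional radii the value is 0 by the convention for Bochner integrals,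
  so an equation \<open>twisted_mean f r P z = 0\<close> says that the mean vanishes if it exists.
\<close>
definition twisted_mean ::
    "(complex ^ 'n \<Rightarrow> complex) \<Rightarrow> real \<Rightarrow> (complex ^ 'n \<Rightarrow> complex) \<Rightarrow> complex ^ 'n \<Rightarrow> complex" where
  "twisted_mean f r P z =
     (LINT w|sphere_measure r.
        f (z - w) * exp (\<i> / 2 * complex_of_real (Im (hermitian_dot z w))) * P w)"

definition in_Lp :: "real \<Rightarrow> 'a measure \<Rightarrow> ('a \<Rightarrow> complex) \<Rightarrow> bool" where
  "in_Lp p M g \<longleftrightarrow> g \<in> borel_measurable M \<and> integrable M (\<lambda>x. norm (g x) powr p)"

end

theory Submission
  imports Defs "HOL-Probability.Probability" "HOL-Complex_Analysis.Complex_Analysis"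
begin

text \<open>The hypothesis enters through one harmonic of highest weight,
\<open>P w = (\<alpha>\<cdot>w)^s (\<beta>\<cdot>cnj w)^t\<close> with \<open>\<alpha>\<cdot>\<beta> = 0\<close>, where the dot is the bilinear product. Write \<open>f0 = f e^(-|u|^2/4)\<close>,
so that \<open>f0 e^(|u|^2/2)\<close> is in \<open>L^p\<close>. Integrating the twisted means against a radial Gaussian of
parameter \<open>\<tau> < 1\<close> turns the hypothesis into
\<open>\<integral> f0(u) exp(\<tau>|u|^2/2 - (\<tau>/2) z\<cdot>cnj u + ((1-\<tau>)/2) cnj z\<cdot>u) P(z-u) du = 0\<close> for \<open>|z| = R\<close>.

The polynomial factor is then traded for two additional angles (lemma \<open>Omega_integral_term\<close>): with
\<open>x = cnj u + e^(i\<theta>) \<alpha>\<close> and \<open>y = u + e^(i\<phi>) \<beta>\<close> the relation says that a density \<open>h\<close> in \<open>(u, \<theta>, \<phi>)\<close> has zero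
integral against \<open>exp(\<tau> x\<cdot>y/2 - (\<tau>/2) z\<cdot>x + ((1-\<tau>)/2) cnj z\<cdot>y)\<close>. Over the sphere \<open>|z| = R\<close> the mean of
\<open>exp(z\<cdot>X + cnj z\<cdot>Y)\<close> is an entire function of \<open>X\<cdot>Y\<close> of Bessel type. Averaging the relation against
polynomials in \<open>z\<close> and \<open>cnj z\<close> therefore yields, for each moment
\<open>m(\<tau>) = \<integral> h (\<eta>\<cdot>x)^a (v\<cdot>y)^b e^(\<tau> x\<cdot>y/2)\<close> and with \<open>N = n + a + b\<close>, the differential equation of infinite order
\<open>\<Sum>j. (-(R^2/2) \<tau>(1-\<tau>))^j m^(j)(\<tau>) / (j! (N+j-1)!) = 0\<close> on \<open>0 < \<tau> < 1\<close>
(lemma \<open>moment_ode\<close>, by induction on \<open>a\<close>).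

The substitution \<open>\<tau> = y/(1+y)\<close>, \<open>G(y) = (1+y)^(-N) m(y/(1+y))\<close> makes this an equation of Euler type,
\<open>\<Sum>i. (-x y)^i G^(i)(y) / (i! (N+i-1)!) = 0\<close> with \<open>x = R^2/2\<close>. Its Mellin transform is the Mellin transform of \<open>G\<close> times an
entire function that is not identically zero, so \<open>G = 0\<close> as soon as \<open>G\<close> grows slowly enough for
its Mellin transform to exist on a line (lemma \<open>mellin_vanish\<close>). The \<open>L^p\<close> bound provides exactly this
growth (lemma \<open>moment_moebius_bound\<close>). Hence all moments vanish for \<open>Re \<tau> < 1\<close>.

At \<open>\<tau> = 0\<close> the vanishing of the moments gives
\<open>(\<alpha>\<cdot>X)^s \<integral> f0(u) (\<beta>\<cdot>\<Xi> - \<beta>\<cdot>cnj u/2)^t exp(X\<cdot>cnj u + \<Xi>\<cdot>u) du = 0\<close> for all \<open>X\<close>, \<open>\<Xi>\<close>. The factor of degree \<open>t\<close> is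
removed one degree at a time by Liouville's theorem (lemma \<open>beta_moment_descent\<close>), where finiteness of \<open>p\<close>
makes the relevant entire function tend to zero. What remains is the Fourier transform of \<open>f0\<close> off a
hyperplane, so \<open>f0 = 0\<close> almost everywhere.\<close>

section \<open>Integrals depending on a complex parameter\<close>

lemma power_le_fact_exp:
  assumes "\<rho> > 0" "0 \<le> (t::real)"
  shows "t ^ k \<le> fact k / \<rho> ^ k * exp (\<rho> * t)"
proof -
  have s: "(\<lambda>n. (\<rho> * t) ^ n /\<^sub>R fact n) sums exp (\<rho> * t)" by (rule exp_converges)
  have "(\<Sum>n\<in>{k}. (\<rho> * t) ^ n /\<^sub>R fact n) \<le> (\<Sum>n. (\<rho> * t) ^ n /\<^sub>R fact n)"
    by (rule sum_le_suminf) (use s sums_summable assms in auto)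
  then have "(\<rho> * t) ^ k /\<^sub>R fact k \<le> exp (\<rho> * t)"
    using sums_unique[OF s] by simp
  then show ?thesis using assms by (simp add: power_mult_distrib divide_simps mult_ac)
qed

lemma integrable_mult_power:
  fixes h a :: "'a \<Rightarrow> complex"
  assumes [measurable]: "h \<in> borel_measurable M" "a \<in> borel_measurable M"
    and int: "integrable M (\<lambda>x. norm (h x) * exp (\<rho> * norm (a x)))" and "\<rho> > 0"
  shows "integrable M (\<lambda>x. h x * a x ^ k)"
proof (rule Bochner_Integration.integrable_bound)
  show "integrable M (\<lambda>x. fact k / \<rho> ^ k * (norm (h x) * exp (\<rho> * norm (a x))))"
    using int by simp
  show "AE x in M. norm (h x * a x ^ k) \<le> norm (fact k / \<rho> ^ k * (norm (h x) * exp (\<rho> * norm (a x))))"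
  proof (rule AE_I2)
    fix x
    have "norm (h x) * norm (a x) ^ k \<le> norm (h x) * (fact k / \<rho> ^ k * exp (\<rho> * norm (a x)))"
      by (intro mult_left_mono power_le_fact_exp) (use \<open>\<rho> > 0\<close> in auto)
    then show "norm (h x * a x ^ k) \<le> norm (fact k / \<rho> ^ k * (norm (h x) * exp (\<rho> * norm (a x))))"
      using \<open>\<rho> > 0\<close> by (simp add: norm_mult norm_power abs_mult mult_ac)
  qed
qed simp

lemma integrable_mult_exp:
  fixes h a :: "'a \<Rightarrow> complex"
  assumes [measurable]: "h \<in> borel_measurable M" "a \<in> borel_measurable M"
    and int: "integrable M (\<lambda>x. norm (h x) * exp (\<rho> * norm (a x)))" and "norm c \<le> \<rho>"
  shows "integrable M (\<lambda>x. h x * exp (c * a x))"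
proof (rule Bochner_Integration.integrable_bound[OF int])
  show "AE x in M. norm (h x * exp (c * a x)) \<le> norm (norm (h x) * exp (\<rho> * norm (a x)))"
  proof (rule AE_I2)
    fix x
    have "Re (c * a x) \<le> norm (c * a x)" by (rule complex_Re_le_cmod)
    also have "\<dots> \<le> \<rho> * norm (a x)" using assms by (simp add: norm_mult mult_right_mono)
    finally show "norm (h x * exp (c * a x)) \<le> norm (norm (h x) * exp (\<rho> * norm (a x)))"
      by (simp add: norm_mult mult_left_mono)
  qed
qed simp

text \<open>Exponential generating series of the moments of \<open>a\<close>. Together with the uniqueness of power series
coefficients it lets one read off polynomial moments from exponential integrals; it is used in
this way for the sphere means, for the circle averages and for the moments at \<open>\<tau> = 0\<close>.\<close>

lemma integral_exp_sums:
  fixes h a :: "'a \<Rightarrow> complex"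
  assumes [measurable]: "h \<in> borel_measurable M" "a \<in> borel_measurable M"
    and int: "integrable M (\<lambda>x. norm (h x) * exp (\<rho> * norm (a x)))" and "\<rho> > 0" and "norm c \<le> \<rho>"
  shows "(\<lambda>k. (LINT x|M. h x * a x ^ k) / fact k * c ^ k) sums (LINT x|M. h x * exp (c * a x))"
proof -
  let ?f = "\<lambda>k x. h x * a x ^ k / fact k * c ^ k"
  have i: "integrable M (?f k)" for k
    using integrable_mult_power[OF assms(1-4)] by auto
  have n: "norm (?f k x) = norm (h x) * (norm (c * a x) ^ k /\<^sub>R fact k)" for k x
    by (simp add: norm_mult norm_divide norm_power power_mult_distrib field_simps)
  have s: "(\<lambda>k. norm (?f k x)) sums (norm (h x) * exp (norm (c * a x)))" for x
    unfolding n by (intro sums_mult exp_converges)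
  have b: "(\<Sum>k<m. norm (?f k x)) \<le> norm (h x) * exp (\<rho> * norm (a x))" for m x
  proof -
    have "(\<Sum>k<m. norm (?f k x)) \<le> (\<Sum>k. norm (?f k x))"
      by (rule sum_le_suminf) (use s in \<open>auto simp: sums_iff\<close>)
    also have "\<dots> = norm (h x) * exp (norm (c * a x))" using s by (simp add: sums_iff)
    also have "\<dots> \<le> norm (h x) * exp (\<rho> * norm (a x))"
      using assms by (intro mult_left_mono) (auto simp: norm_mult mult_right_mono)
    finally show ?thesis .
  qed
  have "summable (\<lambda>k. LINT x|M. norm (?f k x))"
  proof (rule bounded_imp_summable)
    show "0 \<le> (LINT x|M. norm (?f k x))" for k by simp
    show "(\<Sum>k\<le>m. LINT x|M. norm (?f k x)) \<le> (LINT x|M. norm (h x) * exp (\<rho> * norm (a x)))" for m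
    proof -
      have "(\<Sum>k\<le>m. LINT x|M. norm (?f k x)) = (LINT x|M. (\<Sum>k<Suc m. norm (?f k x)))"
        unfolding lessThan_Suc_atMost by (subst Bochner_Integration.integral_sum) (use i in auto)
      also have "\<dots> \<le> (LINT x|M. norm (h x) * exp (\<rho> * norm (a x)))"
        by (rule integral_mono) (use i int b[of _ "Suc m"] in \<open>auto simp del: sum.lessThan_Suc\<close>)
      finally show ?thesis .
    qed
  qed
  then have "(\<lambda>k. LINT x|M. ?f k x) sums (LINT x|M. (\<Sum>k. ?f k x))"
    using s i by (intro sums_integral) (auto simp: sums_iff)
  moreover have "(\<Sum>k. ?f k x) = h x * exp (c * a x)" for x
  proof -
    have "(\<lambda>k. h x * ((c * a x) ^ k /\<^sub>R fact k)) sums (h x * exp (c * a x))"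
      by (intro sums_mult exp_converges)
    moreover have "(\<lambda>k. h x * ((c * a x) ^ k /\<^sub>R fact k)) = (\<lambda>k. ?f k x)"
      by (simp add: fun_eq_iff scaleR_conv_of_real power_mult_distrib field_simps)
    ultimately show ?thesis by (simp add: sums_iff)
  qed
  moreover have "(LINT x|M. ?f k x) = (LINT x|M. h x * a x ^ k) / fact k * c ^ k" for k
    by simp
  ultimately show ?thesis by simp
qed

lemma powser_coeffs_unique:
  fixes a b :: "nat \<Rightarrow> complex"
  assumes r: "r > 0"
    and a: "\<And>c. norm c < r \<Longrightarrow> (\<lambda>k. a k * c ^ k) sums f c"
    and b: "\<And>c. norm c < r \<Longrightarrow> (\<lambda>k. b k * c ^ k) sums f c"
  shows "a = b"
proof (rule ccontr)
  let ?d = "\<lambda>k. a k - b k"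
  assume "a \<noteq> b"
  then have ex: "\<exists>k. ?d k \<noteq> 0" by (auto simp: fun_eq_iff)
  have d: "(\<lambda>k. ?d k * c ^ k) sums 0" if "norm c < r" for c
    using sums_diff[OF a[OF that] b[OF that]] by (simp add: algebra_simps)
  have "?d 0 = 0"
    using sums_unique2[OF d[of 0] powser_sums_zero[of ?d]] r by simp
  then obtain m where m: "?d m \<noteq> 0" "m > 0" using ex by (cases "\<exists>k>0. ?d k \<noteq> 0") (use not_gr_zero in blast)+
  show False
  proof (rule powser_0_nonzero[of r 0 ?d "\<lambda>_. 0" m])
    fix s :: real assume s: "0 < s" "\<And>z::complex. z \<in> cball 0 s - {0} \<Longrightarrow> (0::complex) \<noteq> 0"
    have "complex_of_real s \<in> cball 0 s - {0}" using s(1) by simp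
    then show False using s(2) by blast
  qed (use d m r in simp_all)
qed

text \<open>The domination hypothesis gives, around every point of \<open>U\<close>, a Taylor expansion of the integral by
the exponential generating series, so that the derivatives are the obvious moments.\<close>

lemma laplace_holomorphic:
  fixes h a :: "'a \<Rightarrow> complex"
  assumes [measurable]: "h \<in> borel_measurable M" "a \<in> borel_measurable M"
    and U: "\<And>z. z \<in> U \<Longrightarrow> \<exists>\<rho>>0. integrable M (\<lambda>x. norm (h x * exp (z * a x)) * exp (\<rho> * norm (a x)))"
    and "open U"
  defines "F \<equiv> \<lambda>z. LINT x|M. h x * exp (z * a x)"
  shows "F holomorphic_on U"
    and "\<And>z k. z \<in> U \<Longrightarrow> (deriv ^^ k) F z = (LINT x|M. h x * a x ^ k * exp (z * a x))"
proof -
  have *: "\<exists>\<rho>>0. \<forall>w\<in>ball z \<rho>. (\<lambda>k. (LINT x|M. h x * a x ^ k * exp (z * a x)) / fact k * (w - z) ^ k) sums F w"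
    if zU: "z \<in> U" for z
  proof -
    obtain \<rho> where \<rho>: "\<rho> > 0" "integrable M (\<lambda>x. norm (h x * exp (z * a x)) * exp (\<rho> * norm (a x)))"
      using U[OF zU] by auto
    have "(\<lambda>k. (LINT x|M. h x * a x ^ k * exp (z * a x)) / fact k * (w - z) ^ k) sums F w"
      if "w \<in> ball z \<rho>" for w
      using integral_exp_sums[OF _ _ \<rho>(2) \<rho>(1), of "w - z"] that
      by (simp add: F_def exp_add[symmetric] algebra_simps dist_norm norm_minus_commute)
    then show ?thesis using \<rho>(1) by (intro exI[of _ \<rho>] conjI ballI)
  qed
  have "F field_differentiable at z" if z: "z \<in> U" for z
  proof -
    obtain \<rho> where \<rho>: "\<rho> > 0" "\<forall>w\<in>ball z \<rho>. (\<lambda>k. (LINT x|M. h x * a x ^ k * exp (z * a x)) / fact k * (w - z) ^ k) sums F w"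
      using *[OF z] by auto
    have "F holomorphic_on ball z \<rho>"
      by (rule power_series_holomorphic[OF bspec[OF \<rho>(2)]])
    then show ?thesis using \<rho>(1) by (auto intro: holomorphic_on_imp_differentiable_at)
  qed
  then show "F holomorphic_on U"
    by (simp add: holomorphic_on_def field_differentiable_at_within)
  fix z k assume z: "z \<in> U"
  obtain \<rho> where \<rho>: "\<rho> > 0" "\<forall>w\<in>ball z \<rho>. (\<lambda>k. (LINT x|M. h x * a x ^ k * exp (z * a x)) / fact k * (w - z) ^ k) sums F w"
    using *[OF z] by auto
  have hol: "F holomorphic_on ball z \<rho>"
    by (rule power_series_holomorphic[OF bspec[OF \<rho>(2)]])
  have "(\<lambda>k. (deriv ^^ k) F z / fact k) = (\<lambda>k. (LINT x|M. h x * a x ^ k * exp (z * a x)) / fact k)"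
  proof (rule powser_coeffs_unique[OF \<rho>(1)])
    fix c :: complex assume c: "norm c < \<rho>"
    then have zc: "z + c \<in> ball z \<rho>" by (simp add: dist_norm)
    show "(\<lambda>k. (deriv ^^ k) F z / fact k * c ^ k) sums F (z + c)"
      using holomorphic_power_series[OF hol zc] by simp
    show "(\<lambda>k. (LINT x|M. h x * a x ^ k * exp (z * a x)) / fact k * c ^ k) sums F (z + c)"
      using bspec[OF \<rho>(2) zc] by simp
  qed
  from fun_cong[OF this, of k]
  show "(deriv ^^ k) F z = (LINT x|M. h x * a x ^ k * exp (z * a x))" by simp
qed

section \<open>Gaussian integrals and polar coordinates\<close>

lemma gaussian_integral_complex:
  fixes c :: complex
  shows "integrable lborel (\<lambda>t::real. exp (- complex_of_real (t\<^sup>2) + c * of_real t))"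
    and "(LINT t|lborel. exp (- complex_of_real (t\<^sup>2) + c * of_real t)) = of_real (sqrt pi) * exp (c\<^sup>2 / 4)"
proof -
  let ?h = "\<lambda>t::real. complex_of_real (exp (- t\<^sup>2))"
  have G: "has_bochner_integral lborel (\<lambda>t::real. exp (- (t - d)\<^sup>2)) (sqrt pi)" for d
  proof -
    have "has_bochner_integral lborel (\<lambda>x::real. exp (- x\<^sup>2) * x ^ (2 * 0)) (2 * (sqrt pi / 2))"
      using has_bochner_integral_even_function[OF gaussian_moment_even_pos[where k=0]] by simp
    then show ?thesis
      using lborel_has_bochner_integral_real_affine_iff[of 1 "\<lambda>x::real. exp (- x\<^sup>2)" "sqrt pi" "-d"] by simp
  qed
  have G2: "integrable lborel (\<lambda>t::real. exp (- t\<^sup>2 + C * t))"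
     "(LINT t|lborel. exp (- t\<^sup>2 + C * t)) = sqrt pi * exp (C\<^sup>2 / 4)" for C :: real
  proof -
    have e: "exp (- t\<^sup>2 + C * t) = exp (C\<^sup>2 / 4) * exp (- (t - C / 2)\<^sup>2)" for t :: real
      by (simp add: exp_add[symmetric] power2_eq_square algebra_simps)
    show "integrable lborel (\<lambda>t::real. exp (- t\<^sup>2 + C * t))"
      "(LINT t|lborel. exp (- t\<^sup>2 + C * t)) = sqrt pi * exp (C\<^sup>2 / 4)"
      unfolding e using G[of "C/2"] by (auto simp: has_bochner_integral_iff)
  qed
  have I: "integrable lborel (\<lambda>t::real. norm (?h t) * exp (C * norm (complex_of_real t)))" for C
  proof (rule Bochner_Integration.integrable_bound)
    show "integrable lborel (\<lambda>t::real. exp (- t\<^sup>2 + C * t) + exp (- t\<^sup>2 + (-C) * t))"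
      using G2 by (intro Bochner_Integration.integrable_add)
    show "AE t in lborel. norm (norm (?h t) * exp (C * norm (complex_of_real t))) \<le> norm (exp (- t\<^sup>2 + C * t) + exp (- t\<^sup>2 + (-C) * t))"
    proof (rule AE_I2)
      fix t :: real
      have "exp (- t\<^sup>2) * exp (C * \<bar>t\<bar>) \<le> exp (- t\<^sup>2 + C * t) + exp (- t\<^sup>2 + (-C) * t)"
        by (cases "t \<ge> 0") (simp_all add: mult_exp_exp add_increasing)
      moreover have "0 \<le> exp (- t\<^sup>2 + C * t) + exp (- t\<^sup>2 + (-C) * t)" by (simp add: add_nonneg_nonneg)
      ultimately show "norm (norm (?h t) * exp (C * norm (complex_of_real t))) \<le> norm (exp (- t\<^sup>2 + C * t) + exp (- t\<^sup>2 + (-C) * t))"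
        by simp
    qed
  qed simp
  have e: "exp (- complex_of_real (t\<^sup>2) + c * of_real t) = ?h t * exp (c * of_real t)" for c t
  proof -
    have "?h t = exp (- complex_of_real (t\<^sup>2))" using exp_of_real[of "- t\<^sup>2", where 'a = complex] by simp
    then show ?thesis by (simp only: mult_exp_exp)
  qed
  show "integrable lborel (\<lambda>t::real. exp (- complex_of_real (t\<^sup>2) + c * of_real t))"
    unfolding e by (rule integrable_mult_exp[OF _ _ I[of "norm c"]]) auto
  let ?F = "\<lambda>c. LINT t|lborel. ?h t * exp (c * of_real t)"
  have hol: "?F holomorphic_on UNIV"
  proof (rule laplace_holomorphic)
    fix z :: complex
    have "integrable lborel (\<lambda>t. norm (?h t * exp (z * of_real t)) * exp (1 * norm (complex_of_real t)))"
    proof (rule Bochner_Integration.integrable_bound[OF I[of "norm z + 1"]])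
      show "AE t in lborel. norm (norm (?h t * exp (z * of_real t)) * exp (1 * norm (complex_of_real t)))
          \<le> norm (norm (?h t) * exp ((norm z + 1) * norm (complex_of_real t)))"
      proof (rule AE_I2)
        fix t :: real
        have "Re (z * of_real t) \<le> norm z * \<bar>t\<bar>" using complex_Re_le_cmod[of "z * of_real t"] by (simp add: norm_mult)
        then show "norm (norm (?h t * exp (z * of_real t)) * exp (1 * norm (complex_of_real t)))
          \<le> norm (norm (?h t) * exp ((norm z + 1) * norm (complex_of_real t)))"
          by (simp add: norm_mult abs_mult exp_add[symmetric] algebra_simps)
      qed
    qed simp
    then show "\<exists>\<rho>>0. integrable lborel (\<lambda>t. norm (?h t * exp (z * of_real t)) * exp (\<rho> * norm (complex_of_real t)))"
      by (intro exI[of _ 1]) auto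
  qed auto
  have "?F c - of_real (sqrt pi) * exp (c\<^sup>2 / 4) = 0"
  proof (rule analytic_continuation[of "\<lambda>c. ?F c - of_real (sqrt pi) * exp (c\<^sup>2 / 4)" UNIV \<real> 0 c])
    show "(\<lambda>c. ?F c - of_real (sqrt pi) * exp (c\<^sup>2 / 4)) holomorphic_on UNIV"
      by (intro holomorphic_intros hol) auto
    show "(0::complex) islimpt \<real>"
    proof -
      have "(0::complex) islimpt (of_real ` {0<..})"
        unfolding islimpt_approachable
      proof (intro allI impI)
        fix e :: real assume "e > 0"
        then show "\<exists>x'\<in>complex_of_real ` {0<..}. x' \<noteq> 0 \<and> dist x' 0 < e"
          by (intro bexI[of _ "of_real (e/2)"] imageI) (auto simp: dist_norm norm_divide)
      qed
      then show ?thesis by (rule islimpt_subset) auto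
    qed
    fix z :: complex assume "z \<in> \<real>"
    then obtain C where C: "z = of_real C" by (auto elim: Reals_cases)
    have "?F z = (LINT t|lborel. complex_of_real (exp (- t\<^sup>2 + C * t)))"
      unfolding C by (intro Bochner_Integration.integral_cong) (auto simp: exp_of_real[symmetric] mult_exp_exp)
    also have "\<dots> = of_real (sqrt pi * exp (C\<^sup>2 / 4))"
      using G2[of C] by simp
    finally show "?F z - of_real (sqrt pi) * exp (z\<^sup>2 / 4) = 0"
      by (simp add: C exp_of_real[symmetric])
  qed auto
  then show "(LINT t|lborel. exp (- complex_of_real (t\<^sup>2) + c * of_real t)) = of_real (sqrt pi) * exp (c\<^sup>2 / 4)"
    unfolding e by simp
qed

text \<open>A complex linear form in the exponent is admitted because both Fourier transforms (imaginary
coefficients) and generating functions of moments (arbitrary complex ones) are taken from it.\<close>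

lemma gaussian_integral_euclidean:
  fixes L :: "'a::euclidean_space \<Rightarrow> complex"
  assumes L: "\<And>w. L w = (\<Sum>b\<in>Basis. c b * of_real (w \<bullet> b))"
  shows "integrable lborel (\<lambda>w. exp (- complex_of_real ((norm w)\<^sup>2) + L w))"
    and "(LINT w|lborel. exp (- complex_of_real ((norm w)\<^sup>2) + L w))
       = of_real (sqrt pi) ^ DIM('a) * exp ((\<Sum>b\<in>Basis. (c b)\<^sup>2) / 4)"
proof -
  let ?f = "\<lambda>b (t::real). exp (- complex_of_real (t\<^sup>2) + c b * of_real t)"
  interpret product_sigma_finite "\<lambda>b::'a. lborel :: real measure" ..
  let ?S = "\<lambda>f::'a \<Rightarrow> real. \<Sum>b\<in>Basis. f b *\<^sub>R b"
  have inn: "?S f \<bullet> b = f b" if "b \<in> Basis" for f b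
    using that by (simp add: inner_sum_left_Basis)
  have e: "exp (- complex_of_real ((norm w)\<^sup>2) + L w) = (\<Prod>b\<in>Basis. ?f b (w \<bullet> b))" for w :: 'a
  proof -
    have "(norm w)\<^sup>2 = (\<Sum>b\<in>Basis. (w \<bullet> b)\<^sup>2)"
      unfolding power2_norm_eq_inner using euclidean_inner[of w w] by (simp add: power2_eq_square)
    then have "- complex_of_real ((norm w)\<^sup>2) + L w = (\<Sum>b\<in>Basis. - complex_of_real ((w \<bullet> b)\<^sup>2) + c b * of_real (w \<bullet> b))"
      by (simp add: L sum_subtractf)
    then show ?thesis by (simp add: exp_sum)
  qed
  have e2: "exp (- complex_of_real ((norm (?S f))\<^sup>2) + L (?S f)) = (\<Prod>b\<in>Basis. ?f b (f b))" for f
    unfolding e by (intro prod.cong refl) (simp add: inn)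
  have m[measurable]: "?S \<in> (\<Pi>\<^sub>M b\<in>Basis. lborel) \<rightarrow>\<^sub>M borel"
    by measurable
  have m2[measurable]: "(\<lambda>w. exp (- complex_of_real ((norm w)\<^sup>2) + L w)) \<in> borel_measurable borel"
    unfolding L by measurable
  show "integrable lborel (\<lambda>w. exp (- complex_of_real ((norm w)\<^sup>2) + L w))"
    by (subst lborel_eq, subst integrable_distr_eq, simp, rule m2, unfold e2)
       (intro product_integrable_prod gaussian_integral_complex, simp)
  have "(LINT w|lborel. exp (- complex_of_real ((norm w)\<^sup>2) + L w))
      = (LINT f|(\<Pi>\<^sub>M b\<in>Basis. lborel). (\<Prod>b\<in>Basis. ?f b (f b)))"
    by (subst lborel_eq, subst integral_distr, simp, rule m2, unfold e2) simp
  also have "\<dots> = (\<Prod>b\<in>Basis. LINT t|lborel. ?f b t)"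
    by (intro product_integral_prod gaussian_integral_complex) simp
  also have "\<dots> = of_real (sqrt pi) ^ DIM('a) * exp ((\<Sum>b\<in>Basis. (c b)\<^sup>2) / 4)"
    unfolding gaussian_integral_complex by (simp add: prod.distrib exp_sum sum_divide_distrib)
  finally show "(LINT w|lborel. exp (- complex_of_real ((norm w)\<^sup>2) + L w))
       = of_real (sqrt pi) ^ DIM('a) * exp ((\<Sum>b\<in>Basis. (c b)\<^sup>2) / 4)" .
qed

text \<open>Polar coordinates with the cone description of the sphere: the direction is sampled by a point
\<open>w\<close> of the unit ball. Substitute \<open>\<rho> = u * norm w\<close> for fixed \<open>w\<close> and then \<open>y = u w\<close> for fixed \<open>u\<close>; what remains
for each \<open>y\<close> is the integral of \<open>d * norm y ^ d / u ^ (d + 1)\<close> over \<open>u > norm y\<close>, which is \<open>1\<close>.\<close>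

lemma polar_nn_integral:
  fixes F :: "'a::euclidean_space \<Rightarrow> ennreal"
  assumes [measurable]: "F \<in> borel_measurable borel"
  shows "(\<integral>\<^sup>+y. F y \<partial>lborel) =
    (\<integral>\<^sup>+\<rho>. \<integral>\<^sup>+w. ennreal (indicator {0<..} \<rho> * (real DIM('a) * \<rho> ^ (DIM('a) - 1)) * indicator (ball 0 1) w)
        * F ((\<rho> / norm w) *\<^sub>R w) \<partial>(lborel :: 'a measure) \<partial>lborel)"
proof -
  let ?d = "DIM('a)"
  have d0: "?d > 0" by simp
  have bm: "(indicator (ball (0::'a) 1) :: 'a \<Rightarrow> real) \<in> borel_measurable borel"
    by (intro borel_measurable_indicator borel_open open_ball)
  have [measurable]: "(\<lambda>x. indicator (ball (0::'a) 1) (snd x) :: real) \<in> borel_measurable (borel \<Otimes>\<^sub>M borel)"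
    "(\<lambda>x. indicator (ball (0::'a) 1) (fst x) :: real) \<in> borel_measurable (borel \<Otimes>\<^sub>M borel)"
    by (rule measurable_compose[OF measurable_snd bm], rule measurable_compose[OF measurable_fst bm])
  define W where "W \<rho> w = ennreal (indicator {0<..} \<rho> * (real ?d * \<rho> ^ (?d - 1)) * indicator (ball 0 1) w)" for \<rho> :: real and w :: 'a
  have [measurable]: "case_prod W \<in> borel_measurable (borel \<Otimes>\<^sub>M borel)"
  proof -
    have "(\<lambda>(\<rho>::real, w::'a). ennreal ((if 0 < \<rho> then 1 else 0) * (real ?d * \<rho> ^ (?d - 1)) * (if norm w < 1 then 1 else 0))) \<in> borel_measurable (borel \<Otimes>\<^sub>M borel)"
      by measurable
    moreover have "case_prod W = (\<lambda>(\<rho>::real, w::'a). ennreal ((if 0 < \<rho> then 1 else 0) * (real ?d * \<rho> ^ (?d - 1)) * (if norm w < 1 then 1 else 0)))"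
      by (auto simp: W_def indicator_def fun_eq_iff)
    ultimately show ?thesis by simp
  qed
  have 1: "(\<integral>\<^sup>+\<rho>. W \<rho> w * F ((\<rho> / norm w) *\<^sub>R w) \<partial>lborel) =
      (\<integral>\<^sup>+u. ennreal (indicator {0<..} u * indicator (ball 0 1) w * (real ?d * u ^ (?d - 1) * norm w ^ ?d)) * F (u *\<^sub>R w) \<partial>lborel)"
    if "w \<noteq> 0" for w :: 'a
  proof -
    have "(\<integral>\<^sup>+\<rho>. W \<rho> w * F ((\<rho> / norm w) *\<^sub>R w) \<partial>lborel)
       = ennreal \<bar>norm w\<bar> * (\<integral>\<^sup>+u. W (0 + norm w * u) w * F (((0 + norm w * u) / norm w) *\<^sub>R w) \<partial>lborel)"
      by (rule nn_integral_real_affine) (use that in auto)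
    also have "\<dots> = (\<integral>\<^sup>+u. ennreal \<bar>norm w\<bar> * (W (0 + norm w * u) w * F (((0 + norm w * u) / norm w) *\<^sub>R w)) \<partial>lborel)"
      by (rule nn_integral_cmult[symmetric]) measurable
    also have "\<dots> = (\<integral>\<^sup>+u. ennreal (indicator {0<..} u * indicator (ball 0 1) w * (real ?d * u ^ (?d - 1) * norm w ^ ?d)) * F (u *\<^sub>R w) \<partial>lborel)"
    proof (rule nn_integral_cong)
      fix u :: real
      have p: "norm w ^ ?d = norm w * norm w ^ (?d - 1)" using d0 by (cases ?d) auto
      have "ennreal \<bar>norm w\<bar> * W (0 + norm w * u) w = ennreal (indicator {0<..} u * indicator (ball 0 1) w * (real ?d * u ^ (?d - 1) * norm w ^ ?d))"
        unfolding W_def using that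
        by (subst ennreal_mult[symmetric])
          (auto simp: indicator_def p power_mult_distrib zero_less_mult_iff mult_ac)
      then show "ennreal \<bar>norm w\<bar> * (W (0 + norm w * u) w * F (((0 + norm w * u) / norm w) *\<^sub>R w))
        = ennreal (indicator {0<..} u * indicator (ball 0 1) w * (real ?d * u ^ (?d - 1) * norm w ^ ?d)) * F (u *\<^sub>R w)"
        using that by (simp add: mult.assoc[symmetric])
    qed
    finally show ?thesis .
  qed
  have 2: "(\<integral>\<^sup>+w. ennreal (indicator {0<..} u * indicator (ball 0 1) w * (real ?d * u ^ (?d - 1) * norm w ^ ?d)) * F (u *\<^sub>R w) \<partial>lborel)
    = (\<integral>\<^sup>+y. ennreal (real ?d * norm y ^ ?d * (indicator {norm y<..} u * u powr (- real ?d - 1))) * F y \<partial>lborel)"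
    if "u > 0" for u :: real
  proof -
    have "(indicator (ball (0::'a) 1) :: 'a \<Rightarrow> real) \<in> borel_measurable borel" by (intro borel_measurable_indicator borel_open open_ball)
    then have [measurable]: "(\<lambda>y. indicator (ball (0::'a) 1) ((1/u) *\<^sub>R y) :: real) \<in> borel_measurable borel"
      by (intro measurable_compose[OF _ \<open>(indicator (ball (0::'a) 1) :: 'a \<Rightarrow> real) \<in> borel_measurable borel\<close>, of "\<lambda>y. (1/u) *\<^sub>R y"]) measurable
    let ?H = "\<lambda>y::'a. ennreal (indicator (ball 0 1) ((1/u) *\<^sub>R y) * (real ?d * u ^ (?d - 1) * norm ((1/u) *\<^sub>R y) ^ ?d)) * F y"
    have "(\<integral>\<^sup>+w. ennreal (indicator {0<..} u * indicator (ball 0 1) w * (real ?d * u ^ (?d - 1) * norm w ^ ?d)) * F (u *\<^sub>R w) \<partial>lborel)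
       = (\<integral>\<^sup>+w. ?H (0 + u *\<^sub>R w) \<partial>lborel)"
      using that by (intro nn_integral_cong) simp
    also have "\<dots> = (\<integral>\<^sup>+y. ?H y \<partial>(distr lborel borel (\<lambda>x. 0 + u *\<^sub>R x)))"
      by (subst nn_integral_distr) auto
    also have "\<dots> = (\<integral>\<^sup>+y. ennreal (inverse (u ^ ?d)) * ?H y \<partial>lborel)"
    proof -
      have "(\<integral>\<^sup>+y. ennreal (inverse (u ^ ?d)) * ?H y \<partial>lborel)
        = (\<integral>\<^sup>+y. ennreal (\<bar>u\<bar> ^ ?d) * (ennreal (inverse (u ^ ?d)) * ?H y) \<partial>(distr lborel borel (\<lambda>x. 0 + u *\<^sub>R x)))"
        by (subst lborel_affine[of u "0::'a"], use that in simp, subst nn_integral_density) auto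
      also have "\<dots> = (\<integral>\<^sup>+y. ?H y \<partial>(distr lborel borel (\<lambda>x. 0 + u *\<^sub>R x)))"
        using that by (intro nn_integral_cong) (simp add: mult.assoc[symmetric] ennreal_mult[symmetric])
      finally show ?thesis by simp
    qed
    also have "\<dots> = (\<integral>\<^sup>+y. ennreal (real ?d * norm y ^ ?d * (indicator {norm y<..} u * u powr (- real ?d - 1))) * F y \<partial>lborel)"
    proof (rule nn_integral_cong)
      fix y :: 'a
      have e: "u powr (- real ?d - 1) = inverse (u ^ ?d) * inverse u"
        using that by (simp add: powr_diff powr_minus powr_realpow divide_inverse)
      have p: "u ^ ?d = u * u ^ (?d - 1)" using d0 by (cases ?d) auto
      have eq: "inverse (u ^ ?d) * (indicator (ball 0 1) ((1/u) *\<^sub>R y) * (real ?d * u ^ (?d - 1) * norm ((1/u) *\<^sub>R y) ^ ?d))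
        = real ?d * norm y ^ ?d * (indicator {norm y<..} u * u powr (- real ?d - 1))"
        using that by (simp add: indicator_def e p power_divide field_simps)
      have "ennreal (inverse (u ^ ?d)) * ?H y = ennreal (inverse (u ^ ?d) * (indicator (ball 0 1) ((1/u) *\<^sub>R y) * (real ?d * u ^ (?d - 1) * norm ((1/u) *\<^sub>R y) ^ ?d))) * F y"
        by (subst ennreal_mult) (use that in \<open>auto simp: mult.assoc\<close>)
      then show "ennreal (inverse (u ^ ?d)) * ?H y = ennreal (real ?d * norm y ^ ?d * (indicator {norm y<..} u * u powr (- real ?d - 1))) * F y"
        by (simp only: eq)
    qed
    finally show ?thesis .
  qed
  have 3: "(\<integral>\<^sup>+u. ennreal (indicator {0<..} u) * ennreal (real ?d * norm y ^ ?d * (indicator {norm y<..} u * u powr (- real ?d - 1))) \<partial>lborel) = 1"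
    if "y \<noteq> 0" for y :: 'a
  proof -
    have "(\<integral>\<^sup>+u. ennreal (indicator {0<..} u) * ennreal (real ?d * norm y ^ ?d * (indicator {norm y<..} u * u powr (- real ?d - 1))) \<partial>lborel)
      = (\<integral>\<^sup>+u. ennreal (real ?d * norm y ^ ?d * u powr (- real ?d - 1)) * indicator {norm y ..} u \<partial>lborel)"
    proof (rule nn_integral_cong_AE)
      have "AE u in lborel. u \<noteq> norm y" by (rule AE_lborel_singleton)
      then show "AE u in lborel. ennreal (indicator {0<..} u) * ennreal (real ?d * norm y ^ ?d * (indicator {norm y<..} u * u powr (- real ?d - 1)))
        = ennreal (real ?d * norm y ^ ?d * u powr (- real ?d - 1)) * indicator {norm y ..} u"
      proof eventually_elim
        case (elim u)
        have "u > 0" if "u > norm y" using that norm_ge_zero[of y] by linarith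
        with elim show ?case by (auto simp: indicator_def)
      qed
    qed
    also have "\<dots> = ennreal (0 - (- (norm y ^ ?d * norm y powr (- real ?d))))"
    proof (rule nn_integral_FTC_atLeast[where F = "\<lambda>u. - (norm y ^ ?d * u powr (- real ?d))"])
      fix u assume u: "norm y \<le> u"
      then have "u > 0" using that by (meson norm_le_zero_iff not_le order_trans)
      then show "((\<lambda>u. - (norm y ^ ?d * u powr (- real ?d))) has_real_derivative real ?d * norm y ^ ?d * u powr (- real ?d - 1)) (at u)"
        by (auto intro!: derivative_eq_intros)
      show "0 \<le> real ?d * norm y ^ ?d * u powr (- real ?d - 1)" by simp
    next
      have "((\<lambda>u::real. u powr (- real ?d)) \<longlongrightarrow> 0) at_top"
        by (intro tendsto_neg_powr filterlim_ident) (use d0 in auto)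
      then show "((\<lambda>u::real. - (norm y ^ ?d * u powr (- real ?d))) \<longlongrightarrow> 0) at_top"
        using tendsto_minus[OF tendsto_mult_left[where c = "norm y ^ ?d"]] by fastforce
    qed measurable
    also have "\<dots> = 1" using that by (simp add: powr_minus powr_realpow)
    finally show ?thesis .
  qed
  have "(\<integral>\<^sup>+\<rho>. \<integral>\<^sup>+w. W \<rho> w * F ((\<rho> / norm w) *\<^sub>R w) \<partial>lborel \<partial>lborel)
     = (\<integral>\<^sup>+w. \<integral>\<^sup>+\<rho>. W \<rho> w * F ((\<rho> / norm w) *\<^sub>R w) \<partial>lborel \<partial>lborel)"
    by (rule lborel_pair.Fubini') measurable
  also have "\<dots> = (\<integral>\<^sup>+w. \<integral>\<^sup>+u. ennreal (indicator {0<..} u * indicator (ball 0 1) w * (real ?d * u ^ (?d - 1) * norm w ^ ?d)) * F (u *\<^sub>R w) \<partial>lborel \<partial>lborel)"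
    by (rule nn_integral_cong_AE) (rule AE_mp[OF AE_lborel_singleton[of "0::'a"]], rule AE_I2, rule impI, rule 1)
  also have "\<dots> = (\<integral>\<^sup>+u. \<integral>\<^sup>+w. ennreal (indicator {0<..} u * indicator (ball 0 1) w * (real ?d * u ^ (?d - 1) * norm w ^ ?d)) * F (u *\<^sub>R w) \<partial>lborel \<partial>lborel)"
    by (rule lborel_pair.Fubini'[symmetric]) measurable
  also have "\<dots> = (\<integral>\<^sup>+u. \<integral>\<^sup>+y. (ennreal (indicator {0<..} u) * ennreal (real ?d * norm y ^ ?d * (indicator {norm y<..} u * u powr (- real ?d - 1)))) * F y \<partial>lborel \<partial>lborel)"
  proof (rule nn_integral_cong)
    fix u :: real
    show "(\<integral>\<^sup>+w. ennreal (indicator {0<..} u * indicator (ball 0 1) w * (real ?d * u ^ (?d - 1) * norm w ^ ?d)) * F (u *\<^sub>R w) \<partial>lborel)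
      = (\<integral>\<^sup>+y. (ennreal (indicator {0<..} u) * ennreal (real ?d * norm y ^ ?d * (indicator {norm y<..} u * u powr (- real ?d - 1)))) * F y \<partial>lborel)"
      by (cases "u > 0") (use 2[of u] in \<open>auto simp: indicator_def\<close>)
  qed
  also have "\<dots> = (\<integral>\<^sup>+y. \<integral>\<^sup>+u. (ennreal (indicator {0<..} u) * ennreal (real ?d * norm y ^ ?d * (indicator {norm y<..} u * u powr (- real ?d - 1)))) * F y \<partial>lborel \<partial>lborel)"
  proof (rule lborel_pair.Fubini')
    have "(\<lambda>(y::'a, u::real). (ennreal (indicator {0<..} u) * ennreal (real ?d * norm y ^ ?d * ((if norm y < u then 1 else 0) * u powr (- real ?d - 1)))) * F y) \<in> borel_measurable (lborel \<Otimes>\<^sub>M lborel)"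
      by measurable
    then show "(\<lambda>(y::'a, u::real). (ennreal (indicator {0<..} u) * ennreal (real ?d * norm y ^ ?d * (indicator {norm y<..} u * u powr (- real ?d - 1)))) * F y) \<in> borel_measurable (lborel \<Otimes>\<^sub>M lborel)"
      by (simp add: indicator_def of_bool_def)
  qed
  also have "\<dots> = (\<integral>\<^sup>+y. F y \<partial>lborel)"
  proof (rule nn_integral_cong_AE, rule AE_mp[OF AE_lborel_singleton[of "0::'a"]], rule AE_I2, rule impI)
    fix y :: 'a assume "y \<noteq> 0"
    have [measurable]: "indicator {norm y<..} \<in> borel_measurable (borel :: real measure)" by simp
    have "(\<integral>\<^sup>+u. (ennreal (indicator {0<..} u) * ennreal (real ?d * norm y ^ ?d * (indicator {norm y<..} u * u powr (- real ?d - 1)))) * F y \<partial>lborel)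
      = (\<integral>\<^sup>+u. (ennreal (indicator {0<..} u) * ennreal (real ?d * norm y ^ ?d * (indicator {norm y<..} u * u powr (- real ?d - 1)))) \<partial>lborel) * F y"
      by (rule nn_integral_multc) measurable
    also have "\<dots> = F y" using 3[OF \<open>y \<noteq> 0\<close>] by simp
    finally show "(\<integral>\<^sup>+u. (ennreal (indicator {0<..} u) * ennreal (real ?d * norm y ^ ?d * (indicator {norm y<..} u * u powr (- real ?d - 1)))) * F y \<partial>lborel) = F y" .
  qed
  finally show ?thesis unfolding W_def by simp
qed

lemma polar_distr:
  defines "M \<equiv> density (lborel \<Otimes>\<^sub>M lborel :: (real \<times> 'a::euclidean_space) measure)
     (\<lambda>x. ennreal (indicator {0<..} (fst x) * (real DIM('a) * fst x ^ (DIM('a) - 1)) * indicator (ball 0 1) (snd x)))"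
  shows "distr M borel (\<lambda>x. (fst x / norm (snd x)) *\<^sub>R snd x) = (lborel :: 'a measure)"
proof (rule measure_eqI)
  have bm: "(indicator (ball (0::'a) 1) :: 'a \<Rightarrow> real) \<in> borel_measurable borel" by (intro borel_measurable_indicator borel_open open_ball)
  have [measurable]: "(\<lambda>x. indicator (ball (0::'a) 1) (snd x) :: real) \<in> borel_measurable (borel \<Otimes>\<^sub>M borel)"
    by (intro measurable_compose[OF _ bm, of snd]) measurable
  fix A assume "A \<in> sets (distr M borel (\<lambda>x. (fst x / norm (snd x)) *\<^sub>R snd x))"
  then have A[measurable]: "A \<in> sets borel" by simp
  let ?T = "\<lambda>x::real \<times> 'a. (fst x / norm (snd x)) *\<^sub>R snd x"
  have T[measurable]: "?T \<in> borel \<Otimes>\<^sub>M borel \<rightarrow>\<^sub>M borel" by measurable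
  have [measurable]: "(\<lambda>x. indicator A (?T x) :: ennreal) \<in> borel_measurable (borel \<Otimes>\<^sub>M borel)"
    by (rule measurable_compose[OF T borel_measurable_indicator[OF A]])
  have sM: "sets M = sets (borel \<Otimes>\<^sub>M borel)" unfolding M_def by simp
  have T'[measurable]: "?T \<in> M \<rightarrow>\<^sub>M borel" using T by (simp add: measurable_cong_sets[OF sM refl])
  have "emeasure (distr M borel ?T) A = (\<integral>\<^sup>+x. indicator A x \<partial>distr M borel ?T)" by simp
  also have "\<dots> = (\<integral>\<^sup>+x. indicator A (?T x) \<partial>M)"
    by (rule nn_integral_distr) auto
  also have "\<dots> = (\<integral>\<^sup>+x. ennreal (indicator {0<..} (fst x) * (real DIM('a) * fst x ^ (DIM('a) - 1)) * indicator (ball 0 1) (snd x)) * indicator A (?T x) \<partial>(lborel \<Otimes>\<^sub>M lborel))"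
    unfolding M_def by (rule nn_integral_density) measurable
  also have "\<dots> = (\<integral>\<^sup>+\<rho>. \<integral>\<^sup>+w. ennreal (indicator {0<..} \<rho> * (real DIM('a) * \<rho> ^ (DIM('a) - 1)) * indicator (ball 0 1) w)
        * indicator A ((\<rho> / norm w) *\<^sub>R w) \<partial>(lborel :: 'a measure) \<partial>lborel)"
    by (subst lborel.nn_integral_fst[symmetric]) simp_all
  also have "\<dots> = emeasure lborel A"
    by (subst polar_nn_integral[symmetric]) auto
  finally show "emeasure (distr M borel ?T) A = emeasure lborel A" .
qed simp

lemma polar_integral:
  fixes F :: "'a::euclidean_space \<Rightarrow> complex"
  assumes F: "integrable lborel F"
  shows "(LINT y|lborel. F y) = (LINT \<rho>|lborel. (indicator {0<..} \<rho> * (real DIM('a) * \<rho> ^ (DIM('a) - 1))) *\<^sub>R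
      (LINT w|lborel. indicator (ball (0::'a) 1) w *\<^sub>R F ((\<rho> / norm w) *\<^sub>R w)))"
proof -
  have bm: "(indicator (ball (0::'a) 1) :: 'a \<Rightarrow> real) \<in> borel_measurable borel" by (intro borel_measurable_indicator borel_open open_ball)
  have [measurable]: "(\<lambda>x. indicator (ball (0::'a) 1) (snd x) :: real) \<in> borel_measurable (borel \<Otimes>\<^sub>M borel)"
    by (intro measurable_compose[OF _ bm, of snd]) measurable
  have Fm[measurable]: "F \<in> borel_measurable borel" using F by auto
  let ?W = "\<lambda>x::real \<times> 'a. indicator {0<..} (fst x) * (real DIM('a) * fst x ^ (DIM('a) - 1)) * indicator (ball 0 1) (snd x)"
  let ?M = "density (lborel \<Otimes>\<^sub>M lborel) (\<lambda>x. ennreal (?W x))"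
  let ?T = "\<lambda>x::real \<times> 'a. (fst x / norm (snd x)) *\<^sub>R snd x"
  have [measurable]: "?W \<in> borel_measurable (borel \<Otimes>\<^sub>M borel)" by measurable
  have T[measurable]: "?T \<in> borel \<Otimes>\<^sub>M borel \<rightarrow>\<^sub>M borel" by measurable
  have Wn: "0 \<le> ?W x" for x by (auto simp: indicator_def)
  have int: "integrable ?M (\<lambda>x. F (?T x))"
    using F by (subst (asm) polar_distr[symmetric], subst (asm) integrable_distr_eq) auto
  then have int2: "integrable (lborel \<Otimes>\<^sub>M lborel) (\<lambda>x. ?W x *\<^sub>R F (?T x))"
    by (subst (asm) integrable_density) (use Wn in auto)
  have "(LINT y|lborel. F y) = (LINT x|?M. F (?T x))"
    by (subst polar_distr[symmetric], subst integral_distr) auto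
  also have "\<dots> = (LINT x|(lborel \<Otimes>\<^sub>M lborel). ?W x *\<^sub>R F (?T x))"
    by (subst integral_density) (use Wn in auto)
  also have "\<dots> = (LINT \<rho>|lborel. LINT w|lborel. ?W (\<rho>, w) *\<^sub>R F (?T (\<rho>, w)))"
    using lborel_pair.integral_fst'[OF int2] by simp
  also have "\<dots> = (LINT \<rho>|lborel. (indicator {0<..} \<rho> * (real DIM('a) * \<rho> ^ (DIM('a) - 1))) *\<^sub>R
      (LINT w|lborel. indicator (ball (0::'a) 1) w *\<^sub>R F ((\<rho> / norm w) *\<^sub>R w)))"
    by (subst integral_scaleR_right[symmetric]) (simp add: mult_ac)
  finally show ?thesis .
qed

text \<open>A null set of space meets almost every sphere in a null set; this allows the function of the
theorem to be replaced by a Borel measurable one.\<close>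

lemma polar_AE:
  assumes N: "N \<in> null_sets (lborel :: 'a::euclidean_space measure)"
  shows "AE \<rho> in lborel. \<rho> > 0 \<longrightarrow> (AE w in lborel. w \<in> ball (0::'a) 1 \<longrightarrow> (\<rho> / norm w) *\<^sub>R w \<notin> N)"
proof -
  have [measurable]: "N \<in> sets borel" using N by auto
  have bm: "(indicator (ball (0::'a) 1) :: 'a \<Rightarrow> real) \<in> borel_measurable borel" by (intro borel_measurable_indicator borel_open open_ball)
  have [measurable]: "(\<lambda>x. indicator (ball (0::'a) 1) (snd x) :: real) \<in> borel_measurable (borel \<Otimes>\<^sub>M borel)"
    by (intro measurable_compose[OF _ bm, of snd]) measurable
  note bm[measurable]
  let ?G = "\<lambda>\<rho> w. ennreal (indicator {0<..} \<rho> * (real DIM('a) * \<rho> ^ (DIM('a) - 1)) * indicator (ball 0 1) w)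
        * indicator N ((\<rho> / norm w) *\<^sub>R (w :: 'a))"
  have [measurable]: "case_prod ?G \<in> borel_measurable (borel \<Otimes>\<^sub>M borel)"
    unfolding split_beta' by measurable
  have "(\<integral>\<^sup>+\<rho>. \<integral>\<^sup>+w. ?G \<rho> w \<partial>lborel \<partial>lborel) = (\<integral>\<^sup>+y. indicator N y \<partial>lborel)"
    by (rule polar_nn_integral[symmetric]) measurable
  also have "\<dots> = 0" using N by (simp add: null_setsD1)
  finally have "AE \<rho> in lborel. (\<integral>\<^sup>+w. ?G \<rho> w \<partial>lborel) = 0"
    by (subst (asm) nn_integral_0_iff_AE) measurable
  then show ?thesis
  proof eventually_elim
    case (elim \<rho>)
    then have "AE w in lborel. ?G \<rho> w = 0"
      by (subst (asm) nn_integral_0_iff_AE) measurable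
    then show ?case
    proof (intro impI, eventually_elim)
      fix w assume w: "?G \<rho> w = 0" "\<rho> > 0"
      show "w \<in> ball (0::'a) 1 \<longrightarrow> (\<rho> / norm w) *\<^sub>R w \<notin> N"
        using w by (auto simp: indicator_def split: if_splits)
    qed
  qed
qed

lemma AE_lborel_scale:
  assumes "AE x in lborel. P (x :: 'a::euclidean_space)" and "c \<noteq> 0"
  shows "AE x in lborel. P (c *\<^sub>R x)"
proof -
  from assms(1) obtain N where N: "N \<in> null_sets lborel" "{x \<in> space lborel. \<not> P x} \<subseteq> N"
    by (auto simp: eventually_ae_filter)
  have [measurable]: "N \<in> sets borel" using N by auto
  have "AE x in lborel. x \<notin> N" using N(1) by (rule AE_not_in)
  then have "AE x in distr lborel borel (\<lambda>x. 0 + c *\<^sub>R x). x \<notin> N"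
    by (subst (asm) lborel_affine[of c 0]) (use \<open>c \<noteq> 0\<close> in \<open>auto simp: AE_density\<close>)
  then have "AE x in lborel. c *\<^sub>R x \<notin> N"
    by (subst (asm) AE_distr_iff) auto
  then show ?thesis by eventually_elim (use N(2) in auto)
qed

section \<open>Uniqueness of the Fourier transform\<close>

text \<open>Boxes form a generator of the Borel sets that is stable under intersection, so the integrals over
all Borel sets vanish.\<close>

lemma AE_eq_0_if_box_integrals_0:
  fixes h :: "'a::euclidean_space \<Rightarrow> complex"
  assumes h: "integrable lborel h"
    and box: "\<And>a b. (LINT v|lborel. indicator (box a b) v *\<^sub>R h v) = 0"
  shows "AE v in lborel. h v = 0"
proof -
  have [measurable]: "h \<in> borel_measurable borel" using h by auto
  let ?G = "range (\<lambda>(a, b). box a b :: 'a set)"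
  have UNIV0: "(LINT v|lborel. h v) = 0"
  proof -
    let ?s = "\<lambda>i v. indicator (box (- real i *\<^sub>R One) (real i *\<^sub>R One)) v *\<^sub>R h v"
    have "(\<lambda>i. LINT v|lborel. ?s i v) \<longlonglongrightarrow> (LINT v|lborel. h v)"
    proof (rule integral_dominated_convergence[where w = "\<lambda>v. norm (h v)"])
      show "AE v in lborel. (\<lambda>i. ?s i v) \<longlonglongrightarrow> h v"
      proof (rule AE_I2, rule tendsto_eventually)
        fix v :: 'a
        have "v \<in> (\<Union>i. box (- real i *\<^sub>R One) (real i *\<^sub>R One))" by (simp add: UN_box_eq_UNIV)
        then obtain i0 where i0: "v \<in> box (- real i0 *\<^sub>R One) (real i0 *\<^sub>R One)" by auto
        have "v \<in> box (- real i *\<^sub>R One) (real i *\<^sub>R One)" if "i \<ge> i0" for i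
          using i0 that by (force simp: mem_box)
        then show "\<forall>\<^sub>F i in sequentially. ?s i v = h v"
          by (auto simp: eventually_sequentially intro!: exI[of _ i0])
      qed
      show "AE v in lborel. norm (?s i v) \<le> norm (h v)" for i
        by (rule AE_I2) (auto simp: indicator_def)
    qed (use h in auto)
    then show ?thesis using box by (simp add: LIMSEQ_const_iff)
  qed
  have *: "(LINT v|lborel. indicator A v *\<^sub>R h v) = 0" if "A \<in> sets borel" for A
  proof -
    have iA: "integrable lborel (\<lambda>v. indicator A v *\<^sub>R h v)" if "A \<in> sets borel" for A
      using h that by (intro integrable_mult_indicator) auto
    have "Int_stable ?G"
      by (auto simp: Int_stable_def box_Int_box)
    moreover have "?G \<subseteq> Pow UNIV" by auto
    moreover have AA: "A \<in> sigma_sets UNIV ?G" using that by (simp add: borel_eq_box)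
    moreover have sb: "sigma_sets UNIV ?G = sets borel" by (simp add: borel_eq_box)
    ultimately show ?thesis
    proof (induction A rule: sigma_sets_induct_disjoint)
      case (basic A) then show ?case using box by auto
    next
      case empty show ?case by simp
    next
      case (compl A)
      then have A: "A \<in> sets borel" using sb by simp
      have "(LINT v|lborel. indicator (UNIV - A) v *\<^sub>R h v) = (LINT v|lborel. h v - indicator A v *\<^sub>R h v)"
        by (intro Bochner_Integration.integral_cong) (auto simp: indicator_def)
      then show ?case using compl UNIV0 iA[OF A] h by simp
    next
      case (union A)
      then have A: "A i \<in> sets borel" for i using sb by auto
      have "(LINT v:(\<Union>i. A i)|lborel. h v) = (\<Sum>i. LINT v:A i|lborel. h v)"
        by (rule lebesgue_integral_countable_add)
          (use A union h in \<open>auto simp: disjoint_family_on_def set_integrable_def intro!: integrable_mult_indicator\<close>)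
      then show ?case using union by (simp add: set_lebesgue_integral_def)
    qed
  qed
  have "AE v in lborel. Re (h v) = 0"
  proof (rule density_unique_real)
    fix A assume "A \<in> sets (lborel :: 'a measure)"
    then have A: "A \<in> sets borel" by simp
    have "(LINT v:A|lborel. Re (h v)) = Re (LINT v|lborel. indicator A v *\<^sub>R h v)"
      unfolding set_lebesgue_integral_def using h A
      by (subst integral_Re[symmetric]) (auto intro!: integrable_mult_indicator)
    then show "(LINT v:A|lborel. Re (h v)) = (LINT v:A|lborel. 0)" using *[OF A] by simp
  qed (use h in auto)
  moreover have "AE v in lborel. Im (h v) = 0"
  proof (rule density_unique_real)
    fix A assume "A \<in> sets (lborel :: 'a measure)"
    then have A: "A \<in> sets borel" by simp
    have "(LINT v:A|lborel. Im (h v)) = Im (LINT v|lborel. indicator A v *\<^sub>R h v)"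
      unfolding set_lebesgue_integral_def using h A
      by (subst integral_Im[symmetric]) (auto intro!: integrable_mult_indicator)
    then show "(LINT v:A|lborel. Im (h v)) = (LINT v:A|lborel. 0)" using *[OF A] by simp
  qed (use h in auto)
  ultimately show ?thesis by eventually_elim (simp add: complex_eq_iff)
qed

lemma fourier_gaussian:
  fixes v :: "'a::euclidean_space"
  shows "integrable lborel (\<lambda>w::'a. exp (- complex_of_real ((norm w)\<^sup>2) + 2 * \<i> * of_real (w \<bullet> v)))"
    and "(LINT w|lborel. exp (- complex_of_real ((norm w)\<^sup>2) + 2 * \<i> * of_real (w \<bullet> v)))
     = of_real (sqrt pi ^ DIM('a) * exp (- (norm v)\<^sup>2))"
proof -
  have L: "2 * \<i> * complex_of_real (w \<bullet> v) = (\<Sum>b\<in>Basis. (2 * \<i> * of_real (v \<bullet> b)) * of_real (w \<bullet> b))" for w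
    by (subst euclidean_inner) (simp add: sum_distrib_left mult_ac)
  have c: "(\<Sum>b\<in>Basis. (2 * \<i> * complex_of_real (v \<bullet> b))\<^sup>2) / 4 = of_real (- (norm v)\<^sup>2)"
  proof -
    have "(2 * \<i> * complex_of_real (v \<bullet> b))\<^sup>2 = of_real (- 4 * (v \<bullet> b)\<^sup>2)" for b
      by (simp add: power_mult_distrib)
    then have "(\<Sum>b\<in>Basis. (2 * \<i> * complex_of_real (v \<bullet> b))\<^sup>2) = of_real (- 4 * (\<Sum>b\<in>Basis. (v \<bullet> b)\<^sup>2))"
      by (simp add: sum_distrib_left)
    also have "(\<Sum>b\<in>Basis. (v \<bullet> b)\<^sup>2) = (norm v)\<^sup>2"
      unfolding power2_norm_eq_inner euclidean_inner[of v v] by (simp add: power2_eq_square)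
    finally show ?thesis by simp
  qed
  note G = gaussian_integral_euclidean[of "\<lambda>w. 2 * \<i> * complex_of_real (w \<bullet> v)" "\<lambda>b. 2 * \<i> * of_real (v \<bullet> b)", OF L]
  show "integrable lborel (\<lambda>w::'a. exp (- complex_of_real ((norm w)\<^sup>2) + 2 * \<i> * of_real (w \<bullet> v)))"
    by (rule G(1))
  show "(LINT w|lborel. exp (- complex_of_real ((norm w)\<^sup>2) + 2 * \<i> * of_real (w \<bullet> v)))
     = of_real (sqrt pi ^ DIM('a) * exp (- (norm v)\<^sup>2))"
    unfolding G(2) c by (simp add: exp_of_real[symmetric])
qed

lemma integrable_gaussian:
  "integrable lborel (\<lambda>w::'a::euclidean_space. exp (- (norm w)\<^sup>2))"
  "(LINT w|lborel. exp (- (norm (w::'a::euclidean_space))\<^sup>2)) = sqrt pi ^ DIM('a)"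
proof -
  have e: "exp (- (norm w)\<^sup>2) = Re (exp (- complex_of_real ((norm w)\<^sup>2) + 2 * \<i> * of_real (w \<bullet> 0)))" for w :: 'a
    using exp_of_real[of "- (norm w)\<^sup>2", where 'a = complex] by (metis Re_complex_of_real add.right_neutral inner_zero_right mult_zero_right of_real_0 of_real_minus)
  show "integrable lborel (\<lambda>w::'a. exp (- (norm w)\<^sup>2))"
    unfolding e by (rule integrable_Re[OF fourier_gaussian(1)])
  show "(LINT w|lborel. exp (- (norm (w::'a))\<^sup>2)) = sqrt pi ^ DIM('a)"
    unfolding e by (subst integral_Re[OF fourier_gaussian(1)], subst fourier_gaussian(2)) simp
qed

text \<open>The transform is only required to vanish almost everywhere. Since the Gaussian is its own
transform, Fubini shows that every Gaussian average of \<open>h\<close> vanishes; integrating these over the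
centres in a box and letting the Gaussians concentrate gives the box integrals.\<close>

lemma fourier_unique:
  fixes h :: "'a::euclidean_space \<Rightarrow> complex"
  assumes h: "integrable lborel h"
    and F: "AE \<xi> in lborel. (LINT v|lborel. h v * exp (\<i> * of_real (\<xi> \<bullet> v))) = 0"
  shows "AE v in lborel. h v = 0"
proof (rule AE_eq_0_if_box_integrals_0[OF h])
  have [measurable]: "h \<in> borel_measurable borel" using h by auto
  have gauss0: "(LINT v|lborel. h v * of_real (exp (- (norm (k *\<^sub>R (v - v0)))\<^sup>2))) = 0" if "k > 0" for k v0
  proof -
    let ?g = "\<lambda>v w. h v * exp (- complex_of_real ((norm w)\<^sup>2) + 2 * \<i> * of_real (w \<bullet> (k *\<^sub>R (v - v0))))"
    have ng: "norm (?g v w) = norm (h v) * exp (- (norm w)\<^sup>2)" for v w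
      by (simp add: norm_mult)
    have int: "integrable (lborel \<Otimes>\<^sub>M lborel) (\<lambda>(v, w). ?g v w)"
    proof (rule lborel_pair.Fubini_integrable)
      show "integrable lborel (\<lambda>x. LINT y|lborel. norm (case (x, y) of (v, w) \<Rightarrow> ?g v w))"
        unfolding prod.case ng using h by simp
      show "AE x in lborel. integrable lborel (\<lambda>y. case (x, y) of (v, w) \<Rightarrow> ?g v w)"
        unfolding prod.case by (intro AE_I2 Bochner_Integration.integrable_mult_right fourier_gaussian(1))
    qed measurable
    have "of_real (sqrt pi ^ DIM('a)) * (LINT v|lborel. h v * of_real (exp (- (norm (k *\<^sub>R (v - v0)))\<^sup>2)))
       = (LINT v|lborel. LINT w|lborel. ?g v w)"
      unfolding integral_mult_right_zero fourier_gaussian(2)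
      by (subst integral_mult_right_zero[symmetric]) (simp add: mult_ac)
    also have "\<dots> = (LINT w|lborel. LINT v|lborel. ?g v w)"
      by (rule lborel_pair.Fubini_integral[OF int, symmetric])
    also have "\<dots> = (LINT w|(lborel :: 'a measure). 0)"
    proof (rule Bochner_Integration.integral_cong_AE)
      have "AE w in lborel. (LINT v|lborel. h v * exp (\<i> * of_real (((2 * k) *\<^sub>R w) \<bullet> v))) = 0"
        by (rule AE_lborel_scale[OF F]) (use \<open>k > 0\<close> in simp)
      then show "AE w in lborel. (LINT v|lborel. ?g v w) = 0"
      proof eventually_elim
        case (elim w)
        have "(LINT v|lborel. ?g v w) = (LINT v|lborel. exp (- complex_of_real ((norm w)\<^sup>2) - 2 * \<i> * of_real (w \<bullet> (k *\<^sub>R v0))) * (h v * exp (\<i> * of_real (((2 * k) *\<^sub>R w) \<bullet> v))))"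
          by (intro Bochner_Integration.integral_cong refl) (simp add: mult_exp_exp inner_diff_right algebra_simps)
        then show ?case using elim by (simp only: integral_mult_right_zero mult_zero_right)
      qed
    qed measurable
    finally show ?thesis by simp
  qed
  fix a b :: 'a
  define B where "B = box a b"
  have Bm[measurable]: "B \<in> sets borel" unfolding B_def by simp
  have eB: "emeasure lborel B < \<infinity>" unfolding B_def by (simp add: emeasure_lborel_box_eq)
  let ?\<theta> = "\<lambda>k v. LINT x|lborel. exp (- (norm x)\<^sup>2) * indicator B (v + (1/k) *\<^sub>R (x :: 'a))"
  have ind[measurable]: "(\<lambda>p. indicator B (fst p + c *\<^sub>R snd p) :: real) \<in> borel_measurable (borel \<Otimes>\<^sub>M borel)" for c
    by (intro measurable_compose[OF _ borel_measurable_indicator[OF Bm], of "\<lambda>p. fst p + c *\<^sub>R snd p"]) measurable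
  have ind2[measurable]: "(\<lambda>x. indicator B (v + c *\<^sub>R x) :: real) \<in> borel_measurable borel" for c v
    by (intro measurable_compose[OF _ borel_measurable_indicator[OF Bm], of "\<lambda>x. v + c *\<^sub>R x"]) measurable
  have \<theta>0: "(LINT v|lborel. h v * of_real (?\<theta> k v)) = 0" if k: "k > 0" for k :: real
  proof -
    have s: "?\<theta> k v = k ^ DIM('a) * (LINT y|lborel. indicator B y * exp (- (norm (k *\<^sub>R (v - y)))\<^sup>2))" for v
    proof -
      have "(LINT y|lborel. indicator B y * exp (- (norm (k *\<^sub>R (v - y)))\<^sup>2))
         = (LINT y|distr lborel borel (\<lambda>x. v + (1/k) *\<^sub>R x). (\<bar>1/k\<bar> ^ DIM('a)) *\<^sub>R (indicator B y * exp (- (norm (k *\<^sub>R (v - y)))\<^sup>2)))"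
        by (subst lborel_affine[of "1/k" v], use k in simp, subst integral_density) auto
      also have "\<dots> = (LINT x|lborel. (1/k) ^ DIM('a) * (indicator B (v + (1/k) *\<^sub>R x) * exp (- (norm x)\<^sup>2)))"
        by (subst integral_distr) (use k in \<open>auto simp: algebra_simps\<close>)
      finally show ?thesis using k by (simp add: power_divide mult_ac)
    qed
    let ?g = "\<lambda>v y. h v * of_real (indicator B y * exp (- (norm (k *\<^sub>R (v - y)))\<^sup>2))"
    have int: "integrable (lborel \<Otimes>\<^sub>M lborel) (\<lambda>(v, y). ?g v y)"
    proof (rule Bochner_Integration.integrable_bound)
      have iB: "integrable lborel (\<lambda>y. indicator B y :: real)" using eB by simp
      show "integrable (lborel \<Otimes>\<^sub>M lborel) (\<lambda>(v, y). norm (h v) * indicat_real B y)"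
      proof (rule lborel_pair.Fubini_integrable)
        show "integrable lborel (\<lambda>x. LINT y|lborel. norm (case (x, y) of (v, y) \<Rightarrow> norm (h v) * indicat_real B y))"
          using h by (simp add: abs_mult)
        show "AE x in lborel. integrable lborel (\<lambda>y. case (x, y) of (v, y) \<Rightarrow> norm (h v) * indicat_real B y)"
          using iB by (intro AE_I2) simp
      qed measurable
      show "AE x in lborel \<Otimes>\<^sub>M lborel. norm (case x of (v, y) \<Rightarrow> ?g v y) \<le> norm (case x of (v, y) \<Rightarrow> norm (h v) * indicat_real B y)"
        by (rule AE_I2) (auto simp: norm_mult indicator_def mult_left_le)
    qed measurable
    have gv: "(LINT y|lborel. ?g v y) = h v * of_real (LINT y|lborel. indicator B y * exp (- (norm (k *\<^sub>R (v - y)))\<^sup>2))" for v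
      by (simp only: integral_mult_right_zero integral_complex_of_real)
    have "(LINT v|lborel. h v * of_real (?\<theta> k v)) = (LINT v|lborel. of_real (k ^ DIM('a)) * (LINT y|lborel. ?g v y))"
      unfolding s gv by (simp add: mult_ac)
    also have "\<dots> = of_real (k ^ DIM('a)) * (LINT v|lborel. LINT y|lborel. ?g v y)"
      by (simp only: integral_mult_right_zero)
    also have "(LINT v|lborel. LINT y|lborel. ?g v y) = (LINT y|lborel. LINT v|lborel. ?g v y)"
      by (rule lborel_pair.Fubini_integral[OF int, symmetric])
    also have "\<dots> = (LINT y|lborel. of_real (indicator B y) * (LINT v|lborel. h v * of_real (exp (- (norm (k *\<^sub>R (v - y)))\<^sup>2))))"
      by (intro Bochner_Integration.integral_cong refl, subst integral_mult_right_zero[symmetric]) (simp add: mult_ac)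
    also have "\<dots> = 0" unfolding gauss0[OF k] by simp
    finally show ?thesis by simp
  qed
  have lim\<theta>: "(\<lambda>i. ?\<theta> (real (Suc i)) v) \<longlonglongrightarrow> sqrt pi ^ DIM('a) * indicator B v"
    if v: "v \<notin> cbox a b - box a b" for v
  proof -
    have "(\<lambda>i. LINT x|lborel. exp (- (norm x)\<^sup>2) * indicator B (v + (1/real (Suc i)) *\<^sub>R (x :: 'a)))
       \<longlonglongrightarrow> (LINT x|lborel. exp (- (norm (x :: 'a))\<^sup>2) * indicator B v)"
    proof (rule integral_dominated_convergence[where w = "\<lambda>x. exp (- (norm x)\<^sup>2)"])
      show "integrable lborel (\<lambda>x::'a. exp (- (norm x)\<^sup>2))" by (rule integrable_gaussian)
      show "AE x in lborel. (\<lambda>i. exp (- (norm x)\<^sup>2) * indicator B (v + (1/real (Suc i)) *\<^sub>R (x :: 'a)))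
         \<longlonglongrightarrow> exp (- (norm x)\<^sup>2) * indicator B v"
      proof (rule AE_I2)
        fix x :: 'a
        have l: "(\<lambda>i. v + (1/real (Suc i)) *\<^sub>R x) \<longlonglongrightarrow> v"
        proof -
          have "(\<lambda>i. v + (inverse (real (Suc i))) *\<^sub>R x) \<longlonglongrightarrow> v + 0 *\<^sub>R x"
            by (intro tendsto_intros LIMSEQ_inverse_real_of_nat)
          then show ?thesis by (simp add: divide_inverse)
        qed
        have "\<forall>\<^sub>F i in sequentially. indicator B (v + (1/real (Suc i)) *\<^sub>R x) = (indicator B v :: real)"
        proof (cases "v \<in> box a b")
          case True
          have "\<forall>\<^sub>F i in sequentially. v + (1/real (Suc i)) *\<^sub>R x \<in> box a b"
            by (rule topological_tendstoD[OF l open_box True])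
          then show ?thesis by eventually_elim (use True in \<open>auto simp: B_def\<close>)
        next
          case False
          then have "v \<in> - cbox a b" using v by auto
          moreover have "open (- cbox a b)" by (intro open_Compl closed_cbox)
          ultimately have "\<forall>\<^sub>F i in sequentially. v + (1/real (Suc i)) *\<^sub>R x \<in> - cbox a b"
            by (intro topological_tendstoD[OF l])
          then show ?thesis
            by eventually_elim (use False box_subset_cbox[of a b] in \<open>auto simp: B_def indicator_def\<close>)
        qed
        then show "(\<lambda>i. exp (- (norm x)\<^sup>2) * indicator B (v + (1/real (Suc i)) *\<^sub>R (x :: 'a)))
         \<longlonglongrightarrow> exp (- (norm x)\<^sup>2) * indicator B v"
          by (intro tendsto_mult tendsto_const tendsto_eventually)
      qed
      show "AE x in lborel. norm (exp (- (norm x)\<^sup>2) * indicator B (v + (1/real (Suc i)) *\<^sub>R (x :: 'a))) \<le> exp (- (norm x)\<^sup>2)" for i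
        by (rule AE_I2) (auto simp: indicator_def)
    qed measurable
    then show ?thesis by (simp add: integrable_gaussian(2))
  qed
  have "(\<lambda>i. LINT v|lborel. h v * of_real (?\<theta> (real (Suc i)) v)) \<longlonglongrightarrow> (LINT v|lborel. h v * of_real (sqrt pi ^ DIM('a) * indicator B v))"
  proof (rule integral_dominated_convergence[where w = "\<lambda>v. norm (h v) * sqrt pi ^ DIM('a)"])
    have "negligible (cbox a b - box a b)" by (rule negligible_frontier_interval)
    then have "cbox a b - box a b \<in> null_sets lborel"
      by (auto simp: negligible_iff_null_sets null_sets_completion_iff)
    then have "AE v in lborel. v \<notin> cbox a b - box a b" by (rule AE_not_in)
    then show "AE v in lborel. (\<lambda>i. h v * of_real (?\<theta> (real (Suc i)) v)) \<longlonglongrightarrow> h v * of_real (sqrt pi ^ DIM('a) * indicator B v)"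
      by eventually_elim (intro tendsto_mult tendsto_const tendsto_of_real lim\<theta>)
    show "AE v in lborel. norm (h v * of_real (?\<theta> (real (Suc i)) v)) \<le> norm (h v) * sqrt pi ^ DIM('a)" for i
    proof (rule AE_I2)
      fix v :: 'a
      have "\<bar>?\<theta> (real (Suc i)) v\<bar> \<le> (LINT x|lborel. exp (- (norm (x::'a))\<^sup>2))"
      proof (rule order_trans[OF integral_abs_bound], rule integral_mono)
        show "integrable lborel (\<lambda>x::'a. exp (- (norm x)\<^sup>2))" by (rule integrable_gaussian)
        then show "integrable lborel (\<lambda>x. \<bar>exp (- (norm x)\<^sup>2) * indicator B (v + (1/real (Suc i)) *\<^sub>R (x :: 'a))\<bar>)"
          by (rule Bochner_Integration.integrable_bound) (auto simp: indicator_def)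
      qed (auto simp: indicator_def)
      then show "norm (h v * of_real (?\<theta> (real (Suc i)) v)) \<le> norm (h v) * sqrt pi ^ DIM('a)"
        by (simp add: norm_mult integrable_gaussian(2) mult_left_mono)
    qed
    show "(\<lambda>v. h v * of_real (?\<theta> (real (Suc i)) v)) \<in> borel_measurable lborel" for i
    proof -
      have "(\<lambda>(v, x). exp (- (norm x)\<^sup>2) * indicator B (v + (1/real (Suc i)) *\<^sub>R (x :: 'a))) \<in> borel_measurable (lborel \<Otimes>\<^sub>M lborel)"
        unfolding split_beta' by measurable
      then have "(\<lambda>v. ?\<theta> (real (Suc i)) v) \<in> borel_measurable lborel"
        by (rule lborel.borel_measurable_lebesgue_integral)
      then show ?thesis by measurable
    qed
  qed (use h in \<open>measurable, auto\<close>)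
  then have "(LINT v|lborel. h v * of_real (sqrt pi ^ DIM('a) * indicator B v)) = 0"
    by (simp add: \<theta>0 LIMSEQ_const_iff)
  also have "(LINT v|lborel. h v * of_real (sqrt pi ^ DIM('a) * indicator B v)) = of_real (sqrt pi ^ DIM('a)) * (LINT v|lborel. indicator B v *\<^sub>R h v)"
    by (subst integral_mult_right_zero[symmetric]) (simp add: mult_ac scaleR_conv_of_real)
  finally show "(LINT v|lborel. indicator (box a b) v *\<^sub>R h v) = 0" unfolding B_def by simp
qed

lemma integrable_gaussian_scale:
  assumes "c > 0"
  shows "integrable lborel (\<lambda>w::'a::euclidean_space. exp (- c * (norm w)\<^sup>2))"
proof -
  let ?k = "sqrt c"
  have k: "?k > 0" using assms by simp
  have "integrable lborel (\<lambda>w::'a. exp (- (norm w)\<^sup>2))" by (rule integrable_gaussian)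
  then have "integrable (density (distr lborel borel (\<lambda>x. 0 + ?k *\<^sub>R x)) (\<lambda>_. ennreal (\<bar>?k\<bar> ^ DIM('a)))) (\<lambda>w::'a. exp (- (norm w)\<^sup>2))"
    using lborel_affine[of ?k "0::'a"] k by simp
  then have "integrable (distr lborel borel (\<lambda>x. 0 + ?k *\<^sub>R x)) (\<lambda>w::'a. (\<bar>?k\<bar> ^ DIM('a)) *\<^sub>R exp (- (norm w)\<^sup>2))"
    by (subst (asm) integrable_density) auto
  then have "integrable lborel (\<lambda>w::'a. (\<bar>?k\<bar> ^ DIM('a)) *\<^sub>R exp (- (norm (0 + ?k *\<^sub>R w))\<^sup>2))"
    by (subst (asm) integrable_distr_eq) auto
  then show ?thesis using k assms by (simp add: power_mult_distrib)
qed

lemma integrable_gaussian_exp: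
  assumes "c > 0"
  shows "integrable lborel (\<lambda>w::'a::euclidean_space. exp (- c * (norm w)\<^sup>2 + C * norm w))"
proof (rule Bochner_Integration.integrable_bound)
  show "integrable lborel (\<lambda>w::'a. exp (C\<^sup>2 / (2 * c)) * exp (- (c/2) * (norm w)\<^sup>2))"
    using assms by (intro integrable_mult_right integrable_gaussian_scale) simp
  show "AE w in lborel. norm (exp (- c * (norm (w::'a))\<^sup>2 + C * norm w)) \<le> norm (exp (C\<^sup>2 / (2 * c)) * exp (- (c/2) * (norm w)\<^sup>2))"
  proof (rule AE_I2)
    fix w :: 'a
    have "0 \<le> (c * norm w - C)\<^sup>2" by simp
    then have "2 * c * (C * norm w) \<le> 2 * c * (C\<^sup>2 / (2*c) + (c/2) * (norm w)\<^sup>2)"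
      using assms by (simp add: power2_eq_square algebra_simps)
    then have "C * norm w \<le> C\<^sup>2 / (2*c) + (c/2) * (norm w)\<^sup>2"
      using assms by (subst (asm) mult_le_cancel_left_pos) auto
    then show "norm (exp (- c * (norm w)\<^sup>2 + C * norm w)) \<le> norm (exp (C\<^sup>2 / (2 * c)) * exp (- (c/2) * (norm w)\<^sup>2))"
      by (simp add: mult_exp_exp)
  qed
qed measurable

section \<open>The bilinear product on complex vectors\<close>

definition bdot :: "complex ^ 'n \<Rightarrow> complex ^ 'n \<Rightarrow> complex" where
  "bdot x y = (\<Sum>i\<in>UNIV. x $ i * y $ i)"

text \<open>With the bilinear product, the Hermitian product of \<open>z\<close> and \<open>u\<close> is \<open>bdot z (vcnj u)\<close>; keeping the
conjugation separate makes all dependence on the parameters holomorphic.\<close>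

definition vcnj :: "complex ^ 'n \<Rightarrow> complex ^ 'n" where
  "vcnj u = (\<chi> i. cnj (u $ i))"

lemma bdot_commute: "bdot x y = bdot y x"
  by (simp add: bdot_def mult.commute)

lemma bdot_simps [simp]:
  "bdot (x + y) z = bdot x z + bdot y z" "bdot z (x + y) = bdot z x + bdot z y"
  "bdot (x - y) z = bdot x z - bdot y z" "bdot z (x - y) = bdot z x - bdot z y"
  "bdot (c *s x) z = c * bdot x z" "bdot z (c *s x) = c * bdot z x"
  "bdot (r *\<^sub>R x) z = of_real r * bdot x z" "bdot z (r *\<^sub>R x) = of_real r * bdot z x"
  "bdot (- x) z = - bdot x z" "bdot z (- x) = - bdot z x"
  "bdot 0 z = 0" "bdot z 0 = 0"
  by (simp_all add: bdot_def sum.distrib sum_subtractf sum_distrib_left sum_negf scaleR_conv_of_real[where 'a = complex] algebra_simps)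

lemma bdot_axis [simp]: "bdot (axis i c) x = c * x $ i" "bdot x (axis i c) = x $ i * c"
  by (simp_all add: bdot_def axis_def if_distrib[of "\<lambda>a. a * _"] if_distrib[of "\<lambda>a. _ * a"] cong: if_cong)

lemma vcnj_nth [simp]: "vcnj u $ i = cnj (u $ i)"
  by (simp add: vcnj_def)

lemma vcnj_simps [simp]:
  "vcnj (x + y) = vcnj x + vcnj y" "vcnj (x - y) = vcnj x - vcnj y" "vcnj (r *\<^sub>R x) = r *\<^sub>R vcnj x"
  "vcnj (c *s x) = cnj c *s vcnj x" "vcnj (vcnj x) = x" "vcnj 0 = 0" "vcnj (axis i c) = axis i (cnj c)"
  by (simp_all add: vec_eq_iff axis_def)

lemma cnj_bdot: "cnj (bdot x y) = bdot (vcnj x) (vcnj y)"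
  by (simp add: bdot_def)

lemma norm_vcnj [simp]: "norm (vcnj u) = norm u"
  by (simp add: norm_vec_def)

lemma norm_bdot_le: "norm (bdot x y) \<le> norm x * norm y"
proof -
  have "norm (bdot x y) \<le> (\<Sum>i\<in>UNIV. \<bar>norm (x $ i)\<bar> * \<bar>norm (y $ i)\<bar>)"
    unfolding bdot_def by (rule order_trans[OF norm_sum]) (simp add: norm_mult)
  also have "\<dots> \<le> norm x * norm y"
    unfolding norm_vec_def by (rule L2_set_mult_ineq)
  finally show ?thesis .
qed

lemma bdot_vcnj_self: "bdot (vcnj u) u = of_real ((norm u)\<^sup>2)" "bdot u (vcnj u) = of_real ((norm u)\<^sup>2)"
proof -
  have "(norm u)\<^sup>2 = (\<Sum>i\<in>UNIV. (norm (u $ i))\<^sup>2)"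
    by (simp add: norm_vec_def L2_set_def sum_nonneg)
  then show 1: "bdot (vcnj u) u = of_real ((norm u)\<^sup>2)"
    unfolding bdot_def by (simp only: of_real_sum complex_norm_square vcnj_nth mult.commute)
  then show "bdot u (vcnj u) = of_real ((norm u)\<^sup>2)" by (simp add: bdot_commute)
qed

lemma continuous_on_bdot [continuous_intros]:
  "continuous_on S f \<Longrightarrow> continuous_on S g \<Longrightarrow> continuous_on S (\<lambda>x. bdot (f x) (g x))"
  unfolding bdot_def by (intro continuous_intros)

lemma continuous_on_vcnj [continuous_intros]:
  "continuous_on S f \<Longrightarrow> continuous_on S (\<lambda>x. vcnj (f x))"
  unfolding vcnj_def by (intro continuous_intros continuous_on_vec_lambda)

lemma borel_measurable_vcnj [measurable]: "f \<in> borel_measurable M \<Longrightarrow> (\<lambda>x. vcnj (f x)) \<in> borel_measurable M"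
  by (rule measurable_compose[of f M borel vcnj])
    (auto intro!: borel_measurable_continuous_onI continuous_intros)

lemma borel_measurable_bdot [measurable]:
  fixes f g :: "'b \<Rightarrow> complex ^ 'n"
  assumes [measurable]: "f \<in> borel_measurable M" "g \<in> borel_measurable M"
  shows "(\<lambda>x. bdot (f x) (g x)) \<in> borel_measurable M"
proof -
  have "(\<lambda>p. bdot (fst p) (snd p)) \<in> borel_measurable (borel :: ((complex ^ 'n) \<times> (complex ^ 'n)) measure)"
    by (intro borel_measurable_continuous_onI continuous_intros)
  moreover have "(\<lambda>x. (f x, g x)) \<in> borel_measurable M"
    by measurable
  ultimately have "(\<lambda>x. bdot (fst (f x, g x)) (snd (f x, g x))) \<in> borel_measurable M"
    by (rule measurable_compose[rotated])
  then show ?thesis by simp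
qed

lemma sum_Basis_cvec:
  "(\<Sum>b\<in>(Basis :: (complex ^ 'n) set). \<phi> b) = (\<Sum>i\<in>UNIV. \<phi> (axis i 1) + \<phi> (axis i \<i>))"
proof -
  have B: "(Basis :: (complex ^ 'n) set) = (\<lambda>(i, u). axis i u) ` (UNIV \<times> {1, \<i>})"
    by (auto simp: Basis_vec_def Basis_complex_def)
  have "inj_on (\<lambda>(i, u). axis i u :: complex ^ 'n) (UNIV \<times> {1, \<i>})"
    by (auto simp: inj_on_def axis_eq_axis)
  then have "(\<Sum>b\<in>(Basis :: (complex ^ 'n) set). \<phi> b) = (\<Sum>(i, u)\<in>UNIV \<times> {1, \<i>}. \<phi> (axis i u))"
    unfolding B by (subst sum.reindex) (auto simp: case_prod_unfold)
  also have "\<dots> = (\<Sum>i\<in>UNIV. \<Sum>u\<in>{1, \<i>}. \<phi> (axis i u))"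
    by (rule sum.cartesian_product[symmetric])
  also have "\<dots> = (\<Sum>i\<in>UNIV. \<phi> (axis i 1) + \<phi> (axis i \<i>))"
    by (intro sum.cong refl) (simp add: complex_eq_iff)
  finally show ?thesis .
qed

lemma gaussian_integral_bdot:
  fixes x y :: "complex ^ 'n"
  shows "(LINT w|lborel. exp (- complex_of_real ((norm w)\<^sup>2)) * exp (bdot w x + bdot (vcnj w) y))
     = of_real (pi ^ CARD('n)) * exp (bdot x y)"
proof -
  let ?L = "\<lambda>w. bdot w x + bdot (vcnj w) y"
  have L: "?L w = (\<Sum>b\<in>Basis. ?L b * of_real (w \<bullet> b))" for w
  proof -
    have "(\<Sum>b\<in>Basis. ?L b * of_real (w \<bullet> b)) = (\<Sum>i\<in>UNIV. (x $ i + y $ i) * of_real (Re (w $ i)) + (\<i> * x $ i - \<i> * y $ i) * of_real (Im (w $ i)))"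
      by (simp add: sum_Basis_cvec inner_axis inner_complex_def)
    also have "\<dots> = (\<Sum>i\<in>UNIV. w $ i * x $ i + cnj (w $ i) * y $ i)"
      by (intro sum.cong refl) (simp add: complex_eq_iff algebra_simps)
    finally show ?thesis by (simp add: bdot_def sum.distrib)
  qed
  have "(\<Sum>b\<in>Basis. (?L b)\<^sup>2) / 4 = bdot x y"
  proof -
    have "(\<Sum>b\<in>Basis. (?L b)\<^sup>2) = (\<Sum>i\<in>UNIV. (x $ i + y $ i)\<^sup>2 + (\<i> * x $ i - \<i> * y $ i)\<^sup>2)"
      by (simp add: sum_Basis_cvec)
    also have "\<dots> = (\<Sum>i\<in>UNIV. 4 * (x $ i * y $ i))"
      by (intro sum.cong refl) (simp add: power2_eq_square algebra_simps)
    also have "\<dots> = 4 * bdot x y" by (simp add: bdot_def sum_distrib_left)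
    finally show ?thesis by simp
  qed
  moreover have "of_real (sqrt pi) ^ DIM(complex ^ 'n) = (of_real (pi ^ CARD('n)) :: complex)"
    by (simp add: power_mult mult.commute[of _ 2] of_real_power[symmetric] del: of_real_power)
  ultimately show ?thesis
    using gaussian_integral_euclidean(2)[of ?L ?L, OF L] by (simp add: mult_exp_exp)
qed

text \<open>The Gaussian integral of \<open>exp(w\<cdot>x + cnj w\<cdot>y)\<close> is \<open>pi^n exp(x\<cdot>y)\<close>, and the moments are its Taylor
coefficients.\<close>

lemma gaussian_moments:
  fixes x y :: "complex ^ 'n"
  shows "integrable lborel (\<lambda>w. exp (- complex_of_real ((norm w)\<^sup>2)) * bdot w x ^ k * bdot (vcnj w) y ^ l)"
    and "(LINT w|lborel. exp (- complex_of_real ((norm w)\<^sup>2)) * bdot w x ^ k * bdot (vcnj w) y ^ l)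
     = (if k = l then of_real (pi ^ CARD('n) * fact k) * bdot x y ^ k else 0)"
proof -
  let ?h = "\<lambda>w::complex ^ 'n. exp (- complex_of_real ((norm w)\<^sup>2))"
  have nh: "norm (?h w) = exp (- (norm w)\<^sup>2)" for w by simp
  have I: "integrable lborel (\<lambda>w. norm (?h w * exp (b * bdot (vcnj w) y)) * exp (C * norm (bdot w x)))" if C: "C \<ge> 0" for b C
  proof (rule Bochner_Integration.integrable_bound[OF integrable_gaussian_exp[of 1 "norm b * norm y + C * norm x", OF zero_less_one]])
    show "AE w in lborel. norm (norm (?h w * exp (b * bdot (vcnj w) y)) * exp (C * norm (bdot w x)))
       \<le> norm (exp (- 1 * (norm w)\<^sup>2 + (norm b * norm y + C * norm x) * norm w))"
    proof (rule AE_I2)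
      fix w :: "complex ^ 'n"
      have "Re (b * bdot (vcnj w) y) \<le> norm b * (norm w * norm y)"
        using complex_Re_le_cmod[of "b * bdot (vcnj w) y"] mult_left_mono[OF norm_bdot_le[of "vcnj w" y], of "norm b"]
        by (simp add: norm_mult)
      moreover have "C * norm (bdot w x) \<le> C * (norm w * norm x)"
        using C norm_bdot_le by (intro mult_left_mono) auto
      ultimately show "norm (norm (?h w * exp (b * bdot (vcnj w) y)) * exp (C * norm (bdot w x)))
       \<le> norm (exp (- 1 * (norm w)\<^sup>2 + (norm b * norm y + C * norm x) * norm w))"
        by (simp add: norm_mult mult_exp_exp algebra_simps)
    qed
  qed measurable
  have I2: "integrable lborel (\<lambda>w. norm (?h w * bdot w x ^ k) * exp (1 * norm (bdot (vcnj w) y)))"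
  proof (rule Bochner_Integration.integrable_bound)
    show "integrable lborel (\<lambda>w::complex ^ 'n. fact k * exp (- 1 * (norm w)\<^sup>2 + (norm x + norm y) * norm w))"
      by (intro integrable_mult_right integrable_gaussian_exp) simp
    show "AE w in lborel. norm (norm (?h w * bdot w x ^ k) * exp (1 * norm (bdot (vcnj w) y)))
       \<le> norm (fact k * exp (- 1 * (norm w)\<^sup>2 + (norm x + norm y) * norm w))"
    proof (rule AE_I2)
      fix w :: "complex ^ 'n"
      have "norm (bdot w x) ^ k \<le> fact k / 1 ^ k * exp (1 * norm (bdot w x))"
        by (rule power_le_fact_exp) auto
      also have "\<dots> \<le> fact k * exp (norm w * norm x)" using norm_bdot_le[of w x] by simp
      finally have 1: "norm (bdot w x) ^ k \<le> fact k * exp (norm w * norm x)" .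
      have 2: "exp (norm (bdot (vcnj w) y)) \<le> exp (norm w * norm y)" using norm_bdot_le[of "vcnj w" y] by simp
      have "norm (bdot w x) ^ k * exp (norm (bdot (vcnj w) y)) \<le> (fact k * exp (norm w * norm x)) * exp (norm w * norm y)"
        by (rule mult_mono[OF 1 2]) auto
      then have "exp (- (norm w)\<^sup>2) * (norm (bdot w x) ^ k * exp (norm (bdot (vcnj w) y)))
         \<le> exp (- (norm w)\<^sup>2) * ((fact k * exp (norm w * norm x)) * exp (norm w * norm y))"
        by (rule mult_left_mono) simp
      also have "\<dots> = fact k * (exp (- (norm w)\<^sup>2) * exp (norm w * norm x) * exp (norm w * norm y))"
        by (simp only: mult_ac)
      also have "\<dots> = fact k * exp (- 1 * (norm w)\<^sup>2 + (norm x + norm y) * norm w)"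
        by (simp only: mult_exp_exp) (simp add: algebra_simps)
      finally show "norm (norm (?h w * bdot w x ^ k) * exp (1 * norm (bdot (vcnj w) y)))
       \<le> norm (fact k * exp (- 1 * (norm w)\<^sup>2 + (norm x + norm y) * norm w))"
        by (simp add: norm_mult norm_power mult.assoc)
    qed
  qed measurable
  have step1: "(LINT w|lborel. ?h w * exp (b * bdot (vcnj w) y) * bdot w x ^ k) = of_real (pi ^ CARD('n)) * (b * bdot x y) ^ k" for b k
  proof -
    have "(\<lambda>k. (LINT w|lborel. ?h w * exp (b * bdot (vcnj w) y) * bdot w x ^ k) / fact k)
       = (\<lambda>k. of_real (pi ^ CARD('n)) * (b * bdot x y) ^ k / fact k)"
    proof (rule powser_coeffs_unique[of 1])
      fix c :: complex assume c: "norm c < 1"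
      show "(\<lambda>k. (LINT w|lborel. ?h w * exp (b * bdot (vcnj w) y) * bdot w x ^ k) / fact k * c ^ k)
         sums (of_real (pi ^ CARD('n)) * exp (c * b * bdot x y))"
      proof -
        have 1: "(\<lambda>k. (LINT w|lborel. ?h w * exp (b * bdot (vcnj w) y) * bdot w x ^ k) / fact k * c ^ k)
         sums (LINT w|lborel. ?h w * exp (b * bdot (vcnj w) y) * exp (c * bdot w x))"
          by (rule integral_exp_sums[OF _ _ I[of 1 b]]) (use c in auto)
        have "(LINT w|lborel. ?h w * exp (b * bdot (vcnj w) y) * exp (c * bdot w x))
          = (LINT w|lborel. ?h w * exp (bdot w (c *s x) + bdot (vcnj w) (b *s y)))"
          by (intro Bochner_Integration.integral_cong refl) (simp only: mult.assoc mult_exp_exp bdot_simps add_ac)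
        also have "\<dots> = of_real (pi ^ CARD('n)) * exp (c * b * bdot x y)"
          unfolding gaussian_integral_bdot by (simp add: mult_ac)
        finally have 2: "(LINT w|lborel. ?h w * exp (b * bdot (vcnj w) y) * exp (c * bdot w x)) = of_real (pi ^ CARD('n)) * exp (c * b * bdot x y)" .
        show ?thesis using 1 unfolding 2 .
      qed
      have "(\<lambda>k. of_real (pi ^ CARD('n)) * ((c * b * bdot x y) ^ k /\<^sub>R fact k)) sums (of_real (pi ^ CARD('n)) * exp (c * b * bdot x y))"
        by (intro sums_mult exp_converges)
      moreover have "(\<lambda>k. of_real (pi ^ CARD('n)) * ((c * b * bdot x y) ^ k /\<^sub>R fact k)) = (\<lambda>k. of_real (pi ^ CARD('n)) * (b * bdot x y) ^ k / fact k * c ^ k)"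
        by (rule ext) (simp add: scaleR_conv_of_real power_mult_distrib field_simps)
      ultimately show "(\<lambda>k. of_real (pi ^ CARD('n)) * (b * bdot x y) ^ k / fact k * c ^ k)
         sums (of_real (pi ^ CARD('n)) * exp (c * b * bdot x y))" by (simp only:)
    qed simp
    from fun_cong[OF this, of k] show ?thesis by simp
  qed
  show "integrable lborel (\<lambda>w. ?h w * bdot w x ^ k * bdot (vcnj w) y ^ l)"
    by (rule integrable_mult_power[OF _ _ I2]) auto
  have "(\<lambda>l. (LINT w|lborel. ?h w * bdot w x ^ k * bdot (vcnj w) y ^ l) / fact l)
       = (\<lambda>l. if l = k then of_real (pi ^ CARD('n)) * (bdot x y) ^ k else 0)"
  proof (rule powser_coeffs_unique[of 1])
    fix c :: complex assume c: "norm c < 1"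
    have 1: "(\<lambda>l. (LINT w|lborel. ?h w * bdot w x ^ k * bdot (vcnj w) y ^ l) / fact l * c ^ l)
         sums (LINT w|lborel. ?h w * bdot w x ^ k * exp (c * bdot (vcnj w) y))"
      by (rule integral_exp_sums[OF _ _ I2]) (use c in auto)
    have 2: "(LINT w|lborel. ?h w * bdot w x ^ k * exp (c * bdot (vcnj w) y)) = of_real (pi ^ CARD('n)) * (c * bdot x y) ^ k"
      unfolding step1[of c k, symmetric] by (intro Bochner_Integration.integral_cong refl) (simp only: mult_ac)
    show "(\<lambda>l. (LINT w|lborel. ?h w * bdot w x ^ k * bdot (vcnj w) y ^ l) / fact l * c ^ l)
         sums (of_real (pi ^ CARD('n)) * (c * bdot x y) ^ k)" using 1 unfolding 2 .
    have "(\<lambda>l. if l = k then of_real (pi ^ CARD('n)) * (bdot x y) ^ k * c ^ l else 0) sums (of_real (pi ^ CARD('n)) * (bdot x y) ^ k * c ^ k)"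
      by (rule sums_single)
    moreover have "(\<lambda>l. if l = k then of_real (pi ^ CARD('n)) * (bdot x y) ^ k * c ^ l else 0)
        = (\<lambda>l. (if l = k then of_real (pi ^ CARD('n)) * (bdot x y) ^ k else 0) * c ^ l)"
      by auto
    moreover have "of_real (pi ^ CARD('n)) * (bdot x y) ^ k * c ^ k = of_real (pi ^ CARD('n)) * (c * bdot x y) ^ k"
      by (simp add: power_mult_distrib)
    ultimately show "(\<lambda>l. (if l = k then of_real (pi ^ CARD('n)) * (bdot x y) ^ k else 0) * c ^ l)
         sums (of_real (pi ^ CARD('n)) * (c * bdot x y) ^ k)"
      by (simp only:)
  qed simp
  from fun_cong[OF this, of l]
  show "(LINT w|lborel. ?h w * bdot w x ^ k * bdot (vcnj w) y ^ l)
     = (if k = l then of_real (pi ^ CARD('n) * fact k) * bdot x y ^ k else 0)"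
    by (cases "k = l") (simp_all add: divide_eq_eq mult.commute mult.left_commute)
qed

section \<open>Spherical means of exponentials\<close>

text \<open>The sphere measure before completion; being a Borel measure it can be used in Fubini's theorem.\<close>

definition usphere :: "real \<Rightarrow> 'a::euclidean_space measure" where
  "usphere r = distr (uniform_measure lborel (ball 0 1)) borel (\<lambda>x. (r / norm x) *\<^sub>R x)"

lemma sphere_measure_eq: "sphere_measure r = completion (usphere r)"
  by (simp add: sphere_measure_def usphere_def)

lemma sets_usphere [simp, measurable_cong]: "sets (usphere r) = sets borel"
  by (simp add: usphere_def)

lemma space_usphere [simp]: "space (usphere r) = UNIV"
  by (simp add: usphere_def)

lemma emeasure_unit_ball: "emeasure lborel (ball (0::'a::euclidean_space) 1) \<noteq> 0"
    "emeasure lborel (ball (0::'a) 1) < \<infinity>"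
proof -
  have "\<not> negligible (ball (0::'a) 1)" by (intro open_not_negligible) auto
  then show "emeasure lborel (ball (0::'a::euclidean_space) 1) \<noteq> 0"
    by (auto simp: negligible_iff_null_sets null_sets_completion_iff null_sets_def)
  show "emeasure lborel (ball (0::'a) 1) < \<infinity>"
    by (rule emeasure_lborel_ball_finite)
qed

lemma measure_unit_ball_pos: "measure lborel (ball (0::'a::euclidean_space) 1) > 0"
  using emeasure_unit_ball[where 'a = 'a] by (simp add: measure_def enn2real_positive_iff less_top[symmetric] zero_less_iff_neq_zero)

lemma prob_space_usphere: "prob_space (usphere r :: 'a::euclidean_space measure)"
  unfolding usphere_def
  by (intro prob_space.prob_space_distr prob_space_uniform_measure)
    (use emeasure_unit_ball[where 'a = 'a] in \<open>auto simp: uniform_measure_def\<close>)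

lemma AE_usphere_iff:
  assumes "Measurable.pred borel P"
  shows "(AE z in usphere r. P z) \<longleftrightarrow> (AE w in lborel. w \<in> ball (0::'a::euclidean_space) 1 \<longrightarrow> P ((r / norm w) *\<^sub>R w))"
proof -
  have "(AE z in usphere r. P z) \<longleftrightarrow> (AE w in uniform_measure lborel (ball (0::'a) 1). P ((r / norm w) *\<^sub>R w))"
    unfolding usphere_def using assms by (intro AE_distr_iff) auto
  also have "\<dots> \<longleftrightarrow> (AE w in lborel. w \<in> ball (0::'a) 1 \<longrightarrow> P ((r / norm w) *\<^sub>R w))"
    by (rule AE_uniform_measure[OF emeasure_unit_ball])
  finally show ?thesis .
qed

lemma norm_usphere: "AE z in usphere r. norm (z :: 'a::euclidean_space) = \<bar>r\<bar>"
proof (subst AE_usphere_iff)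
  have "AE w in lborel. w \<noteq> (0::'a)" by (rule AE_lborel_singleton)
  then show "AE w in lborel. w \<in> ball (0::'a) 1 \<longrightarrow> norm ((r / norm w) *\<^sub>R w) = \<bar>r\<bar>"
    by eventually_elim simp
qed measurable

lemma integral_usphere:
  fixes f :: "'a::euclidean_space \<Rightarrow> complex"
  assumes [measurable]: "f \<in> borel_measurable borel"
  shows "(LINT z|usphere r. f z)
    = (LINT w|lborel. indicat_real (ball 0 1) w *\<^sub>R f ((r / norm w) *\<^sub>R w)) /\<^sub>R measure lborel (ball (0::'a) 1)"
proof -
  have bm: "(indicator (ball (0::'a) 1) :: 'a \<Rightarrow> real) \<in> borel_measurable borel"
    by (intro borel_measurable_indicator borel_open open_ball)
  let ?V = "measure lborel (ball (0::'a) 1)"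
  have u: "uniform_measure lborel (ball (0::'a) 1) = density lborel (\<lambda>w. ennreal (indicat_real (ball 0 1) w / ?V))"
    unfolding uniform_measure_def
    using emeasure_unit_ball[where 'a = 'a] measure_unit_ball_pos[where 'a = 'a]
    by (intro density_cong) (auto simp: emeasure_eq_ennreal_measure less_top indicator_def divide_ennreal ennreal_1[symmetric] simp del: ennreal_1)
  have "(LINT z|usphere r. f z) = (LINT w|lborel. (indicat_real (ball 0 1) w / ?V) *\<^sub>R f ((r / norm w) *\<^sub>R w))"
    unfolding usphere_def u
    by (subst integral_distr, simp, simp, subst integral_density) (use bm in auto)
  also have "\<dots> = (LINT w|lborel. (1 / ?V) *\<^sub>R (indicat_real (ball 0 1) w *\<^sub>R f ((r / norm w) *\<^sub>R w)))"
    by (intro Bochner_Integration.integral_cong refl) (simp add: field_simps)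
  also have "\<dots> = (LINT w|lborel. indicat_real (ball 0 1) w *\<^sub>R f ((r / norm w) *\<^sub>R w)) /\<^sub>R ?V"
    unfolding integral_scaleR_right by (simp add: inverse_eq_divide)
  finally show ?thesis .
qed

lemma polar_usphere:
  fixes F :: "'a::euclidean_space \<Rightarrow> complex"
  assumes F: "integrable lborel F"
  shows "(LINT y|lborel. F y) = (LINT \<rho>|lborel. (indicat_real {0<..} \<rho> * (measure lborel (ball (0::'a) 1) * real DIM('a) * \<rho> ^ (DIM('a) - 1))) *\<^sub>R
      (LINT z|usphere \<rho>. F z))"
proof -
  have [measurable]: "F \<in> borel_measurable borel" using F by auto
  show ?thesis
    unfolding polar_integral[OF F] using measure_unit_ball_pos[where 'a = 'a]
    by (intro Bochner_Integration.integral_cong refl) (simp add: integral_usphere)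
qed

lemma null_sets_usphere_AE:
  assumes N: "N \<in> null_sets (lborel :: 'a::euclidean_space measure)"
  shows "AE \<rho> in lborel. \<rho> > 0 \<longrightarrow> N \<in> null_sets (usphere \<rho>)"
  using polar_AE[OF N]
proof eventually_elim
  case (elim \<rho>)
  have [measurable]: "N \<in> sets borel" using N by auto
  show ?case
  proof
    assume "\<rho> > 0"
    then have "AE z in usphere \<rho>. z \<notin> N"
      using elim by (subst AE_usphere_iff) auto
    then show "N \<in> null_sets (usphere \<rho>)"
      by (subst AE_iff_null_sets) auto
  qed
qed

lemma gaussian_moment_half_line:
  shows "integrable lborel (\<lambda>x::real. indicat_real {0<..} x * (exp (- x\<^sup>2) * x ^ m))"
    and "(LINT x|lborel. indicat_real {0<..} x * (exp (- x\<^sup>2) * x ^ m)) > 0"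
    and "m = 2 * k + 1 \<Longrightarrow> (LINT x|lborel. indicat_real {0<..} x * (exp (- x\<^sup>2) * x ^ m)) = fact k / 2"
proof -
  have *: "has_bochner_integral lborel (\<lambda>x. indicat_real {0<..} x * (exp (- x\<^sup>2) * x ^ m)) v"
    if "has_bochner_integral lborel (\<lambda>x::real. indicat_real {0..} x *\<^sub>R (exp (- x\<^sup>2) * x ^ m)) v" for v
  proof (rule has_bochner_integralI_AE[OF that])
    have "AE x in lborel. x \<noteq> (0::real)" by (rule AE_lborel_singleton)
    then show "AE x in lborel. indicat_real {0..} x *\<^sub>R (exp (- x\<^sup>2) * x ^ m) = indicat_real {0<..} x * (exp (- x\<^sup>2) * x ^ m)"
      by eventually_elim (auto simp: indicator_def)
  qed measurable
  have "\<exists>v>0. has_bochner_integral lborel (\<lambda>x. indicat_real {0<..} x * (exp (- x\<^sup>2) * x ^ m)) v"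
  proof (cases "even m")
    case True
    then obtain k where "m = 2 * k" by auto
    then show ?thesis using *[of "sqrt pi / 2 * (fact (2 * k) / (2 ^ (2 * k) * fact k))"] gaussian_moment_even_pos[of k]
      by (intro exI[of _ "sqrt pi / 2 * (fact (2 * k) / (2 ^ (2 * k) * fact k))"]) auto
  next
    case False
    then obtain k where "m = 2 * k + 1" by (elim oddE)
    then show ?thesis using *[of "fact k / 2"] gaussian_moment_odd_pos[of k]
      by (intro exI[of _ "fact k / 2"]) auto
  qed
  then show "integrable lborel (\<lambda>x::real. indicat_real {0<..} x * (exp (- x\<^sup>2) * x ^ m))"
    "(LINT x|lborel. indicat_real {0<..} x * (exp (- x\<^sup>2) * x ^ m)) > 0"
    by (auto simp: has_bochner_integral_iff)
  show "m = 2 * k + 1 \<Longrightarrow> (LINT x|lborel. indicat_real {0<..} x * (exp (- x\<^sup>2) * x ^ m)) = fact k / 2"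
    using *[of "fact k / 2"] gaussian_moment_odd_pos[of k] by (auto simp: has_bochner_integral_iff)
qed

text \<open>A Gaussian moment factors into a radial integral and the spherical moment of the same degree.
Hence the spherical moments follow from the Gaussian ones.\<close>

lemma usphere_moments_radial:
  fixes x y :: "complex ^ 'n" and k l :: nat
  defines "M \<equiv> (LINT z|usphere 1. bdot z x ^ k * bdot (vcnj z) y ^ l)"
  shows "(LINT w|lborel. exp (- complex_of_real ((norm w)\<^sup>2)) * bdot w x ^ k * bdot (vcnj w) y ^ l)
    = of_real (measure lborel (ball (0::complex ^ 'n) 1) * (2 * real CARD('n)) *
        (LINT \<rho>|lborel. indicat_real {0<..} \<rho> * (exp (- \<rho>\<^sup>2) * \<rho> ^ (2 * CARD('n) - 1 + k + l)))) * M"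
proof -
  let ?V = "measure lborel (ball (0::complex ^ 'n) 1)"
  let ?F = "\<lambda>w. exp (- complex_of_real ((norm w)\<^sup>2)) * bdot w x ^ k * bdot (vcnj w) y ^ l"
  have inner: "(LINT z|usphere \<rho>. ?F z) = of_real (exp (- \<rho>\<^sup>2) * \<rho> ^ (k + l)) * M" if "\<rho> > 0" for \<rho>
  proof -
    have "(LINT w|lborel. indicat_real (ball 0 1) w *\<^sub>R ?F ((\<rho> / norm w) *\<^sub>R w))
      = (LINT w|lborel. of_real (exp (- \<rho>\<^sup>2) * \<rho> ^ (k + l)) * (indicat_real (ball 0 1) w *\<^sub>R (bdot ((1 / norm w) *\<^sub>R w) x ^ k * bdot (vcnj ((1 / norm w) *\<^sub>R w)) y ^ l)))"
    proof (rule Bochner_Integration.integral_cong_AE)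
      have bm[measurable]: "(indicator (ball (0::complex ^ 'n) 1) :: complex ^ 'n \<Rightarrow> real) \<in> borel_measurable borel"
        by (intro borel_measurable_indicator borel_open open_ball)
      show "(\<lambda>w. indicat_real (ball 0 1) w *\<^sub>R ?F ((\<rho> / norm w) *\<^sub>R w)) \<in> borel_measurable lborel" by measurable
      show "(\<lambda>w. of_real (exp (- \<rho>\<^sup>2) * \<rho> ^ (k + l)) * (indicat_real (ball 0 1) w *\<^sub>R (bdot ((1 / norm w) *\<^sub>R w) x ^ k * bdot (vcnj ((1 / norm w) *\<^sub>R w)) y ^ l))) \<in> borel_measurable lborel" by measurable
      have "AE w in lborel. w \<noteq> (0::complex ^ 'n)" by (rule AE_lborel_singleton)
      then show "AE w in lborel. indicat_real (ball 0 1) w *\<^sub>R ?F ((\<rho> / norm w) *\<^sub>R w)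
        = of_real (exp (- \<rho>\<^sup>2) * \<rho> ^ (k + l)) * (indicat_real (ball 0 1) w *\<^sub>R (bdot ((1 / norm w) *\<^sub>R w) x ^ k * bdot (vcnj ((1 / norm w) *\<^sub>R w)) y ^ l))"
      proof eventually_elim
        fix w :: "complex ^ 'n" assume w: "w \<noteq> 0"
        have e: "exp (- (complex_of_real \<rho>)\<^sup>2) = of_real (exp (- \<rho>\<^sup>2))"
          using exp_of_real[of "- \<rho>\<^sup>2", where 'a = complex] by simp
        show "indicat_real (ball 0 1) w *\<^sub>R ?F ((\<rho> / norm w) *\<^sub>R w)
        = of_real (exp (- \<rho>\<^sup>2) * \<rho> ^ (k + l)) * (indicat_real (ball 0 1) w *\<^sub>R (bdot ((1 / norm w) *\<^sub>R w) x ^ k * bdot (vcnj ((1 / norm w) *\<^sub>R w)) y ^ l))"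
          using w that by (simp add: e power_add power_mult_distrib power_divide scaleR_conv_of_real[where 'a = complex] mult_ac)
      qed
    qed
    then have "(LINT w|lborel. indicat_real (ball 0 1) w *\<^sub>R ?F ((\<rho> / norm w) *\<^sub>R w))
      = of_real (exp (- \<rho>\<^sup>2) * \<rho> ^ (k + l)) * (LINT w|lborel. indicat_real (ball 0 1) w *\<^sub>R (bdot ((1 / norm w) *\<^sub>R w) x ^ k * bdot (vcnj ((1 / norm w) *\<^sub>R w)) y ^ l))"
      by (simp only: integral_mult_right_zero)
    moreover have "(LINT z|usphere \<rho>. ?F z) = (LINT w|lborel. indicat_real (ball 0 1) w *\<^sub>R ?F ((\<rho> / norm w) *\<^sub>R w)) /\<^sub>R ?V"
      by (rule integral_usphere) measurable
    moreover have "M = (LINT w|lborel. indicat_real (ball 0 1) w *\<^sub>R (bdot ((1 / norm w) *\<^sub>R w) x ^ k * bdot (vcnj ((1 / norm w) *\<^sub>R w)) y ^ l)) /\<^sub>R ?V"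
      unfolding M_def by (rule integral_usphere) measurable
    ultimately show ?thesis
      by (simp only: mult_scaleR_right)
  qed
  have d: "DIM(complex ^ 'n) = 2 * CARD('n)" by simp
  have "(LINT w|lborel. ?F w) = (LINT \<rho>|lborel. (indicat_real {0<..} \<rho> * (?V * real DIM(complex ^ 'n) * \<rho> ^ (DIM(complex ^ 'n) - 1))) *\<^sub>R
      (LINT z|usphere \<rho>. ?F z))"
    by (rule polar_usphere[OF gaussian_moments(1)])
  also have "\<dots> = (LINT \<rho>|lborel. of_real (?V * (2 * real CARD('n)) * (indicat_real {0<..} \<rho> * (exp (- \<rho>\<^sup>2) * \<rho> ^ (2 * CARD('n) - 1 + k + l)))) * M)"
  proof (rule Bochner_Integration.integral_cong[OF refl])
    fix \<rho> :: real
    show "(indicat_real {0<..} \<rho> * (?V * real DIM(complex ^ 'n) * \<rho> ^ (DIM(complex ^ 'n) - 1))) *\<^sub>R (LINT z|usphere \<rho>. ?F z)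
      = of_real (?V * (2 * real CARD('n)) * (indicat_real {0<..} \<rho> * (exp (- \<rho>\<^sup>2) * \<rho> ^ (2 * CARD('n) - 1 + k + l)))) * M"
    proof (cases "\<rho> > 0")
      case True
      have pw: "\<rho> ^ (2 * CARD('n) - 1 + k + l) = \<rho> ^ (2 * CARD('n) - 1) * \<rho> ^ (k + l)"
        by (simp only: power_add mult.assoc)
      show ?thesis
        unfolding inner[OF True] pw d scaleR_conv_of_real by (simp only: of_real_mult of_nat_mult of_nat_numeral mult_ac)
    qed simp
  qed
  also have "\<dots> = of_real (?V * (2 * real CARD('n)) *
        (LINT \<rho>|lborel. indicat_real {0<..} \<rho> * (exp (- \<rho>\<^sup>2) * \<rho> ^ (2 * CARD('n) - 1 + k + l)))) * M"
    by (simp only: integral_mult_left_zero integral_mult_right_zero integral_complex_of_real)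
  finally show ?thesis .
qed

lemma usphere_moments:
  fixes x y :: "complex ^ 'n"
  shows "(LINT z|usphere 1. bdot z x ^ k * bdot (vcnj z) y ^ l)
    = (if k = l then of_real (fact (CARD('n) - 1) * fact k / fact (CARD('n) + k - 1)) * bdot x y ^ k else 0)"
proof -
  let ?V = "measure lborel (ball (0::complex ^ 'n) 1)"
  let ?n = "CARD('n)"
  have n: "?n > 0" by simp
  let ?g = "\<lambda>m. LINT \<rho>|lborel. indicat_real {0<..} \<rho> * (exp (- \<rho>\<^sup>2) * \<rho> ^ m)"
  have gk: "?g (2 * ?n - 1 + k + k) = fact (?n + k - 1) / 2" for k
  proof (rule gaussian_moment_half_line(3))
    show "2 * ?n - 1 + k + k = 2 * (?n + k - 1) + 1" using n by linarith
  qed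
  interpret prob_space "usphere 1 :: (complex ^ 'n) measure" by (rule prob_space_usphere)
  have "of_real (pi ^ ?n) = (of_real (?V * (2 * real ?n) * ?g (2 * ?n - 1 + 0 + 0)) * (1::complex))"
    using usphere_moments_radial[of "0::complex ^ 'n" 0 0 0] gaussian_moments(2)[of "0::complex ^ 'n" 0 0 0]
    using prob_space by simp
  then have "pi ^ ?n = ?V * (2 * real ?n) * ?g (2 * ?n - 1 + 0 + 0)"
    by (simp only: of_real_eq_iff mult_1_right)
  then have V: "pi ^ ?n = ?V * real ?n * fact (?n - 1)"
    unfolding gk[of 0] by simp
  show ?thesis
  proof (cases "k = l")
    case True
    have "complex_of_real (pi ^ ?n * fact k) * bdot x y ^ k = of_real (?V * real ?n * fact (?n + k - 1)) * (LINT z|usphere 1. bdot z x ^ k * bdot (vcnj z) y ^ k)"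
    proof -
      have "of_real (?V * (2 * real ?n) * (fact (?n + k - 1) / 2)) * (LINT z|usphere 1. bdot z x ^ k * bdot (vcnj z) y ^ k) = complex_of_real (pi ^ ?n * fact k) * bdot x y ^ k"
        unfolding gk[of k, symmetric] usphere_moments_radial[symmetric] gaussian_moments(2) by simp
      then show ?thesis by (simp add: mult.assoc)
    qed
    then have "complex_of_real (?V * real ?n) * (of_real (fact (?n - 1) * fact k) * bdot x y ^ k)
       = of_real (?V * real ?n) * (of_real (fact (?n + k - 1)) * (LINT z|usphere 1. bdot z x ^ k * bdot (vcnj z) y ^ k))"
      unfolding V by (simp add: mult_ac)
    then have "of_real (fact (?n - 1) * fact k) * bdot x y ^ k = of_real (fact (?n + k - 1)) * (LINT z|usphere 1. bdot z x ^ k * bdot (vcnj z) y ^ k)"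
      using measure_unit_ball_pos[where 'a = "complex ^ 'n"] n by (subst (asm) mult_cancel_left) (auto simp del: of_real_mult)
    then show ?thesis using True by (simp add: field_simps)
  next
    case False
    let ?c = "?V * (2 * real ?n) * ?g (2 * ?n - 1 + k + l)"
    let ?E = "LINT z|usphere 1. bdot z x ^ k * bdot (vcnj z) y ^ l"
    have e1: "complex_of_real ?c * ?E = 0"
      unfolding usphere_moments_radial[symmetric] gaussian_moments(2) using False by simp
    have "?c > 0"
      by (intro mult_pos_pos gaussian_moment_half_line(2) measure_unit_ball_pos) (use n in auto)
    then have "complex_of_real ?c \<noteq> 0"
      unfolding of_real_eq_0_iff by (rule not_sym[OF less_imp_neq])
    moreover have "complex_of_real ?c = 0 \<or> ?E = 0" by (rule iffD1[OF mult_eq_0_iff e1])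
    ultimately have "?E = 0" by blast
    then show ?thesis using False by simp
  qed
qed

text \<open>Up to normalisation and a power of the variable this is the modified Bessel function of order
\<open>n - 1\<close> at \<open>2 R sqrt u\<close>; the power series has no branch point.\<close>

definition bessel :: "nat \<Rightarrow> real \<Rightarrow> complex \<Rightarrow> complex" where
  "bessel n R u = (\<Sum>k. of_real (R ^ (2 * k) / (fact k * fact (n + k - 1))) * u ^ k)"

lemma bessel_sums: "(\<lambda>k. of_real (R ^ (2 * k) / (fact k * fact (n + k - 1))) * u ^ k) sums bessel n R u"
proof -
  have "summable (\<lambda>k. of_real (R ^ (2 * k) / (fact k * fact (n + k - 1))) * u ^ k)"
  proof (rule summable_comparison_test')
    show "summable (\<lambda>k. (R\<^sup>2 * norm u) ^ k /\<^sub>R fact k)"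
      using exp_converges[of "R\<^sup>2 * norm u"] by (simp add: sums_iff)
    fix k :: nat
    have "1 \<le> (fact (n + k - 1) :: real)" by (rule fact_ge_1)
    then have "R ^ (2 * k) / (fact k * fact (n + k - 1)) * norm u ^ k \<le> R ^ (2 * k) / (fact k * 1) * norm u ^ k"
      by (intro mult_right_mono divide_left_mono mult_left_mono) auto
    moreover have "R ^ (2 * k) / (fact k * 1) * norm u ^ k = (R\<^sup>2 * norm u) ^ k /\<^sub>R fact k"
      by (simp add: power_mult power_mult_distrib divide_inverse)
    moreover have "norm (of_real (R ^ (2 * k) / (fact k * fact (n + k - 1))) * u ^ k) = R ^ (2 * k) / (fact k * fact (n + k - 1)) * norm u ^ k"
    proof -
      have "0 \<le> R ^ (2 * k) / (fact k * fact (n + k - 1))" by simp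
      then show ?thesis unfolding norm_mult norm_of_real norm_power by (simp only: abs_of_nonneg)
    qed
    ultimately show "norm (of_real (R ^ (2 * k) / (fact k * fact (n + k - 1))) * u ^ k) \<le> (R\<^sup>2 * norm u) ^ k /\<^sub>R fact k"
      by simp
  qed
  then show ?thesis unfolding bessel_def by (rule summable_sums)
qed

lemma bessel_holomorphic [holomorphic_intros]: "bessel n R holomorphic_on A"
proof -
  have hol: "bessel n R holomorphic_on ball 0 (norm z + 1)" for z
    by (rule power_series_holomorphic[where a = "\<lambda>k. of_real (R ^ (2 * k) / (fact k * fact (n + k - 1)))"])
      (use bessel_sums[of R n] in simp)
  have "bessel n R field_differentiable at z" for z
    using holomorphic_on_imp_differentiable_at[OF hol[of z] open_ball, of z] by simp
  then show ?thesis by (simp add: holomorphic_on_def field_differentiable_at_within)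
qed

lemma entire_taylor:
  assumes "f holomorphic_on UNIV"
  shows "(\<lambda>h. (deriv ^^ (K + h)) f w / fact h * d ^ h) sums (deriv ^^ K) f (w + d)"
proof -
  have "(deriv ^^ K) f holomorphic_on ball w (norm d + 1)"
    by (rule holomorphic_on_subset[OF holomorphic_higher_deriv[OF assms open_UNIV]]) simp
  then have "(\<lambda>h. (deriv ^^ h) ((deriv ^^ K) f) w / fact h * (w + d - w) ^ h) sums (deriv ^^ K) f (w + d)"
    by (rule holomorphic_power_series) (simp add: dist_norm)
  then show ?thesis by (simp add: funpow_add[symmetric, THEN fun_cong, unfolded o_def] add.commute)
qed

lemma bessel_deriv_0: "(deriv ^^ m) (bessel n R) 0 = of_real (R ^ (2 * m) / fact (n + m - 1))"
proof -
  have "(\<lambda>m. (deriv ^^ m) (bessel n R) 0 / fact m) = (\<lambda>k. of_real (R ^ (2 * k) / (fact k * fact (n + k - 1))))"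
  proof (rule powser_coeffs_unique[of 1])
    fix c :: complex
    show "(\<lambda>m. (deriv ^^ m) (bessel n R) 0 / fact m * c ^ m) sums bessel n R c"
      using entire_taylor[OF bessel_holomorphic, of 0 n R 0 c] by simp
    show "(\<lambda>k. of_real (R ^ (2 * k) / (fact k * fact (n + k - 1))) * c ^ k) sums bessel n R c"
      by (rule bessel_sums)
  qed simp
  from fun_cong[OF this, of m] show ?thesis by (simp add: field_simps)
qed

lemma bessel_deriv_sums:
  "(\<lambda>h. of_real (R ^ (2 * (K + h)) / (fact h * fact (n + K + h - 1))) * u ^ h) sums (deriv ^^ K) (bessel n R) u"
  using entire_taylor[OF bessel_holomorphic, of K n R 0 u]
  by (simp add: bessel_deriv_0 add.assoc mult.commute)

text \<open>Taylor expansion in \<open>d\<close> of a product of a power of a linear function with a power series.\<close>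

lemma sums_cauchy_product_polynomial:
  fixes b :: "nat \<Rightarrow> complex"
  assumes b: "\<And>d. (\<lambda>j. b j * d ^ j) sums g d"
  shows "(\<lambda>p. (\<Sum>i\<le>p. (of_nat (q choose i) * e ^ i * a ^ (q - i)) * b (p - i)) * d ^ p) sums ((a + d * e) ^ q * g d)"
proof -
  have bs: "summable (\<lambda>j. norm (b j * d ^ j))"
    by (rule powser_insidea[of _ "of_real (norm d + 1)"]) (use b[of "of_real (norm d + 1)"] in \<open>auto simp: sums_iff norm_of_real\<close>)
  let ?a = "\<lambda>i. of_nat (q choose i) * e ^ i * a ^ (q - i) * d ^ i"
  have af: "?a i = 0" if "i \<notin> {..q}" for i using that by (simp add: binomial_eq_0)
  have as: "summable (\<lambda>i. norm (?a i))"
    by (rule summable_finite[of "{..q}"]) (use af in auto)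
  have asum: "(\<Sum>i. ?a i) = (a + d * e) ^ q"
  proof -
    have "(\<Sum>i. ?a i) = (\<Sum>i\<le>q. ?a i)" by (rule suminf_finite) (use af in auto)
    also have "\<dots> = (d * e + a) ^ q"
      unfolding binomial_ring by (intro sum.cong refl) (simp add: power_mult_distrib mult_ac)
    finally show ?thesis by (simp add: add.commute)
  qed
  have "(\<lambda>p. \<Sum>i\<le>p. ?a i * (b (p - i) * d ^ (p - i))) sums ((\<Sum>i. ?a i) * (\<Sum>j. b j * d ^ j))"
    by (rule Cauchy_product_sums[OF as bs])
  moreover have "(\<Sum>i\<le>p. ?a i * (b (p - i) * d ^ (p - i))) = (\<Sum>i\<le>p. (of_nat (q choose i) * e ^ i * a ^ (q - i)) * b (p - i)) * d ^ p" for p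
    unfolding sum_distrib_right
  proof (rule sum.cong[OF refl])
    fix i assume "i \<in> {..p}"
    then have "d ^ i * d ^ (p - i) = d ^ p" by (simp add: power_add[symmetric])
    then show "?a i * (b (p - i) * d ^ (p - i)) = (of_nat (q choose i) * e ^ i * a ^ (q - i)) * b (p - i) * d ^ p"
      by (simp only: mult_ac \<open>d ^ i * d ^ (p - i) = d ^ p\<close>[symmetric])
  qed
  ultimately show ?thesis using asum b[of d] by (simp add: sums_iff)
qed

lemma usphere_integrable:
  fixes g :: "'a::euclidean_space \<Rightarrow> complex"
  assumes [measurable]: "g \<in> borel_measurable borel" and b: "\<And>z. norm z = \<bar>R\<bar> \<Longrightarrow> norm (g z) \<le> K"
  shows "integrable (usphere R) g"
proof -
  interpret prob_space "usphere R :: 'a measure" by (rule prob_space_usphere)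
  show ?thesis
  proof (rule integrable_const_bound[where B = K])
    show "AE z in usphere R. norm (g z) \<le> K"
      using norm_usphere[of R] by eventually_elim (rule b)
  qed simp
qed

lemma usphere_scale:
  fixes f :: "'a::euclidean_space \<Rightarrow> complex"
  assumes [measurable]: "f \<in> borel_measurable borel"
  shows "(LINT z|usphere R. f z) = (LINT z|usphere 1. f (R *\<^sub>R z))"
  by (subst (1 2) integral_usphere) (simp_all add: divide_inverse)

lemma norm_exp_le: "norm (exp (z::complex)) \<le> exp (norm z)"
  by (simp add: complex_Re_le_cmod)

text \<open>By \<open>usphere_moments\<close> only the terms of equal degree in \<open>z\<close> and \<open>cnj z\<close> survive, so that the mean depends on \<open>x\<close> and
\<open>y\<close> only through \<open>bdot x y\<close>.\<close>

lemma usphere_exp_mean: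
  fixes x y :: "complex ^ 'n"
  shows "(LINT z|usphere R. exp (bdot z x + bdot (vcnj z) y)) = fact (CARD('n) - 1) * bessel (CARD('n)) R (bdot x y)"
proof -
  let ?n = "CARD('n)"
  have bx: "norm (bdot z x) \<le> norm x" "norm (bdot (vcnj z) x) \<le> norm x" if "norm z = \<bar>1\<bar>" for z x :: "complex ^ 'n"
    using norm_bdot_le[of z x] norm_bdot_le[of "vcnj z" x] that by auto
  let ?x = "R *\<^sub>R x" and ?y = "R *\<^sub>R y"
  have I1: "integrable (usphere 1) (\<lambda>z. norm (bdot z ?x ^ k) * exp (1 * norm (bdot (vcnj z) ?y)))" for k
  proof -
    have "integrable (usphere 1) (\<lambda>z. complex_of_real (norm (bdot z ?x ^ k) * exp (1 * norm (bdot (vcnj z) ?y))))"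
    proof (rule usphere_integrable)
      fix z :: "complex ^ 'n" assume z: "norm z = \<bar>1\<bar>"
      have "norm (bdot z ?x ^ k) * exp (1 * norm (bdot (vcnj z) ?y)) \<le> norm ?x ^ k * exp (norm ?y)"
        unfolding norm_power using bx[OF z, of ?x] bx[OF z, of ?y] by (intro mult_mono power_mono) auto
      then show "norm (complex_of_real (norm (bdot z ?x ^ k) * exp (1 * norm (bdot (vcnj z) ?y)))) \<le> norm ?x ^ k * exp (norm ?y)"
        by (simp only: norm_of_real abs_mult abs_norm_cancel abs_exp_cancel)
    qed measurable
    then show ?thesis by (simp only: complex_of_real_integrable_eq)
  qed
  have I2: "integrable (usphere 1) (\<lambda>z. norm (exp (bdot (vcnj z) ?y)) * exp (1 * norm (bdot z ?x)))"
  proof -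
    have "integrable (usphere 1) (\<lambda>z. complex_of_real (norm (exp (bdot (vcnj z) ?y)) * exp (1 * norm (bdot z ?x))))"
    proof (rule usphere_integrable)
      fix z :: "complex ^ 'n" assume z: "norm z = \<bar>1\<bar>"
      have "norm (exp (bdot (vcnj z) ?y)) \<le> exp (norm ?y)"
        using norm_exp_le[of "bdot (vcnj z) ?y"] bx[OF z, of ?y] by (meson exp_le_cancel_iff order_trans)
      then have "norm (exp (bdot (vcnj z) ?y)) * exp (1 * norm (bdot z ?x)) \<le> exp (norm ?y) * exp (norm ?x)"
        using bx[OF z, of ?x] by (intro mult_mono) auto
      then show "norm (complex_of_real (norm (exp (bdot (vcnj z) ?y)) * exp (1 * norm (bdot z ?x)))) \<le> exp (norm ?y) * exp (norm ?x)"
        by (simp only: norm_of_real abs_mult abs_norm_cancel abs_exp_cancel)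
    qed measurable
    then show ?thesis by (simp only: complex_of_real_integrable_eq)
  qed
  have c: "(LINT z|usphere 1. exp (bdot (vcnj z) ?y) * bdot z ?x ^ k)
     = of_real (fact (?n - 1) * R ^ (2 * k) / fact (?n + k - 1)) * bdot x y ^ k" for k
  proof -
    have "(\<lambda>l. (LINT z|usphere 1. bdot z ?x ^ k * bdot (vcnj z) ?y ^ l) / fact l * 1 ^ l) sums (LINT z|usphere 1. bdot z ?x ^ k * exp (1 * bdot (vcnj z) ?y))"
      by (rule integral_exp_sums[OF _ _ I1]) auto
    then have s: "(\<lambda>l. (LINT z|usphere 1. bdot z ?x ^ k * bdot (vcnj z) ?y ^ l) / fact l) sums (LINT z|usphere 1. exp (bdot (vcnj z) ?y) * bdot z ?x ^ k)"
      by (simp add: mult.commute)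
    have e: "(\<lambda>l. (LINT z|usphere 1. bdot z ?x ^ k * bdot (vcnj z) ?y ^ l) / fact l)
       = (\<lambda>l. if l = k then of_real (fact (?n - 1) / fact (?n + k - 1)) * bdot ?x ?y ^ k else 0)"
      unfolding usphere_moments by (auto simp: field_simps)
    have "bdot ?x ?y ^ k = of_real (R ^ (2 * k)) * bdot x y ^ k"
      by (simp add: power_mult_distrib power_mult power2_eq_square)
    then show ?thesis using sums_unique2[OF s[unfolded e] sums_single[of k]] by simp
  qed
  have "(\<lambda>k. (LINT z|usphere 1. exp (bdot (vcnj z) ?y) * bdot z ?x ^ k) / fact k * 1 ^ k)
      sums (LINT z|usphere 1. exp (bdot (vcnj z) ?y) * exp (1 * bdot z ?x))"
    by (rule integral_exp_sums[OF _ _ I2]) auto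
  then have s1: "(\<lambda>k. fact (?n - 1) * (of_real (R ^ (2 * k) / (fact k * fact (?n + k - 1))) * bdot x y ^ k))
      sums (LINT z|usphere 1. exp (bdot z ?x + bdot (vcnj z) ?y))"
    unfolding c by (simp add: mult_exp_exp add.commute field_simps)
  have "(\<lambda>k. fact (?n - 1) * (of_real (R ^ (2 * k) / (fact k * fact (?n + k - 1))) * bdot x y ^ k))
      sums (fact (?n - 1) * bessel ?n R (bdot x y))"
    by (intro sums_mult bessel_sums)
  from sums_unique2[OF s1 this]
  show ?thesis by (subst usphere_scale) simp_all
qed

text \<open>Compare coefficients of \<open>c^q\<close> after replacing \<open>x\<close> by \<open>x + c v\<close> in \<open>usphere_exp_mean\<close>.\<close>

lemma usphere_poly_exp_mean:
  fixes x y v :: "complex ^ 'n"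
  shows "(LINT z|usphere R. exp (bdot z x + bdot (vcnj z) y) * bdot z v ^ q)
     = fact (CARD('n) - 1) * (bdot v y ^ q * (deriv ^^ q) (bessel (CARD('n)) R) (bdot x y))"
proof -
  let ?n = "CARD('n)"
  let ?h = "\<lambda>z. exp (bdot z x + bdot (vcnj z) y)"
  have nb: "norm (?h z) \<le> exp (\<bar>R\<bar> * norm x + \<bar>R\<bar> * norm y)" if "norm z = \<bar>R\<bar>" for z
  proof -
    have "norm (bdot z x + bdot (vcnj z) y) \<le> norm (bdot z x) + norm (bdot (vcnj z) y)" by (rule norm_triangle_ineq)
    also have "\<dots> \<le> \<bar>R\<bar> * norm x + \<bar>R\<bar> * norm y"
      using norm_bdot_le[of z x] norm_bdot_le[of "vcnj z" y] that by simp
    finally show ?thesis using norm_exp_le[of "bdot z x + bdot (vcnj z) y"] by (meson exp_le_cancel_iff order_trans)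
  qed
  have int: "integrable (usphere R) (\<lambda>z. norm (?h z) * exp (1 * norm (bdot z v)))"
  proof -
    have "integrable (usphere R) (\<lambda>z. complex_of_real (norm (?h z) * exp (1 * norm (bdot z v))))"
    proof (rule usphere_integrable)
      fix z :: "complex ^ 'n" assume z: "norm z = \<bar>R\<bar>"
      have "norm (?h z) * exp (1 * norm (bdot z v)) \<le> exp (\<bar>R\<bar> * norm x + \<bar>R\<bar> * norm y) * exp (\<bar>R\<bar> * norm v)"
        using norm_bdot_le[of z v] z by (intro mult_mono nb) auto
      then show "norm (complex_of_real (norm (?h z) * exp (1 * norm (bdot z v)))) \<le> exp (\<bar>R\<bar> * norm x + \<bar>R\<bar> * norm y) * exp (\<bar>R\<bar> * norm v)"
        by (simp only: norm_of_real abs_mult abs_norm_cancel abs_exp_cancel)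
    qed measurable
    then show ?thesis by (simp only: complex_of_real_integrable_eq)
  qed
  let ?f = "\<lambda>c. fact (?n - 1) * bessel ?n R (bdot x y + c * bdot v y)"
  have A: "(\<lambda>k. ((LINT z|usphere R. ?h z * bdot z v ^ k) / fact k) * c ^ k) sums ?f c" if c: "norm c < 1" for c
  proof -
    have "(\<lambda>k. ((LINT z|usphere R. ?h z * bdot z v ^ k) / fact k) * c ^ k) sums (LINT z|usphere R. ?h z * exp (c * bdot z v))"
      by (rule integral_exp_sums[OF _ _ int]) (use c in auto)
    moreover have "(LINT z|usphere R. ?h z * exp (c * bdot z v)) = (LINT z|usphere R. exp (bdot z (x + c *s v) + bdot (vcnj z) y))"
      by (intro Bochner_Integration.integral_cong refl) (simp add: mult_exp_exp add_ac)
    ultimately show ?thesis unfolding usphere_exp_mean by simp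
  qed
  have B: "(\<lambda>k. (fact (?n - 1) * (bdot v y ^ k * (deriv ^^ k) (bessel ?n R) (bdot x y)) / fact k) * c ^ k) sums ?f c" for c
    using sums_mult[OF entire_taylor[OF bessel_holomorphic, of 0 ?n R "bdot x y" "c * bdot v y"], of "fact (?n - 1)"]
    by (simp add: power_mult_distrib mult_ac)
  from powser_coeffs_unique[OF zero_less_one A B]
  have "(LINT z|usphere R. ?h z * bdot z v ^ q) / fact q = fact (?n - 1) * (bdot v y ^ q * (deriv ^^ q) (bessel ?n R) (bdot x y)) / fact q"
    by (rule fun_cong)
  then show ?thesis by simp
qed

text \<open>Compare coefficients of \<open>d^a\<close> after replacing \<open>y\<close> by \<open>y + d \<eta>\<close> in \<open>usphere_poly_exp_mean\<close>. The term with index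
\<open>i\<close> arises from \<open>i\<close> differentiations of the polynomial prefactor; the terms with \<open>i > 0\<close> have lower
degree in both \<open>v\<cdot>y\<close> and \<open>\<eta>\<cdot>x\<close>.\<close>

lemma usphere_bipoly_exp_mean:
  fixes x y v \<eta> :: "complex ^ 'n"
  shows "(LINT z|usphere R. exp (bdot z x + bdot (vcnj z) y) * bdot z v ^ q * bdot (vcnj z) \<eta> ^ a)
     = fact (CARD('n) - 1) * fact a * (\<Sum>i\<le>a. of_nat (q choose i) * bdot v \<eta> ^ i * bdot v y ^ (q - i)
         * ((deriv ^^ (q + (a - i))) (bessel (CARD('n)) R) (bdot x y) / fact (a - i) * bdot x \<eta> ^ (a - i)))"
proof -
  let ?n = "CARD('n)"
  let ?h = "\<lambda>z. exp (bdot z x + bdot (vcnj z) y) * bdot z v ^ q"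
  have nb: "norm (?h z) \<le> exp (\<bar>R\<bar> * norm x + \<bar>R\<bar> * norm y) * (\<bar>R\<bar> * norm v) ^ q" if "norm z = \<bar>R\<bar>" for z
  proof -
    have "norm (bdot z x + bdot (vcnj z) y) \<le> norm (bdot z x) + norm (bdot (vcnj z) y)" by (rule norm_triangle_ineq)
    also have "\<dots> \<le> \<bar>R\<bar> * norm x + \<bar>R\<bar> * norm y"
      using norm_bdot_le[of z x] norm_bdot_le[of "vcnj z" y] that by simp
    finally have "norm (exp (bdot z x + bdot (vcnj z) y)) \<le> exp (\<bar>R\<bar> * norm x + \<bar>R\<bar> * norm y)"
      using norm_exp_le[of "bdot z x + bdot (vcnj z) y"] by (meson exp_le_cancel_iff order_trans)
    moreover have "norm (bdot z v ^ q) \<le> (\<bar>R\<bar> * norm v) ^ q"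
      unfolding norm_power using norm_bdot_le[of z v] that by (intro power_mono) auto
    ultimately show ?thesis unfolding norm_mult by (intro mult_mono) auto
  qed
  have int: "integrable (usphere R) (\<lambda>z. norm (?h z) * exp (1 * norm (bdot (vcnj z) \<eta>)))"
  proof -
    have "integrable (usphere R) (\<lambda>z. complex_of_real (norm (?h z) * exp (1 * norm (bdot (vcnj z) \<eta>))))"
    proof (rule usphere_integrable)
      fix z :: "complex ^ 'n" assume z: "norm z = \<bar>R\<bar>"
      have "norm (?h z) * exp (1 * norm (bdot (vcnj z) \<eta>)) \<le> exp (\<bar>R\<bar> * norm x + \<bar>R\<bar> * norm y) * (\<bar>R\<bar> * norm v) ^ q * exp (\<bar>R\<bar> * norm \<eta>)"
        using norm_bdot_le[of "vcnj z" \<eta>] z by (intro mult_mono nb) auto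
      then show "norm (complex_of_real (norm (?h z) * exp (1 * norm (bdot (vcnj z) \<eta>)))) \<le> exp (\<bar>R\<bar> * norm x + \<bar>R\<bar> * norm y) * (\<bar>R\<bar> * norm v) ^ q * exp (\<bar>R\<bar> * norm \<eta>)"
        by (simp only: norm_of_real abs_mult abs_norm_cancel abs_exp_cancel)
    qed measurable
    then show ?thesis by (simp only: complex_of_real_integrable_eq)
  qed
  let ?D = "\<lambda>j. (deriv ^^ j) (bessel ?n R)"
  let ?f = "\<lambda>d. fact (?n - 1) * ((bdot v y + d * bdot v \<eta>) ^ q * ?D q (bdot x y + d * bdot x \<eta>))"
  have A: "(\<lambda>k. ((LINT z|usphere R. ?h z * bdot (vcnj z) \<eta> ^ k) / fact k) * d ^ k) sums ?f d" if d: "norm d < 1" for d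
  proof -
    have "(\<lambda>k. ((LINT z|usphere R. ?h z * bdot (vcnj z) \<eta> ^ k) / fact k) * d ^ k) sums (LINT z|usphere R. ?h z * exp (d * bdot (vcnj z) \<eta>))"
      by (rule integral_exp_sums[OF _ _ int]) (use d in auto)
    moreover have "(LINT z|usphere R. ?h z * exp (d * bdot (vcnj z) \<eta>)) = (LINT z|usphere R. exp (bdot z x + bdot (vcnj z) (y + d *s \<eta>)) * bdot z v ^ q)"
      by (intro Bochner_Integration.integral_cong refl) (simp add: exp_add)
    ultimately show ?thesis unfolding usphere_poly_exp_mean by simp
  qed
  let ?b = "\<lambda>j. ?D (q + j) (bdot x y) / fact j * bdot x \<eta> ^ j"
  have "(\<lambda>j. ?b j * d ^ j) sums ?D q (bdot x y + d * bdot x \<eta>)" for d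
    using entire_taylor[OF bessel_holomorphic, of q ?n R "bdot x y" "d * bdot x \<eta>"]
    by (simp add: power_mult_distrib mult_ac)
  from sums_mult[OF sums_cauchy_product_polynomial[OF this, of q "bdot v \<eta>" "bdot v y"], of "fact (?n - 1)"]
  have B: "(\<lambda>p. (fact (?n - 1) * (\<Sum>i\<le>p. (of_nat (q choose i) * bdot v \<eta> ^ i * bdot v y ^ (q - i)) * ?b (p - i))) * d ^ p) sums ?f d" for d
    by (simp only: mult.assoc)
  from powser_coeffs_unique[OF zero_less_one A B]
  have "(LINT z|usphere R. ?h z * bdot (vcnj z) \<eta> ^ a) / fact a = fact (?n - 1) * (\<Sum>i\<le>a. (of_nat (q choose i) * bdot v \<eta> ^ i * bdot v y ^ (q - i)) * ?b (a - i))"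
    by (rule fun_cong)
  then have "(LINT z|usphere R. ?h z * bdot (vcnj z) \<eta> ^ a) = fact a * (fact (?n - 1) * (\<Sum>i\<le>a. (of_nat (q choose i) * bdot v \<eta> ^ i * bdot v y ^ (q - i)) * ?b (a - i)))"
    by (simp only: nonzero_divide_eq_eq[OF fact_nonzero] mult_ac)
  then show ?thesis by (simp only: mult_ac)
qed

section \<open>Averages over the circle\<close>

definition circle_measure :: "real measure" where
  "circle_measure = uniform_measure lborel {0..2*pi}"

lemma sets_circle_measure [simp, measurable_cong]: "sets circle_measure = sets borel"
  by (simp add: circle_measure_def)

lemma space_circle_measure [simp]: "space circle_measure = UNIV"
  by (simp add: circle_measure_def)

lemma prob_space_circle_measure: "prob_space circle_measure"
  unfolding circle_measure_def by (rule prob_space_uniform_measure) (simp_all add: emeasure_lborel_Icc_eq)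

lemma circle_integrable:
  fixes g :: "real \<Rightarrow> 'b::{banach, second_countable_topology}"
  assumes "g \<in> borel_measurable borel" "\<And>x. norm (g x) \<le> B"
  shows "integrable circle_measure g"
proof -
  interpret prob_space circle_measure by (rule prob_space_circle_measure)
  show ?thesis by (rule integrable_const_bound[where B = B]) (use assms in auto)
qed

lemma circle_integral_eq:
  fixes g :: "real \<Rightarrow> complex"
  assumes c: "continuous_on UNIV g"
  shows "(LINT \<theta>|circle_measure. g \<theta>) = integral {0..2*pi} g / (2 * pi)"
proof -
  let ?A = "{0..2*pi} :: real set"
  have S: "set_integrable lborel ?A g"
    unfolding set_integrable_def by (rule borel_integrable_compact) (use c continuous_on_subset in auto)
  have gm: "g \<in> borel_measurable borel" using c by (rule borel_measurable_continuous_onI)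
  have "(LINT \<theta>|circle_measure. g \<theta>) = (LINT \<theta>|lborel. indicator ?A \<theta> *\<^sub>R g \<theta>) / (2 * pi)"
  proof -
    have e: "indicator ?A x / emeasure lborel ?A = ennreal (indicator ?A x / (2 * pi))" for x :: real
      by (simp add: divide_ennreal[symmetric] split: split_indicator)
    have "circle_measure = density lborel (\<lambda>x. ennreal (indicator ?A x / (2 * pi)))"
      unfolding circle_measure_def uniform_measure_def e ..
    moreover have "(LINT \<theta>|density lborel (\<lambda>x. ennreal (indicator ?A x / (2 * pi))). g \<theta>) = (LINT \<theta>|lborel. (indicator ?A \<theta> / (2 * pi)) *\<^sub>R g \<theta>)"
      by (rule integral_density) (use gm in auto)
    moreover have "(LINT \<theta>|lborel. (indicator ?A \<theta> / (2 * pi)) *\<^sub>R g \<theta>) = (LINT \<theta>|lborel. (1 / (2 * pi)) *\<^sub>R (indicator ?A \<theta> *\<^sub>R g \<theta>))"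
      by (intro Bochner_Integration.integral_cong refl) (simp add: field_simps)
    ultimately show ?thesis by (simp only: integral_scaleR_right) (simp add: scaleR_conv_of_real field_simps)
  qed
  also have "(LINT \<theta>|lborel. indicator ?A \<theta> *\<^sub>R g \<theta>) = integral ?A g"
    using set_borel_integral_eq_integral(2)[OF S] by (simp add: set_lebesgue_integral_def)
  finally show ?thesis .
qed

lemma circle_integral_cis:
  "(LINT \<theta>|circle_measure. cis (- (real s * \<theta>)) * cis \<theta> ^ j) = (if j = s then 1 else 0)"
proof (cases "j = s")
  case True
  have "cis (- (real s * \<theta>)) * cis \<theta> ^ j = 1" for \<theta>
    by (simp add: True Complex.DeMoivre cis_mult)
  then show ?thesis using True prob_space.prob_space[OF prob_space_circle_measure] by simp
next
  case False
  define c where "c = real j - real s"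
  have c: "c \<noteq> 0" using False by (simp add: c_def)
  have e: "cis (- (real s * \<theta>)) * cis \<theta> ^ j = exp (\<i> * of_real c * of_real \<theta>)" for \<theta>
    unfolding Complex.DeMoivre cis_mult by (simp add: cis_conv_exp c_def algebra_simps)
  have "((\<lambda>\<theta>. exp (\<i> * of_real c * of_real \<theta>)) has_integral
      (exp (\<i> * of_real c * of_real (2 * pi)) / (\<i> * of_real c) - exp (\<i> * of_real c * of_real 0) / (\<i> * of_real c))) {0..2*pi}"
  proof (rule fundamental_theorem_of_calculus)
    fix \<theta> :: real
    have "((\<lambda>w. exp (\<i> * of_real c * w) / (\<i> * of_real c)) has_field_derivative exp (\<i> * of_real c * of_real \<theta>)) (at (of_real \<theta>))"
      using c by (auto intro!: derivative_eq_intros)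
    from has_vector_derivative_real_field[OF this]
    show "((\<lambda>\<theta>. exp (\<i> * of_real c * of_real \<theta>) / (\<i> * of_real c)) has_vector_derivative exp (\<i> * of_real c * of_real \<theta>)) (at \<theta> within {0..2*pi})"
      by (simp add: has_vector_derivative_at_within)
  qed simp
  moreover have "exp (\<i> * of_real c * of_real (2 * pi)) = 1"
    unfolding exp_eq_1 by (auto simp: c_def intro!: exI[of _ "int j - int s"])
  ultimately have "((\<lambda>\<theta>. exp (\<i> * of_real c * of_real \<theta>)) has_integral 0) {0..2*pi}" by simp
  then have "integral {0..2*pi} (\<lambda>\<theta>. exp (\<i> * of_real c * of_real \<theta>)) = 0" by (rule integral_unique)
  then show ?thesis unfolding e using False by (subst circle_integral_eq) (auto intro!: continuous_intros)
qed

text \<open>The coefficient of \<open>c^s\<close> in \<open>(A + c B)^a exp(c D)\<close>.\<close>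

definition circle_coeff :: "nat \<Rightarrow> nat \<Rightarrow> complex \<Rightarrow> complex \<Rightarrow> complex \<Rightarrow> complex" where
  "circle_coeff s a A B D = (\<Sum>k\<le>min a s. of_nat (a choose k) * A ^ (a - k) * B ^ k * (D ^ (s - k) / fact (s - k)))"

lemma circle_integral_exp:
  "(LINT \<theta>|circle_measure. cis (- (real s * \<theta>)) * cis \<theta> ^ k * exp (D * cis \<theta>)) = (if k \<le> s then D ^ (s - k) / fact (s - k) else 0)"
proof -
  let ?h = "\<lambda>\<theta>. cis (- (real s * \<theta>)) * cis \<theta> ^ k"
  have m: "cis \<in> borel_measurable borel" by (intro borel_measurable_continuous_onI continuous_intros)
  have hm: "?h \<in> borel_measurable borel" by (intro borel_measurable_continuous_onI continuous_intros)
  have nb: "norm (?h \<theta>) = 1" for \<theta> by (simp add: norm_mult norm_power)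
  have "integrable circle_measure (\<lambda>\<theta>. norm (?h \<theta>) * exp ((norm D + 1) * norm (cis \<theta>)))"
    unfolding nb norm_cis by (rule circle_integrable) auto
  then have "(\<lambda>j. (LINT \<theta>|circle_measure. ?h \<theta> * cis \<theta> ^ j) / fact j * D ^ j) sums (LINT \<theta>|circle_measure. ?h \<theta> * exp (D * cis \<theta>))"
    by (rule integral_exp_sums[OF _ _ _ add_nonneg_pos[OF norm_ge_zero[of D] zero_less_one], rotated 2]) (use m hm in simp_all)
  moreover have "(LINT \<theta>|circle_measure. ?h \<theta> * cis \<theta> ^ j) = (if k + j = s then 1 else 0)" for j
    using circle_integral_cis[of s "k + j"] by (simp only: power_add mult.assoc)
  ultimately have S: "(\<lambda>j. (if k + j = s then 1 else 0) / fact j * D ^ j) sums (LINT \<theta>|circle_measure. ?h \<theta> * exp (D * cis \<theta>))"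
    by simp
  show ?thesis
  proof (cases "k \<le> s")
    case True
    have "(\<lambda>j. (if k + j = s then 1 else 0) / fact j * D ^ j) = (\<lambda>j. if j = s - k then D ^ j / fact j else 0)"
      using True by (auto simp: fun_eq_iff)
    then show ?thesis using sums_unique2[OF S] sums_single[of "s - k" "\<lambda>j. D ^ j / fact j"] True by simp
  next
    case False
    then have "(\<lambda>j. (if k + j = s then 1 else 0) / fact j * D ^ j) = (\<lambda>j. 0)" by (auto simp: fun_eq_iff)
    then show ?thesis using sums_unique2[OF S] sums_zero False by (simp only: if_False)
  qed
qed

lemma circle_integral_poly_exp:
  "(LINT \<theta>|circle_measure. cis (- (real s * \<theta>)) * (A + cis \<theta> * B) ^ a * exp (D * cis \<theta>)) = circle_coeff s a A B D"
proof -
  have e: "cis (- (real s * \<theta>)) * (A + cis \<theta> * B) ^ a * exp (D * cis \<theta>)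
     = (\<Sum>k\<le>a. of_nat (a choose k) * A ^ (a - k) * B ^ k * (cis (- (real s * \<theta>)) * cis \<theta> ^ k * exp (D * cis \<theta>)))" for \<theta>
    unfolding add.commute[of A] binomial_ring sum_distrib_left sum_distrib_right
    by (intro sum.cong refl) (simp only: power_mult_distrib mult_ac)
  have I: "integrable circle_measure (\<lambda>\<theta>. cis (- (real s * \<theta>)) * cis \<theta> ^ k * exp (D * cis \<theta>))" for k
  proof (rule circle_integrable)
    show "(\<lambda>\<theta>. cis (- (real s * \<theta>)) * cis \<theta> ^ k * exp (D * cis \<theta>)) \<in> borel_measurable borel"
      by (intro borel_measurable_continuous_onI continuous_intros)
    show "norm (cis (- (real s * \<theta>)) * cis \<theta> ^ k * exp (D * cis \<theta>)) \<le> exp (norm D)" for \<theta>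
      using norm_exp_le[of "D * cis \<theta>"] by (simp add: norm_mult norm_power)
  qed
  have "(LINT \<theta>|circle_measure. cis (- (real s * \<theta>)) * (A + cis \<theta> * B) ^ a * exp (D * cis \<theta>))
    = (\<Sum>k\<le>a. of_nat (a choose k) * A ^ (a - k) * B ^ k * (if k \<le> s then D ^ (s - k) / fact (s - k) else 0))"
    unfolding e by (subst Bochner_Integration.integral_sum) (auto simp only: integrable_mult_right I integral_mult_right_zero circle_integral_exp)
  also have "\<dots> = circle_coeff s a A B D"
    unfolding circle_coeff_def by (rule sum.mono_neutral_cong_right) auto
  finally show ?thesis .
qed

section \<open>An Euler equation of infinite order\<close>

lemma integrable_exp_neg_abs:
  assumes "\<kappa> > 0"
  shows "integrable lborel (\<lambda>v::real. exp (- \<kappa> * \<bar>v\<bar>))"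
proof -
  have "(\<integral>\<^sup>+x. ennreal (exp (- \<kappa> * x)) * indicator {0..} x \<partial>lborel) = ennreal (0 - (- (exp (- \<kappa> * 0) / \<kappa>)))"
  proof (rule nn_integral_FTC_atLeast[where F = "\<lambda>x. - (exp (- \<kappa> * x) / \<kappa>)"])
    show "((\<lambda>x. - (exp (- \<kappa> * x) / \<kappa>)) has_real_derivative exp (- \<kappa> * x)) (at x)" for x
      using assms by (auto intro!: derivative_eq_intros)
    have "((\<lambda>x. exp (- \<kappa> * x)) \<longlongrightarrow> 0) at_top"
      by (rule filterlim_compose[OF exp_at_bot])
        (use assms in \<open>intro filterlim_tendsto_neg_mult_at_bot[OF tendsto_const _ filterlim_ident]; simp\<close>)
    from tendsto_minus[OF tendsto_divide[OF this tendsto_const[of \<kappa>]]]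
    show "((\<lambda>x. - (exp (- \<kappa> * x) / \<kappa>)) \<longlongrightarrow> 0) at_top" using assms by simp
  qed auto
  also have "\<dots> < \<infinity>" by simp
  finally have "integrable lborel (\<lambda>x. indicator {0..} x *\<^sub>R exp (- \<kappa> * x))"
    by (intro integrableI_bounded) (auto simp: indicator_mult_ennreal mult.commute ennreal_mult' intro!: order.strict_trans1[OF nn_integral_mono])
  then have "has_bochner_integral lborel (\<lambda>x. indicator {0..} x *\<^sub>R exp (- \<kappa> * \<bar>x\<bar>)) (LINT x|lborel. indicator {0..} x *\<^sub>R exp (- \<kappa> * x))"
    by (subst has_bochner_integral_cong[OF refl _ refl, where g = "\<lambda>x. indicator {0..} x *\<^sub>R exp (- \<kappa> * x)"])
      (auto simp: has_bochner_integral_iff indicator_def)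
  from has_bochner_integral_even_function[OF this]
  show ?thesis by (simp add: has_bochner_integral_iff)
qed

text \<open>The weight \<open>(1+y)^(-N)\<close> is the one for which the substitution \<open>\<tau> = y/(1+y)\<close> turns the series in
\<open>(\<tau>(1-\<tau>))^j m^(j)\<close> into one in the Euler derivatives \<open>y^i G^(i)\<close>. The half plane \<open>Re \<tau> < 1\<close> corresponds
to \<open>Re y > -1\<close> and the interval \<open>0 < \<tau> < 1\<close> to \<open>y > 0\<close>.\<close>

definition moebius_tr :: "(complex \<Rightarrow> complex) \<Rightarrow> nat \<Rightarrow> complex \<Rightarrow> complex" where
  "moebius_tr m N y = m (y / (1 + y)) / (1 + y) ^ N"

lemma Re_moebius:
  assumes "Re y > -1"
  shows "Re (y / (1 + y)) < 1" "1 + y \<noteq> 0"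
proof -
  show ne: "1 + y \<noteq> 0"
  proof
    assume "1 + y = 0" then have "Re (1 + y) = 0" by simp
    then show False using assms by simp
  qed
  then have "y / (1 + y) = 1 - 1 / (1 + y)" by (simp add: field_simps)
  moreover have "Re (1 / (1 + y)) = Re (1 + y) / (norm (1 + y))\<^sup>2"
    by (simp add: Re_divide cmod_power2)
  moreover have "Re (1 + y) / (norm (1 + y))\<^sup>2 > 0" using assms ne by (intro divide_pos_pos) auto
  ultimately show "Re (y / (1 + y)) < 1" by simp
qed

lemma moebius_tr_holomorphic:
  assumes "m holomorphic_on {\<tau>. Re \<tau> < 1}"
  shows "moebius_tr m N holomorphic_on {y. Re y > -1}"
proof -
  have "(m \<circ> (\<lambda>y. y / (1 + y))) holomorphic_on {y. Re y > -1}"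
    by (rule holomorphic_on_compose_gen[OF _ assms]) (use Re_moebius in \<open>auto intro!: holomorphic_intros\<close>)
  then show ?thesis
    unfolding moebius_tr_def[abs_def] o_def by (intro holomorphic_intros) (use Re_moebius in auto)
qed

lemma open_Re_gt [simp]: "open {y. Re y > c}" "open {y. Re y < c}"
  by (simp_all add: open_halfspace_Re_gt open_halfspace_Re_lt)

text \<open>The coefficients in the expansion of the higher derivatives of the transform (\<open>moebius_tr_higher_deriv\<close>).\<close>

definition moebius_coeff :: "nat \<Rightarrow> nat \<Rightarrow> nat \<Rightarrow> real" where
  "moebius_coeff N i j = (- 1) ^ (i + j) * real (i choose j) * (fact (N + i - 1) / fact (N + j - 1))"

lemma moebius_coeff_Suc:
  assumes "N \<ge> 1"
  shows "moebius_coeff N (Suc i) 0 = - real (N + i + 0) * moebius_coeff N i 0"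
    and "moebius_coeff N (Suc i) (Suc j) = - real (N + i + Suc j) * moebius_coeff N i (Suc j) + moebius_coeff N i j"
proof -
  have aux: "(a + b) * (c * F / (D * K)) = e * (a * (F / (D * K))) + b * (F / K)"
    if "(a + b) * c * F = e * a * F + b * D * F" "D > 0" "K > 0" for a b c D K F e :: real
  proof -
    have "(a + b) * (c * F / (D * K)) = ((a + b) * c * F) / (D * K)" by simp
    also have "\<dots> = e * (a * (F / (D * K))) + b * (F / K)"
      unfolding that(1) using that(2,3) by (simp add: add_divide_distrib)
    finally show ?thesis .
  qed
  obtain M where N: "N = Suc M" using assms by (cases N) auto
  show "moebius_coeff N (Suc i) 0 = - real (N + i + 0) * moebius_coeff N i 0"
    by (simp add: moebius_coeff_def N algebra_simps)
  have c: "real (Suc j) * real (i choose Suc j) = (real i - real j) * real (i choose j)"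
  proof -
    have "Suc j * (Suc i choose Suc j) = Suc i * (i choose j)" by (rule Suc_times_binomial)
    then have "real (Suc j * (Suc i choose Suc j)) = real (Suc i * (i choose j))" by (simp only:)
    then show ?thesis by (simp add: algebra_simps)
  qed
  have "real (Suc i choose Suc j) * (real (N + i) * F / (real (N + j) * K)) =
     real (N + i + Suc j) * (real (i choose Suc j) * (F / (real (N + j) * K))) + real (i choose j) * (F / K)" if "K > 0" for F K :: real
  proof -
    have "(real (i choose Suc j) + real (i choose j)) * real (N + i) * F
      = real (N + i + Suc j) * real (i choose Suc j) * F + real (i choose j) * real (N + j) * F + ((real i - real j) * real (i choose j) - real (Suc j) * real (i choose Suc j)) * F"
      by (simp add: algebra_simps)
    then have "(real (i choose Suc j) + real (i choose j)) * real (N + i) * F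
      = real (N + i + Suc j) * real (i choose Suc j) * F + real (i choose j) * real (N + j) * F"
      unfolding c by simp
    moreover have "real (N + j) > 0" using N by simp
    ultimately show ?thesis using aux that unfolding binomial_Suc_Suc of_nat_add[of "i choose j"] by (metis add.commute)
  qed
  note key = this[of "fact (N + j - 1)" "fact (N + i - 1)"]
  have f: "(fact (N + k) :: real) = real (N + k) * fact (N + k - 1)" for k
    using N by simp
  have "moebius_coeff N (Suc i) (Suc j) = (- 1) ^ (i + j) * (real (Suc i choose Suc j) * (real (N + i) * fact (N + i - 1) / (real (N + j) * fact (N + j - 1))))"
    by (simp only: moebius_coeff_def f[symmetric]) simp
  also have "\<dots> = (- 1) ^ (i + j) * (real (N + i + Suc j) * (real (i choose Suc j) * (fact (N + i - 1) / (real (N + j) * fact (N + j - 1)))) + real (i choose j) * (fact (N + i - 1) / fact (N + j - 1)))"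
    by (subst key) simp_all
  also have "\<dots> = - real (N + i + Suc j) * moebius_coeff N i (Suc j) + moebius_coeff N i j"
    by (simp only: moebius_coeff_def f[symmetric] distrib_left) (simp add: algebra_simps add_divide_distrib diff_divide_distrib)
  finally show "moebius_coeff N (Suc i) (Suc j) = - real (N + i + Suc j) * moebius_coeff N i (Suc j) + moebius_coeff N i j" .
qed

lemma moebius_tr_higher_deriv:
  fixes m :: "complex \<Rightarrow> complex" and y :: complex and N i :: nat
  assumes m: "m holomorphic_on {\<tau>. Re \<tau> < 1}" and N: "N \<ge> 1" and y: "Re y > -1"
  shows "(deriv ^^ i) (moebius_tr m N) y = (\<Sum>j\<le>i. of_real (moebius_coeff N i j) * ((deriv ^^ j) m (y / (1 + y)) / (1 + y) ^ (N + i + j)))"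
  using y
proof (induction i arbitrary: y)
  case 0
  then show ?case by (simp add: moebius_tr_def moebius_coeff_def)
next
  case (Suc i)
  let ?S = "{y. Re y > -1}"
  let ?e = "\<lambda>j. (deriv ^^ j) m (y / (1 + y)) / (1 + y) ^ (N + Suc i + j)"
  have ne: "1 + y \<noteq> 0" and lt: "Re (y / (1 + y)) < 1" using Re_moebius Suc.prems by auto
  have t: "((\<lambda>y. y / (1 + y)) has_field_derivative 1 / (1 + y)\<^sup>2) (at y)"
    using ne by (auto intro!: derivative_eq_intros simp: field_simps power2_eq_square)
  have mj: "((deriv ^^ j) m has_field_derivative (deriv ^^ Suc j) m (y / (1 + y))) (at (y / (1 + y)))" for j
  proof -
    have "(deriv ^^ j) m holomorphic_on {\<tau>. Re \<tau> < 1}" by (rule holomorphic_higher_deriv[OF m]) simp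
    from holomorphic_derivI[OF this, of "y / (1 + y)"] show ?thesis using lt by simp
  qed
  have T: "((\<lambda>y. of_real (moebius_coeff N i j) * ((deriv ^^ j) m (y / (1 + y)) / (1 + y) ^ (N + i + j))) has_field_derivative
      of_real (moebius_coeff N i j) * (?e (Suc j) - of_nat (N + i + j) * ?e j)) (at y)" for j
  proof -
    have "((\<lambda>y. (deriv ^^ j) m (y / (1 + y)) * inverse ((1 + y) ^ (N + i + j))) has_field_derivative
      ((deriv ^^ j) m (y / (1 + y)) * (- (of_nat (N + i + j) * (1 + y) ^ (N + i + j - 1)) / ((1 + y) ^ (N + i + j) * (1 + y) ^ (N + i + j)))
       + (deriv ^^ Suc j) m (y / (1 + y)) * (1 / (1 + y)\<^sup>2) * inverse ((1 + y) ^ (N + i + j)))) (at y)"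
      by (rule derivative_eq_intros DERIV_chain2[OF mj t] refl | (use ne in \<open>simp; fail\<close>))+
        (use ne in \<open>simp add: field_simps\<close>)
    moreover have "(1 + y) ^ (N + i + j - 1) / ((1 + y) ^ (N + i + j) * (1 + y) ^ (N + i + j)) = 1 / (1 + y) ^ (N + Suc i + j)"
    proof -
      obtain M where M: "N + i + j = Suc M" using N by (cases "N + i + j") auto
      then have "N + Suc i + j = Suc (Suc M)" by simp
      have gen: "w ^ M / (w ^ Suc M * w ^ Suc M) = 1 / w ^ Suc (Suc M)" if "w \<noteq> 0" for w :: complex
        using that by (simp add: field_simps)
      show ?thesis
        unfolding \<open>N + Suc i + j = Suc (Suc M)\<close> M diff_Suc_1 by (rule gen[OF ne])
    qed
    moreover have "1 / (1 + y)\<^sup>2 * inverse ((1 + y) ^ (N + i + j)) = 1 / (1 + y) ^ (N + Suc i + Suc j)"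
      by (simp add: power_add power2_eq_square divide_inverse mult_ac)
    moreover have "a * (- (c * P) / Q) + b * (1 / (1 + y)\<^sup>2) * W = b * (1 / (1 + y)\<^sup>2 * W) - c * (a * (P / Q))" for a b c P Q W :: complex
      by simp
    ultimately have "((\<lambda>y. (deriv ^^ j) m (y / (1 + y)) / (1 + y) ^ (N + i + j)) has_field_derivative
      (?e (Suc j) - of_nat (N + i + j) * ?e j)) (at y)"
      by (simp only: divide_inverse[of "(deriv ^^ _) m _" "_ ^ _"] divide_inverse[of 1] mult_1_left)
    then show ?thesis by (rule DERIV_cmult)
  qed
  have "((\<lambda>y. \<Sum>j\<le>i. of_real (moebius_coeff N i j) * ((deriv ^^ j) m (y / (1 + y)) / (1 + y) ^ (N + i + j))) has_field_derivative
      (\<Sum>j\<le>i. of_real (moebius_coeff N i j) * (?e (Suc j) - of_nat (N + i + j) * ?e j))) (at y)"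
    by (rule DERIV_sum) (rule T)
  then have "((deriv ^^ i) (moebius_tr m N) has_field_derivative
      (\<Sum>j\<le>i. of_real (moebius_coeff N i j) * (?e (Suc j) - of_nat (N + i + j) * ?e j))) (at y)"
    by (rule has_field_derivative_transform_within_open[of _ _ _ ?S]) (use Suc in auto)
  then have "(deriv ^^ Suc i) (moebius_tr m N) y = (\<Sum>j\<le>i. of_real (moebius_coeff N i j) * (?e (Suc j) - of_nat (N + i + j) * ?e j))"
    by (simp add: DERIV_imp_deriv)
  also have "\<dots> = (\<Sum>j\<le>i. of_real (moebius_coeff N i j) * ?e (Suc j)) - (\<Sum>j\<le>i. of_real (real (N + i + j) * moebius_coeff N i j) * ?e j)"
    by (simp add: right_diff_distrib sum_subtractf mult_ac)
  also have "(\<Sum>j\<le>i. of_real (real (N + i + j) * moebius_coeff N i j) * ?e j) = (\<Sum>j\<le>Suc i. of_real (real (N + i + j) * moebius_coeff N i j) * ?e j)"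
    by (simp add: moebius_coeff_def)
  also have "\<dots> = of_real (real (N + i + 0) * moebius_coeff N i 0) * ?e 0 + (\<Sum>j\<le>i. of_real (real (N + i + Suc j) * moebius_coeff N i (Suc j)) * ?e (Suc j))"
    by (rule sum.atMost_Suc_shift)
  also have "(\<Sum>j\<le>i. of_real (moebius_coeff N i j) * ?e (Suc j)) - (of_real (real (N + i + 0) * moebius_coeff N i 0) * ?e 0 + (\<Sum>j\<le>i. of_real (real (N + i + Suc j) * moebius_coeff N i (Suc j)) * ?e (Suc j)))
    = of_real (moebius_coeff N (Suc i) 0) * ?e 0 + (\<Sum>j\<le>i. of_real (moebius_coeff N (Suc i) (Suc j)) * ?e (Suc j))"
  proof -
    have "of_real (moebius_coeff N (Suc i) (Suc j)) * E = of_real (moebius_coeff N i j) * E - of_real (real (N + i + Suc j) * moebius_coeff N i (Suc j)) * E" for j and E :: complex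
      by (simp only: moebius_coeff_Suc[OF N]) (simp add: algebra_simps)
    moreover have "of_real (moebius_coeff N (Suc i) 0) * E = - (of_real (real (N + i + 0) * moebius_coeff N i 0) * E)" for E :: complex
      by (simp only: moebius_coeff_Suc[OF N]) (simp add: algebra_simps)
    ultimately show ?thesis by (simp only: sum_subtractf) simp
  qed
  also have "\<dots> = (\<Sum>j\<le>Suc i. of_real (moebius_coeff N (Suc i) j) * ?e j)"
    by (rule sum.atMost_Suc_shift[symmetric])
  finally show ?case .
qed

lemma summable_deriv_fact2:
  assumes "m holomorphic_on S" "open S" "z \<in> S"
  shows "summable (\<lambda>j. norm (a ^ j / (fact j * fact (N + j - 1)) * (deriv ^^ j) m z))"
proof -
  obtain r where r: "r > 0" "cball z r \<subseteq> S" using assms open_contains_cball by blast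
  have hol: "m holomorphic_on ball z r" and cont: "continuous_on (cball z r) m"
    using assms(1) r(2) ball_subset_cball holomorphic_on_subset holomorphic_on_imp_continuous_on by (blast, blast)
  obtain B where B: "\<forall>w\<in>cball z r. norm (m w) \<le> B"
    using compact_imp_bounded[OF compact_continuous_image[OF cont compact_cball]] by (auto simp: bounded_iff)
  have d: "norm ((deriv ^^ j) m z) \<le> fact j * B / r ^ j" for j
    by (rule Cauchy_inequality[OF hol cont r(1)]) (use B in \<open>auto simp: dist_norm\<close>)
  have "norm (m z) \<le> B" using B r(1) by simp
  then have B0: "B \<ge> 0" using norm_ge_zero[of "m z"] by linarith
  show ?thesis
  proof (rule summable_comparison_test_ev)
    show "summable (\<lambda>j. of_nat (Suc j) * B * ((norm a / r) ^ j /\<^sub>R fact j))"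
    proof -
      have "summable (\<lambda>j. (2 * norm a / r) ^ j /\<^sub>R fact j)" using exp_converges by (rule sums_summable)
      then have "summable (\<lambda>j. B * ((2 * norm a / r) ^ j /\<^sub>R fact j))" by (rule summable_mult)
      then show ?thesis
      proof (rule summable_comparison_test')
        fix j :: nat
        have "real (Suc j) \<le> 2 ^ j" using less_exp[of j] by (metis Suc_leI of_nat_le_iff of_nat_numeral of_nat_power)
        then have "real (Suc j) * B * ((norm a / r) ^ j /\<^sub>R fact j) \<le> 2 ^ j * B * ((norm a / r) ^ j /\<^sub>R fact j)"
          using B0 r(1) by (intro mult_right_mono) auto
        also have "\<dots> = B * ((2 * norm a / r) ^ j /\<^sub>R fact j)"
          by (simp add: power_divide power_mult_distrib)
        finally show "norm (of_nat (Suc j) * B * ((norm a / r) ^ j /\<^sub>R fact j)) \<le> B * ((2 * norm a / r) ^ j /\<^sub>R fact j)"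
          using B0 r(1) by (simp add: abs_mult)
      qed
    qed
    have "norm (norm (a ^ j / (fact j * fact (N + j - 1)) * (deriv ^^ j) m z)) \<le> of_nat (Suc j) * B * ((norm a / r) ^ j /\<^sub>R fact j)" for j
    proof -
      have f: "(fact j :: real) \<le> of_nat (Suc j) * fact (N + j - 1)"
      proof (cases "N + j")
        case 0 then show ?thesis by simp
      next
        case (Suc k)
        have "j \<le> Suc k" using Suc by simp
        then consider "j \<le> k" | "j = Suc k" by linarith
        then show ?thesis
        proof cases
          case 1
          have "(fact j :: real) \<le> 1 * fact k" using 1 by (simp add: fact_mono)
          also have "\<dots> \<le> of_nat (Suc j) * fact k" by (intro mult_right_mono) auto
          finally show ?thesis using Suc by simp
        next
          case 2
          have "(fact (Suc k) :: real) = real (Suc k) * fact k" by simp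
          also have "\<dots> \<le> real (Suc j) * fact k" using 2 by (intro mult_right_mono) auto
          finally show ?thesis using Suc 2 by simp
        qed
      qed
      have "norm (a ^ j / (fact j * fact (N + j - 1)) * (deriv ^^ j) m z) = norm a ^ j / (fact j * fact (N + j - 1)) * norm ((deriv ^^ j) m z)"
        by (simp add: norm_mult norm_divide norm_power)
      also have "\<dots> \<le> norm a ^ j / (fact j * fact (N + j - 1)) * (fact j * B / r ^ j)"
        by (intro mult_left_mono d) auto
      also have "\<dots> = (B * (norm a / r) ^ j) * (1 / fact (N + j - 1))"
        by (simp add: power_divide mult_ac)
      also have "\<dots> \<le> (B * (norm a / r) ^ j) * (of_nat (Suc j) / fact j)"
        using B0 r(1) f by (intro mult_left_mono) (auto simp: field_simps)
      also have "\<dots> = of_nat (Suc j) * B * ((norm a / r) ^ j /\<^sub>R fact j)" by (simp add: divide_inverse mult_ac)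
      finally show ?thesis by simp
    qed
    then show "\<forall>\<^sub>F j in sequentially. norm (norm (a ^ j / (fact j * fact (N + j - 1)) * (deriv ^^ j) m z)) \<le> of_nat (Suc j) * B * ((norm a / r) ^ j /\<^sub>R fact j)"
      by simp
  qed
qed

text \<open>Insert the formula for the derivatives of the transform and sum over \<open>i\<close> first: the coefficient of the
\<open>j\<close>-th derivative of \<open>m\<close> is an exponential series in \<open>x y/(1+y)\<close>, and since \<open>\<tau>(1-\<tau>) = y/(1+y)^2\<close> the
double series is an exponential times the series of the hypothesis. Absolute convergence holds
because the two factorials in the denominator outweigh the Cauchy bounds of the derivatives.\<close>

lemma moebius_tr_euler_series:
  fixes y :: real
  assumes m: "m holomorphic_on {\<tau>. Re \<tau> < 1}" and N: "N \<ge> 1" and y: "y > 0"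
    and S: "(\<lambda>j. (- of_real (x * (y / (1 + y)) * (1 - y / (1 + y)))) ^ j / (fact j * fact (N + j - 1)) * (deriv ^^ j) m (of_real (y / (1 + y)))) sums 0"
  shows "(\<lambda>i. (- of_real x) ^ i / (fact i * fact (N + i - 1)) * (of_real (y ^ i) * (deriv ^^ i) (moebius_tr m N) (of_real y))) sums 0"
proof -
  define \<tau> where "\<tau> = y / (1 + y)"
  have \<tau>: "0 < \<tau>" "\<tau> < 1" "1 - \<tau> = 1 / (1 + y)" using y by (auto simp: \<tau>_def field_simps)
  let ?P = "\<lambda>j. (- of_real (x * \<tau> * (1 - \<tau>))) ^ j / (fact j * fact (N + j - 1)) * (deriv ^^ j) m (of_real \<tau>)"
  let ?E = "\<lambda>k. (of_real (x * \<tau>)) ^ k / fact k :: complex"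
  have P: "summable (\<lambda>j. norm (?P j))"
    by (rule summable_deriv_fact2[OF m]) (use \<tau> in auto)
  have E: "summable (\<lambda>k. norm (?E k))"
    using summable_norm_exp[of "of_real (x * \<tau>) :: complex"] by (simp add: scaleR_conv_of_real divide_inverse mult.commute norm_mult)
  have C: "(\<lambda>i. \<Sum>j\<le>i. ?P j * ?E (i - j)) sums ((\<Sum>j. ?P j) * (\<Sum>k. ?E k))"
    by (rule Cauchy_product_sums[OF P E])
  have P0: "(\<Sum>j. ?P j) = 0" using S unfolding \<tau>_def by (simp add: sums_iff)
  have T: "(- of_real x) ^ i / (fact i * fact (N + i - 1)) * (of_real (y ^ i) * (deriv ^^ i) (moebius_tr m N) (of_real y))
     = 1 / of_real (1 + y) ^ N * (\<Sum>j\<le>i. ?P j * ?E (i - j))" for i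
  proof -
    have "(deriv ^^ i) (moebius_tr m N) (of_real y) = (\<Sum>j\<le>i. of_real (moebius_coeff N i j) * ((deriv ^^ j) m (of_real \<tau>) / of_real (1 + y) ^ (N + i + j)))"
      using moebius_tr_higher_deriv[OF m N, of "of_real y" i] y by (simp add: \<tau>_def)
    then have "(- of_real x) ^ i / (fact i * fact (N + i - 1)) * (of_real (y ^ i) * (deriv ^^ i) (moebius_tr m N) (of_real y))
      = (\<Sum>j\<le>i. of_real ((- x) ^ i / (fact i * fact (N + i - 1)) * y ^ i * moebius_coeff N i j / (1 + y) ^ (N + i + j)) * (deriv ^^ j) m (of_real \<tau>))"
      by (simp add: sum_distrib_left) (simp add: mult_ac)
    also have "\<dots> = (\<Sum>j\<le>i. of_real (1 / (1 + y) ^ N * ((- (x * \<tau> * (1 - \<tau>))) ^ j / (fact j * fact (N + j - 1))) * ((x * \<tau>) ^ (i - j) / fact (i - j))) * (deriv ^^ j) m (of_real \<tau>))"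
    proof (rule sum.cong[OF refl])
      fix j assume "j \<in> {..i}"
      then obtain k where i: "i = j + k" using le_Suc_ex by auto
      have b: "real (i choose j) / fact i = 1 / (fact j * fact k)"
        unfolding i by (simp add: binomial_fact)
      have "(- x) ^ i / (fact i * fact (N + i - 1)) * y ^ i * moebius_coeff N i j / (1 + y) ^ (N + i + j)
        = (- x) ^ i * y ^ i * (-1) ^ (i + j) * (real (i choose j) / fact i) / fact (N + j - 1) / (1 + y) ^ (N + i + j)"
        by (simp add: moebius_coeff_def)
      also have "\<dots> = (- x) ^ i * y ^ i * (-1) ^ (i + j) * (1 / (fact j * fact k)) / fact (N + j - 1) / (1 + y) ^ (N + i + j)"
        by (simp only: b)
      also have "(- x) ^ i * y ^ i * (-1) ^ (i + j) = (- 1) ^ j * (x * y) ^ j * (x * y) ^ k"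
        unfolding i by (simp add: power_add power_mult_distrib power_minus[of x] mult_ac)
      also have "(- 1) ^ j * (x * y) ^ j * (x * y) ^ k * (1 / (fact j * fact k)) / fact (N + j - 1) / (1 + y) ^ (N + i + j)
        = 1 / (1 + y) ^ N * ((- (x * \<tau> * (1 - \<tau>))) ^ j / (fact j * fact (N + j - 1))) * ((x * \<tau>) ^ k / fact k)"
        unfolding \<tau>(3) unfolding \<tau>_def i using y
        by (simp add: power_add power_mult_distrib power_divide power_minus[of "_ / _"] mult_ac)
      finally show "of_real ((- x) ^ i / (fact i * fact (N + i - 1)) * y ^ i * moebius_coeff N i j / (1 + y) ^ (N + i + j)) * (deriv ^^ j) m (of_real \<tau>)
        = of_real (1 / (1 + y) ^ N * ((- (x * \<tau> * (1 - \<tau>))) ^ j / (fact j * fact (N + j - 1))) * ((x * \<tau>) ^ (i - j) / fact (i - j))) * (deriv ^^ j) m (of_real \<tau>)"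
        by (simp only: i add_diff_cancel_left')
    qed
    also have "\<dots> = 1 / of_real (1 + y) ^ N * (\<Sum>j\<le>i. ?P j * ?E (i - j))"
      by (simp add: sum_distrib_left) (simp add: mult_ac)
    finally show ?thesis .
  qed
  show ?thesis unfolding T using sums_mult[OF C, of "1 / of_real (1 + y) ^ N"] P0 by simp
qed

text \<open>The multiplier of the Euler operator under the Mellin transform: \<open>y^i G^(i)\<close> is
transformed into \<open>(-1)^i pochhammer \<sigma> i\<close> times the transform of \<open>G\<close>.\<close>

definition euler_mult :: "real \<Rightarrow> nat \<Rightarrow> complex \<Rightarrow> complex" where
  "euler_mult x N \<sigma> = (\<Sum>i. of_real (x ^ i / (fact i * fact (N + i - 1))) * pochhammer \<sigma> i)"

lemma norm_pochhammer_le: "norm (pochhammer (\<sigma> :: complex) i) \<le> pochhammer (norm \<sigma>) i"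
proof (induction i)
  case (Suc i)
  have "norm (\<sigma> + of_nat i) \<le> norm \<sigma> + real i" by (rule order_trans[OF norm_triangle_ineq]) simp
  then show ?case using Suc unfolding pochhammer_Suc norm_mult
    by (intro mult_mono) (auto intro: order_trans[OF norm_ge_zero])
qed simp

lemma pochhammer_mono_real:
  assumes "0 \<le> a" "a \<le> (b :: real)"
  shows "0 \<le> pochhammer a i" "pochhammer a i \<le> pochhammer b i"
proof -
  have "0 \<le> pochhammer a i \<and> pochhammer a i \<le> pochhammer b i"
    using assms by (induction i) (auto simp: pochhammer_Suc intro!: mult_mono)
  then show "0 \<le> pochhammer a i" "pochhammer a i \<le> pochhammer b i" by auto
qed

lemma pochhammer_nat_le: "pochhammer (real (Suc M)) i \<le> 2 ^ (M + i) * fact i"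
proof -
  have "pochhammer (real (Suc M)) i = fact (M + i) / fact M"
    using pochhammer_fact[where 'a = real] pochhammer_product'[of "1::real" M i] by (simp add: pochhammer_fact[symmetric] add.commute)
  also have "\<dots> = real ((M + i) choose i) * fact i"
    by (simp add: binomial_fact)
  also have "real ((M + i) choose i) \<le> 2 ^ (M + i)"
    using binomial_le_pow2[of "M + i" i] by (metis of_nat_le_iff of_nat_numeral of_nat_power)
  finally show ?thesis by simp
qed

lemma euler_mult_bound:
  fixes \<sigma> :: complex
  assumes "x > 0" "norm \<sigma> \<le> real (Suc M)" "N \<ge> 1"
  shows "norm (of_real (x ^ i / (fact i * fact (N + i - 1))) * pochhammer \<sigma> i) \<le> 2 ^ M * ((2 * x) ^ i /\<^sub>R fact i)"
proof -
  have "norm (pochhammer \<sigma> i) \<le> pochhammer (norm \<sigma>) i" by (rule norm_pochhammer_le)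
  also have "\<dots> \<le> pochhammer (real (Suc M)) i"
    using assms(2) by (intro pochhammer_mono_real) auto
  also have "\<dots> \<le> 2 ^ (M + i) * fact i" by (rule pochhammer_nat_le)
  finally have p: "norm (pochhammer \<sigma> i) \<le> 2 ^ (M + i) * fact i" .
  have f: "(fact i :: real) \<le> fact (N + i - 1)" using assms(3) by (intro fact_mono) auto
  have "norm (of_real (x ^ i / (fact i * fact (N + i - 1))) * pochhammer \<sigma> i) = x ^ i / (fact i * fact (N + i - 1)) * norm (pochhammer \<sigma> i)"
    using assms(1) by (simp add: norm_mult norm_power norm_divide)
  also have "\<dots> \<le> x ^ i / (fact i * fact i) * (2 ^ (M + i) * fact i)"
    using p f assms(1) by (intro mult_mono divide_left_mono mult_left_mono) auto
  also have "\<dots> = 2 ^ M * ((2 * x) ^ i /\<^sub>R fact i)"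
    by (simp add: power_add power_mult_distrib field_simps)
  finally show ?thesis .
qed

lemma euler_mult_sums:
  assumes "x > 0" "N \<ge> 1"
  shows "(\<lambda>i. of_real (x ^ i / (fact i * fact (N + i - 1))) * pochhammer \<sigma> i) sums euler_mult x N \<sigma>"
proof -
  obtain M where M: "norm \<sigma> \<le> real (Suc M)" using real_arch_simple[of "norm \<sigma>"] by (metis le_less_linear less_imp_le of_nat_Suc order_trans le_add_same_cancel2 zero_le_one less_add_one)
  have "summable (\<lambda>i. of_real (x ^ i / (fact i * fact (N + i - 1))) * pochhammer \<sigma> i)"
  proof (rule summable_comparison_test')
    show "summable (\<lambda>i. 2 ^ M * ((2 * x) ^ i /\<^sub>R fact i))"
      using exp_converges[of "2 * x"] by (intro summable_mult) (rule sums_summable)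
    show "norm (of_real (x ^ i / (fact i * fact (N + i - 1))) * pochhammer \<sigma> i) \<le> 2 ^ M * ((2 * x) ^ i /\<^sub>R fact i)" for i
      by (rule euler_mult_bound[OF assms(1) M assms(2)])
  qed
  then show ?thesis unfolding euler_mult_def by (rule summable_sums)
qed

lemma euler_mult_holomorphic:
  assumes "x > 0" "N \<ge> 1"
  shows "euler_mult x N holomorphic_on UNIV"
proof (rule holomorphic_uniform_sequence[OF open_UNIV])
  show "(\<lambda>\<sigma>. \<Sum>i<n. of_real (x ^ i / (fact i * fact (N + i - 1))) * pochhammer \<sigma> i) holomorphic_on UNIV" for n
    unfolding pochhammer_prod by (intro holomorphic_intros)
  fix z :: complex
  obtain M where M: "norm z + 1 \<le> real M" using real_arch_simple by blast
  have "uniform_limit (cball z 1) (\<lambda>n \<sigma>. \<Sum>i<n. of_real (x ^ i / (fact i * fact (N + i - 1))) * pochhammer \<sigma> i)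
      (\<lambda>\<sigma>. \<Sum>i. of_real (x ^ i / (fact i * fact (N + i - 1))) * pochhammer \<sigma> i) sequentially"
  proof (rule Weierstrass_m_test)
    show "summable (\<lambda>i. 2 ^ M * ((2 * x) ^ i /\<^sub>R fact i))"
      using exp_converges[of "2 * x"] by (intro summable_mult) (rule sums_summable)
    fix i and \<sigma> :: complex assume "\<sigma> \<in> cball z 1"
    then have "norm \<sigma> \<le> norm z + 1" using norm_triangle_ineq2[of \<sigma> z] by (simp add: dist_norm norm_minus_commute)
    then have "norm \<sigma> \<le> real (Suc M)" using M by simp
    then show "norm (of_real (x ^ i / (fact i * fact (N + i - 1))) * pochhammer \<sigma> i) \<le> 2 ^ M * ((2 * x) ^ i /\<^sub>R fact i)"
      by (rule euler_mult_bound[OF assms(1) _ assms(2)])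
  qed
  then show "\<exists>d>0. cball z d \<subseteq> UNIV \<and> uniform_limit (cball z d) (\<lambda>n \<sigma>. \<Sum>i<n. of_real (x ^ i / (fact i * fact (N + i - 1))) * pochhammer \<sigma> i) (euler_mult x N) sequentially"
    unfolding euler_mult_def[abs_def] by (intro exI[of _ 1]) auto
qed

text \<open>At \<open>\<sigma> = 0\<close> only the term \<open>i = 0\<close> survives, so that the function does not vanish identically.\<close>

lemma euler_mult_zeros:
  assumes "x > 0" "N \<ge> 1"
  shows "countable {\<sigma>. euler_mult x N \<sigma> = 0}"
proof (cases "euler_mult x N constant_on UNIV")
  case True
  have "euler_mult x N 0 = of_real (1 / fact (N - 1))"
  proof -
    have "(\<lambda>i. of_real (x ^ i / (fact i * fact (N + i - 1))) * pochhammer 0 i) sums (of_real (x ^ 0 / (fact 0 * fact (N + 0 - 1))) * pochhammer (0::complex) 0)"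
      using sums_single[of 0 "\<lambda>i. of_real (x ^ i / (fact i * fact (N + i - 1))) * pochhammer (0::complex) i"]
      by (rule sums_cong[THEN iffD1, rotated]) (auto simp: pochhammer_0_left)
    from sums_unique2[OF euler_mult_sums[OF assms] this] show ?thesis by simp
  qed
  moreover have "euler_mult x N \<sigma> = euler_mult x N 0" for \<sigma> using True unfolding constant_on_def by (metis UNIV_I)
  ultimately have "{\<sigma>. euler_mult x N \<sigma> = 0} = {}" by auto
  then show ?thesis by simp
next
  case False
  have "countable {\<sigma>\<in>UNIV. euler_mult x N \<sigma> = 0}"
    by (rule holomorphic_countable_zeros[OF euler_mult_holomorphic[OF assms] open_UNIV connected_UNIV _ False])
      (simp add: fsigma_UNIV)
  then show ?thesis by simp
qed

text \<open>A function bounded by \<open>y^A\<close> near \<open>0\<close> and by \<open>y^(-B)\<close> near infinity has an absolutely convergent Mellin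
transform for \<open>-A < \<sigma> < B\<close>; here \<open>y = exp v\<close>.\<close>

lemma mellin_line_bound:
  fixes A B \<sigma> v :: real
  assumes "A + B > 0"
  shows "exp (\<sigma> * v) * (exp v powr A * (1 + exp v) powr (- A - B)) \<le> exp (- min (\<sigma> + A) (B - \<sigma>) * \<bar>v\<bar>)"
proof (cases "v \<ge> 0")
  case True
  have "(1 + exp v) powr (- A - B) \<le> exp v powr (- A - B)"
    using assms by (intro powr_mono2') auto
  then have "exp (\<sigma> * v) * (exp v powr A * (1 + exp v) powr (- A - B)) \<le> exp (\<sigma> * v) * (exp v powr A * exp v powr (- A - B))"
    by (intro mult_left_mono) auto
  also have "\<dots> = exp (- ((B - \<sigma>) * v))"
    by (simp add: powr_def mult_exp_exp algebra_simps)
  also have "\<dots> \<le> exp (- min (\<sigma> + A) (B - \<sigma>) * \<bar>v\<bar>)"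
    using True by (simp add: mult_right_mono)
  finally show ?thesis .
next
  case False
  have "(1 + exp v) powr (- A - B) \<le> 1"
    using powr_mono[of "- A - B" 0 "1 + exp v"] assms by (simp add: add_pos_pos less_imp_neq[symmetric])
  then have "exp (\<sigma> * v) * (exp v powr A * (1 + exp v) powr (- A - B)) \<le> exp (\<sigma> * v) * (exp v powr A * 1)"
    by (intro mult_left_mono) auto
  also have "\<dots> = exp ((\<sigma> + A) * v)"
    by (simp add: powr_def mult_exp_exp algebra_simps)
  also have "\<dots> \<le> exp (- min (\<sigma> + A) (B - \<sigma>) * \<bar>v\<bar>)"
    using False by (simp add: mult_right_mono)
  finally show ?thesis .
qed

lemma continuous_AE_zero:
  fixes h :: "'a::euclidean_space \<Rightarrow> complex"
  assumes "AE v in lborel. h v = 0" "continuous_on UNIV h"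
  shows "h v = 0"
proof -
  have o: "open {v. h v \<noteq> 0}" using assms(2) by (intro open_Collect_neq) auto
  have "{v. h v \<noteq> 0} \<in> null_sets lborel"
    using assms(1) o by (subst AE_iff_null_sets) auto
  then have "negligible {v. h v \<noteq> 0}" by (simp add: negligible_iff_null_sets null_sets_completionI)
  then have "{v. h v \<noteq> 0} = {}" using open_not_negligible[OF o] by blast
  then show ?thesis by auto
qed

text \<open>On the line \<open>Re \<sigma> = s0\<close> the Mellin transform of \<open>G = moebius_tr m N\<close> times \<open>euler_mult\<close> vanishes. As the
multiplier has countably many zeros, the Mellin transform, which is a Fourier transform in \<open>v = ln y\<close>, vanishes almost
everywhere. The bound is required on discs around \<open>y > 0\<close> rather than for \<open>y\<close> alone because
Cauchy's inequality then bounds \<open>y^i G^(i)\<close> by \<open>i! 2^i\<close> times the same function; the denominators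
\<open>fact i * fact (N + i - 1)\<close> of the series leave enough room for that.\<close>

lemma mellin_vanish:
  fixes m :: "complex \<Rightarrow> complex" and x A B C :: real
  assumes m: "m holomorphic_on {\<tau>. Re \<tau> < 1}" and N: "N \<ge> 1" and x: "x > 0" and AB: "A + B > 0"
    and S: "\<And>t::real. 0 < t \<Longrightarrow> t < 1 \<Longrightarrow>
       (\<lambda>j. (- of_real (x * t * (1 - t))) ^ j / (fact j * fact (N + j - 1)) * (deriv ^^ j) m (of_real t)) sums 0"
    and bound: "\<And>(y::real) y'. y > 0 \<Longrightarrow> norm (y' - of_real y) \<le> y / 2 \<Longrightarrow>
       norm (moebius_tr m N y') \<le> C * (y powr A * (1 + y) powr (- A - B))"
    and \<tau>: "Re \<tau> < 1"
  shows "m \<tau> = 0"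
proof -
  let ?G = "moebius_tr m N"
  define Bd where "Bd v = exp v powr A * (1 + exp v) powr (- A - B)" for v :: real
  have C0: "C \<ge> 0"
  proof -
    have "0 \<le> C * (1 powr A * (1 + 1) powr (- A - B))" using order_trans[OF norm_ge_zero bound[of 1 1]] by simp
    then show ?thesis by (simp add: zero_le_mult_iff)
  qed
  \<comment> \<open>\<open>K i\<close> is \<open>y^i G^(i)(y)\<close> at \<open>y = exp v\<close>.\<close>
  define K where "K i v = of_real (exp v ^ i) * (deriv ^^ i) ?G (of_real (exp v))" for i and v :: real
  have GH: "?G holomorphic_on {y. Re y > -1}" by (rule moebius_tr_holomorphic[OF m])
  have GiH: "(deriv ^^ i) ?G holomorphic_on {y. Re y > -1}" for i by (rule holomorphic_higher_deriv[OF GH]) simp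
  have Kb: "norm (K i v) \<le> fact i * 2 ^ i * C * Bd v" for i v
  proof -
    let ?y = "exp v"
    have sub: "cball (of_real ?y) (?y / 2) \<subseteq> {y. Re y > -1}"
    proof
      fix w :: complex assume "w \<in> cball (of_real ?y) (?y / 2)"
      then have "norm (of_real ?y - w) \<le> ?y / 2" by (simp add: dist_norm)
      then have "\<bar>Re (of_real ?y - w)\<bar> \<le> ?y / 2" using abs_Re_le_cmod order_trans by blast
      then have "?y - Re w \<le> ?y / 2" using abs_ge_self[of "Re (of_real ?y - w)"] by (simp del: abs_ge_self)
      then have "Re w > 0" using exp_gt_zero[of v] by linarith
      then show "w \<in> {y. Re y > -1}" by simp
    qed
    have "norm ((deriv ^^ i) ?G (of_real ?y)) \<le> fact i * (C * Bd v) / (?y / 2) ^ i"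
    proof (rule Cauchy_inequality)
      show "?G holomorphic_on ball (of_real ?y) (?y / 2)" using GH sub ball_subset_cball holomorphic_on_subset by (metis order_trans)
      show "continuous_on (cball (of_real ?y) (?y / 2)) ?G" using GH sub holomorphic_on_subset holomorphic_on_imp_continuous_on by metis
      show "norm (?G w) \<le> C * Bd v" if "norm (of_real ?y - w) = ?y / 2" for w
        unfolding Bd_def by (rule bound) (use that in \<open>auto simp: norm_minus_commute\<close>)
    qed simp
    then have "norm (K i v) \<le> ?y ^ i * (fact i * (C * Bd v) / (?y / 2) ^ i)"
      unfolding K_def norm_mult norm_of_real by (intro mult_mono) auto
    also have "\<dots> = fact i * 2 ^ i * C * Bd v" by (simp add: power_divide)
    finally show ?thesis .
  qed
  have Kd: "(K i has_vector_derivative (of_nat i * K i v + K (Suc i) v)) (at v)" for i v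
  proof -
    have e: "((\<lambda>v::real. complex_of_real (exp v)) has_vector_derivative of_real (exp v)) (at v)"
      by (intro has_vector_derivative_of_real has_real_derivative_iff_has_vector_derivative[THEN iffD1] DERIV_exp)
    have d1: "((\<lambda>v. (deriv ^^ i) ?G (complex_of_real (exp v))) has_vector_derivative (of_real (exp v) * (deriv ^^ Suc i) ?G (of_real (exp v)))) (at v)"
    proof -
      have "Re (complex_of_real (exp v)) > -1" using exp_gt_zero[of v] by (simp del: exp_gt_zero)
      then have "((deriv ^^ i) ?G has_field_derivative (deriv ^^ Suc i) ?G (of_real (exp v))) (at (of_real (exp v)))"
        using holomorphic_derivI[OF GiH, of "of_real (exp v)"] by simp
      from field_vector_diff_chain_at[OF e this] show ?thesis by (simp add: o_def)
    qed
    have d2: "((\<lambda>v::real. complex_of_real (exp v ^ i)) has_vector_derivative of_real (real i * exp v ^ i)) (at v)"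
    proof -
      have "((\<lambda>v. exp (real i * v)) has_real_derivative (real i * exp (real i * v))) (at v)"
        by (auto intro!: derivative_eq_intros)
      then have "((\<lambda>v. exp v ^ i) has_real_derivative real i * exp v ^ i) (at v)"
        by (simp add: exp_of_nat_mult)
      then have "((\<lambda>v. exp v ^ i) has_vector_derivative real i * exp v ^ i) (at v)"
        by (simp add: has_real_derivative_iff_has_vector_derivative)
      from bounded_linear.has_vector_derivative[OF bounded_linear_of_real this] show ?thesis by simp
    qed
    from has_vector_derivative_mult[OF d2 d1]
    show ?thesis unfolding K_def[abs_def] by (simp add: algebra_simps)
  qed
  have Kc: "continuous_on UNIV (K i)" for i
    using Kd by (meson continuous_at_imp_continuous_on has_vector_derivative_continuous)
  have Km[measurable]: "K i \<in> borel_measurable borel" for i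
    using Kc by (rule borel_measurable_continuous_onI)
  let ?e = "\<lambda>\<sigma> v. exp (\<sigma> * complex_of_real v)"
  have eb: "norm (?e \<sigma> v * K i v) \<le> fact i * 2 ^ i * C * exp (- min (Re \<sigma> + A) (B - Re \<sigma>) * \<bar>v\<bar>)" for \<sigma> v i
  proof -
    have "norm (?e \<sigma> v * K i v) \<le> exp (Re \<sigma> * v) * (fact i * 2 ^ i * C * Bd v)"
      unfolding norm_mult using Kb[of i v] by (intro mult_mono) auto
    also have "\<dots> = fact i * 2 ^ i * C * (exp (Re \<sigma> * v) * Bd v)" by simp
    also have "\<dots> \<le> fact i * 2 ^ i * C * exp (- min (Re \<sigma> + A) (B - Re \<sigma>) * \<bar>v\<bar>)"
      unfolding Bd_def using C0 by (intro mult_left_mono mellin_line_bound[OF AB]) auto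
    finally show ?thesis .
  qed
  have int: "integrable lborel (\<lambda>v. ?e \<sigma> v * K i v)" if "- A < Re \<sigma>" "Re \<sigma> < B" for \<sigma> i
  proof (rule Bochner_Integration.integrable_bound)
    show "integrable lborel (\<lambda>v. fact i * 2 ^ i * C * exp (- min (Re \<sigma> + A) (B - Re \<sigma>) * \<bar>v\<bar>))"
      using that by (intro integrable_mult_right integrable_exp_neg_abs) auto
    show "AE v in lborel. norm (?e \<sigma> v * K i v) \<le> norm (fact i * 2 ^ i * C * exp (- min (Re \<sigma> + A) (B - Re \<sigma>) * \<bar>v\<bar>))"
      unfolding real_norm_def by (intro AE_I2 order_trans[OF eb abs_ge_self])
  qed measurable
  have rec: "(LINT v|lborel. ?e \<sigma> v * K (Suc i) v) = - (\<sigma> + of_nat i) * (LINT v|lborel. ?e \<sigma> v * K i v)"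
    if \<sigma>: "- A < Re \<sigma>" "Re \<sigma> < B" for \<sigma> i
  proof -
    let ?D = "\<lambda>v. (\<sigma> + of_nat i) * (?e \<sigma> v * K i v) + ?e \<sigma> v * K (Suc i) v"
    have lim0: "((\<lambda>v. ?e \<sigma> v * K i v) \<longlongrightarrow> 0) F" if "filterlim (\<lambda>v. \<bar>v\<bar>) at_top F" for F
    proof (rule Lim_null_comparison)
      let ?k = "min (Re \<sigma> + A) (B - Re \<sigma>)"
      have k: "?k > 0" using \<sigma> by auto
      show "\<forall>\<^sub>F v in F. norm (?e \<sigma> v * K i v) \<le> fact i * 2 ^ i * C * exp (- ?k * \<bar>v\<bar>)"
        using eb by (intro always_eventually allI)
      have "((\<lambda>v. exp (- ?k * \<bar>v\<bar>)) \<longlongrightarrow> 0) F"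
        by (rule filterlim_compose[OF exp_at_bot], rule filterlim_tendsto_neg_mult_at_bot[OF tendsto_const _ that]) (use k in simp)
      then show "((\<lambda>v. fact i * 2 ^ i * C * exp (- ?k * \<bar>v\<bar>)) \<longlongrightarrow> 0) F"
        by (rule tendsto_mult_right_zero)
    qed
    have "(LBINT v=-\<infinity>..\<infinity>. ?D v) = 0 - 0"
    proof (rule interval_integral_FTC_integrable)
      show "((\<lambda>v. ?e \<sigma> v * K i v) has_vector_derivative ?D v) (at v)" for v
      proof -
        have "((\<lambda>w. exp (\<sigma> * w)) has_field_derivative (\<sigma> * exp (\<sigma> * of_real v))) (at (of_real v))"
          by (auto intro!: derivative_eq_intros)
        from has_field_derivative_at_within[OF this, of \<real>]
        have "((\<lambda>v. ?e \<sigma> v) has_vector_derivative (\<sigma> * ?e \<sigma> v)) (at v)"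
          using has_vector_derivative_real_field[OF \<open>((\<lambda>w. exp (\<sigma> * w)) has_field_derivative (\<sigma> * exp (\<sigma> * of_real v))) (at (of_real v))\<close>] by simp
        from has_vector_derivative_mult[OF this Kd[of i v]] show ?thesis by (simp add: algebra_simps)
      qed
      have "continuous_on UNIV ?D" by (intro continuous_intros Kc)
      then show "isCont ?D v" for v by (simp add: continuous_on_eq_continuous_at)
      show "set_integrable lborel (einterval (- \<infinity>) \<infinity>) ?D"
        using int[OF \<sigma>] by (simp add: set_integrable_def)
      show "(((\<lambda>v. ?e \<sigma> v * K i v) \<circ> real_of_ereal) \<longlongrightarrow> 0) (at_right (- \<infinity>))"
        unfolding ereal_tendsto_simps by (rule lim0, unfold filterlim_at_top eventually_at_bot_linorder, intro allI, rule_tac x = "- Z" in exI) auto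
      show "(((\<lambda>v. ?e \<sigma> v * K i v) \<circ> real_of_ereal) \<longlongrightarrow> 0) (at_left \<infinity>)"
        unfolding ereal_tendsto_simps by (rule lim0, unfold filterlim_at_top eventually_at_top_linorder, intro allI, rule_tac x = "Z" in exI) auto
    qed simp
    then have "(LINT v|lborel. ?D v) = 0"
      by (simp add: interval_lebesgue_integral_def set_lebesgue_integral_def)
    then have "(\<sigma> + of_nat i) * (LINT v|lborel. ?e \<sigma> v * K i v) + (LINT v|lborel. ?e \<sigma> v * K (Suc i) v) = 0"
      by (simp only: Bochner_Integration.integral_add int[OF \<sigma>] integrable_mult_right integral_mult_right_zero)
    then show ?thesis unfolding mult_minus_left by (subst eq_neg_iff_add_eq_0) (simp only: add.commute)
  qed
  have L: "(LINT v|lborel. ?e \<sigma> v * K i v) = (- 1) ^ i * pochhammer \<sigma> i * (LINT v|lborel. ?e \<sigma> v * K 0 v)"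
    if "- A < Re \<sigma>" "Re \<sigma> < B" for \<sigma> i
  proof (induction i)
    case (Suc i)
    show ?case unfolding rec[OF that] Suc.IH pochhammer_Suc power_Suc by (simp only: mult_ac mult_minus_left mult_minus_right mult_1_left)
  qed simp
  \<comment> \<open>Transform the Euler equation term by term; \<open>rec\<close> is integration by parts on the line.\<close>
  have E0: "euler_mult x N \<sigma> * (LINT v|lborel. ?e \<sigma> v * K 0 v) = 0" if \<sigma>: "- A < Re \<sigma>" "Re \<sigma> < B" for \<sigma>
  proof -
    let ?c = "\<lambda>i. (- of_real x) ^ i / (fact i * fact (N + i - 1)) :: complex"
    let ?k = "min (Re \<sigma> + A) (B - Re \<sigma>)"
    have Q: "(\<lambda>i. ?c i * K i v) sums 0" for v
      using moebius_tr_euler_series[OF m N exp_gt_zero[of v], of x] S[of "exp v / (1 + exp v)"]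
      unfolding K_def by (simp add: add_pos_pos)
    have nb: "norm (?c i * (?e \<sigma> v * K i v)) \<le> C * ((2 * x) ^ i / fact (N + i - 1)) * exp (- ?k * \<bar>v\<bar>)" for i v
    proof -
      have "norm (?c i * (?e \<sigma> v * K i v)) = x ^ i / (fact i * fact (N + i - 1)) * norm (?e \<sigma> v * K i v)"
        using x by (simp add: norm_mult norm_divide norm_power)
      also have "\<dots> \<le> x ^ i / (fact i * fact (N + i - 1)) * (fact i * 2 ^ i * C * exp (- ?k * \<bar>v\<bar>))"
        using x eb[of \<sigma> v i] by (intro mult_left_mono) auto
      also have "\<dots> = C * ((2 * x) ^ i / fact (N + i - 1)) * exp (- ?k * \<bar>v\<bar>)"
        by (simp add: power_mult_distrib)
      finally show ?thesis .
    qed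
    have sf: "summable (\<lambda>i. (2 * x) ^ i / fact (N + i - 1))"
    proof (rule summable_comparison_test')
      show "summable (\<lambda>i. (2 * x) ^ i /\<^sub>R fact i)" using exp_converges by (rule sums_summable)
      fix i :: nat
      have "(fact i :: real) \<le> fact (N + i - 1)" using N by (intro fact_mono) auto
      then show "norm ((2 * x) ^ i / fact (N + i - 1)) \<le> (2 * x) ^ i /\<^sub>R fact i"
        using x by (simp add: field_simps)
    qed
    have I: "integrable lborel (\<lambda>v. ?c i * (?e \<sigma> v * K i v))" for i using int[OF \<sigma>] by simp
    have ek: "integrable lborel (\<lambda>v. exp (- ?k * \<bar>v\<bar>))" using \<sigma> by (intro integrable_exp_neg_abs) auto
    have P1: "(\<lambda>i. LINT v|lborel. ?c i * (?e \<sigma> v * K i v)) sums (LINT v|lborel. (\<Sum>i. ?c i * (?e \<sigma> v * K i v)))"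
    proof (rule sums_integral[OF I])
      show "AE v in lborel. summable (\<lambda>i. norm (?c i * (?e \<sigma> v * K i v)))"
      proof (rule AE_I2)
        fix v :: real
        show "summable (\<lambda>i. norm (?c i * (?e \<sigma> v * K i v)))"
        proof (rule summable_comparison_test')
          show "summable (\<lambda>i. C * ((2 * x) ^ i / fact (N + i - 1)) * exp (- ?k * \<bar>v\<bar>))"
            by (intro summable_mult2 summable_mult sf)
          show "norm (norm (?c i * (?e \<sigma> v * K i v))) \<le> C * ((2 * x) ^ i / fact (N + i - 1)) * exp (- ?k * \<bar>v\<bar>)" for i
            using nb[of i v] by simp
        qed
      qed
      show "summable (\<lambda>i. LINT v|lborel. norm (?c i * (?e \<sigma> v * K i v)))"
      proof (rule summable_comparison_test')
        show "summable (\<lambda>i. C * ((2 * x) ^ i / fact (N + i - 1)) * (LINT v|lborel. exp (- ?k * \<bar>v\<bar>)))"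
          by (intro summable_mult2 summable_mult sf)
        fix i
        have "(LINT v|lborel. norm (?c i * (?e \<sigma> v * K i v))) \<le> (LINT v|lborel. C * ((2 * x) ^ i / fact (N + i - 1)) * exp (- ?k * \<bar>v\<bar>))"
          by (rule integral_mono) (use I ek nb in \<open>auto simp del: times_divide_eq_right\<close>)
        also have "\<dots> = C * ((2 * x) ^ i / fact (N + i - 1)) * (LINT v|lborel. exp (- ?k * \<bar>v\<bar>))"
          by (rule integral_mult_right_zero)
        finally show "norm (LINT v|lborel. norm (?c i * (?e \<sigma> v * K i v))) \<le> C * ((2 * x) ^ i / fact (N + i - 1)) * (LINT v|lborel. exp (- ?k * \<bar>v\<bar>))"
          by simp
      qed
    qed
    have P2: "(\<Sum>i. ?c i * (?e \<sigma> v * K i v)) = 0" for v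
    proof -
      have "(\<lambda>i. ?e \<sigma> v * (?c i * K i v)) sums (?e \<sigma> v * 0)" by (rule sums_mult[OF Q])
      moreover have "(\<lambda>i. ?e \<sigma> v * (?c i * K i v)) = (\<lambda>i. ?c i * (?e \<sigma> v * K i v))" by (simp add: fun_eq_iff)
      ultimately show ?thesis by (simp add: sums_iff)
    qed
    have P3: "(LINT v|lborel. ?c i * (?e \<sigma> v * K i v)) = of_real (x ^ i / (fact i * fact (N + i - 1))) * pochhammer \<sigma> i * (LINT v|lborel. ?e \<sigma> v * K 0 v)" for i
    proof -
      have "(- complex_of_real x) ^ i * (- 1) ^ i = of_real (x ^ i)"
        unfolding power_mult_distrib[symmetric] by simp
      moreover have "a / d * (e * b * c) = (a * e) / d * b * c" for a b c d e :: complex by simp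
      ultimately show ?thesis unfolding integral_mult_right_zero L[OF \<sigma>, of i] by (simp only: of_real_divide of_real_mult of_real_fact)
    qed
    have Q1: "(\<lambda>i. of_real (x ^ i / (fact i * fact (N + i - 1))) * pochhammer \<sigma> i * (LINT v|lborel. ?e \<sigma> v * K 0 v)) sums 0"
      using P1 unfolding P2 P3 by (simp only: Bochner_Integration.integral_zero)
    have Q2: "(\<lambda>i. of_real (x ^ i / (fact i * fact (N + i - 1))) * pochhammer \<sigma> i * (LINT v|lborel. ?e \<sigma> v * K 0 v)) sums (euler_mult x N \<sigma> * (LINT v|lborel. ?e \<sigma> v * K 0 v))"
      by (rule sums_mult2[OF euler_mult_sums[OF x N]])
    show ?thesis by (rule sums_unique2[OF Q2 Q1])
  qed
  \<comment> \<open>Any point of the strip would do.\<close>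
  define s0 where "s0 = (B - A) / 2"
  have s0: "- A < s0" "s0 < B" using AB by (auto simp: s0_def)
  have "AE v in lborel. ?e (of_real s0) v * K 0 v = 0"
  proof (rule fourier_unique)
    show "integrable lborel (\<lambda>v. ?e (of_real s0) v * K 0 v)" using int[of "of_real s0" 0] s0 by simp
    let ?Z = "{\<xi>::real. euler_mult x N (of_real s0 + \<i> * of_real \<xi>) = 0}"
    have "countable ((\<lambda>\<xi>. complex_of_real s0 + \<i> * of_real \<xi>) ` ?Z)"
      by (rule countable_subset[OF _ euler_mult_zeros[OF x N]]) auto
    then have "countable ?Z" by (rule countable_image_inj_on) (simp add: inj_on_def)
    then have "AE \<xi> in lborel. \<xi> \<notin> ?Z"
      by (intro AE_not_in countable_imp_null_set_lborel)
    then show "AE \<xi> in lborel. (LINT v|lborel. ?e (of_real s0) v * K 0 v * exp (\<i> * of_real (\<xi> \<bullet> v))) = 0"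
    proof eventually_elim
      case (elim \<xi>)
      have "(LINT v|lborel. ?e (of_real s0) v * K 0 v * exp (\<i> * of_real (\<xi> \<bullet> v))) = (LINT v|lborel. ?e (of_real s0 + \<i> * of_real \<xi>) v * K 0 v)"
      proof (intro Bochner_Integration.integral_cong refl)
        fix v :: real
        have "?e (of_real s0) v * exp (\<i> * of_real (\<xi> \<bullet> v)) = ?e (of_real s0 + \<i> * of_real \<xi>) v"
          unfolding mult_exp_exp by (simp add: algebra_simps)
        then show "?e (of_real s0) v * K 0 v * exp (\<i> * of_real (\<xi> \<bullet> v)) = ?e (of_real s0 + \<i> * of_real \<xi>) v * K 0 v"
          by (metis mult.assoc mult.commute)
      qed
      then show ?case using E0[of "of_real s0 + \<i> * of_real \<xi>"] elim s0 by simp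
    qed
  qed
  then have h0: "?e (of_real s0) v * K 0 v = 0" for v
    by (rule continuous_AE_zero) (intro continuous_intros Kc)
  have G0: "?G (of_real y) = 0" if "y > 0" for y
    using h0[of "ln y"] that by (simp add: K_def)
  have m0: "m (of_real t) = 0" if "0 < t" "t < 1" for t
  proof -
    have y: "t / (1 - t) > 0" using that by simp
    have "complex_of_real (t / (1 - t)) / (1 + of_real (t / (1 - t))) = of_real t"
      using that by (simp add: divide_simps complex_eq_iff)
    moreover have "1 + complex_of_real (t / (1 - t)) \<noteq> 0"
      using y by (metis add_pos_pos less_irrefl of_real_1 of_real_add of_real_eq_0_iff zero_less_one)
    ultimately show ?thesis using G0[OF y] by (simp add: moebius_tr_def)
  qed
  show "m \<tau> = 0"
  proof (rule analytic_continuation[OF m _ _ _ _ _ _ ])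
    show "open {\<tau>. Re \<tau> < 1}" by simp
    show "connected {\<tau>. Re \<tau> < 1}" by (intro convex_connected convex_halfspace_Re_lt)
    show "of_real ` {0<..<1} \<subseteq> {\<tau>. Re \<tau> < 1}" by auto
    show "(1/2 :: complex) \<in> {\<tau>. Re \<tau> < 1}" by simp
    show "(1/2 :: complex) islimpt of_real ` {0<..<1}"
      unfolding islimpt_approachable
    proof (intro allI impI)
      fix e :: real assume e: "e > 0"
      let ?t = "1/2 + min e (1/2) / 2"
      show "\<exists>x'\<in>complex_of_real ` {0<..<1}. x' \<noteq> 1/2 \<and> dist x' (1/2) < e"
      proof (rule bexI[of _ "of_real ?t"])
        have "complex_of_real ?t - 1/2 = of_real (min e (1/2) / 2)" by simp
        then have "dist (complex_of_real ?t) (1/2) = \<bar>min e (1/2) / 2\<bar>" unfolding dist_norm by (simp only: norm_of_real)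
        moreover have "0 < min e (1/2) / 2" "min e (1/2) / 2 < e" using e by auto
        ultimately show "complex_of_real ?t \<noteq> 1/2 \<and> dist (complex_of_real ?t) (1/2) < e"
          by (metis abs_of_pos dist_self less_irrefl)
        show "complex_of_real ?t \<in> complex_of_real ` {0<..<1}" using e by (intro imageI) auto
      qed
    qed
    show "m z = 0" if "z \<in> of_real ` {0<..<1}" for z using that m0 by auto
    show "\<tau> \<in> {\<tau>. Re \<tau> < 1}" using \<tau> by simp
  qed
qed

text \<open>Termwise integration when the coefficients decay so fast that the series is dominated by an
exponential of type \<open>\<epsilon>\<close>; it is applied with a small \<open>\<epsilon>\<close>.\<close>

lemma integral_power_series:
  fixes H a :: "'a \<Rightarrow> complex" and c :: "nat \<Rightarrow> complex"
  assumes [measurable]: "H \<in> borel_measurable M" "a \<in> borel_measurable M"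
    and int: "integrable M (\<lambda>x. norm (H x) * exp (\<epsilon> * norm (a x)))" and \<epsilon>: "\<epsilon> > 0"
    and c: "\<And>h. norm (c h) \<le> B * (\<epsilon> ^ h / fact h)"
    and g: "\<And>w. (\<lambda>h. c h * w ^ h) sums g w"
  shows "(\<lambda>h. c h * (LINT x|M. H x * a x ^ h)) sums (LINT x|M. H x * g (a x))"
    and "integrable M (\<lambda>x. H x * g (a x))"
proof -
  have B: "B \<ge> 0" using order_trans[OF norm_ge_zero c[of 0]] by simp
  have bd: "norm (\<Sum>h<k. H x * (c h * a x ^ h)) \<le> B * (norm (H x) * exp (\<epsilon> * norm (a x)))" for k x
  proof -
    have "norm (\<Sum>h<k. H x * (c h * a x ^ h)) \<le> (\<Sum>h<k. norm (H x) * (B * ((\<epsilon> * norm (a x)) ^ h / fact h)))"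
    proof (rule sum_norm_le)
      fix h
      have "norm (c h) * norm (a x) ^ h \<le> B * (\<epsilon> ^ h / fact h) * norm (a x) ^ h"
        by (intro mult_right_mono c) simp
      then show "norm (H x * (c h * a x ^ h)) \<le> norm (H x) * (B * ((\<epsilon> * norm (a x)) ^ h / fact h))"
        unfolding norm_mult norm_power by (intro mult_left_mono) (simp_all add: power_mult_distrib)
    qed
    also have "\<dots> = norm (H x) * (B * (\<Sum>h<k. (\<epsilon> * norm (a x)) ^ h /\<^sub>R fact h))"
      by (simp add: sum_distrib_left divide_inverse mult_ac)
    also have "\<dots> \<le> norm (H x) * (B * exp (\<epsilon> * norm (a x)))"
      unfolding exp_def using B \<epsilon> by (intro mult_left_mono sum_le_suminf summable_exp_generic) auto
    finally show ?thesis by (simp add: mult_ac)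
  qed
  have Hg: "(\<lambda>h. H x * (c h * a x ^ h)) sums (H x * g (a x))" for x
    by (intro sums_mult g)
  have gm: "(\<lambda>x. H x * g (a x)) \<in> borel_measurable M"
    by (rule borel_measurable_LIMSEQ_metric[where f = "\<lambda>k x. \<Sum>h<k. H x * (c h * a x ^ h)"])
      (use Hg in \<open>auto simp: sums_def\<close>)
  have I: "integrable M (\<lambda>x. H x * (c h * a x ^ h))" for h
  proof (rule Bochner_Integration.integrable_bound)
    show "integrable M (\<lambda>x. norm (c h) * (fact h / \<epsilon> ^ h) * (norm (H x) * exp (\<epsilon> * norm (a x))))" using int by simp
    have "norm (H x * (c h * a x ^ h)) \<le> norm (c h) * (fact h / \<epsilon> ^ h) * (norm (H x) * exp (\<epsilon> * norm (a x)))" for x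
    proof -
      have "norm (H x) * norm (c h) * norm (a x) ^ h \<le> norm (H x) * norm (c h) * (fact h / \<epsilon> ^ h * exp (\<epsilon> * norm (a x)))"
        using \<epsilon> by (intro mult_left_mono power_le_fact_exp) auto
      then show ?thesis by (simp only: norm_mult norm_power mult_ac)
    qed
    then show "AE x in M. norm (H x * (c h * a x ^ h)) \<le> norm (norm (c h) * (fact h / \<epsilon> ^ h) * (norm (H x) * exp (\<epsilon> * norm (a x))))"
      unfolding real_norm_def by (intro AE_I2 order_trans[OF _ abs_ge_self])
  qed measurable
  have dom: "integrable M (\<lambda>x. B * (norm (H x) * exp (\<epsilon> * norm (a x))))" using int by simp
  have lim: "AE x in M. (\<lambda>k. \<Sum>h<k. H x * (c h * a x ^ h)) \<longlonglongrightarrow> H x * g (a x)"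
    using Hg by (simp add: sums_def)
  have sm: "(\<lambda>x. \<Sum>h<k. H x * (c h * a x ^ h)) \<in> borel_measurable M" for k by measurable
  show "integrable M (\<lambda>x. H x * g (a x))"
    by (rule integrable_dominated_convergence[OF gm sm dom lim]) (use bd in auto)
  have "(\<lambda>k. LINT x|M. (\<Sum>h<k. H x * (c h * a x ^ h))) \<longlonglongrightarrow> (LINT x|M. H x * g (a x))"
    by (rule integral_dominated_convergence[OF gm sm dom lim]) (use bd in auto)
  moreover have "(LINT x|M. (\<Sum>h<k. H x * (c h * a x ^ h))) = (\<Sum>h<k. c h * (LINT x|M. H x * a x ^ h))" for k
    unfolding Bochner_Integration.integral_sum[OF I]
    by (intro sum.cong refl) (simp only: mult.left_commute[of "H _"] integral_mult_right_zero)
  ultimately show "(\<lambda>h. c h * (LINT x|M. H x * a x ^ h)) sums (LINT x|M. H x * g (a x))" by (simp add: sums_def)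
qed

section \<open>Lifting the kernel relation\<close>

text \<open>Here \<open>f0\<close> stands for \<open>f e^(-|u|^2/4)\<close>, so \<open>weighted_Lp\<close> is the integrability hypothesis on \<open>f\<close>, and
\<open>\<alpha>\<close>, \<open>\<beta>\<close>, \<open>s\<close>, \<open>t\<close> describe the harmonic \<open>(\<alpha>\<cdot>w)^s (\<beta>\<cdot>cnj w)^t\<close>, for which \<open>orth\<close> is the harmonicity when
\<open>s\<close> and \<open>t\<close> are positive.\<close>

locale twisted_transform =
  fixes f0 :: "complex ^ 'n \<Rightarrow> complex" and \<alpha> \<beta> :: "complex ^ 'n" and s t :: nat and p :: real
  assumes f0_measurable [measurable]: "f0 \<in> borel_measurable borel"
    and p_ge_1: "1 \<le> p"
    and weighted_Lp: "integrable lborel (\<lambda>u. (norm (f0 u) * exp ((norm u)\<^sup>2 / 2)) powr p)"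
    and orth: "bdot \<alpha> \<beta> = 0"
begin

text \<open>With \<open>g = f0 e^(|u|^2/2)\<close> the integrand is \<open>g\<close> times a Gaussian factor. Since \<open>g \<le> 1 + g^p\<close>, it suffices
that this factor is both integrable and bounded.\<close>

lemma integrable_f0_exp:
  assumes "a < 1"
  shows "integrable lborel (\<lambda>u. norm (f0 u) * exp (a * (norm u)\<^sup>2 / 2 + C * norm u))"
proof -
  let ?g = "\<lambda>u. norm (f0 u) * exp ((norm u)\<^sup>2 / 2)"
  let ?e = "\<lambda>u::complex^'n. exp (- ((1 - a) / 2) * (norm u)\<^sup>2 + C * norm u)"
  let ?B = "exp (C\<^sup>2 / (2 * (1 - a)))"
  have eb: "?e u \<le> ?B" for u
  proof -
    define d r where "d = 1 - a" and "r = norm u"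
    have "2 * d * (- (d / 2) * r\<^sup>2 + C * r) = C\<^sup>2 - (d * r - C)\<^sup>2"
      by (simp add: power2_eq_square algebra_simps)
    then have "2 * (1 - a) * (- ((1 - a) / 2) * (norm u)\<^sup>2 + C * norm u) \<le> C\<^sup>2"
      unfolding d_def r_def by simp
    then have "- ((1 - a) / 2) * (norm u)\<^sup>2 + C * norm u \<le> C\<^sup>2 / (2 * (1 - a))"
      using assms by (simp add: pos_le_divide_eq mult.commute)
    then show ?thesis by simp
  qed
  show ?thesis
  proof (rule Bochner_Integration.integrable_bound)
    show "integrable lborel (\<lambda>u. ?e u + ?B * (?g u powr p))"
      using assms weighted_Lp by (intro Bochner_Integration.integrable_add integrable_gaussian_exp integrable_mult_right) auto
    show "AE u in lborel. norm (norm (f0 u) * exp (a * (norm u)\<^sup>2 / 2 + C * norm u)) \<le> norm (?e u + ?B * (?g u powr p))"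
    proof (rule AE_I2)
      fix u
      have "norm (f0 u) * exp (a * (norm u)\<^sup>2 / 2 + C * norm u) = ?g u * ?e u"
        by (simp add: mult_exp_exp field_simps)
      moreover have "?g u * ?e u \<le> (1 + ?g u powr p) * ?e u"
      proof (rule mult_right_mono)
        show "?g u \<le> 1 + ?g u powr p"
        proof (cases "?g u \<le> 1")
          case False
          then have "?g u powr 1 \<le> ?g u powr p" using p_ge_1 by (intro powr_mono) auto
          then show ?thesis using False by simp
        qed (simp add: add_increasing2)
      qed simp
      moreover have "(1 + ?g u powr p) * ?e u \<le> ?e u + ?B * (?g u powr p)"
      proof -
        have "?g u powr p * ?e u \<le> ?g u powr p * ?B" by (intro mult_left_mono eb) simp
        then show ?thesis by (simp add: distrib_right mult.commute)
      qed
      ultimately have le: "norm (f0 u) * exp (a * (norm u)\<^sup>2 / 2 + C * norm u) \<le> ?e u + ?B * (?g u powr p)"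
        by linarith
      show "norm (norm (f0 u) * exp (a * (norm u)\<^sup>2 / 2 + C * norm u)) \<le> norm (?e u + ?B * (?g u powr p))"
        unfolding real_norm_def abs_mult abs_norm_cancel abs_exp_cancel by (rule order_trans[OF le abs_ge_self])
    qed
  qed measurable
qed

text \<open>The angles are averaged with total mass one, so that integrals over the product reduce to
integrals over \<open>u\<close> without constants.\<close>

definition Omega :: "((complex ^ 'n) \<times> real \<times> real) measure" where
  "Omega = lborel \<Otimes>\<^sub>M (circle_measure \<Otimes>\<^sub>M circle_measure)"

text \<open>The shifts by \<open>\<alpha>\<close> and \<open>\<beta>\<close> are chosen such that averaging an exponential of \<open>X\<cdot>x + \<Xi>\<cdot>y\<close> against \<open>e^(-is\<theta>) e^(-it\<phi>)\<close>
extracts the powers \<open>(X\<cdot>\<alpha>)^s\<close> and \<open>(\<Xi>\<cdot>\<beta>)^t\<close>.\<close>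

definition lift_x :: "(complex ^ 'n) \<times> real \<times> real \<Rightarrow> complex ^ 'n" where
  "lift_x \<omega> = vcnj (fst \<omega>) + cis (fst (snd \<omega>)) *s \<alpha>"

definition lift_y :: "(complex ^ 'n) \<times> real \<times> real \<Rightarrow> complex ^ 'n" where
  "lift_y \<omega> = fst \<omega> + cis (snd (snd \<omega>)) *s \<beta>"

text \<open>The exponential cancels the term \<open>e^(i\<phi>) \<beta>\<cdot>cnj u\<close> of \<open>\<tau> x\<cdot>y/2\<close> at \<open>\<tau> = 1\<close>. Without it the second power in
\<open>Omega_integral_term\<close> would involve \<open>\<tau> \<beta>\<cdot>cnj u\<close> instead of \<open>(1-\<tau>) \<beta>\<cdot>cnj u\<close> and not be a multiple of
\<open>\<beta>\<cdot>cnj(z - u)\<close>.\<close>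

definition lifted_f0 :: "(complex ^ 'n) \<times> real \<times> real \<Rightarrow> complex" where
  "lifted_f0 \<omega> = f0 (fst \<omega>) * exp (- (cis (snd (snd \<omega>)) * bdot \<beta> (vcnj (fst \<omega>)) / 2))
     * cis (- (real s * fst (snd \<omega>))) * cis (- (real t * snd (snd \<omega>)))"

abbreviation lift_xy :: "(complex ^ 'n) \<times> real \<times> real \<Rightarrow> complex" where
  "lift_xy \<omega> \<equiv> bdot (lift_x \<omega>) (lift_y \<omega>)"

lemma sets_Om [simp, measurable_cong]: "sets Omega = sets borel"
proof -
  have "sets Omega = sets ((borel :: (complex ^ 'n) measure) \<Otimes>\<^sub>M ((borel :: real measure) \<Otimes>\<^sub>M (borel :: real measure)))"
    unfolding Omega_def by (intro sets_pair_measure_cong) simp_all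
  then show ?thesis by (simp only: borel_prod)
qed

lemma space_Om [simp]: "space Omega = UNIV"
  by (simp add: Omega_def space_pair_measure)

lemma smult_measurable [measurable]:
  "(\<lambda>c. c *s (v :: complex ^ 'n)) \<in> borel_measurable borel"
  unfolding vector_scalar_mult_def by (intro borel_measurable_continuous_onI continuous_intros continuous_on_vec_lambda)

lemma cis_measurable [measurable]: "cis \<in> borel_measurable borel"
  by (intro borel_measurable_continuous_onI continuous_intros)

lemma fst_borel [measurable]: "fst \<in> borel_measurable (borel :: ((complex ^ 'n) \<times> real \<times> real) measure)"
  "(\<lambda>x. fst (snd x)) \<in> borel_measurable (borel :: ((complex ^ 'n) \<times> real \<times> real) measure)"
  "(\<lambda>x. snd (snd x)) \<in> borel_measurable (borel :: ((complex ^ 'n) \<times> real \<times> real) measure)"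
  by (intro borel_measurable_continuous_onI continuous_intros)+

lemma lift_x_measurable [measurable]: "lift_x \<in> borel_measurable borel"
proof -
  have "(\<lambda>\<omega> :: (complex ^ 'n) \<times> real \<times> real. cis (fst (snd \<omega>)) *s \<alpha>) \<in> borel_measurable borel"
    by (rule measurable_compose[OF measurable_compose[OF fst_borel(2) cis_measurable] smult_measurable])
  then show ?thesis unfolding lift_x_def[abs_def] by (intro borel_measurable_add borel_measurable_vcnj fst_borel(1))
qed

lemma lift_y_measurable [measurable]: "lift_y \<in> borel_measurable borel"
proof -
  have "(\<lambda>\<omega> :: (complex ^ 'n) \<times> real \<times> real. cis (snd (snd \<omega>)) *s \<beta>) \<in> borel_measurable borel"
    by (rule measurable_compose[OF measurable_compose[OF fst_borel(3) cis_measurable] smult_measurable])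
  then show ?thesis unfolding lift_y_def[abs_def] by (intro borel_measurable_add fst_borel(1))
qed

lemma lifted_f0_measurable [measurable]: "lifted_f0 \<in> borel_measurable borel"
proof -
  have "(\<lambda>\<omega> :: (complex ^ 'n) \<times> real \<times> real. f0 (fst \<omega>)) \<in> borel_measurable borel"
    by (rule measurable_compose[OF fst_borel(1) f0_measurable])
  moreover have "(\<lambda>\<omega> :: (complex ^ 'n) \<times> real \<times> real. exp (- (cis (snd (snd \<omega>)) * bdot \<beta> (vcnj (fst \<omega>)) / 2))
     * cis (- (real s * fst (snd \<omega>))) * cis (- (real t * snd (snd \<omega>)))) \<in> borel_measurable borel"
    by (intro borel_measurable_continuous_onI continuous_intros) auto
  ultimately show ?thesis unfolding lifted_f0_def[abs_def] mult.assoc by (rule borel_measurable_times)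
qed

definition \<kappa> :: real where "\<kappa> = norm \<alpha> + norm \<beta> + 1"

lemma \<kappa>_pos: "\<kappa> > 0" by (simp add: \<kappa>_def add_nonneg_pos)

lemma norm_bdot_xx: "norm (bdot \<eta> (lift_x \<omega>)) \<le> norm \<eta> * (norm (fst \<omega>) + \<kappa>)"
proof -
  have "norm (bdot \<eta> (lift_x \<omega>)) \<le> norm (bdot \<eta> (vcnj (fst \<omega>))) + norm (bdot \<eta> \<alpha>)"
    unfolding lift_x_def bdot_simps by (rule order_trans[OF norm_triangle_ineq]) (simp add: norm_mult)
  also have "\<dots> \<le> norm \<eta> * norm (fst \<omega>) + norm \<eta> * norm \<alpha>"
    using norm_bdot_le[of \<eta> "vcnj (fst \<omega>)"] norm_bdot_le[of \<eta> \<alpha>] by simp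
  also have "\<dots> \<le> norm \<eta> * (norm (fst \<omega>) + \<kappa>)"
    unfolding distrib_left[symmetric] \<kappa>_def by (intro mult_left_mono) auto
  finally show ?thesis .
qed

lemma norm_bdot_yy: "norm (bdot v (lift_y \<omega>)) \<le> norm v * (norm (fst \<omega>) + \<kappa>)"
proof -
  have "norm (bdot v (lift_y \<omega>)) \<le> norm (bdot v (fst \<omega>)) + norm (bdot v \<beta>)"
    unfolding lift_y_def bdot_simps by (rule order_trans[OF norm_triangle_ineq]) (simp add: norm_mult)
  also have "\<dots> \<le> norm v * norm (fst \<omega>) + norm v * norm \<beta>"
    using norm_bdot_le[of v "fst \<omega>"] norm_bdot_le[of v \<beta>] by simp
  also have "\<dots> \<le> norm v * (norm (fst \<omega>) + \<kappa>)"
    unfolding distrib_left[symmetric] \<kappa>_def by (intro mult_left_mono) auto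
  finally show ?thesis .
qed

text \<open>Orthogonality of \<open>\<alpha>\<close> and \<open>\<beta>\<close> removes the term in \<open>e^(i(\<theta>+\<phi>))\<close>; the angles stay decoupled.\<close>

lemma lift_xy_eq: "lift_xy \<omega> = of_real ((norm (fst \<omega>))\<^sup>2) + cis (fst (snd \<omega>)) * bdot \<alpha> (fst \<omega>) + cis (snd (snd \<omega>)) * bdot \<beta> (vcnj (fst \<omega>))"
  unfolding lift_x_def lift_y_def bdot_simps bdot_vcnj_self orth bdot_commute[of "vcnj (fst \<omega>)" \<beta>] by simp

lemma norm_xy_diff: "norm (lift_xy \<omega> - of_real ((norm (fst \<omega>))\<^sup>2)) \<le> \<kappa> * norm (fst \<omega>)"
proof -
  have "norm (lift_xy \<omega> - of_real ((norm (fst \<omega>))\<^sup>2)) \<le> norm (bdot \<alpha> (fst \<omega>)) + norm (bdot \<beta> (vcnj (fst \<omega>)))"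
  proof -
    have "lift_xy \<omega> - of_real ((norm (fst \<omega>))\<^sup>2) = cis (fst (snd \<omega>)) * bdot \<alpha> (fst \<omega>) + cis (snd (snd \<omega>)) * bdot \<beta> (vcnj (fst \<omega>))"
      by (simp only: lift_xy_eq) simp
    then show ?thesis using norm_triangle_ineq[of "cis (fst (snd \<omega>)) * bdot \<alpha> (fst \<omega>)" "cis (snd (snd \<omega>)) * bdot \<beta> (vcnj (fst \<omega>))"]
      by (simp add: norm_mult)
  qed
  also have "\<dots> \<le> norm \<alpha> * norm (fst \<omega>) + norm \<beta> * norm (fst \<omega>)"
    using norm_bdot_le[of \<alpha> "fst \<omega>"] norm_bdot_le[of \<beta> "vcnj (fst \<omega>)"] by simp
  also have "\<dots> \<le> \<kappa> * norm (fst \<omega>)"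
    unfolding distrib_right[symmetric] \<kappa>_def by (intro mult_right_mono) auto
  finally show ?thesis .
qed

lemma norm_xy: "norm (lift_xy \<omega>) \<le> (norm (fst \<omega>))\<^sup>2 + \<kappa> * norm (fst \<omega>)"
proof -
  have "norm (lift_xy \<omega>) \<le> norm (lift_xy \<omega> - of_real ((norm (fst \<omega>))\<^sup>2)) + norm (complex_of_real ((norm (fst \<omega>))\<^sup>2))"
    using norm_triangle_ineq[of "lift_xy \<omega> - of_real ((norm (fst \<omega>))\<^sup>2)" "of_real ((norm (fst \<omega>))\<^sup>2)"] by simp
  then show ?thesis using norm_xy_diff[of \<omega>] by (simp add: norm_power)
qed

lemma Re_mult_xy: "Re (\<tau> * lift_xy \<omega>) \<le> Re \<tau> * (norm (fst \<omega>))\<^sup>2 + norm \<tau> * \<kappa> * norm (fst \<omega>)"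
proof -
  have "Re (\<tau> * lift_xy \<omega>) = Re \<tau> * (norm (fst \<omega>))\<^sup>2 + Re (\<tau> * (lift_xy \<omega> - of_real ((norm (fst \<omega>))\<^sup>2)))"
    by (simp add: algebra_simps)
  also have "Re (\<tau> * (lift_xy \<omega> - of_real ((norm (fst \<omega>))\<^sup>2))) \<le> norm \<tau> * (\<kappa> * norm (fst \<omega>))"
    using complex_Re_le_cmod[of "\<tau> * (lift_xy \<omega> - of_real ((norm (fst \<omega>))\<^sup>2))"] mult_left_mono[OF norm_xy_diff[of \<omega>] norm_ge_zero[of \<tau>]]
    unfolding norm_mult by linarith
  finally show ?thesis by simp
qed

lemma norm_hh: "norm (lifted_f0 \<omega>) \<le> norm (f0 (fst \<omega>)) * exp (\<kappa> * norm (fst \<omega>))"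
proof -
  have "norm (cis (snd (snd \<omega>)) * bdot \<beta> (vcnj (fst \<omega>)) / 2) \<le> norm \<beta> * norm (fst \<omega>) / 2"
    using norm_bdot_le[of \<beta> "vcnj (fst \<omega>)"] by (simp add: norm_mult)
  also have "\<dots> \<le> norm \<beta> * norm (fst \<omega>)" by simp
  also have "\<dots> \<le> \<kappa> * norm (fst \<omega>)" unfolding \<kappa>_def by (intro mult_right_mono) auto
  finally have "norm (- (cis (snd (snd \<omega>)) * bdot \<beta> (vcnj (fst \<omega>)) / 2)) \<le> \<kappa> * norm (fst \<omega>)" by simp
  then have "norm (exp (- (cis (snd (snd \<omega>)) * bdot \<beta> (vcnj (fst \<omega>)) / 2))) \<le> exp (\<kappa> * norm (fst \<omega>))"
    using norm_exp_le by (meson exp_le_cancel_iff order_trans)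
  then show ?thesis unfolding lifted_f0_def norm_mult by (simp add: mult_left_mono)
qed

lemma Omega_integrable:
  fixes \<phi> :: "(complex ^ 'n) \<times> real \<times> real \<Rightarrow> 'b::{banach, second_countable_topology}"
  assumes m: "\<phi> \<in> borel_measurable borel" and a: "a < 1"
    and b: "\<And>\<omega>. norm (\<phi> \<omega>) \<le> K * (norm (f0 (fst \<omega>)) * exp (a * (norm (fst \<omega>))\<^sup>2 / 2 + C * norm (fst \<omega>)))"
  shows "integrable Omega \<phi>"
proof -
  interpret C: prob_space circle_measure by (rule prob_space_circle_measure)
  interpret CC: pair_prob_space circle_measure circle_measure ..
  interpret O: pair_sigma_finite lborel "circle_measure \<Otimes>\<^sub>M circle_measure" ..
  let ?D = "\<lambda>u. K * (norm (f0 u) * exp (a * (norm u)\<^sup>2 / 2 + C * norm u))"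
  have Dm: "?D \<in> borel_measurable borel" by measurable
  have D: "integrable lborel ?D" using integrable_f0_exp[OF a] by simp
  have "integrable Omega (\<lambda>\<omega>. ?D (fst \<omega>))"
    unfolding Omega_def
  proof (rule O.Fubini_integrable)
    show "(\<lambda>\<omega>. ?D (fst \<omega>)) \<in> borel_measurable (lborel \<Otimes>\<^sub>M (circle_measure \<Otimes>\<^sub>M circle_measure))"
      by (rule measurable_compose[OF measurable_fst]) (use Dm in simp)
    show "integrable lborel (\<lambda>x. \<integral>y. norm (?D (fst (x, y))) \<partial>(circle_measure \<Otimes>\<^sub>M circle_measure))"
      using integrable_norm[OF D] by (simp add: CC.prob_space)
  qed simp
  then show ?thesis
  proof (rule Bochner_Integration.integrable_bound)
    show "\<phi> \<in> borel_measurable Omega" using m by (simp cong: measurable_cong_sets)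
    show "AE \<omega> in Omega. norm (\<phi> \<omega>) \<le> norm (?D (fst \<omega>))"
      unfolding real_norm_def by (intro AE_I2 order_trans[OF b abs_ge_self])
  qed
qed

lemma circle_pair_integral:
  fixes g h :: "real \<Rightarrow> complex"
  assumes "continuous_on UNIV g" "continuous_on UNIV h" "\<And>x. norm (g x) \<le> B" "\<And>x. norm (h x) \<le> B'"
  shows "(LINT q|(circle_measure \<Otimes>\<^sub>M circle_measure). g (fst q) * h (snd q)) = (LINT x|circle_measure. g x) * (LINT x|circle_measure. h x)"
proof -
  interpret C: prob_space circle_measure by (rule prob_space_circle_measure)
  interpret CC: pair_prob_space circle_measure circle_measure ..
  have m: "g \<in> borel_measurable borel" "h \<in> borel_measurable borel"
    using assms by (auto intro: borel_measurable_continuous_onI)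
  have I: "integrable (circle_measure \<Otimes>\<^sub>M circle_measure) (\<lambda>q. g (fst q) * h (snd q))"
  proof (rule CC.integrable_const_bound)
    show "AE q in circle_measure \<Otimes>\<^sub>M circle_measure. norm (g (fst q) * h (snd q)) \<le> B * B'"
      using assms(3,4) order_trans[OF norm_ge_zero assms(3)] by (auto simp: norm_mult intro!: AE_I2 mult_mono)
    show "(\<lambda>q. g (fst q) * h (snd q)) \<in> borel_measurable (circle_measure \<Otimes>\<^sub>M circle_measure)"
      by (intro borel_measurable_times measurable_compose[OF measurable_fst] measurable_compose[OF measurable_snd])
        (use m in simp_all)
  qed
  have "(LINT q|(circle_measure \<Otimes>\<^sub>M circle_measure). g (fst q) * h (snd q)) = (LINT x|circle_measure. (LINT y|circle_measure. g x * h y))"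
    using CC.integral_fst'[OF I] by simp
  then show ?thesis by simp
qed

text \<open>The master estimate: since \<open>x\<cdot>y\<close> differs from \<open>|u|^2\<close> by a multiple of \<open>|u|\<close>, everything is dominated by \<open>f0\<close>
times a Gaussian of parameter \<open>Re \<tau> + \<rho> < 1\<close>.\<close>

lemma Omega_exp_integrable:
  assumes \<tau>: "Re \<tau> + \<rho> < 1" and \<rho>: "0 \<le> \<rho>"
  shows "integrable Omega (\<lambda>\<omega>. norm (lifted_f0 \<omega>) * norm (exp (\<tau> * (lift_xy \<omega> / 2) + bdot X (lift_x \<omega>) + bdot \<Xi> (lift_y \<omega>)))
     * exp (\<rho> * norm (lift_xy \<omega> / 2) + norm (bdot \<eta> (lift_x \<omega>)) + norm (bdot v (lift_y \<omega>))))"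
proof -
  define W where "W = norm X + norm \<Xi> + norm \<eta> + norm v"
  define C where "C = \<kappa> + norm \<tau> * \<kappa> / 2 + \<rho> * \<kappa> / 2 + W"
  show ?thesis
  proof (rule Omega_integrable[OF _ \<tau>, where C = C and K = "exp (W * \<kappa>)"])
    show "(\<lambda>\<omega>. norm (lifted_f0 \<omega>) * norm (exp (\<tau> * (lift_xy \<omega> / 2) + bdot X (lift_x \<omega>) + bdot \<Xi> (lift_y \<omega>)))
     * exp (\<rho> * norm (lift_xy \<omega> / 2) + norm (bdot \<eta> (lift_x \<omega>)) + norm (bdot v (lift_y \<omega>)))) \<in> borel_measurable borel"
      by measurable
    fix \<omega> :: "(complex ^ 'n) \<times> real \<times> real"
    let ?u = "norm (fst \<omega>)"
    have 1: "Re (\<tau> * (lift_xy \<omega> / 2)) \<le> (Re \<tau> * ?u\<^sup>2 + norm \<tau> * \<kappa> * ?u) / 2"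
      using Re_mult_xy[of \<tau> \<omega>] by simp
    have 2: "\<rho> * norm (lift_xy \<omega> / 2) \<le> \<rho> * ((?u\<^sup>2 + \<kappa> * ?u) / 2)"
      using norm_xy[of \<omega>] \<rho> by (intro mult_left_mono) (auto simp: norm_divide)
    have 3: "Re (bdot X (lift_x \<omega>)) \<le> norm X * (?u + \<kappa>)" "Re (bdot \<Xi> (lift_y \<omega>)) \<le> norm \<Xi> * (?u + \<kappa>)"
      using order_trans[OF complex_Re_le_cmod norm_bdot_xx] order_trans[OF complex_Re_le_cmod norm_bdot_yy] by auto
    have 4: "norm (bdot \<eta> (lift_x \<omega>)) \<le> norm \<eta> * (?u + \<kappa>)" "norm (bdot v (lift_y \<omega>)) \<le> norm v * (?u + \<kappa>)"
      by (rule norm_bdot_xx norm_bdot_yy)+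
    have "Re (\<tau> * (lift_xy \<omega> / 2)) + Re (bdot X (lift_x \<omega>)) + Re (bdot \<Xi> (lift_y \<omega>)) + (\<rho> * norm (lift_xy \<omega> / 2) + norm (bdot \<eta> (lift_x \<omega>)) + norm (bdot v (lift_y \<omega>))) + \<kappa> * ?u
      \<le> (Re \<tau> * ?u\<^sup>2 + norm \<tau> * \<kappa> * ?u) / 2 + norm X * (?u + \<kappa>) + norm \<Xi> * (?u + \<kappa>) + (\<rho> * ((?u\<^sup>2 + \<kappa> * ?u) / 2) + norm \<eta> * (?u + \<kappa>) + norm v * (?u + \<kappa>)) + \<kappa> * ?u"
      by (intro add_mono 1 2 3 4 order_refl)
    also have "\<dots> = W * \<kappa> + ((Re \<tau> + \<rho>) * ?u\<^sup>2 / 2 + C * ?u)"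
      unfolding C_def W_def by (simp add: field_simps)
    finally have E: "exp (Re (\<tau> * (lift_xy \<omega> / 2)) + Re (bdot X (lift_x \<omega>)) + Re (bdot \<Xi> (lift_y \<omega>)) + (\<rho> * norm (lift_xy \<omega> / 2) + norm (bdot \<eta> (lift_x \<omega>)) + norm (bdot v (lift_y \<omega>))) + \<kappa> * ?u)
       \<le> exp (W * \<kappa> + ((Re \<tau> + \<rho>) * ?u\<^sup>2 / 2 + C * ?u))"
      by simp
    have "norm (lifted_f0 \<omega>) * norm (exp (\<tau> * (lift_xy \<omega> / 2) + bdot X (lift_x \<omega>) + bdot \<Xi> (lift_y \<omega>))) * exp (\<rho> * norm (lift_xy \<omega> / 2) + norm (bdot \<eta> (lift_x \<omega>)) + norm (bdot v (lift_y \<omega>)))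
      \<le> (norm (f0 (fst \<omega>)) * exp (\<kappa> * ?u)) * norm (exp (\<tau> * (lift_xy \<omega> / 2) + bdot X (lift_x \<omega>) + bdot \<Xi> (lift_y \<omega>))) * exp (\<rho> * norm (lift_xy \<omega> / 2) + norm (bdot \<eta> (lift_x \<omega>)) + norm (bdot v (lift_y \<omega>)))"
      by (intro mult_right_mono norm_hh) auto
    also have "\<dots> = norm (f0 (fst \<omega>)) * exp (Re (\<tau> * (lift_xy \<omega> / 2)) + Re (bdot X (lift_x \<omega>)) + Re (bdot \<Xi> (lift_y \<omega>)) + (\<rho> * norm (lift_xy \<omega> / 2) + norm (bdot \<eta> (lift_x \<omega>)) + norm (bdot v (lift_y \<omega>))) + \<kappa> * ?u)"
      unfolding norm_exp_eq_Re plus_complex.sel by (simp only: exp_add mult_ac)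
    also have "\<dots> \<le> norm (f0 (fst \<omega>)) * exp (W * \<kappa> + ((Re \<tau> + \<rho>) * ?u\<^sup>2 / 2 + C * ?u))"
      by (intro mult_left_mono E) simp
    also have "\<dots> = exp (W * \<kappa>) * (norm (f0 (fst \<omega>)) * exp ((Re \<tau> + \<rho>) * ?u\<^sup>2 / 2 + C * ?u))"
      unfolding exp_add by (simp only: mult_ac)
    finally show "norm (norm (lifted_f0 \<omega>) * norm (exp (\<tau> * (lift_xy \<omega> / 2) + bdot X (lift_x \<omega>) + bdot \<Xi> (lift_y \<omega>))) * exp (\<rho> * norm (lift_xy \<omega> / 2) + norm (bdot \<eta> (lift_x \<omega>)) + norm (bdot v (lift_y \<omega>))))
       \<le> exp (W * \<kappa>) * (norm (f0 (fst \<omega>)) * exp ((Re \<tau> + \<rho>) * ?u\<^sup>2 / 2 + C * ?u))"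
      by (simp only: real_norm_def abs_mult abs_norm_cancel abs_exp_cancel)
  qed
qed

abbreviation lifted_term where
  "lifted_term \<eta> v a b \<omega> \<equiv> lifted_f0 \<omega> * bdot \<eta> (lift_x \<omega>) ^ a * bdot v (lift_y \<omega>) ^ b"

lemma lifted_term_dominated:
  assumes \<tau>: "Re \<tau> + \<rho> < 1" and \<rho>: "0 \<le> \<rho>"
  shows "integrable Omega (\<lambda>\<omega>. norm (lifted_term \<eta> v a b \<omega> * exp (\<tau> * (lift_xy \<omega> / 2) + bdot X (lift_x \<omega>) + bdot \<Xi> (lift_y \<omega>))) * exp (\<rho> * norm (lift_xy \<omega> / 2)))"
proof (rule Bochner_Integration.integrable_bound)
  let ?D = "\<lambda>\<omega>. norm (lifted_f0 \<omega>) * norm (exp (\<tau> * (lift_xy \<omega> / 2) + bdot X (lift_x \<omega>) + bdot \<Xi> (lift_y \<omega>)))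
     * exp (\<rho> * norm (lift_xy \<omega> / 2) + norm (bdot \<eta> (lift_x \<omega>)) + norm (bdot v (lift_y \<omega>)))"
  show "integrable Omega (\<lambda>\<omega>. (fact a * fact b) * ?D \<omega>)"
    by (intro integrable_mult_right Omega_exp_integrable[OF assms])
  have "norm (lifted_term \<eta> v a b \<omega> * exp (\<tau> * (lift_xy \<omega> / 2) + bdot X (lift_x \<omega>) + bdot \<Xi> (lift_y \<omega>))) * exp (\<rho> * norm (lift_xy \<omega> / 2)) \<le> (fact a * fact b) * ?D \<omega>" for \<omega>
  proof -
    have pa: "norm (bdot \<eta> (lift_x \<omega>)) ^ a \<le> fact a * exp (norm (bdot \<eta> (lift_x \<omega>)))"
      using power_le_fact_exp[of 1 "norm (bdot \<eta> (lift_x \<omega>))" a] by simp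
    have pb: "norm (bdot v (lift_y \<omega>)) ^ b \<le> fact b * exp (norm (bdot v (lift_y \<omega>)))"
      using power_le_fact_exp[of 1 "norm (bdot v (lift_y \<omega>))" b] by simp
    let ?E = "norm (exp (\<tau> * (lift_xy \<omega> / 2) + bdot X (lift_x \<omega>) + bdot \<Xi> (lift_y \<omega>)))"
    have "norm (lifted_f0 \<omega>) * norm (bdot \<eta> (lift_x \<omega>)) ^ a * norm (bdot v (lift_y \<omega>)) ^ b * ?E * exp (\<rho> * norm (lift_xy \<omega> / 2))
      \<le> norm (lifted_f0 \<omega>) * (fact a * exp (norm (bdot \<eta> (lift_x \<omega>)))) * (fact b * exp (norm (bdot v (lift_y \<omega>)))) * ?E * exp (\<rho> * norm (lift_xy \<omega> / 2))"
      by (intro mult_right_mono mult_mono mult_left_mono pa pb) auto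
    also have "\<dots> = (fact a * fact b) * ?D \<omega>"
      unfolding exp_add[of "\<rho> * norm (lift_xy \<omega> / 2) + norm (bdot \<eta> (lift_x \<omega>))"] exp_add[of "\<rho> * norm (lift_xy \<omega> / 2)"]
      by (simp only: mult_ac)
    finally show ?thesis by (simp only: norm_mult norm_power)
  qed
  then show "AE \<omega> in Omega. norm (norm (lifted_term \<eta> v a b \<omega> * exp (\<tau> * (lift_xy \<omega> / 2) + bdot X (lift_x \<omega>) + bdot \<Xi> (lift_y \<omega>))) * exp (\<rho> * norm (lift_xy \<omega> / 2))) \<le> norm ((fact a * fact b) * ?D \<omega>)"
    unfolding real_norm_def abs_mult[of "norm (lifted_term \<eta> v a b _ * _)"] abs_norm_cancel abs_exp_cancel
    by (intro AE_I2 order_trans[OF _ abs_ge_self])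
qed measurable

lemma lifted_term_integrable:
  assumes \<tau>: "Re \<tau> < 1"
  shows "integrable Omega (\<lambda>\<omega>. lifted_term \<eta> v a b \<omega> * exp (\<tau> * (lift_xy \<omega> / 2) + bdot X (lift_x \<omega>) + bdot \<Xi> (lift_y \<omega>)))"
proof -
  have "integrable Omega (\<lambda>\<omega>. norm (lifted_term \<eta> v a b \<omega> * exp (\<tau> * (lift_xy \<omega> / 2) + bdot X (lift_x \<omega>) + bdot \<Xi> (lift_y \<omega>))))"
    using lifted_term_dominated[of \<tau> 0 \<eta> a v b X \<Xi>] \<tau> by simp
  moreover have "(\<lambda>\<omega>. lifted_term \<eta> v a b \<omega> * exp (\<tau> * (lift_xy \<omega> / 2) + bdot X (lift_x \<omega>) + bdot \<Xi> (lift_y \<omega>))) \<in> borel_measurable Omega"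
    by measurable
  ultimately show ?thesis by (simp add: integrable_norm_iff)
qed

lemma circle_factor_bound:
  "norm (cis (- (real k * x)) * (A + cis x * B) ^ a * exp (D * cis x)) \<le> (norm A + norm B) ^ a * exp (norm D)"
proof -
  have "norm (A + cis x * B) \<le> norm A + norm B"
    by (rule order_trans[OF norm_triangle_ineq]) (simp add: norm_mult)
  moreover have "norm (exp (D * cis x)) \<le> exp (norm D)"
    using norm_exp_le[of "D * cis x"] by (simp add: norm_mult)
  ultimately show ?thesis unfolding norm_mult norm_power norm_cis mult_1_left
    by (intro mult_mono power_mono) auto
qed

text \<open>For fixed \<open>u\<close> the integrand is a product of a function of \<open>\<theta>\<close> and a function of \<open>\<phi>\<close>, whose circle averages
are known.\<close>

lemma Omega_integral_term:
  assumes \<tau>: "Re \<tau> < 1"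
  shows "(LINT \<omega>|Omega. lifted_term \<eta> v a b \<omega> * exp (\<tau> * (lift_xy \<omega> / 2) + bdot X (lift_x \<omega>) + bdot \<Xi> (lift_y \<omega>)))
    = (LINT u|lborel. f0 u * exp (\<tau> * of_real ((norm u)\<^sup>2) / 2 + bdot X (vcnj u) + bdot \<Xi> u)
        * circle_coeff s a (bdot \<eta> (vcnj u)) (bdot \<eta> \<alpha>) (bdot X \<alpha> + \<tau> / 2 * bdot \<alpha> u)
        * circle_coeff t b (bdot v u) (bdot v \<beta>) (bdot \<Xi> \<beta> - (1 - \<tau>) / 2 * bdot \<beta> (vcnj u)))"
proof -
  interpret C: prob_space circle_measure by (rule prob_space_circle_measure)
  interpret CC: pair_prob_space circle_measure circle_measure ..
  interpret O: pair_sigma_finite lborel "circle_measure \<Otimes>\<^sub>M circle_measure" ..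
  let ?F = "\<lambda>\<omega>. lifted_term \<eta> v a b \<omega> * exp (\<tau> * (lift_xy \<omega> / 2) + bdot X (lift_x \<omega>) + bdot \<Xi> (lift_y \<omega>))"
  have "(LINT \<omega>|Omega. ?F \<omega>) = (LINT u|lborel. (LINT q|(circle_measure \<Otimes>\<^sub>M circle_measure). ?F (u, q)))"
    using O.integral_fst'[OF lifted_term_integrable[OF \<tau>, unfolded Omega_def]] unfolding Omega_def by simp
  also have "\<dots> = (LINT u|lborel. f0 u * exp (\<tau> * of_real ((norm u)\<^sup>2) / 2 + bdot X (vcnj u) + bdot \<Xi> u)
        * circle_coeff s a (bdot \<eta> (vcnj u)) (bdot \<eta> \<alpha>) (bdot X \<alpha> + \<tau> / 2 * bdot \<alpha> u)
        * circle_coeff t b (bdot v u) (bdot v \<beta>) (bdot \<Xi> \<beta> - (1 - \<tau>) / 2 * bdot \<beta> (vcnj u)))"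
  proof (rule Bochner_Integration.integral_cong[OF refl])
    fix u
    let ?D1 = "bdot X \<alpha> + \<tau> / 2 * bdot \<alpha> u" and ?D2 = "bdot \<Xi> \<beta> - (1 - \<tau>) / 2 * bdot \<beta> (vcnj u)"
    let ?g = "\<lambda>x. cis (- (real s * x)) * (bdot \<eta> (vcnj u) + cis x * bdot \<eta> \<alpha>) ^ a * exp (?D1 * cis x)"
    let ?h = "\<lambda>x. cis (- (real t * x)) * (bdot v u + cis x * bdot v \<beta>) ^ b * exp (?D2 * cis x)"
    let ?c = "f0 u * exp (\<tau> * of_real ((norm u)\<^sup>2) / 2 + bdot X (vcnj u) + bdot \<Xi> u)"
    have e: "?F (u, q) = ?c * (?g (fst q) * ?h (snd q))" for q
    proof -
      have ex: "- (cis (snd q) * bdot \<beta> (vcnj u) / 2) + (\<tau> * (lift_xy (u, q) / 2) + bdot X (lift_x (u, q)) + bdot \<Xi> (lift_y (u, q)))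
        = (\<tau> * of_real ((norm u)\<^sup>2) / 2 + bdot X (vcnj u) + bdot \<Xi> u) + ?D1 * cis (fst q) + ?D2 * cis (snd q)"
        unfolding lift_xy_eq by (simp add: lift_x_def lift_y_def field_simps)
      have "?F (u, q) = f0 u * exp (- (cis (snd q) * bdot \<beta> (vcnj u) / 2) + (\<tau> * (lift_xy (u, q) / 2) + bdot X (lift_x (u, q)) + bdot \<Xi> (lift_y (u, q))))
         * cis (- (real s * fst q)) * cis (- (real t * snd q)) * (bdot \<eta> (vcnj u) + cis (fst q) * bdot \<eta> \<alpha>) ^ a * (bdot v u + cis (snd q) * bdot v \<beta>) ^ b"
        unfolding exp_add[of "- (cis (snd q) * bdot \<beta> (vcnj u) / 2)"] lifted_f0_def fst_conv snd_conv
        by (simp only: lift_x_def lift_y_def fst_conv snd_conv bdot_simps mult_ac)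
      also have "\<dots> = ?c * (?g (fst q) * ?h (snd q))"
        unfolding ex exp_add[of "_ + ?D1 * cis (fst q)"] exp_add[of _ "?D1 * cis (fst q)"] by (simp only: mult_ac)
      finally show ?thesis .
    qed
    have "(LINT q|(circle_measure \<Otimes>\<^sub>M circle_measure). ?g (fst q) * ?h (snd q)) = (LINT x|circle_measure. ?g x) * (LINT x|circle_measure. ?h x)"
      by (rule circle_pair_integral[OF _ _ circle_factor_bound circle_factor_bound]) (intro continuous_intros)+
    then have "(LINT q|(circle_measure \<Otimes>\<^sub>M circle_measure). ?F (u, q)) = ?c * ((LINT x|circle_measure. ?g x) * (LINT x|circle_measure. ?h x))"
      unfolding e integral_mult_right_zero by (simp only:)
    then show "(LINT q|(circle_measure \<Otimes>\<^sub>M circle_measure). ?F (u, q)) = ?c * circle_coeff s a (bdot \<eta> (vcnj u)) (bdot \<eta> \<alpha>) ?D1 * circle_coeff t b (bdot v u) (bdot v \<beta>) ?D2"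
      unfolding circle_integral_poly_exp by (simp only: mult.assoc)
  qed
  finally show ?thesis .
qed

definition moment :: "complex ^ 'n \<Rightarrow> complex ^ 'n \<Rightarrow> nat \<Rightarrow> nat \<Rightarrow> complex \<Rightarrow> complex" where
  "moment \<eta> v a b \<tau> = (LINT \<omega>|Omega. lifted_term \<eta> v a b \<omega> * exp (\<tau> * (lift_xy \<omega> / 2)))"

lemma moment_holomorphic: "moment \<eta> v a b holomorphic_on {\<tau>. Re \<tau> < 1}"
  and moment_deriv: "Re \<tau> < 1 \<Longrightarrow> (deriv ^^ k) (moment \<eta> v a b) \<tau> = (LINT \<omega>|Omega. lifted_term \<eta> v a b \<omega> * (lift_xy \<omega> / 2) ^ k * exp (\<tau> * (lift_xy \<omega> / 2)))"
proof -
  have m: "lifted_term \<eta> v a b \<in> borel_measurable Omega" "(\<lambda>\<omega>. lift_xy \<omega> / 2) \<in> borel_measurable Omega"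
    by measurable
  have U: "\<exists>\<rho>>0. integrable Omega (\<lambda>\<omega>. norm (lifted_term \<eta> v a b \<omega> * exp (z * (lift_xy \<omega> / 2))) * exp (\<rho> * norm (lift_xy \<omega> / 2)))"
    if "z \<in> {\<tau>. Re \<tau> < 1}" for z
    using that lifted_term_dominated[of z "(1 - Re z) / 2" \<eta> a v b 0 0]
    by (intro exI[of _ "(1 - Re z) / 2"]) (simp add: field_simps)
  have o: "open {\<tau>. Re \<tau> < 1}" by (simp add: open_halfspace_Re_lt)
  show "moment \<eta> v a b holomorphic_on {\<tau>. Re \<tau> < 1}"
    using laplace_holomorphic(1)[OF m U o] by (simp only: moment_def[abs_def])
  show "Re \<tau> < 1 \<Longrightarrow> (deriv ^^ k) (moment \<eta> v a b) \<tau> = (LINT \<omega>|Omega. lifted_term \<eta> v a b \<omega> * (lift_xy \<omega> / 2) ^ k * exp (\<tau> * (lift_xy \<omega> / 2)))"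
    using laplace_holomorphic(2)[OF m U o, of \<tau> k] by (simp only: moment_def[abs_def] mem_Collect_eq)
qed

section \<open>The differential equation of the moments\<close>

lemma sigma_finite_Om: "sigma_finite_measure Omega"
proof -
  interpret C: prob_space circle_measure by (rule prob_space_circle_measure)
  interpret CC: pair_prob_space circle_measure circle_measure ..
  interpret O: pair_sigma_finite lborel "circle_measure \<Otimes>\<^sub>M circle_measure" ..
  show ?thesis unfolding Omega_def by (rule O.sigma_finite_measure_axioms)
qed

text \<open>The relation for every \<open>z\<close> on the sphere is multiplied by a polynomial in \<open>z\<close> and \<open>cnj z\<close> and averaged; Fubini
moves the average inside.\<close>

lemma averaged_condition:
  fixes \<tau> :: real
  assumes R: "R > 0" and \<tau>: "0 < \<tau>" "\<tau> < 1"
    and cond: "\<And>z. norm z = R \<Longrightarrow> (LINT \<omega>|Omega. lifted_f0 \<omega> * exp (of_real \<tau> * (lift_xy \<omega> / 2)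
        + bdot (- (of_real \<tau> / 2) *s z) (lift_x \<omega>) + bdot (of_real ((1 - \<tau>) / 2) *s vcnj z) (lift_y \<omega>))) = 0"
  shows "(LINT \<omega>|Omega. lifted_f0 \<omega> * exp (of_real \<tau> * (lift_xy \<omega> / 2)) * (LINT z|usphere R.
      exp (bdot z (- (of_real \<tau> / 2) *s lift_x \<omega>) + bdot (vcnj z) (of_real ((1 - \<tau>) / 2) *s lift_y \<omega>)) * bdot z v ^ b * bdot (vcnj z) \<eta> ^ a)) = 0"
proof -
  interpret S: prob_space "usphere R :: (complex ^ 'n) measure" by (rule prob_space_usphere)
  interpret O: sigma_finite_measure Omega by (rule sigma_finite_Om)
  interpret P: pair_sigma_finite "usphere R :: (complex ^ 'n) measure" Omega ..
  let ?c1 = "- (complex_of_real \<tau> / 2)" and ?c2 = "complex_of_real ((1 - \<tau>) / 2)"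
  let ?q = "\<lambda>z. bdot z v ^ b * bdot (vcnj z) \<eta> ^ a"
  let ?F = "\<lambda>z \<omega>. lifted_f0 \<omega> * exp (of_real \<tau> * (lift_xy \<omega> / 2)) *
    (exp (?c1 * bdot z (lift_x \<omega>) + ?c2 * bdot (vcnj z) (lift_y \<omega>)) * bdot z v ^ b * bdot (vcnj z) \<eta> ^ a)"
  have xO: "lift_x \<in> borel_measurable Omega" "lift_y \<in> borel_measurable Omega" "lifted_f0 \<in> borel_measurable Omega"
    by measurable
  have mF: "case_prod ?F \<in> borel_measurable (usphere R \<Otimes>\<^sub>M Omega)"
  proof -
    note [measurable] = measurable_compose[OF measurable_snd xO(1)] measurable_compose[OF measurable_snd xO(2)] measurable_compose[OF measurable_snd xO(3)]
    have "fst \<in> borel_measurable ((usphere R :: (complex ^ 'n) measure) \<Otimes>\<^sub>M Omega)"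
      using measurable_fst[of "usphere R :: (complex ^ 'n) measure" Omega] by (simp cong: measurable_cong_sets)
    note [measurable] = this
    show ?thesis unfolding case_prod_unfold by measurable
  qed
  define W where "W = \<kappa> + \<tau> * \<kappa> / 2 + R"
  define K where "K = (R * norm v) ^ b * (R * norm \<eta>) ^ a * exp (R * \<kappa>)"
  let ?D = "\<lambda>\<omega>. K * (norm (f0 (fst \<omega>)) * exp (\<tau> * (norm (fst \<omega>))\<^sup>2 / 2 + W * norm (fst \<omega>)))"
  have K0: "K \<ge> 0" unfolding K_def using R by (intro mult_nonneg_nonneg zero_le_power) auto
  have bd: "norm (?F z \<omega>) \<le> ?D \<omega>" if z: "norm z = R" for z \<omega>
  proof -
    let ?u = "norm (fst \<omega>)"
    have "Re (?c1 * bdot z (lift_x \<omega>) + ?c2 * bdot (vcnj z) (lift_y \<omega>)) \<le> norm (?c1 * bdot z (lift_x \<omega>)) + norm (?c2 * bdot (vcnj z) (lift_y \<omega>))"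
      using complex_Re_le_cmod norm_triangle_ineq order_trans by blast
    also have "\<dots> \<le> \<tau> / 2 * (R * (?u + \<kappa>)) + (1 - \<tau>) / 2 * (R * (?u + \<kappa>))"
    proof (rule add_mono)
      have "norm ?c1 = \<tau> / 2" using \<tau> by (simp add: norm_divide)
      then show "norm (?c1 * bdot z (lift_x \<omega>)) \<le> \<tau> / 2 * (R * (?u + \<kappa>))"
        unfolding norm_mult using norm_bdot_xx[of z \<omega>] z \<tau> by (simp only:) (intro mult_left_mono, auto)
      have "norm ?c2 = (1 - \<tau>) / 2" using \<tau> unfolding norm_of_real by simp
      then show "norm (?c2 * bdot (vcnj z) (lift_y \<omega>)) \<le> (1 - \<tau>) / 2 * (R * (?u + \<kappa>))"
        unfolding norm_mult using norm_bdot_yy[of "vcnj z" \<omega>] z \<tau> by (simp only: norm_vcnj) (intro mult_left_mono, auto)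
    qed
    also have "\<dots> = R * (?u + \<kappa>) / 2" by (simp add: field_simps)
    also have "\<dots> \<le> R * (?u + \<kappa>)" using R \<kappa>_pos by simp
    finally have e1: "norm (exp (?c1 * bdot z (lift_x \<omega>) + ?c2 * bdot (vcnj z) (lift_y \<omega>))) \<le> exp (R * (?u + \<kappa>))"
      unfolding norm_exp_eq_Re by simp
    have "Re (of_real \<tau> * (lift_xy \<omega> / 2)) \<le> (\<tau> * ?u\<^sup>2 + \<tau> * \<kappa> * ?u) / 2"
      using Re_mult_xy[of "of_real \<tau>" \<omega>] \<tau> by simp
    then have e2: "norm (exp (of_real \<tau> * (lift_xy \<omega> / 2))) \<le> exp ((\<tau> * ?u\<^sup>2 + \<tau> * \<kappa> * ?u) / 2)"
      unfolding norm_exp_eq_Re by simp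
    have e3: "norm (bdot z v) ^ b \<le> (R * norm v) ^ b" "norm (bdot (vcnj z) \<eta>) ^ a \<le> (R * norm \<eta>) ^ a"
      using norm_bdot_le[of z v] norm_bdot_le[of "vcnj z" \<eta>] z by (auto intro!: power_mono)
    have "norm (?F z \<omega>) \<le> (norm (f0 (fst \<omega>)) * exp (\<kappa> * ?u)) * exp ((\<tau> * ?u\<^sup>2 + \<tau> * \<kappa> * ?u) / 2) * (exp (R * (?u + \<kappa>)) * (R * norm v) ^ b * (R * norm \<eta>) ^ a)"
      unfolding norm_mult norm_power using R by (intro mult_mono e1 e2 e3 norm_hh) (auto intro!: mult_nonneg_nonneg)
    also have "\<dots> = (R * norm v) ^ b * (R * norm \<eta>) ^ a * norm (f0 (fst \<omega>)) * exp (\<kappa> * ?u + (\<tau> * ?u\<^sup>2 + \<tau> * \<kappa> * ?u) / 2 + R * (?u + \<kappa>))"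
      unfolding exp_add by (simp only: mult_ac)
    also have "\<kappa> * ?u + (\<tau> * ?u\<^sup>2 + \<tau> * \<kappa> * ?u) / 2 + R * (?u + \<kappa>) = R * \<kappa> + (\<tau> * ?u\<^sup>2 / 2 + W * ?u)"
      unfolding W_def by (simp add: field_simps)
    also have "(R * norm v) ^ b * (R * norm \<eta>) ^ a * norm (f0 (fst \<omega>)) * exp (R * \<kappa> + (\<tau> * ?u\<^sup>2 / 2 + W * ?u)) = ?D \<omega>"
      unfolding K_def exp_add[of "R * \<kappa>"] by (simp only: mult_ac)
    finally show ?thesis .
  qed
  have Dint: "integrable Omega ?D"
    by (rule Omega_integrable[where a = \<tau> and C = W and K = K]) (use \<tau> K0 in \<open>auto simp: abs_mult intro!: measurable_compose[OF fst_borel(1)]\<close>)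
  have Fint: "integrable Omega (?F z)" if z: "norm z = R" for z
  proof (rule Bochner_Integration.integrable_bound[OF Dint])
    show "?F z \<in> borel_measurable Omega" using xO by measurable
    show "AE \<omega> in Omega. norm (?F z \<omega>) \<le> norm (?D \<omega>)"
      unfolding real_norm_def by (intro AE_I2 order_trans[OF bd[OF z] abs_ge_self])
  qed
  have nz: "AE z in usphere R. norm (z :: complex ^ 'n) = R"
    using norm_usphere[of R] R by simp
  have int: "integrable (usphere R \<Otimes>\<^sub>M Omega) (case_prod ?F)"
  proof (rule P.Fubini_integrable[OF mF])
    have nm: "(\<lambda>z. LINT \<omega>|Omega. norm (case_prod ?F (z, \<omega>))) \<in> borel_measurable (usphere R)"
      by (rule O.borel_measurable_lebesgue_integral) (use measurable_compose[OF mF borel_measurable_norm] in \<open>simp add: case_prod_unfold\<close>)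
    show "integrable (usphere R) (\<lambda>z. LINT \<omega>|Omega. norm (case_prod ?F (z, \<omega>)))"
    proof (rule S.integrable_const_bound[OF _ nm])
      show "AE z in usphere R. norm (LINT \<omega>|Omega. norm (case_prod ?F (z, \<omega>))) \<le> (LINT \<omega>|Omega. ?D \<omega>)"
        using nz
      proof eventually_elim
        case (elim z)
        have "(LINT \<omega>|Omega. norm (?F z \<omega>)) \<le> (LINT \<omega>|Omega. ?D \<omega>)"
          by (intro integral_mono integrable_norm Fint elim Dint bd)
        then show ?case unfolding prod.case real_norm_def by (subst abs_of_nonneg) (intro Bochner_Integration.integral_nonneg norm_ge_zero)
      qed
    qed
    show "AE z in usphere R. integrable Omega (\<lambda>\<omega>. case_prod ?F (z, \<omega>))"
      using nz by eventually_elim (simp only: prod.case Fint)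
  qed
  have inner: "(LINT \<omega>|Omega. ?F z \<omega>) = 0" if z: "norm z = R" for z
  proof -
    have "?F z \<omega> = ?q z * (lifted_f0 \<omega> * exp (of_real \<tau> * (lift_xy \<omega> / 2) + bdot (?c1 *s z) (lift_x \<omega>) + bdot (?c2 *s vcnj z) (lift_y \<omega>)))" for \<omega>
      unfolding bdot_simps add.assoc[of "of_real \<tau> * (lift_xy \<omega> / 2)"] exp_add[of "of_real \<tau> * (lift_xy \<omega> / 2)"] by (simp only: mult_ac)
    then have "(LINT \<omega>|Omega. ?F z \<omega>) = ?q z * (LINT \<omega>|Omega. lifted_f0 \<omega> * exp (of_real \<tau> * (lift_xy \<omega> / 2) + bdot (?c1 *s z) (lift_x \<omega>) + bdot (?c2 *s vcnj z) (lift_y \<omega>)))"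
      by (simp only: integral_mult_right_zero)
    then show ?thesis using cond[OF z] by simp
  qed
  have "(LINT \<omega>|Omega. (LINT z|usphere R. ?F z \<omega>)) = (LINT z|usphere R. (LINT \<omega>|Omega. ?F z \<omega>))"
    by (rule P.Fubini_integral[OF int])
  also have "\<dots> = (LINT z|(usphere R :: (complex ^ 'n) measure). 0)"
  proof (rule Bochner_Integration.integral_cong_AE)
    show "(\<lambda>z. LINT \<omega>|Omega. ?F z \<omega>) \<in> borel_measurable (usphere R)"
      by (rule O.borel_measurable_lebesgue_integral) (use mF in \<open>simp add: case_prod_unfold\<close>)
    show "AE z in usphere R. (LINT \<omega>|Omega. ?F z \<omega>) = 0" using nz by eventually_elim (rule inner)
  qed simp
  finally show ?thesis by (simp only: integral_mult_right_zero bdot_simps Bochner_Integration.integral_zero)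
qed

text \<open>Expanding the Bessel type function into its power series turns the integral into a series of
derivatives of the moment at the same point \<open>\<tau>\<close>.\<close>

lemma moment_series:
  assumes \<tau>: "Re \<tau> < 1" and R: "R > 0"
  shows "(\<lambda>h. of_real (R ^ (2 * (K + h)) / (fact h * fact (CARD('n) + K + h - 1))) * (2 * w) ^ h * (deriv ^^ h) (moment \<eta> v a b) \<tau>)
      sums (LINT \<omega>|Omega. lifted_term \<eta> v a b \<omega> * exp (\<tau> * (lift_xy \<omega> / 2)) * (deriv ^^ K) (bessel (CARD('n)) R) (w * lift_xy \<omega>))"
    and "integrable Omega (\<lambda>\<omega>. lifted_term \<eta> v a b \<omega> * exp (\<tau> * (lift_xy \<omega> / 2)) * (deriv ^^ K) (bessel (CARD('n)) R) (w * lift_xy \<omega>))"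
proof -
  let ?n = "CARD('n)"
  \<comment> \<open>Half of the room that \<open>Re \<tau> < 1\<close> leaves in \<open>lifted_term_dominated\<close>.\<close>
  define \<epsilon> where "\<epsilon> = (1 - Re \<tau>) / 2"
  have \<epsilon>: "\<epsilon> > 0" "Re \<tau> + \<epsilon> < 1" using \<tau> by (auto simp: \<epsilon>_def field_simps)
  let ?H = "\<lambda>\<omega>. lifted_term \<eta> v a b \<omega> * exp (\<tau> * (lift_xy \<omega> / 2))"
  let ?c = "\<lambda>h. of_real (R ^ (2 * (K + h)) / (fact h * fact (?n + K + h - 1))) * (2 * w) ^ h :: complex"
  let ?A = "R\<^sup>2 * (2 * norm w)"
  have m: "?H \<in> borel_measurable Omega" "(\<lambda>\<omega>. lift_xy \<omega> / 2) \<in> borel_measurable Omega" by measurable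
  have int: "integrable Omega (\<lambda>\<omega>. norm (?H \<omega>) * exp (\<epsilon> * norm (lift_xy \<omega> / 2)))"
    using lifted_term_dominated[OF \<epsilon>(2) less_imp_le[OF \<epsilon>(1)], of \<eta> a v b 0 0] by simp
  have c: "norm (?c h) \<le> (R ^ (2 * K) * exp (?A / \<epsilon>)) * (\<epsilon> ^ h / fact h)" for h
  proof -
    have "1 \<le> ?n" by (simp add: Suc_leI)
    then have "h \<le> ?n + K + h - 1" by linarith
    then have f: "(fact h :: real) \<le> fact (?n + K + h - 1)" by (rule fact_mono)
    have n: "norm (?c h) = R ^ (2 * K) * (?A ^ h / fact h) / fact (?n + K + h - 1)"
      using R by (simp add: norm_mult norm_power norm_divide power_add power_mult power_mult_distrib)
    have "?A ^ h / fact h \<le> \<epsilon> ^ h * exp (?A / \<epsilon>)"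
    proof -
      have "(?A / \<epsilon>) ^ h \<le> fact h / 1 ^ h * exp (1 * (?A / \<epsilon>))"
        using \<epsilon> by (intro power_le_fact_exp) auto
      then show ?thesis using \<epsilon> by (simp add: power_divide field_simps)
    qed
    then have "R ^ (2 * K) * (?A ^ h / fact h) / fact (?n + K + h - 1) \<le> R ^ (2 * K) * (\<epsilon> ^ h * exp (?A / \<epsilon>)) / fact h"
      using f R \<epsilon> by (intro frac_le mult_left_mono) auto
    then show ?thesis unfolding n by (simp add: mult_ac)
  qed
  have g: "(\<lambda>h. ?c h * u ^ h) sums (deriv ^^ K) (bessel ?n R) (w * (2 * u))" for u
    using bessel_deriv_sums[where n = ?n and R = R and K = K and u = "w * (2 * u)"] by (simp add: power_mult_distrib mult_ac)
  note I = integral_power_series[OF m int \<epsilon>(1) c g]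
  have d: "(LINT \<omega>|Omega. ?H \<omega> * (lift_xy \<omega> / 2) ^ h) = (deriv ^^ h) (moment \<eta> v a b) \<tau>" for h
    unfolding moment_deriv[OF \<tau>] by (intro Bochner_Integration.integral_cong refl) (simp only: mult_ac)
  have w: "w * (2 * (lift_xy \<omega> / 2)) = w * lift_xy \<omega>" for \<omega> by simp
  show "(\<lambda>h. ?c h * (deriv ^^ h) (moment \<eta> v a b) \<tau>) sums (LINT \<omega>|Omega. ?H \<omega> * (deriv ^^ K) (bessel ?n R) (w * lift_xy \<omega>))"
    using I(1) unfolding d w .
  show "integrable Omega (\<lambda>\<omega>. ?H \<omega> * (deriv ^^ K) (bessel ?n R) (w * lift_xy \<omega>))"
    using I(2) unfolding w .
qed

lemma deriv_zero_halfplane: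
  assumes z: "\<And>\<tau>. Re \<tau> < 1 \<Longrightarrow> F \<tau> = 0" and \<tau>: "Re \<tau> < 1"
  shows "(deriv ^^ h) F \<tau> = 0"
proof -
  have "\<forall>\<^sub>F x in nhds \<tau>. x \<in> {x. Re x < 1}"
    by (rule eventually_nhds_in_open) (use \<tau> open_halfspace_Re_lt[of 1] in auto)
  then have "\<forall>\<^sub>F x in nhds \<tau>. F x = 0" by eventually_elim (use z in auto)
  then have "(deriv ^^ h) F \<tau> = (deriv ^^ h) (\<lambda>x. 0) \<tau>"
    by (rule higher_deriv_cong_ev) simp
  then show ?thesis by simp
qed

text \<open>By \<open>usphere_bipoly_exp_mean\<close> the averaged relation is a sum over \<open>i \<le> a\<close>. The terms with \<open>i \<ge> 1\<close>
are built from moments with exponents \<open>a - i\<close> and \<open>b - i\<close>, which vanish by assumption; the term \<open>i = 0\<close> gives the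
equation, with \<open>N = n + a + b\<close> because the Bessel type function is differentiated \<open>a + b\<close> times.\<close>

lemma moment_ode:
  fixes t' :: real
  assumes R: "R > 0" and t': "0 < t'" "t' < 1"
    and cond: "\<And>z. norm z = R \<Longrightarrow> (LINT \<omega>|Omega. lifted_f0 \<omega> * exp (of_real t' * (lift_xy \<omega> / 2)
        + bdot (- (of_real t' / 2) *s z) (lift_x \<omega>) + bdot (of_real ((1 - t') / 2) *s vcnj z) (lift_y \<omega>))) = 0"
    and lower: "\<And>i \<tau>. 1 \<le> i \<Longrightarrow> i \<le> a \<Longrightarrow> i \<le> b \<Longrightarrow> Re \<tau> < 1 \<Longrightarrow> moment \<eta> v (a - i) (b - i) \<tau> = 0"
  shows "(\<lambda>j. (- of_real (R\<^sup>2 / 2 * t' * (1 - t'))) ^ j / (fact j * fact (CARD('n) + a + b + j - 1)) * (deriv ^^ j) (moment \<eta> v a b) (of_real t')) sums 0"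
proof -
  let ?n = "CARD('n)" and ?\<tau> = "complex_of_real t'"
  have \<tau>: "Re ?\<tau> < 1" using t' by simp
  let ?c1 = "- (?\<tau> / 2)" and ?c2 = "complex_of_real ((1 - t') / 2)"
  let ?w = "?c1 * ?c2"
  let ?D = "\<lambda>j. (deriv ^^ j) (bessel ?n R)"
  let ?T = "\<lambda>i \<omega>. lifted_term \<eta> v (a - i) (b - i) \<omega> * exp (?\<tau> * (lift_xy \<omega> / 2)) * ?D (b + (a - i)) (?w * lift_xy \<omega>)"
  let ?e = "\<lambda>i. of_nat (b choose i) * bdot v \<eta> ^ i * ?c2 ^ (b - i) * ?c1 ^ (a - i) / fact (a - i)"
  let ?C = "fact (?n - 1) * fact a :: complex"
  have I: "integrable Omega (?T i)" for i by (rule moment_series(2)[OF \<tau> R])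
  have e: "lifted_f0 \<omega> * exp (?\<tau> * (lift_xy \<omega> / 2)) * (?C * (\<Sum>i\<le>a. of_nat (b choose i) * bdot v \<eta> ^ i * bdot v (?c2 *s lift_y \<omega>) ^ (b - i)
         * (?D (b + (a - i)) (bdot (?c1 *s lift_x \<omega>) (?c2 *s lift_y \<omega>)) / fact (a - i) * bdot (?c1 *s lift_x \<omega>) \<eta> ^ (a - i))))
      = ?C * (\<Sum>i\<le>a. ?e i * ?T i \<omega>)" for \<omega>
  proof -
    have "lifted_f0 \<omega> * exp (?\<tau> * (lift_xy \<omega> / 2)) * (of_nat (b choose i) * bdot v \<eta> ^ i * bdot v (?c2 *s lift_y \<omega>) ^ (b - i)
         * (?D (b + (a - i)) (bdot (?c1 *s lift_x \<omega>) (?c2 *s lift_y \<omega>)) / fact (a - i) * bdot (?c1 *s lift_x \<omega>) \<eta> ^ (a - i))) = ?e i * ?T i \<omega>" for i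
    proof -
      have w: "bdot (?c1 *s lift_x \<omega>) (?c2 *s lift_y \<omega>) = ?w * lift_xy \<omega>" by (simp only: bdot_simps mult_ac)
      show ?thesis unfolding w unfolding bdot_simps power_mult_distrib bdot_commute[of "lift_x \<omega>" \<eta>] divide_inverse by (simp only: mult_ac)
    qed
    then have "(\<Sum>i\<le>a. lifted_f0 \<omega> * exp (?\<tau> * (lift_xy \<omega> / 2)) * (of_nat (b choose i) * bdot v \<eta> ^ i * bdot v (?c2 *s lift_y \<omega>) ^ (b - i)
         * (?D (b + (a - i)) (bdot (?c1 *s lift_x \<omega>) (?c2 *s lift_y \<omega>)) / fact (a - i) * bdot (?c1 *s lift_x \<omega>) \<eta> ^ (a - i)))) = (\<Sum>i\<le>a. ?e i * ?T i \<omega>)"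
      by (simp only:)
    then show ?thesis unfolding sum_distrib_left[symmetric] by (simp only: mult.left_commute[of _ ?C])
  qed
  have "(LINT \<omega>|Omega. ?C * (\<Sum>i\<le>a. ?e i * ?T i \<omega>)) = 0"
    using averaged_condition[OF R t' cond, of v b \<eta> a] unfolding usphere_bipoly_exp_mean e by simp
  then have "(LINT \<omega>|Omega. (\<Sum>i\<le>a. ?e i * ?T i \<omega>)) = 0"
    unfolding integral_mult_right_zero by simp
  then have S0: "(\<Sum>i\<le>a. ?e i * (LINT \<omega>|Omega. ?T i \<omega>)) = 0"
    by (subst (asm) Bochner_Integration.integral_sum) (simp_all only: integrable_mult_right I integral_mult_right_zero)
  have T0: "?e i * (LINT \<omega>|Omega. ?T i \<omega>) = 0" if i: "1 \<le> i" "i \<le> a" for i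
  proof (cases "i \<le> b")
    case True
    have "(deriv ^^ h) (moment \<eta> v (a - i) (b - i)) ?\<tau> = 0" for h
      by (rule deriv_zero_halfplane[OF lower[OF i True] \<tau>])
    then have "(\<lambda>h. 0) sums (LINT \<omega>|Omega. ?T i \<omega>)"
      using moment_series(1)[OF \<tau> R, of "b + (a - i)" ?w \<eta> v "a - i" "b - i"] by (simp only: mult_zero_right)
    from sums_unique2[OF this sums_zero] show ?thesis by (simp only: mult_zero_right)
  next
    case False
    then have "b choose i = 0" by (simp add: binomial_eq_0)
    then show ?thesis by (simp only: of_nat_0 mult_zero_left div_0)
  qed
  have "(\<Sum>i\<le>a. ?e i * (LINT \<omega>|Omega. ?T i \<omega>)) = ?e 0 * (LINT \<omega>|Omega. ?T 0 \<omega>)"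
  proof -
    have "(\<Sum>i\<in>{..a} - {0}. ?e i * (LINT \<omega>|Omega. ?T i \<omega>)) = 0"
      by (rule sum.neutral, intro ballI T0) auto
    then show ?thesis by (simp only: sum.remove[of "{..a}" 0] finite_atMost atMost_iff zero_le add_0_right)
  qed
  then have "?e 0 * (LINT \<omega>|Omega. ?T 0 \<omega>) = 0" using S0 by (rule trans[OF sym])
  moreover have "?e 0 \<noteq> 0" using t' by simp
  ultimately have "(LINT \<omega>|Omega. ?T 0 \<omega>) = 0" using mult_eq_0_iff by blast
  then have "(\<lambda>h. of_real (R ^ (2 * (b + a + h)) / (fact h * fact (?n + (b + a) + h - 1))) * (2 * ?w) ^ h * (deriv ^^ h) (moment \<eta> v a b) ?\<tau>) sums 0"
    using moment_series(1)[OF \<tau> R, of "b + a" ?w \<eta> v a b] by (simp only: diff_zero)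
  from sums_mult[OF this, of "of_real (1 / R ^ (2 * (b + a)))"]
  have S: "(\<lambda>h. of_real (1 / R ^ (2 * (b + a))) * (of_real (R ^ (2 * (b + a + h)) / (fact h * fact (?n + (b + a) + h - 1))) * (2 * ?w) ^ h * (deriv ^^ h) (moment \<eta> v a b) ?\<tau>)) sums 0"
    by simp
  have "of_real (1 / R ^ (2 * (b + a))) * (of_real (R ^ (2 * (b + a + h)) / (fact h * fact (?n + (b + a) + h - 1))) * (2 * ?w) ^ h * (deriv ^^ h) (moment \<eta> v a b) ?\<tau>)
     = (- of_real (R\<^sup>2 / 2 * t' * (1 - t'))) ^ h / (fact h * fact (?n + a + b + h - 1)) * (deriv ^^ h) (moment \<eta> v a b) ?\<tau>" for h
  proof -
    have w: "2 * ?w = of_real (- (t' * (1 - t') / 2))" by (simp add: field_simps)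
    have "1 / R ^ (2 * (b + a)) * (R ^ (2 * (b + a + h)) / (fact h * fact (?n + (b + a) + h - 1))) * (- (t' * (1 - t') / 2)) ^ h
      = (- (R\<^sup>2 / 2 * t' * (1 - t'))) ^ h / (fact h * fact (?n + a + b + h - 1))"
    proof -
      have "(- (R\<^sup>2 / 2 * t' * (1 - t'))) ^ h = (R ^ (2 * h)) * (- (t' * (1 - t') / 2)) ^ h"
        unfolding power_mult power_mult_distrib[symmetric] by (simp add: mult.assoc)
      moreover have "R ^ (2 * (b + a + h)) = R ^ (2 * (b + a)) * R ^ (2 * h)" by (simp add: power_add[symmetric] distrib_left)
      moreover have "?n + (b + a) + h - 1 = ?n + a + b + h - 1" by simp
      ultimately show ?thesis using R by simp
    qed
    then have "complex_of_real (1 / R ^ (2 * (b + a)) * (R ^ (2 * (b + a + h)) / (fact h * fact (?n + (b + a) + h - 1))) * (- (t' * (1 - t') / 2)) ^ h)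
      = of_real ((- (R\<^sup>2 / 2 * t' * (1 - t'))) ^ h / (fact h * fact (?n + a + b + h - 1)))" by (simp only:)
    then show ?thesis unfolding w
      by (simp only: of_real_mult of_real_power of_real_divide of_real_minus of_real_fact mult.assoc[symmetric])
  qed
  then show ?thesis using S by (simp only:)
qed

end

section \<open>Growth of the moments\<close>

lemma gaussian_integral_scale:
  assumes c: "c > 0"
  shows "(LINT w|lborel. exp (- ((norm (w::'a::euclidean_space))\<^sup>2 / c))) = sqrt (pi * c) ^ DIM('a)"
proof -
  let ?k = "sqrt c"
  have k: "?k > 0" using c by simp
  have "(LINT w|lborel. exp (- ((norm (w::'a))\<^sup>2 / c)))
      = (LINT w|density (distr lborel borel (\<lambda>x. 0 + ?k *\<^sub>R x)) (\<lambda>_. ennreal (\<bar>?k\<bar> ^ DIM('a))). exp (- ((norm (w::'a))\<^sup>2 / c)))"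
    using lborel_affine[of ?k "0::'a"] k by simp
  also have "\<dots> = (LINT w|distr lborel borel (\<lambda>x. 0 + ?k *\<^sub>R x). (\<bar>?k\<bar> ^ DIM('a)) *\<^sub>R exp (- ((norm (w::'a))\<^sup>2 / c)))"
    by (subst integral_density) auto
  also have "\<dots> = (LINT w|lborel. (\<bar>?k\<bar> ^ DIM('a)) *\<^sub>R exp (- ((norm (0 + ?k *\<^sub>R (w::'a)))\<^sup>2 / c)))"
    by (subst integral_distr) auto
  also have "\<dots> = ?k ^ DIM('a) * (LINT w|lborel. exp (- (norm (w::'a))\<^sup>2))"
    using k c by (simp add: power_mult_distrib)
  also have "\<dots> = sqrt (pi * c) ^ DIM('a)"
    unfolding integrable_gaussian(2) by (simp add: real_sqrt_mult power_mult_distrib)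
  finally show ?thesis .
qed

text \<open>Splits \<open>g\<close> at the level \<open>\<theta>\<close>; the freedom in \<open>\<theta>\<close> is what turns \<open>L^p\<close> information into decay.\<close>

lemma le_add_powr:
  fixes g \<theta> p :: real
  assumes "g \<ge> 0" "\<theta> > 0" "1 \<le> p"
  shows "g \<le> \<theta> + \<theta> powr (1 - p) * g powr p"
proof (cases "g \<le> \<theta>")
  case True
  then show ?thesis by (simp add: add_increasing2)
next
  case False
  then have g: "g / \<theta> > 1" "g > 0" using assms(2) by (auto simp: field_simps)
  have "(g / \<theta>) powr 1 \<le> (g / \<theta>) powr p" using g assms(3) by (intro powr_mono) auto
  then have "g \<le> \<theta> * (g / \<theta>) powr p" using g assms(2) by (simp add: field_simps)
  also have "\<dots> = \<theta> powr (1 - p) * g powr p"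
    using g assms(2) by (simp add: powr_divide powr_diff)
  finally show ?thesis using assms(2) by simp
qed

lemma poly_gauss_bound:
  "\<exists>K\<ge>0. \<forall>\<rho>\<ge>0. (1 + \<rho>) ^ M * exp (- (\<rho>\<^sup>2 / 9)) \<le> K * exp (- (\<rho>\<^sup>2 / 18) :: real)"
proof (intro exI conjI allI impI)
  show "0 \<le> fact M * exp (11/2 :: real)" by simp
  fix \<rho> :: real assume \<rho>: "\<rho> \<ge> 0"
  have "(1 + \<rho>) ^ M \<le> fact M / 1 ^ M * exp (1 * (1 + \<rho>))"
    using \<rho> by (intro power_le_fact_exp) auto
  then have "(1 + \<rho>) ^ M * exp (- (\<rho>\<^sup>2 / 9)) \<le> fact M * exp (1 + \<rho>) * exp (- (\<rho>\<^sup>2 / 9))"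
    by (intro mult_right_mono) auto
  also have "\<dots> = fact M * exp (1 + \<rho> - \<rho>\<^sup>2 / 9)" by (simp only: mult.assoc mult_exp_exp diff_conv_add_uminus)
  also have "\<dots> \<le> fact M * exp (11/2 + - (\<rho>\<^sup>2 / 18))"
  proof -
    have "0 \<le> (\<rho> - 9)\<^sup>2" by simp
    then have "1 + \<rho> - \<rho>\<^sup>2 / 9 \<le> 11/2 + - (\<rho>\<^sup>2 / 18)" by (simp add: power2_eq_square field_simps)
    then show ?thesis by simp
  qed
  also have "\<dots> = fact M * exp (11/2) * exp (- (\<rho>\<^sup>2 / 18))" by (simp only: exp_add mult.assoc)
  finally show "(1 + \<rho>) ^ M * exp (- (\<rho>\<^sup>2 / 9)) \<le> fact M * exp (11/2) * exp (- (\<rho>\<^sup>2 / 18))" .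
qed

text \<open>Here \<open>\<sigma>\<close> is the size of \<open>\<tau>\<close>. The point is the factor \<open>\<sigma>^(s-a)\<close> (truncated subtraction), the order of vanishing at \<open>\<tau> = 0\<close>.\<close>

lemma circle_coeff_bound1:
  fixes A B D :: complex
  assumes A: "norm A \<le> KA * w" and B: "norm B \<le> KB" and D: "norm D \<le> KD * (\<sigma> * w)"
    and \<sigma>: "0 \<le> \<sigma>" "\<sigma> \<le> 3" and w: "1 \<le> w" and K: "0 \<le> KA" "0 \<le> KB" "0 \<le> KD"
  shows "norm (circle_coeff s a A B D)
    \<le> (\<Sum>k\<le>min a s. real (a choose k) * KA ^ (a - k) * KB ^ k * KD ^ (s - k) * 3 ^ s) * (\<sigma> ^ (s - a) * w ^ (a + s))"
proof -
  have "norm (circle_coeff s a A B D) \<le> (\<Sum>k\<le>min a s. (real (a choose k) * KA ^ (a - k) * KB ^ k * KD ^ (s - k) * 3 ^ s) * (\<sigma> ^ (s - a) * w ^ (a + s)))"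
    unfolding circle_coeff_def
  proof (rule sum_norm_le)
    fix k assume k: "k \<in> {..min a s}"
    have 1: "norm A ^ (a - k) \<le> KA ^ (a - k) * w ^ (a - k)"
      using A by (simp add: power_mono power_mult_distrib[symmetric])
    have 2: "norm B ^ k \<le> KB ^ k" using B by (simp add: power_mono)
    have 3: "norm D ^ (s - k) / fact (s - k) \<le> KD ^ (s - k) * (3 ^ s * \<sigma> ^ (s - a)) * w ^ (s - k)"
    proof -
      have "norm D ^ (s - k) / fact (s - k) \<le> norm D ^ (s - k) / 1"
        by (intro divide_left_mono) (auto simp: fact_ge_1)
      also have "\<dots> \<le> (KD * (\<sigma> * w)) ^ (s - k)" using D by (simp add: power_mono)
      also have "\<dots> = KD ^ (s - k) * \<sigma> ^ (s - k) * w ^ (s - k)" by (simp add: power_mult_distrib)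
      also have "\<dots> \<le> KD ^ (s - k) * (3 ^ s * \<sigma> ^ (s - a)) * w ^ (s - k)"
      proof (intro mult_right_mono mult_left_mono)
        have "s - k = (s - a) + ((s - k) - (s - a))" using k by auto
        then have "\<sigma> ^ (s - k) = \<sigma> ^ (s - a) * \<sigma> ^ ((s - k) - (s - a))" by (metis power_add)
        also have "\<dots> \<le> \<sigma> ^ (s - a) * 3 ^ s"
        proof (intro mult_left_mono)
          have "\<sigma> ^ ((s - k) - (s - a)) \<le> 3 ^ ((s - k) - (s - a))" using \<sigma> by (intro power_mono)
          also have "\<dots> \<le> (3::real) ^ s" by (intro power_increasing) auto
          finally show "\<sigma> ^ ((s - k) - (s - a)) \<le> 3 ^ s" .
        qed (use \<sigma> in auto)
        finally show "\<sigma> ^ (s - k) \<le> 3 ^ s * \<sigma> ^ (s - a)" by (simp only: mult.commute)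
      qed (use w K in auto)
      finally show ?thesis .
    qed
    have "norm (of_nat (a choose k) * A ^ (a - k) * B ^ k * (D ^ (s - k) / fact (s - k)))
      = real (a choose k) * norm A ^ (a - k) * norm B ^ k * (norm D ^ (s - k) / fact (s - k))"
      by (simp add: norm_mult norm_power norm_divide)
    also have "\<dots> \<le> real (a choose k) * (KA ^ (a - k) * w ^ (a - k)) * KB ^ k * (KD ^ (s - k) * (3 ^ s * \<sigma> ^ (s - a)) * w ^ (s - k))"
      using K w \<sigma> by (intro mult_mono mult_left_mono 1 2 3) auto
    also have "\<dots> = real (a choose k) * KA ^ (a - k) * KB ^ k * KD ^ (s - k) * 3 ^ s * \<sigma> ^ (s - a) * w ^ ((a - k) + (s - k))"
      unfolding power_add by (simp only: mult_ac)
    also have "\<dots> \<le> real (a choose k) * KA ^ (a - k) * KB ^ k * KD ^ (s - k) * 3 ^ s * \<sigma> ^ (s - a) * w ^ (a + s)"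
      using K w \<sigma> by (intro mult_left_mono power_increasing) auto
    finally show "norm (of_nat (a choose k) * A ^ (a - k) * B ^ k * (D ^ (s - k) / fact (s - k)))
      \<le> (real (a choose k) * KA ^ (a - k) * KB ^ k * KD ^ (s - k) * 3 ^ s) * (\<sigma> ^ (s - a) * w ^ (a + s))"
      by (simp only: mult_ac)
  qed
  then show ?thesis by (simp only: sum_distrib_right)
qed

text \<open>Here \<open>L\<close> is of the size of \<open>1/(1-\<tau>)\<close> and \<open>w\<close> at least \<open>sqrt L\<close>. All terms of the sum are comparable because each step
of \<open>k\<close> trades \<open>w^2\<close> for \<open>L\<close>.\<close>

lemma circle_coeff_bound2:
  fixes A B D :: complex
  assumes A: "norm A \<le> KA * w" and B: "norm B \<le> KB" and D: "norm D \<le> KD * (w / L)"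
    and L: "1 \<le> L" and w: "L \<le> w\<^sup>2" "1 \<le> w" and K: "0 \<le> KA" "0 \<le> KB" "0 \<le> KD"
  shows "norm (circle_coeff s a A B D)
    \<le> (\<Sum>k\<le>min a s. real (a choose k) * KA ^ (a - k) * KB ^ k * KD ^ (s - k)) * (w ^ (a + s) / L ^ s)"
proof -
  have "norm (circle_coeff s a A B D) \<le> (\<Sum>k\<le>min a s. (real (a choose k) * KA ^ (a - k) * KB ^ k * KD ^ (s - k)) * (w ^ (a + s) / L ^ s))"
    unfolding circle_coeff_def
  proof (rule sum_norm_le)
    fix k assume k: "k \<in> {..min a s}"
    have 1: "norm A ^ (a - k) \<le> KA ^ (a - k) * w ^ (a - k)"
      using A by (simp add: power_mono power_mult_distrib[symmetric])
    have 2: "norm B ^ k \<le> KB ^ k" using B by (simp add: power_mono)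
    have 3: "norm D ^ (s - k) / fact (s - k) \<le> KD ^ (s - k) * (w ^ (s - k) / L ^ (s - k))"
    proof -
      have "norm D ^ (s - k) / fact (s - k) \<le> norm D ^ (s - k) / 1"
        by (intro divide_left_mono) (auto simp: fact_ge_1)
      also have "\<dots> \<le> (KD * (w / L)) ^ (s - k)" using D by (simp add: power_mono)
      finally show ?thesis by (simp add: power_mult_distrib power_divide)
    qed
    have 4: "w ^ (a - k) * (w ^ (s - k) / L ^ (s - k)) \<le> w ^ (a + s) / L ^ s"
    proof -
      have "L ^ k \<le> (w\<^sup>2) ^ k" using L w by (intro power_mono) auto
      then have "w ^ (a - k) * w ^ (s - k) * L ^ k \<le> w ^ (a - k) * w ^ (s - k) * (w\<^sup>2) ^ k"
        using w by (intro mult_left_mono) auto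
      also have "\<dots> = w ^ (a + s)" using k by (simp add: power_mult[symmetric] power_add[symmetric])
      finally have "w ^ (a - k) * w ^ (s - k) * L ^ k \<le> w ^ (a + s)" .
      moreover have "L ^ s = L ^ (s - k) * L ^ k" using k by (simp add: power_add[symmetric])
      ultimately show ?thesis using L by (simp add: field_simps)
    qed
    have "norm (of_nat (a choose k) * A ^ (a - k) * B ^ k * (D ^ (s - k) / fact (s - k)))
      = real (a choose k) * norm A ^ (a - k) * norm B ^ k * (norm D ^ (s - k) / fact (s - k))"
      by (simp add: norm_mult norm_power norm_divide)
    also have "\<dots> \<le> real (a choose k) * (KA ^ (a - k) * w ^ (a - k)) * KB ^ k * (KD ^ (s - k) * (w ^ (s - k) / L ^ (s - k)))"
      using K w by (intro mult_mono mult_left_mono 1 2 3) auto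
    also have "\<dots> = (real (a choose k) * KA ^ (a - k) * KB ^ k * KD ^ (s - k)) * (w ^ (a - k) * (w ^ (s - k) / L ^ (s - k)))"
      by (simp only: mult_ac)
    also have "\<dots> \<le> (real (a choose k) * KA ^ (a - k) * KB ^ k * KD ^ (s - k)) * (w ^ (a + s) / L ^ s)"
      using K by (intro mult_left_mono 4) auto
    finally show "norm (of_nat (a choose k) * A ^ (a - k) * B ^ k * (D ^ (s - k) / fact (s - k)))
      \<le> (real (a choose k) * KA ^ (a - k) * KB ^ k * KD ^ (s - k)) * (w ^ (a + s) / L ^ s)" .
  qed
  then show ?thesis by (simp only: sum_distrib_right)
qed

context twisted_transform begin

abbreviation Lp_density :: "complex ^ 'n \<Rightarrow> real" where
  "Lp_density u \<equiv> norm (f0 u) * exp ((norm u)\<^sup>2 / 2)"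

lemma weighted_gauss_integrable:
  assumes "c > 0"
  shows "integrable lborel (\<lambda>u. Lp_density u * exp (- ((norm u)\<^sup>2 / c)))"
proof -
  have e: "Lp_density u * exp (- ((norm u)\<^sup>2 / c)) = norm (f0 u) * exp ((1 - 2 / c) * (norm u)\<^sup>2 / 2 + 0 * norm u)" for u
    unfolding mult.assoc mult_exp_exp using assms by (simp add: field_simps)
  show ?thesis unfolding e by (rule integrable_f0_exp) (use assms in simp)
qed

text \<open>The gain \<open>L^(-1/p)\<close> over the volume factor \<open>L^n\<close> comes from splitting at the level \<open>L^(-1/p)\<close>. For \<open>s = t = 0\<close> and \<open>a = b = 0\<close> it is what
makes the strip of the Mellin transform nonempty.\<close>

lemma weighted_gauss_bound:
  "\<exists>K\<ge>0. \<forall>L\<ge>1. (LINT u|lborel. Lp_density u * exp (- ((norm u)\<^sup>2 / (18 * L)))) \<le> K * L powr (real CARD('n) - 1 / p)"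
proof (intro exI conjI allI impI)
  let ?G = "(LINT u|lborel. Lp_density u powr p)"
  let ?n = "CARD('n)"
  show "0 \<le> (18 * pi) ^ ?n + ?G" by (intro add_nonneg_nonneg Bochner_Integration.integral_nonneg) auto
  fix L :: real assume L: "L \<ge> 1"
  \<comment> \<open>The level at which both terms of \<open>le_add_powr\<close> have at most the order \<open>L^(n - 1/p)\<close>.\<close>
  let ?\<theta> = "L powr (- (1 / p))"
  let ?e = "\<lambda>u :: complex ^ 'n. exp (- ((norm u)\<^sup>2 / (18 * L)))"
  have n1: "real ?n \<ge> 1" by (simp add: Suc_leI)
  have ei: "integrable lborel ?e"
    using integrable_gaussian_scale[of "1 / (18 * L)", where 'a = "complex ^ 'n"] L by simp
  have bi: "integrable lborel (\<lambda>u. ?\<theta> * ?e u + ?\<theta> powr (1 - p) * Lp_density u powr p)"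
    by (intro Bochner_Integration.integrable_add integrable_mult_right ei weighted_Lp)
  have "(LINT u|lborel. Lp_density u * ?e u) \<le> (LINT u|lborel. ?\<theta> * ?e u + ?\<theta> powr (1 - p) * Lp_density u powr p)"
  proof (rule integral_mono[OF weighted_gauss_integrable bi])
    fix u
    have "Lp_density u * ?e u \<le> (?\<theta> + ?\<theta> powr (1 - p) * Lp_density u powr p) * ?e u"
      using L p_ge_1 by (intro mult_right_mono le_add_powr) auto
    also have "\<dots> = ?\<theta> * ?e u + ?\<theta> powr (1 - p) * Lp_density u powr p * ?e u" by (rule distrib_right)
    also have "\<dots> \<le> ?\<theta> * ?e u + ?\<theta> powr (1 - p) * Lp_density u powr p * 1"
      using L by (intro add_left_mono mult_left_mono) auto
    finally show "Lp_density u * ?e u \<le> ?\<theta> * ?e u + ?\<theta> powr (1 - p) * Lp_density u powr p" by simp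
  qed (use L in auto)
  also have "\<dots> = ?\<theta> * (LINT u|lborel. ?e u) + ?\<theta> powr (1 - p) * ?G"
    by (simp only: Bochner_Integration.integral_add integrable_mult_right ei weighted_Lp integral_mult_right_zero)
  also have "(LINT u|lborel. ?e u) = (18 * pi) ^ ?n * L powr real ?n"
  proof -
    have "(LINT u|lborel. ?e u) = sqrt (pi * (18 * L)) ^ DIM(complex ^ 'n)"
      by (rule gaussian_integral_scale) (use L in simp)
    also have "DIM(complex ^ 'n) = 2 * ?n" by simp
    also have "sqrt (pi * (18 * L)) ^ (2 * ?n) = (pi * (18 * L)) ^ ?n"
      using L by (simp add: power_mult)
    finally show ?thesis using L by (simp add: power_mult_distrib powr_realpow mult_ac)
  qed
  also have "?\<theta> * ((18 * pi) ^ ?n * L powr real ?n) = (18 * pi) ^ ?n * L powr (real ?n - 1 / p)"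
    using L by (simp add: powr_diff powr_minus field_simps)
  also have "?\<theta> powr (1 - p) * ?G \<le> L powr (real ?n - 1 / p) * ?G"
  proof (intro mult_right_mono Bochner_Integration.integral_nonneg)
    have "- (1 / p) * (1 - p) = 1 - 1 / p" using p_ge_1 by (simp add: field_simps)
    then have "?\<theta> powr (1 - p) = L powr (1 - 1 / p)" by (simp only: powr_powr)
    also have "\<dots> \<le> L powr (real ?n - 1 / p)" using L n1 by (intro powr_mono) auto
    finally show "?\<theta> powr (1 - p) \<le> L powr (real ?n - 1 / p)" .
  qed simp
  finally show "(LINT u|lborel. Lp_density u * ?e u) \<le> ((18 * pi) ^ ?n + ?G) * L powr (real ?n - 1 / p)"
    by (simp add: algebra_simps)
qed

lemma moment_explicit:
  assumes \<tau>: "Re \<tau> < 1"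
  shows "moment \<eta> v a b \<tau> = (LINT u|lborel. f0 u * exp (\<tau> * of_real ((norm u)\<^sup>2) / 2)
        * circle_coeff s a (bdot \<eta> (vcnj u)) (bdot \<eta> \<alpha>) (\<tau> / 2 * bdot \<alpha> u)
        * circle_coeff t b (bdot v u) (bdot v \<beta>) (- ((1 - \<tau>) / 2 * bdot \<beta> (vcnj u))))"
  using Omega_integral_term[OF \<tau>, of \<eta> a v b 0 0] unfolding moment_def by (simp only: bdot_simps add_0_right add_0_left diff_0)

text \<open>With \<open>1 - Re \<tau>\<close> of order \<open>1/L\<close> the Gaussian weight lives on \<open>|u| \<le> sqrt L\<close>, where the two circle
coefficients are of the size of the stated powers.\<close>

lemma moment_bound:
  "\<exists>C\<ge>0. \<forall>\<tau> L. 1 \<le> L \<longrightarrow> 2 / (9 * L) \<le> 1 - Re \<tau> \<longrightarrow> norm \<tau> \<le> 3 \<longrightarrow> norm (1 - \<tau>) \<le> 2 / L \<longrightarrow>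
     norm (moment \<eta> v a b \<tau>) \<le> C * (norm \<tau> ^ (s - a) * L powr (real (a + b + s + t) / 2 - real t + (real CARD('n) - 1 / p)))"
proof -
  let ?M = "a + b + s + t" and ?n = "CARD('n)"
  obtain K1 where K1: "K1 \<ge> 0" "\<And>\<rho>::real. \<rho> \<ge> 0 \<Longrightarrow> (1 + \<rho>) ^ ?M * exp (- (\<rho>\<^sup>2 / 9)) \<le> K1 * exp (- (\<rho>\<^sup>2 / 18))"
    using poly_gauss_bound[of ?M] by blast
  obtain K2 where K2: "K2 \<ge> 0" "\<And>L. L \<ge> 1 \<Longrightarrow> (LINT u|lborel. Lp_density u * exp (- ((norm u)\<^sup>2 / (18 * L)))) \<le> K2 * L powr (real ?n - 1 / p)"
    using weighted_gauss_bound by blast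
  define S1 where "S1 = (\<Sum>k\<le>min a s. real (a choose k) * norm \<eta> ^ (a - k) * (norm \<eta> * norm \<alpha>) ^ k * norm \<alpha> ^ (s - k) * 3 ^ s)"
  define S2 where "S2 = (\<Sum>k\<le>min b t. real (b choose k) * norm v ^ (b - k) * (norm v * norm \<beta>) ^ k * norm \<beta> ^ (t - k))"
  have S: "S1 \<ge> 0" "S2 \<ge> 0" unfolding S1_def S2_def by (intro sum_nonneg mult_nonneg_nonneg zero_le_power; simp)+
  show ?thesis
  proof (intro exI conjI allI impI)
    show "0 \<le> S1 * S2 * K1 * K2" using S K1(1) K2(1) by simp
    fix \<tau> :: complex and L :: real
    assume L: "1 \<le> L" and r: "2 / (9 * L) \<le> 1 - Re \<tau>" and t3: "norm \<tau> \<le> 3" and t2: "norm (1 - \<tau>) \<le> 2 / L"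
    have "0 < 2 / (9 * L)" using L by simp
    then have \<tau>: "Re \<tau> < 1" using r by linarith
    let ?\<sigma> = "norm \<tau>"
    let ?Q = "S1 * S2 * K1 * (?\<sigma> ^ (s - a) * (sqrt L ^ ?M / L ^ t))"
    let ?F = "\<lambda>u. f0 u * exp (\<tau> * of_real ((norm u)\<^sup>2) / 2)
        * circle_coeff s a (bdot \<eta> (vcnj u)) (bdot \<eta> \<alpha>) (\<tau> / 2 * bdot \<alpha> u)
        * circle_coeff t b (bdot v u) (bdot v \<beta>) (- ((1 - \<tau>) / 2 * bdot \<beta> (vcnj u)))"
    have bd: "norm (?F u) \<le> ?Q * (Lp_density u * exp (- ((norm u)\<^sup>2 / (18 * L))))" for u
    proof -
      \<comment> \<open>\<open>w\<close> bounds both \<open>norm u\<close> and the natural length \<open>sqrt L\<close>.\<close>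
      define w where "w = sqrt L + norm u"
      define \<rho> where "\<rho> = norm u / sqrt L"
      have sL: "sqrt L \<ge> 1" using L by simp
      have w1: "1 \<le> w" "norm u \<le> w" "sqrt L \<le> w" using sL by (auto simp: w_def add_increasing2)
      have wL: "L \<le> w\<^sup>2" using power_mono[OF w1(3), of 2] L by simp
      have \<rho>: "\<rho> \<ge> 0" "\<rho>\<^sup>2 = (norm u)\<^sup>2 / L" using L by (auto simp: \<rho>_def power_divide)
      have w\<rho>: "w = sqrt L * (1 + \<rho>)" using L by (simp add: w_def \<rho>_def field_simps)
      have c1: "norm (circle_coeff s a (bdot \<eta> (vcnj u)) (bdot \<eta> \<alpha>) (\<tau> / 2 * bdot \<alpha> u)) \<le> S1 * (?\<sigma> ^ (s - a) * w ^ (a + s))"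
        unfolding S1_def
      proof (rule circle_coeff_bound1)
        show "norm (bdot \<eta> (vcnj u)) \<le> norm \<eta> * w"
          using norm_bdot_le[of \<eta> "vcnj u"] mult_left_mono[OF w1(2) norm_ge_zero[of \<eta>]] by simp
        show "norm (bdot \<eta> \<alpha>) \<le> norm \<eta> * norm \<alpha>" by (rule norm_bdot_le)
        have "norm (\<tau> / 2 * bdot \<alpha> u) \<le> ?\<sigma> / 2 * (norm \<alpha> * w)"
          unfolding norm_mult using norm_bdot_le[of \<alpha> u] mult_left_mono[OF w1(2) norm_ge_zero[of \<alpha>]]
          by (intro mult_mono) (auto simp: norm_divide)
        also have "\<dots> \<le> ?\<sigma> * (norm \<alpha> * w)" using w1(1) by (intro mult_right_mono) auto
        finally show "norm (\<tau> / 2 * bdot \<alpha> u) \<le> norm \<alpha> * (?\<sigma> * w)" by (simp only: mult_ac)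
      qed (use t3 w1 in auto)
      have c2: "norm (circle_coeff t b (bdot v u) (bdot v \<beta>) (- ((1 - \<tau>) / 2 * bdot \<beta> (vcnj u)))) \<le> S2 * (w ^ (b + t) / L ^ t)"
        unfolding S2_def
      proof (rule circle_coeff_bound2)
        show "norm (bdot v u) \<le> norm v * w"
          using norm_bdot_le[of v u] mult_left_mono[OF w1(2) norm_ge_zero[of v]] by simp
        show "norm (bdot v \<beta>) \<le> norm v * norm \<beta>" by (rule norm_bdot_le)
        have "norm (- ((1 - \<tau>) / 2 * bdot \<beta> (vcnj u))) \<le> (2 / L) / 2 * (norm \<beta> * w)"
          unfolding norm_minus_cancel norm_mult norm_divide using t2 L norm_bdot_le[of \<beta> "vcnj u"] mult_left_mono[OF w1(2) norm_ge_zero[of \<beta>]]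
          by (intro mult_mono) auto
        then show "norm (- ((1 - \<tau>) / 2 * bdot \<beta> (vcnj u))) \<le> norm \<beta> * (w / L)" by simp
      qed (use L wL w1 in auto)
      have e: "norm (f0 u * exp (\<tau> * of_real ((norm u)\<^sup>2) / 2)) \<le> Lp_density u * exp (- (\<rho>\<^sup>2 / 9))"
      proof -
        have "2 / (9 * L) * (norm u)\<^sup>2 \<le> (1 - Re \<tau>) * (norm u)\<^sup>2" by (intro mult_right_mono r) simp
        then have "Re (\<tau> * of_real ((norm u)\<^sup>2) / 2) \<le> (norm u)\<^sup>2 / 2 + - (\<rho>\<^sup>2 / 9)"
          unfolding \<rho>(2) using L by (simp add: algebra_simps)
        then show ?thesis unfolding norm_mult norm_exp_eq_Re mult.assoc mult_exp_exp by (intro mult_left_mono) auto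
      qed
      have "norm (?F u) \<le> (Lp_density u * exp (- (\<rho>\<^sup>2 / 9))) * (S1 * (?\<sigma> ^ (s - a) * w ^ (a + s))) * (S2 * (w ^ (b + t) / L ^ t))"
        unfolding norm_mult[of "f0 u * exp (\<tau> * of_real ((norm u)\<^sup>2) / 2) * _"] norm_mult[of "f0 u * exp (\<tau> * of_real ((norm u)\<^sup>2) / 2)"]
        using S L w1 by (intro mult_mono e c1 c2) auto
      also have "\<dots> = S1 * S2 * (?\<sigma> ^ (s - a) / L ^ t) * Lp_density u * (w ^ ((a + s) + (b + t)) * exp (- (\<rho>\<^sup>2 / 9)))"
        unfolding power_add[of w "a + s"] by simp
      also have "w ^ ((a + s) + (b + t)) * exp (- (\<rho>\<^sup>2 / 9)) = sqrt L ^ ?M * ((1 + \<rho>) ^ ?M * exp (- (\<rho>\<^sup>2 / 9)))"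
        unfolding w\<rho> power_mult_distrib by (simp add: ac_simps)
      also have "S1 * S2 * (?\<sigma> ^ (s - a) / L ^ t) * Lp_density u * (sqrt L ^ ?M * ((1 + \<rho>) ^ ?M * exp (- (\<rho>\<^sup>2 / 9))))
        \<le> S1 * S2 * (?\<sigma> ^ (s - a) / L ^ t) * Lp_density u * (sqrt L ^ ?M * (K1 * exp (- (\<rho>\<^sup>2 / 18))))"
        using S L by (intro mult_left_mono K1(2) \<rho>(1)) auto
      also have "\<dots> = ?Q * (Lp_density u * exp (- ((norm u)\<^sup>2 / (18 * L))))"
        unfolding \<rho>(2) by (simp add: mult_ac)
      finally show ?thesis .
    qed
    have Q0: "?Q \<ge> 0" using S K1(1) L by simp
    have wi: "integrable lborel (\<lambda>u. ?Q * (Lp_density u * exp (- ((norm u)\<^sup>2 / (18 * L)))))"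
      by (intro integrable_mult_right weighted_gauss_integrable) (use L in simp)
    have "norm (moment \<eta> v a b \<tau>) \<le> (LINT u|lborel. norm (?F u))"
      unfolding moment_explicit[OF \<tau>] by (rule integral_norm_bound)
    also have "\<dots> \<le> (LINT u|lborel. ?Q * (Lp_density u * exp (- ((norm u)\<^sup>2 / (18 * L)))))"
      by (rule integral_mono'[OF wi bd]) (rule mult_nonneg_nonneg[OF Q0], simp)
    also have "\<dots> = ?Q * (LINT u|lborel. Lp_density u * exp (- ((norm u)\<^sup>2 / (18 * L))))" by (rule integral_mult_right_zero)
    also have "\<dots> \<le> ?Q * (K2 * L powr (real ?n - 1 / p))" by (intro mult_left_mono K2(2) L Q0)
    also have "\<dots> = S1 * S2 * K1 * K2 * (?\<sigma> ^ (s - a) * L powr (real ?M / 2 - real t + (real ?n - 1 / p)))"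
    proof -
      have "sqrt L ^ ?M = L powr (real ?M / 2)"
        using L by (simp add: powr_half_sqrt[symmetric] powr_realpow[symmetric] powr_powr)
      moreover have "L ^ t = L powr real t" using L by (simp add: powr_realpow)
      ultimately have "sqrt L ^ ?M / L ^ t * L powr (real ?n - 1 / p) = L powr (real ?M / 2 - real t + (real ?n - 1 / p))"
        using L by (simp only: powr_add powr_diff)
      then have "S1 * S2 * K1 * K2 * (?\<sigma> ^ (s - a) * (sqrt L ^ ?M / L ^ t * L powr (real ?n - 1 / p))) = S1 * S2 * K1 * K2 * (?\<sigma> ^ (s - a) * L powr (real ?M / 2 - real t + (real ?n - 1 / p)))"
        by (simp only:)
      then show ?thesis by (simp only: mult_ac)
    qed
    finally show "norm (moment \<eta> v a b \<tau>) \<le> S1 * S2 * K1 * K2 * (?\<sigma> ^ (s - a) * L powr (real ?M / 2 - real t + (real ?n - 1 / p)))" .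
  qed
qed

text \<open>On the disc around \<open>y\<close> all quantities of \<open>moment_bound\<close> are comparable to their values at \<open>y\<close>, with \<open>L = 1 + y\<close>.\<close>

lemma moment_moebius_bound:
  "\<exists>C. \<forall>y y'. y > 0 \<longrightarrow> norm (y' - of_real y) \<le> y / 2 \<longrightarrow>
     norm (moebius_tr (moment \<eta> v a b) (CARD('n) + a + b) y') \<le> C * (y powr real (s - a) * (1 + y) powr (- real (s - a) - ((real a + real b + real t - real s) / 2 + 1 / p)))"
proof -
  let ?N = "CARD('n) + a + b"
  let ?E = "real (a + b + s + t) / 2 - real t + (real CARD('n) - 1 / p)"
  obtain C where C: "C \<ge> 0" "\<And>\<tau> L. 1 \<le> L \<Longrightarrow> 2 / (9 * L) \<le> 1 - Re \<tau> \<Longrightarrow> norm \<tau> \<le> 3 \<Longrightarrow> norm (1 - \<tau>) \<le> 2 / L \<Longrightarrow>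
     norm (moment \<eta> v a b \<tau>) \<le> C * (norm \<tau> ^ (s - a) * L powr ?E)"
    using moment_bound[of \<eta> v a b] by blast
  show ?thesis
  proof (intro exI allI impI)
    fix y :: real and y' :: complex
    assume y: "y > 0" and y': "norm (y' - of_real y) \<le> y / 2"
    define L where "L = 1 + y"
    define z where "z = 1 + y'"
    define \<tau> where "\<tau> = y' / z"
    have L: "L \<ge> 1" "y \<le> L" "L > 0" using y by (auto simp: L_def)
    have "\<bar>Re (y' - of_real y)\<bar> \<le> y / 2" using y' abs_Re_le_cmod order_trans by blast
    then have "\<bar>Re y' - y\<bar> \<le> y / 2" by simp
    then have "Re y' \<ge> y / 2" by linarith
    then have Rz: "Re z \<ge> L / 2" using y by (simp add: z_def L_def)
    have nz: "norm z \<ge> L / 2" using Rz complex_Re_le_cmod[of z] by linarith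
    have z0: "z \<noteq> 0" using nz L by auto
    have ny: "norm y' \<le> 3 * y / 2"
      using norm_triangle_ineq[of "y' - of_real y" "of_real y"] y' y by simp
    have nz2: "norm z \<le> 3 / 2 * L"
      using norm_triangle_ineq[of 1 y'] ny unfolding z_def L_def by simp
    have t1: "1 - \<tau> = 1 / z" using z0 by (simp add: \<tau>_def z_def field_simps)
    have "norm (1 - \<tau>) = 1 / norm z" unfolding t1 by (simp add: norm_divide)
    also have "\<dots> \<le> 1 / (L / 2)" using nz L by (intro frac_le) auto
    finally have b1: "norm (1 - \<tau>) \<le> 2 / L" by simp
    have b2: "2 / (9 * L) \<le> 1 - Re \<tau>"
    proof -
      have "1 - Re \<tau> = Re (1 / z)" using t1 by (metis minus_complex.simps(1) one_complex.simps(1))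
      also have "\<dots> = Re z / (norm z)\<^sup>2" by (simp add: Re_divide cmod_power2)
      finally have eq: "1 - Re \<tau> = Re z / (norm z)\<^sup>2" .
      have "(norm z)\<^sup>2 \<le> (3 / 2 * L)\<^sup>2" using nz2 by (intro power_mono) auto
      then have "(L / 2) / (3 / 2 * L)\<^sup>2 \<le> Re z / (norm z)\<^sup>2"
        using Rz L z0 by (intro frac_le) auto
      moreover have "(L / 2) / (3 / 2 * L)\<^sup>2 = 2 / (9 * L)" using L by (simp add: power2_eq_square field_simps)
      ultimately show ?thesis using eq by simp
    qed
    have "norm \<tau> = norm y' / norm z" by (simp add: \<tau>_def norm_divide)
    also have "\<dots> \<le> (3 * y / 2) / (L / 2)" using ny nz L y by (intro frac_le) auto
    finally have b3: "norm \<tau> \<le> 3 * (y / L)" by simp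
    have b4: "norm \<tau> \<le> 3" using b3 L y by (smt (verit) divide_le_eq_1)
    have "norm (moebius_tr (moment \<eta> v a b) ?N y') = norm (moment \<eta> v a b \<tau>) / norm z ^ ?N"
      by (simp add: moebius_tr_def \<tau>_def z_def norm_divide norm_power)
    also have "\<dots> \<le> (C * (norm \<tau> ^ (s - a) * L powr ?E)) / (L / 2) ^ ?N"
      using nz L C(1) by (intro frac_le C(2) L b2 b4 b1 power_mono) auto
    also have "\<dots> \<le> (C * ((3 * (y / L)) ^ (s - a) * L powr ?E)) / (L / 2) ^ ?N"
      using L C(1) b3 by (intro divide_right_mono mult_left_mono mult_right_mono power_mono) auto
    also have "\<dots> = C * 3 ^ (s - a) * 2 ^ ?N * (y powr real (s - a) * (L powr (- real (s - a)) * L powr ?E * L powr (- real ?N)))"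
    proof -
      have Lp: "L powr (- real k) = 1 / L ^ k" for k
        using L by (simp add: powr_minus powr_realpow divide_inverse)
      have "L powr (- real ?N) = 1 / L ^ ?N" "L powr (- real (s - a)) = 1 / L ^ (s - a)" "y powr real (s - a) = y ^ (s - a)"
        using y by (simp_all only: Lp powr_realpow)
      then show ?thesis by (simp only: power_divide power_mult_distrib) (simp add: mult_ac)
    qed
    also have "L powr (- real (s - a)) * L powr ?E * L powr (- real ?N) = L powr (- real (s - a) - ((real a + real b + real t - real s) / 2 + 1 / p))"
      unfolding powr_add[symmetric] by (rule arg_cong[of _ _ "\<lambda>x. L powr x"]) (simp add: field_simps)
    finally show "norm (moebius_tr (moment \<eta> v a b) ?N y') \<le> C * 3 ^ (s - a) * 2 ^ ?N * (y powr real (s - a) * (1 + y) powr (- real (s - a) - ((real a + real b + real t - real s) / 2 + 1 / p)))"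
      unfolding L_def .
  qed
qed

text \<open>Induction on \<open>a\<close>, as required by \<open>moment_ode\<close>. The Mellin strip is nonempty because \<open>A + B\<close> is at least \<open>1/p\<close>.\<close>

lemma moment_vanish:
  assumes R: "R > 0"
    and cond: "\<And>z t'. norm z = R \<Longrightarrow> 0 < t' \<Longrightarrow> t' < 1 \<Longrightarrow> (LINT \<omega>|Omega. lifted_f0 \<omega> * exp (of_real t' * (lift_xy \<omega> / 2)
        + bdot (- (of_real t' / 2) *s z) (lift_x \<omega>) + bdot (of_real ((1 - t') / 2) *s vcnj z) (lift_y \<omega>))) = 0"
  shows "Re \<tau> < 1 \<Longrightarrow> moment \<eta> v a b \<tau> = 0"
proof (induction a arbitrary: b \<tau> rule: less_induct)
  case (less a)
  let ?A = "real (s - a)" and ?B = "(real a + real b + real t - real s) / 2 + 1 / p"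
  obtain C where C: "\<And>y y'. y > 0 \<Longrightarrow> norm (y' - of_real y) \<le> y / 2 \<Longrightarrow>
     norm (moebius_tr (moment \<eta> v a b) (CARD('n) + a + b) y') \<le> C * (y powr ?A * (1 + y) powr (- ?A - ?B))"
    using moment_moebius_bound[of \<eta> v a b] by blast
  have p: "1 / p > 0" using p_ge_1 by simp
  have AB: "?A + ?B > 0"
  proof (cases "s \<ge> a")
    case True
    then have "?A + ?B = (real s - real a + real b + real t) / 2 + 1 / p" by (simp add: of_nat_diff field_simps)
    then show ?thesis using p True by (smt (verit) divide_nonneg_pos of_nat_0_le_iff of_nat_mono)
  next
    case False
    then show ?thesis using p by (simp add: add_nonneg_pos)
  qed
  show ?case
  proof (rule mellin_vanish[OF moment_holomorphic _ _ AB _ C less.prems])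
    show "1 \<le> CARD('n) + a + b" by (simp add: Suc_leI trans_le_add1)
    show "R\<^sup>2 / 2 > 0" using R by simp
    fix t' :: real assume t': "0 < t'" "t' < 1"
    show "(\<lambda>j. (- of_real (R\<^sup>2 / 2 * t' * (1 - t'))) ^ j / (fact j * fact (CARD('n) + a + b + j - 1)) * (deriv ^^ j) (moment \<eta> v a b) (of_real t')) sums 0"
      by (rule moment_ode[OF R t' cond[OF _ t'] less.IH]) auto
  qed
qed

section \<open>From vanishing moments to the vanishing of the density\<close>

text \<open>The moments at \<open>\<tau> = 0\<close> with \<open>\<eta> = X\<close> and \<open>v = \<Xi>\<close> are the coefficients of a double exponential series.\<close>

lemma Omega_exp_vanish:
  assumes V: "\<And>a b. moment X \<Xi> a b 0 = 0"
  shows "(LINT \<omega>|Omega. lifted_f0 \<omega> * exp (bdot X (lift_x \<omega>) + bdot \<Xi> (lift_y \<omega>))) = 0"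
proof -
  have m: "(\<lambda>\<omega>. bdot X (lift_x \<omega>)) \<in> borel_measurable Omega" "(\<lambda>\<omega>. bdot \<Xi> (lift_y \<omega>)) \<in> borel_measurable Omega" "lifted_f0 \<in> borel_measurable Omega"
    by measurable
  let ?E = "\<lambda>\<omega>. norm (lifted_f0 \<omega>) * exp (norm (bdot X (lift_x \<omega>)) + norm (bdot \<Xi> (lift_y \<omega>)))"
  have EI: "integrable Omega ?E"
    using Omega_exp_integrable[of 0 0 0 0 X \<Xi>] by simp
  have I1: "integrable Omega (\<lambda>\<omega>. norm (lifted_f0 \<omega> * bdot X (lift_x \<omega>) ^ a) * exp (1 * norm (bdot \<Xi> (lift_y \<omega>))))" for a
  proof (rule Bochner_Integration.integrable_bound)
    show "integrable Omega (\<lambda>\<omega>. fact a * ?E \<omega>)" using EI by (rule integrable_mult_right)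
    show "AE \<omega> in Omega. norm (norm (lifted_f0 \<omega> * bdot X (lift_x \<omega>) ^ a) * exp (1 * norm (bdot \<Xi> (lift_y \<omega>)))) \<le> norm (fact a * ?E \<omega>)"
    proof (rule AE_I2)
      fix \<omega>
      have "norm (bdot X (lift_x \<omega>)) ^ a \<le> fact a * exp (norm (bdot X (lift_x \<omega>)))"
        using power_le_fact_exp[of 1 "norm (bdot X (lift_x \<omega>))" a] by simp
      then have "norm (lifted_f0 \<omega>) * norm (bdot X (lift_x \<omega>)) ^ a * exp (norm (bdot \<Xi> (lift_y \<omega>))) \<le> norm (lifted_f0 \<omega>) * (fact a * exp (norm (bdot X (lift_x \<omega>)))) * exp (norm (bdot \<Xi> (lift_y \<omega>)))"
        by (intro mult_right_mono mult_left_mono) auto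
      also have "\<dots> = fact a * ?E \<omega>" unfolding exp_add by (simp only: mult_ac)
      finally have "norm (lifted_f0 \<omega>) * norm (bdot X (lift_x \<omega>)) ^ a * exp (norm (bdot \<Xi> (lift_y \<omega>))) \<le> fact a * ?E \<omega>" .
      then have "norm (norm (lifted_f0 \<omega> * bdot X (lift_x \<omega>) ^ a) * exp (1 * norm (bdot \<Xi> (lift_y \<omega>)))) \<le> fact a * ?E \<omega>"
        by (simp only: real_norm_def norm_mult norm_power abs_mult abs_norm_cancel abs_exp_cancel power_abs mult_1_left)
      then show "norm (norm (lifted_f0 \<omega> * bdot X (lift_x \<omega>) ^ a) * exp (1 * norm (bdot \<Xi> (lift_y \<omega>)))) \<le> norm (fact a * ?E \<omega>)"
        by (rule order_trans) (simp only: real_norm_def abs_ge_self)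
    qed
  qed (use m in measurable)
  have 1: "(LINT \<omega>|Omega. lifted_f0 \<omega> * exp (bdot \<Xi> (lift_y \<omega>)) * bdot X (lift_x \<omega>) ^ a) = 0" for a
  proof -
    have "(\<lambda>k. (LINT \<omega>|Omega. (lifted_f0 \<omega> * bdot X (lift_x \<omega>) ^ a) * bdot \<Xi> (lift_y \<omega>) ^ k) / fact k * 1 ^ k) sums (LINT \<omega>|Omega. (lifted_f0 \<omega> * bdot X (lift_x \<omega>) ^ a) * exp (1 * bdot \<Xi> (lift_y \<omega>)))"
      by (rule integral_exp_sums[OF _ _ I1]) (use m in auto)
    moreover have "(LINT \<omega>|Omega. (lifted_f0 \<omega> * bdot X (lift_x \<omega>) ^ a) * bdot \<Xi> (lift_y \<omega>) ^ k) = 0" for k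
      using V[of a k] by (simp only: moment_def mult_zero_left exp_zero mult_1_right)
    ultimately have "(\<lambda>k. 0) sums (LINT \<omega>|Omega. (lifted_f0 \<omega> * bdot X (lift_x \<omega>) ^ a) * exp (1 * bdot \<Xi> (lift_y \<omega>)))"
      by (simp only: div_0 mult_zero_left)
    from sums_unique2[OF this sums_zero] show ?thesis by (simp only: mult_1_left mult_ac)
  qed
  have I2: "integrable Omega (\<lambda>\<omega>. norm (lifted_f0 \<omega> * exp (bdot \<Xi> (lift_y \<omega>))) * exp (1 * norm (bdot X (lift_x \<omega>))))"
  proof (rule Bochner_Integration.integrable_bound[OF EI])
    show "AE \<omega> in Omega. norm (norm (lifted_f0 \<omega> * exp (bdot \<Xi> (lift_y \<omega>))) * exp (1 * norm (bdot X (lift_x \<omega>)))) \<le> norm (?E \<omega>)"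
    proof (rule AE_I2)
      fix \<omega>
      have "norm (lifted_f0 \<omega>) * norm (exp (bdot \<Xi> (lift_y \<omega>))) * exp (norm (bdot X (lift_x \<omega>))) \<le> norm (lifted_f0 \<omega>) * exp (norm (bdot \<Xi> (lift_y \<omega>))) * exp (norm (bdot X (lift_x \<omega>)))"
        by (intro mult_right_mono mult_left_mono norm_exp_le) auto
      also have "\<dots> = ?E \<omega>" unfolding exp_add by (simp only: mult_ac)
      finally show "norm (norm (lifted_f0 \<omega> * exp (bdot \<Xi> (lift_y \<omega>))) * exp (1 * norm (bdot X (lift_x \<omega>)))) \<le> norm (?E \<omega>)"
        unfolding real_norm_def abs_mult abs_norm_cancel abs_exp_cancel norm_mult mult_1_left .
    qed
  qed (use m in measurable)
  have "(\<lambda>k. (LINT \<omega>|Omega. (lifted_f0 \<omega> * exp (bdot \<Xi> (lift_y \<omega>))) * bdot X (lift_x \<omega>) ^ k) / fact k * 1 ^ k) sums (LINT \<omega>|Omega. (lifted_f0 \<omega> * exp (bdot \<Xi> (lift_y \<omega>))) * exp (1 * bdot X (lift_x \<omega>)))"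
    by (rule integral_exp_sums[OF _ _ I2]) (use m in auto)
  then have "(\<lambda>k. 0) sums (LINT \<omega>|Omega. (lifted_f0 \<omega> * exp (bdot \<Xi> (lift_y \<omega>))) * exp (1 * bdot X (lift_x \<omega>)))"
    by (simp only: 1 div_0 mult_zero_left)
  from sums_unique2[OF this sums_zero] show ?thesis by (simp only: exp_add mult_1_left mult_ac)
qed

text \<open>For \<open>b = 0\<close> this is the Fourier-Laplace transform of \<open>f0\<close> in the variables \<open>u\<close> and \<open>cnj u\<close>.\<close>

definition beta_moment :: "nat \<Rightarrow> complex ^ 'n \<Rightarrow> complex ^ 'n \<Rightarrow> complex" where
  "beta_moment b X \<Xi> = (LINT u|lborel. f0 u * (bdot \<Xi> \<beta> - bdot \<beta> (vcnj u) / 2) ^ b * exp (bdot X (vcnj u) + bdot \<Xi> u))"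

lemma beta_moment_t_vanish:
  assumes V: "\<And>a b. moment X \<Xi> a b 0 = 0" and X: "bdot X \<alpha> ^ s \<noteq> 0"
  shows "beta_moment t X \<Xi> = 0"
proof -
  have "(LINT \<omega>|Omega. lifted_term 0 0 0 0 \<omega> * exp (0 * (lift_xy \<omega> / 2) + bdot X (lift_x \<omega>) + bdot \<Xi> (lift_y \<omega>))) = 0"
    using Omega_exp_vanish[OF V] by (simp only: power_0 mult_1_right mult_zero_left add_0_left)
  then have "(LINT u|lborel. f0 u * exp (0 * of_real ((norm u)\<^sup>2) / 2 + bdot X (vcnj u) + bdot \<Xi> u)
        * circle_coeff s 0 (bdot 0 (vcnj u)) (bdot 0 \<alpha>) (bdot X \<alpha> + 0 / 2 * bdot \<alpha> u)
        * circle_coeff t 0 (bdot 0 u) (bdot 0 \<beta>) (bdot \<Xi> \<beta> - (1 - 0) / 2 * bdot \<beta> (vcnj u))) = 0"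
    using Omega_integral_term[of 0 0 0 0 0 X \<Xi>] by simp
  moreover have "circle_coeff k 0 A B D = D ^ k / fact k" for k A B D
    by (simp add: circle_coeff_def)
  ultimately have "(LINT u|lborel. (bdot X \<alpha> ^ s / fact s / fact t) * (f0 u * (bdot \<Xi> \<beta> - bdot \<beta> (vcnj u) / 2) ^ t * exp (bdot X (vcnj u) + bdot \<Xi> u))) = 0"
    by (simp add: mult_ac)
  then show ?thesis unfolding beta_moment_def integral_mult_right_zero using X by auto
qed

lemma f0_mult_integrable:
  fixes \<phi> :: "complex ^ 'n \<Rightarrow> 'b::{banach, second_countable_topology}"
  assumes m: "\<phi> \<in> borel_measurable borel" and b: "\<And>u. norm (\<phi> u) \<le> K * (norm (f0 u) * exp (C * norm u))"
  shows "integrable lborel \<phi>"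
proof (rule Bochner_Integration.integrable_bound)
  show "integrable lborel (\<lambda>u. K * (norm (f0 u) * exp (0 * (norm u)\<^sup>2 / 2 + C * norm u)))"
    by (intro integrable_mult_right integrable_f0_exp) simp
  show "AE u in lborel. norm (\<phi> u) \<le> norm (K * (norm (f0 u) * exp (0 * (norm u)\<^sup>2 / 2 + C * norm u)))"
    unfolding real_norm_def mult_zero_left div_0 add_0_left by (intro AE_I2 order_trans[OF b abs_ge_self])
qed (use m in simp)

lemma beta_moment_dominated:
  "integrable lborel (\<lambda>u. norm (f0 u * (e - bdot \<beta> (vcnj u) / 2) ^ b * exp (bdot X (vcnj u) + bdot \<Xi> u)) * exp (\<rho> * norm u))"
proof -
  let ?c = "norm e + norm \<beta>"
  have b1: "norm ((e - bdot \<beta> (vcnj u) / 2) ^ b) \<le> fact b * (exp ?c * exp (?c * norm u))" for u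
  proof -
    have "norm (e - bdot \<beta> (vcnj u) / 2) \<le> norm e + norm \<beta> * norm u / 2"
      using norm_triangle_ineq4[of e "bdot \<beta> (vcnj u) / 2"] norm_bdot_le[of \<beta> "vcnj u"] by (simp add: norm_divide)
    also have "\<dots> \<le> ?c * 1 + ?c * norm u"
      by (simp add: algebra_simps add_increasing add_increasing2)
    finally have n: "norm (e - bdot \<beta> (vcnj u) / 2) \<le> ?c + ?c * norm u" by simp
    have "norm ((e - bdot \<beta> (vcnj u) / 2) ^ b) \<le> fact b * exp (norm (e - bdot \<beta> (vcnj u) / 2))"
      using power_le_fact_exp[of 1 "norm (e - bdot \<beta> (vcnj u) / 2)" b] by (simp add: norm_power)
    also have "\<dots> \<le> fact b * exp (?c + ?c * norm u)" using n by simp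
    finally show ?thesis by (simp add: exp_add)
  qed
  have b2: "norm (exp (bdot X (vcnj u) + bdot \<Xi> u)) \<le> exp ((norm X + norm \<Xi>) * norm u)" for u
  proof -
    have "norm (bdot X (vcnj u) + bdot \<Xi> u) \<le> (norm X + norm \<Xi>) * norm u"
      using norm_triangle_ineq[of "bdot X (vcnj u)" "bdot \<Xi> u"] norm_bdot_le[of X "vcnj u"] norm_bdot_le[of \<Xi> u] by (simp add: distrib_right)
    then show ?thesis using norm_exp_le[of "bdot X (vcnj u) + bdot \<Xi> u"] by (meson exp_le_cancel_iff order_trans)
  qed
  show ?thesis
  proof (rule f0_mult_integrable)
    fix u
    have "norm (f0 u) * norm ((e - bdot \<beta> (vcnj u) / 2) ^ b) * norm (exp (bdot X (vcnj u) + bdot \<Xi> u)) * exp (\<rho> * norm u)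
      \<le> norm (f0 u) * (fact b * (exp ?c * exp (?c * norm u))) * exp ((norm X + norm \<Xi>) * norm u) * exp (\<rho> * norm u)"
      by (intro mult_right_mono mult_mono mult_left_mono b1 b2) auto
    also have "\<dots> = fact b * exp ?c * (norm (f0 u) * exp ((?c + (norm X + norm \<Xi>) + \<rho>) * norm u))"
      by (simp add: distrib_right exp_add)
    finally show "norm (norm (f0 u * (e - bdot \<beta> (vcnj u) / 2) ^ b * exp (bdot X (vcnj u) + bdot \<Xi> u)) * exp (\<rho> * norm u))
      \<le> fact b * exp ?c * (norm (f0 u) * exp ((?c + (norm X + norm \<Xi>) + \<rho>) * norm u))"
      by (simp only: real_norm_def abs_mult abs_norm_cancel abs_exp_cancel norm_mult)
  qed measurable
qed

lemma beta_moment_integrable: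
  "integrable lborel (\<lambda>u. f0 u * (e - bdot \<beta> (vcnj u) / 2) ^ b * exp (bdot X (vcnj u) + bdot \<Xi> u))"
proof (rule integrable_norm_cancel)
  show "integrable lborel (\<lambda>u. norm (f0 u * (e - bdot \<beta> (vcnj u) / 2) ^ b * exp (bdot X (vcnj u) + bdot \<Xi> u)))"
    using beta_moment_dominated[of e b X \<Xi> 0] by (simp only: mult_zero_left exp_zero mult_1_right)
qed measurable

text \<open>Differentiating in \<open>c\<close> produces \<open>\<beta>\<cdot>cnj u\<close>, which is \<open>2 \<Xi>\<cdot>\<beta>\<close> minus twice the factor of the moment; the latter
contributes the moment of degree \<open>b + 1\<close>, which vanishes. So the derivative is a multiple of the
function.\<close>

lemma beta_moment_shift:
  assumes \<beta>\<alpha>: "\<And>c. bdot (X + c *s \<beta>) \<alpha> = bdot X \<alpha>"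
    and Z: "\<And>X'. bdot X' \<alpha> = bdot X \<alpha> \<Longrightarrow> beta_moment (Suc b) X' \<Xi> = 0"
  shows "beta_moment b (X + c *s \<beta>) \<Xi> = exp (2 * c * bdot \<Xi> \<beta>) * beta_moment b X \<Xi>"
proof -
  let ?h = "\<lambda>u. f0 u * (bdot \<Xi> \<beta> - bdot \<beta> (vcnj u) / 2) ^ b * exp (bdot X (vcnj u) + bdot \<Xi> u)"
  let ?a = "\<lambda>u. bdot \<beta> (vcnj u)"
  let ?F = "\<lambda>c. LINT u|lborel. ?h u * exp (c * ?a u)"
  have m: "?h \<in> borel_measurable lborel" "?a \<in> borel_measurable lborel" by measurable
  have ec: "?h u * exp (c * ?a u) = f0 u * (bdot \<Xi> \<beta> - bdot \<beta> (vcnj u) / 2) ^ b * exp (bdot (X + c *s \<beta>) (vcnj u) + bdot \<Xi> u)" for u c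
    by (simp add: exp_add mult_ac)
  have Fe: "?F c = beta_moment b (X + c *s \<beta>) \<Xi>" for c unfolding ec beta_moment_def ..
  have U: "\<exists>\<rho>>0. integrable lborel (\<lambda>u. norm (?h u * exp (c * ?a u)) * exp (\<rho> * norm (?a u)))" if "c \<in> UNIV" for c
  proof (intro exI conjI)
    show "(1::real) > 0" by simp
    show "integrable lborel (\<lambda>u. norm (?h u * exp (c * ?a u)) * exp (1 * norm (?a u)))"
      unfolding ec
    proof (rule Bochner_Integration.integrable_bound[OF beta_moment_dominated[of "bdot \<Xi> \<beta>" b "X + c *s \<beta>" \<Xi> "norm \<beta>"]])
      show "AE u in lborel. norm (norm (f0 u * (bdot \<Xi> \<beta> - bdot \<beta> (vcnj u) / 2) ^ b * exp (bdot (X + c *s \<beta>) (vcnj u) + bdot \<Xi> u)) * exp (1 * norm (?a u)))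
        \<le> norm (norm (f0 u * (bdot \<Xi> \<beta> - bdot \<beta> (vcnj u) / 2) ^ b * exp (bdot (X + c *s \<beta>) (vcnj u) + bdot \<Xi> u)) * exp (norm \<beta> * norm u))"
      proof (rule AE_I2)
        fix u
        have "norm (?a u) \<le> norm \<beta> * norm u" using norm_bdot_le[of \<beta> "vcnj u"] by simp
        then have "exp (1 * norm (?a u)) \<le> exp (norm \<beta> * norm u)" by simp
        then show "norm (norm (f0 u * (bdot \<Xi> \<beta> - bdot \<beta> (vcnj u) / 2) ^ b * exp (bdot (X + c *s \<beta>) (vcnj u) + bdot \<Xi> u)) * exp (1 * norm (?a u)))
        \<le> norm (norm (f0 u * (bdot \<Xi> \<beta> - bdot \<beta> (vcnj u) / 2) ^ b * exp (bdot (X + c *s \<beta>) (vcnj u) + bdot \<Xi> u)) * exp (norm \<beta> * norm u))"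
          unfolding real_norm_def abs_mult[of "norm _" "exp _"] abs_norm_cancel abs_exp_cancel by (intro mult_left_mono) auto
      qed
    qed measurable
  qed
  note LH = laplace_holomorphic[OF m U open_UNIV]
  have hol: "?F holomorphic_on UNIV" by (rule LH(1))
  have d: "deriv ?F c = 2 * bdot \<Xi> \<beta> * ?F c" for c
  proof -
    have I0: "integrable lborel (\<lambda>u. ?h u * exp (c * ?a u))"
      unfolding ec by (rule beta_moment_integrable)
    have I1: "integrable lborel (\<lambda>u. f0 u * (bdot \<Xi> \<beta> - bdot \<beta> (vcnj u) / 2) ^ Suc b * exp (bdot (X + c *s \<beta>) (vcnj u) + bdot \<Xi> u))"
      by (rule beta_moment_integrable)
    have "deriv ?F c = (LINT u|lborel. ?h u * ?a u ^ 1 * exp (c * ?a u))"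
      using LH(2)[of c 1] by simp
    also have "\<dots> = (LINT u|lborel. 2 * bdot \<Xi> \<beta> * (?h u * exp (c * ?a u)) - 2 * (f0 u * (bdot \<Xi> \<beta> - bdot \<beta> (vcnj u) / 2) ^ Suc b * exp (bdot (X + c *s \<beta>) (vcnj u) + bdot \<Xi> u)))"
    proof (rule Bochner_Integration.integral_cong[OF refl])
      fix u
      have g: "h * a ^ 1 * e = 2 * x * (h * e) - 2 * ((h * e) * (x - a / 2))" for h a e x :: complex
        by (simp add: field_simps)
      have "?h u * ?a u ^ 1 * exp (c * ?a u) = 2 * bdot \<Xi> \<beta> * (?h u * exp (c * ?a u)) - 2 * ((?h u * exp (c * ?a u)) * (bdot \<Xi> \<beta> - bdot \<beta> (vcnj u) / 2))"
        by (rule g)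
      also have "(?h u * exp (c * ?a u)) * (bdot \<Xi> \<beta> - bdot \<beta> (vcnj u) / 2) = f0 u * (bdot \<Xi> \<beta> - bdot \<beta> (vcnj u) / 2) ^ Suc b * exp (bdot (X + c *s \<beta>) (vcnj u) + bdot \<Xi> u)"
        unfolding ec by (simp only: power_Suc mult_ac)
      finally show "?h u * ?a u ^ 1 * exp (c * ?a u) = 2 * bdot \<Xi> \<beta> * (?h u * exp (c * ?a u)) - 2 * (f0 u * (bdot \<Xi> \<beta> - bdot \<beta> (vcnj u) / 2) ^ Suc b * exp (bdot (X + c *s \<beta>) (vcnj u) + bdot \<Xi> u))" .
    qed
    also have "\<dots> = 2 * bdot \<Xi> \<beta> * ?F c - 2 * beta_moment (Suc b) (X + c *s \<beta>) \<Xi>"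
      unfolding beta_moment_def by (simp only: Bochner_Integration.integral_diff integrable_mult_right I0 I1 integral_mult_right_zero)
    also have "beta_moment (Suc b) (X + c *s \<beta>) \<Xi> = 0" by (rule Z) (rule \<beta>\<alpha>)
    finally show ?thesis by simp
  qed
  let ?k = "\<lambda>c. exp (- (2 * bdot \<Xi> \<beta>) * c) * ?F c"
  have "\<exists>C. \<forall>c\<in>UNIV. ?k c = C"
  proof (rule has_field_derivative_zero_constant)
    fix c
    have "(?F has_field_derivative deriv ?F c) (at c)" by (rule holomorphic_derivI[OF hol]) auto
    then have "(?k has_field_derivative (exp (- (2 * bdot \<Xi> \<beta>) * c) * (- (2 * bdot \<Xi> \<beta>))) * ?F c + deriv ?F c * exp (- (2 * bdot \<Xi> \<beta>) * c)) (at c)"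
      by (intro DERIV_mult) (auto intro!: derivative_eq_intros)
    moreover have "(exp (- (2 * bdot \<Xi> \<beta>) * c) * (- (2 * bdot \<Xi> \<beta>))) * ?F c + deriv ?F c * exp (- (2 * bdot \<Xi> \<beta>) * c) = 0"
      unfolding d by (simp only: mult_minus_right mult_minus_left mult_ac add.left_inverse)
    ultimately show "(?k has_field_derivative 0) (at c within UNIV)" by (simp only:)
  qed simp
  then obtain C where C: "\<forall>c\<in>UNIV. ?k c = C" by (rule exE)
  have "?k c = ?k 0" by (rule trans[OF bspec[OF C UNIV_I] sym[OF bspec[OF C UNIV_I]]])
  then have "exp (- (2 * bdot \<Xi> \<beta>) * c) * ?F c = ?F 0" by (simp only: mult_zero_right exp_zero mult_1_left)
  then have "exp (2 * c * bdot \<Xi> \<beta>) * (exp (- (2 * bdot \<Xi> \<beta>) * c) * ?F c) = exp (2 * c * bdot \<Xi> \<beta>) * ?F 0" by (simp only:)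
  moreover have "exp (2 * c * bdot \<Xi> \<beta>) * exp (- (2 * bdot \<Xi> \<beta>) * c) = 1"
    unfolding mult_exp_exp by (simp add: mult_ac)
  ultimately have "?F c = exp (2 * c * bdot \<Xi> \<beta>) * ?F 0" by (simp only: mult.assoc[symmetric] mult_1_left)
  then show ?thesis unfolding Fe by (simp add: vec_eq_iff)
qed

end

lemma integral_translation:
  fixes f :: "'a::euclidean_space \<Rightarrow> real"
  assumes [measurable]: "f \<in> borel_measurable borel"
  shows "(LINT u|lborel. f (u - w)) = (LINT u|lborel. f u)"
    and "integrable lborel f \<Longrightarrow> integrable lborel (\<lambda>u. f (u - w))"
proof -
  have d: "lborel = distr lborel borel ((+) w)" by (rule lborel_distr_plus[symmetric])
  show "(LINT u|lborel. f (u - w)) = (LINT u|lborel. f u)"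
    by (subst d, subst integral_distr) auto
  show "integrable lborel (\<lambda>u. f (u - w))" if "integrable lborel f"
    by (subst d, subst integrable_distr_eq) (use that in auto)
qed

lemma integral_gauss_translate_small:
  fixes G :: "'a::euclidean_space \<Rightarrow> real"
  assumes G: "integrable lborel G" and nn: "\<And>u. G u \<ge> 0" and \<epsilon>: "\<epsilon> > 0"
  shows "\<exists>B. \<forall>w. norm w \<ge> B \<longrightarrow> (LINT u|lborel. G u * exp (- ((norm (u - w))\<^sup>2 / 4))) < \<epsilon>"
proof (rule ccontr)
  assume "\<not> ?thesis"
  then have "\<forall>n::nat. \<exists>w. norm w \<ge> real n \<and> (LINT u|lborel. G u * exp (- ((norm (u - w))\<^sup>2 / 4))) \<ge> \<epsilon>"
    by (meson not_less)
  then obtain w where w: "\<And>n. norm (w n) \<ge> real n" "\<And>n. (LINT u|lborel. G u * exp (- ((norm (u - w n))\<^sup>2 / 4))) \<ge> \<epsilon>"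
    by metis
  have [measurable]: "G \<in> borel_measurable borel" using G by (simp add: integrable_iff_bounded)
  have "(\<lambda>n. LINT u|lborel. G u * exp (- ((norm (u - w n))\<^sup>2 / 4))) \<longlonglongrightarrow> (LINT u|(lborel :: 'a measure). 0)"
  proof (rule integral_dominated_convergence[OF _ _ G])
    show "AE u in lborel. (\<lambda>n. G u * exp (- ((norm (u - w n))\<^sup>2 / 4))) \<longlonglongrightarrow> 0"
    proof (rule AE_I2)
      fix u
      have "filterlim (\<lambda>n. norm (u - w n)) at_top sequentially"
      proof (rule filterlim_at_top_mono)
        show "filterlim (\<lambda>n. - norm u + real n) at_top sequentially"
          by (rule filterlim_tendsto_add_at_top[OF tendsto_const filterlim_real_sequentially])
        show "\<forall>\<^sub>F n in sequentially. - norm u + real n \<le> norm (u - w n)"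
        proof (intro always_eventually allI)
          fix n
          show "- norm u + real n \<le> norm (u - w n)"
            using w(1)[of n] norm_triangle_ineq2[of "w n" u] by (simp add: norm_minus_commute)
        qed
      qed
      then have "filterlim (\<lambda>n. (norm (u - w n))\<^sup>2 / 4) at_top sequentially"
        using filterlim_tendsto_pos_mult_at_top[OF tendsto_const[of "1 / 4 :: real"] _ filterlim_pow_at_top[of 2]] by simp
      then have "filterlim (\<lambda>n. - ((norm (u - w n))\<^sup>2 / 4)) at_bot sequentially"
        by (simp add: filterlim_uminus_at_bot)
      then have "(\<lambda>n. exp (- ((norm (u - w n))\<^sup>2 / 4))) \<longlonglongrightarrow> 0"
        by (rule filterlim_compose[OF exp_at_bot])
      then show "(\<lambda>n. G u * exp (- ((norm (u - w n))\<^sup>2 / 4))) \<longlonglongrightarrow> 0" by (rule tendsto_mult_right_zero)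
    qed
    show "AE u in lborel. norm (G u * exp (- ((norm (u - w n))\<^sup>2 / 4))) \<le> G u" for n
      using nn by (intro AE_I2) (simp add: abs_mult mult_left_le)
  qed measurable
  then have "(\<lambda>n. LINT u|lborel. G u * exp (- ((norm (u - w n))\<^sup>2 / 4))) \<longlonglongrightarrow> 0" by simp
  from LIMSEQ_le_const[OF this, of \<epsilon>] w(2) show False using \<epsilon> by force
qed

context twisted_transform begin

text \<open>Splitting at a small level \<open>\<theta>\<close> leaves \<open>g^p\<close>, which is integrable, against a Gaussian that moves
off to infinity. This step fails for \<open>p = \<infinity>\<close>.\<close>

lemma Lp_gauss_translate_small:
  assumes \<epsilon>: "\<epsilon> > 0"
  shows "\<exists>B. \<forall>w. norm w \<ge> B \<longrightarrow> (LINT u|lborel. Lp_density u * exp (- ((norm (u - w))\<^sup>2 / 4))) < \<epsilon>"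
    and "integrable lborel (\<lambda>u. Lp_density u * exp (- ((norm (u - w))\<^sup>2 / 4)))"
proof -
  let ?e = "\<lambda>u :: complex ^ 'n. exp (- ((norm u)\<^sup>2 / 4))"
  have ei: "integrable lborel ?e"
    using integrable_gaussian_scale[of "1 / 4", where 'a = "complex ^ 'n"] by simp
  have em: "?e \<in> borel_measurable borel" by measurable
  have eT: "integrable lborel (\<lambda>u. ?e (u - w))" for w by (rule integral_translation(2)[OF em ei])
  let ?I = "LINT u|lborel. ?e u"
  have I0: "?I \<ge> 0" by (intro Bochner_Integration.integral_nonneg) simp
  have pT: "integrable lborel (\<lambda>u. Lp_density u powr p * ?e (u - w))" for w
    by (rule Bochner_Integration.integrable_bound[OF weighted_Lp]) (auto simp: abs_mult mult_left_le)
  have le: "Lp_density u * ?e (u - w) \<le> \<theta> * ?e (u - w) + \<theta> powr (1 - p) * (Lp_density u powr p * ?e (u - w))" if "\<theta> > 0" for \<theta> u w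
  proof -
    have "Lp_density u * ?e (u - w) \<le> (\<theta> + \<theta> powr (1 - p) * Lp_density u powr p) * ?e (u - w)"
      using that p_ge_1 by (intro mult_right_mono le_add_powr) auto
    then show ?thesis by (simp only: distrib_right mult.assoc)
  qed
  have bi: "integrable lborel (\<lambda>u. \<theta> * ?e (u - w) + \<theta> powr (1 - p) * (Lp_density u powr p * ?e (u - w)))" for \<theta> w
    by (intro Bochner_Integration.integrable_add integrable_mult_right eT pT)
  show gT: "integrable lborel (\<lambda>u. Lp_density u * ?e (u - w))" for w
  proof (rule Bochner_Integration.integrable_bound[OF bi[of 1]])
    show "AE u in lborel. norm (Lp_density u * ?e (u - w)) \<le> norm (1 * ?e (u - w) + 1 powr (1 - p) * (Lp_density u powr p * ?e (u - w)))"
      using le[of 1 _ w] by (intro AE_I2) (simp add: abs_mult)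
  qed measurable
  define \<theta> where "\<theta> = \<epsilon> / (2 * (?I + 1))"
  have I1: "?I + 1 > 0" using I0 by linarith
  have \<theta>1: "\<theta> > 0" unfolding \<theta>_def using \<epsilon> I1 by (intro divide_pos_pos mult_pos_pos) auto
  have "\<theta> * (?I + 1) = \<epsilon> / 2" unfolding \<theta>_def using I1 by (simp add: field_simps)
  then have "\<theta> * ?I < \<epsilon> / 2" using \<theta>1 by (simp add: distrib_left)
  note \<theta> = \<theta>1 this
  obtain B where B: "\<And>w. norm w \<ge> B \<Longrightarrow> (LINT u|lborel. Lp_density u powr p * ?e (u - w)) < \<epsilon> / 2 / \<theta> powr (1 - p)"
    using integral_gauss_translate_small[OF weighted_Lp, of "\<epsilon> / 2 / \<theta> powr (1 - p)"] \<epsilon> \<theta> by auto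
  show "\<exists>B. \<forall>w. norm w \<ge> B \<longrightarrow> (LINT u|lborel. Lp_density u * ?e (u - w)) < \<epsilon>"
  proof (intro exI allI impI)
    fix w :: "complex ^ 'n" assume w: "norm w \<ge> B"
    have "(LINT u|lborel. Lp_density u * ?e (u - w)) \<le> (LINT u|lborel. \<theta> * ?e (u - w) + \<theta> powr (1 - p) * (Lp_density u powr p * ?e (u - w)))"
      by (rule integral_mono[OF gT bi]) (rule le[OF \<theta>(1)])
    also have "\<dots> = \<theta> * ?I + \<theta> powr (1 - p) * (LINT u|lborel. Lp_density u powr p * ?e (u - w))"
      by (simp only: Bochner_Integration.integral_add integrable_mult_right eT pT integral_mult_right_zero integral_translation(1)[OF em])
    also have "\<dots> < \<epsilon> / 2 + \<epsilon> / 2"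
    proof (rule add_strict_mono[OF \<theta>(2)])
      show "\<theta> powr (1 - p) * (LINT u|lborel. Lp_density u powr p * ?e (u - w)) < \<epsilon> / 2"
        using B[OF w] \<theta>(1) by (simp add: pos_less_divide_eq mult.commute)
    qed
    finally show "(LINT u|lborel. Lp_density u * ?e (u - w)) < \<epsilon>" by simp
  qed
qed

lemma beta_moment_entire_along_axis:
  assumes \<Xi>0: "bdot \<Xi>0 \<beta> = 0" and \<beta>\<beta>: "bdot \<beta> \<beta> = 1"
  shows "(\<lambda>\<omega>. beta_moment b X (\<Xi>0 + \<omega> *s \<beta>)) holomorphic_on UNIV"
proof -
  let ?h = "\<lambda>k u. f0 u * (0 - bdot \<beta> (vcnj u) / 2) ^ k * exp (bdot X (vcnj u) + bdot \<Xi>0 u)"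
  let ?a = "\<lambda>u. bdot \<beta> u"
  let ?F = "\<lambda>k \<omega>. LINT u|lborel. ?h k u * exp (\<omega> * ?a u)"
  have ec: "?h k u * exp (\<omega> * ?a u) = f0 u * (0 - bdot \<beta> (vcnj u) / 2) ^ k * exp (bdot X (vcnj u) + bdot (\<Xi>0 + \<omega> *s \<beta>) u)" for k u \<omega>
    unfolding bdot_simps by (simp only: exp_add mult_ac)
  have m: "?h k \<in> borel_measurable lborel" "?a \<in> borel_measurable lborel" for k by measurable
  have U: "\<exists>\<rho>>0. integrable lborel (\<lambda>u. norm (?h k u * exp (c * ?a u)) * exp (\<rho> * norm (?a u)))" if "c \<in> UNIV" for c k
  proof (intro exI conjI)
    show "(1::real) > 0" by simp
    let ?f = "\<lambda>u. f0 u * (0 - bdot \<beta> (vcnj u) / 2) ^ k * exp (bdot X (vcnj u) + bdot (\<Xi>0 + c *s \<beta>) u)"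
    show "integrable lborel (\<lambda>u. norm (?h k u * exp (c * ?a u)) * exp (1 * norm (?a u)))"
      unfolding ec
    proof (rule Bochner_Integration.integrable_bound[OF beta_moment_dominated[of 0 k X "\<Xi>0 + c *s \<beta>" "norm \<beta>"]])
      show "AE u in lborel. norm (norm (?f u) * exp (1 * norm (?a u))) \<le> norm (norm (?f u) * exp (norm \<beta> * norm u))"
      proof (rule AE_I2)
        fix u
        have "exp (1 * norm (?a u)) \<le> exp (norm \<beta> * norm u)" using norm_bdot_le[of \<beta> u] by simp
        then show "norm (norm (?f u) * exp (1 * norm (?a u))) \<le> norm (norm (?f u) * exp (norm \<beta> * norm u))"
          unfolding real_norm_def abs_mult[of "norm _" "exp _"] abs_norm_cancel abs_exp_cancel by (intro mult_left_mono) auto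
      qed
    qed measurable
  qed
  have hol: "?F k holomorphic_on UNIV" for k by (rule laplace_holomorphic(1)[OF m U open_UNIV])
  have I: "integrable lborel (\<lambda>u. ?h k u * exp (\<omega> * ?a u))" for k \<omega>
    unfolding ec by (rule beta_moment_integrable)
  have "beta_moment b X (\<Xi>0 + \<omega> *s \<beta>) = (\<Sum>i\<le>b. (of_nat (b choose i) * \<omega> ^ i) * ?F (b - i) \<omega>)" for \<omega>
  proof -
    have "f0 u * (bdot (\<Xi>0 + \<omega> *s \<beta>) \<beta> - bdot \<beta> (vcnj u) / 2) ^ b * exp (bdot X (vcnj u) + bdot (\<Xi>0 + \<omega> *s \<beta>) u)
      = (\<Sum>i\<le>b. (of_nat (b choose i) * \<omega> ^ i) * (?h (b - i) u * exp (\<omega> * ?a u)))" for u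
    proof -
      have "bdot (\<Xi>0 + \<omega> *s \<beta>) \<beta> - bdot \<beta> (vcnj u) / 2 = \<omega> + (0 - bdot \<beta> (vcnj u) / 2)" using \<Xi>0 \<beta>\<beta> by simp
      then have "f0 u * (bdot (\<Xi>0 + \<omega> *s \<beta>) \<beta> - bdot \<beta> (vcnj u) / 2) ^ b * exp (bdot X (vcnj u) + bdot (\<Xi>0 + \<omega> *s \<beta>) u)
        = f0 u * (\<Sum>i\<le>b. of_nat (b choose i) * \<omega> ^ i * (0 - bdot \<beta> (vcnj u) / 2) ^ (b - i)) * exp (bdot X (vcnj u) + bdot (\<Xi>0 + \<omega> *s \<beta>) u)"
        by (simp only: binomial_ring)
      then show ?thesis unfolding ec by (simp only: sum_distrib_left sum_distrib_right mult_ac)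
    qed
    then show ?thesis unfolding beta_moment_def
      by (simp only: Bochner_Integration.integral_sum integrable_mult_right I integral_mult_right_zero)
  qed
  then show ?thesis by (simp only:) (intro holomorphic_intros hol)
qed

text \<open>The factor \<open>exp(|u|^2/2)\<close> that separates \<open>f0\<close> from its \<open>L^p\<close> density completes the square.\<close>

lemma gauss_completion:
  assumes j: "\<beta> = axis j 1"
  shows "- ((norm u)\<^sup>2 / 2) + 2 * Re (\<omega> * bdot \<beta> u) - 2 * (norm \<omega>)\<^sup>2 = - ((norm (u - (2 * cnj \<omega>) *s \<beta>))\<^sup>2 / 2)"
proof -
  let ?c = "2 * cnj \<omega>"
  have "complex_of_real ((norm (u - ?c *s \<beta>))\<^sup>2) = bdot (vcnj (u - ?c *s \<beta>)) (u - ?c *s \<beta>)" by (rule bdot_vcnj_self(1)[symmetric])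
  also have "\<dots> = of_real ((norm u)\<^sup>2) - ?c * cnj (u $ j) - cnj ?c * u $ j + cnj ?c * ?c"
    unfolding vcnj_simps bdot_simps bdot_vcnj_self j by (simp add: algebra_simps)
  finally have "Re (complex_of_real ((norm (u - ?c *s \<beta>))\<^sup>2)) = Re (of_real ((norm u)\<^sup>2) - ?c * cnj (u $ j) - cnj ?c * u $ j + cnj ?c * ?c)" by (simp only:)
  then have "(norm (u - ?c *s \<beta>))\<^sup>2 = (norm u)\<^sup>2 - 4 * Re (\<omega> * u $ j) + 4 * (norm \<omega>)\<^sup>2"
    by (simp add: cmod_power2) (simp add: power2_eq_square algebra_simps)
  moreover have "bdot \<beta> u = u $ j" using j by simp
  moreover have "- (N / 2) + 2 * q - 2 * c = - ((N - 4 * q + 4 * c) / 2)" for N q c :: real by (simp add: field_simps)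
  ultimately show ?thesis by (simp only:)
qed

text \<open>Fix everything but the coordinate \<open>\<omega> = \<Xi>\<cdot>\<beta>\<close> and consider the entire function
\<open>k \<omega> = exp(-2 x \<omega>) * (moment of degree b)\<close> with \<open>x = X\<cdot>\<beta>\<close>. By \<open>beta_moment_shift\<close> it does not change when \<open>x\<close>
is replaced by any other number, in particular by \<open>cnj \<omega>\<close>, a choice that depends on \<open>\<omega>\<close> but costs
nothing since \<open>k\<close> is already known to be holomorphic. With this choice the exponent is a Gaussian centred at
\<open>2 cnj \<omega>\<close>, so that \<open>k\<close> tends to zero and Liouville's theorem applies.\<close>

lemma beta_moment_descent:
  assumes j: "\<beta> = axis j 1"
    and Z: "\<And>X' \<Xi>'. bdot X' \<alpha> ^ s \<noteq> 0 \<Longrightarrow> beta_moment (Suc b) X' \<Xi>' = 0"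
    and X: "bdot X \<alpha> ^ s \<noteq> 0"
  shows "beta_moment b X \<Xi> = 0"
proof -
  have \<beta>\<beta>: "bdot \<beta> \<beta> = 1" unfolding j bdot_axis(1) by (simp add: axis_def)
  have \<beta>\<alpha>: "bdot \<beta> \<alpha> = 0" using orth by (simp add: bdot_commute)
  define x where "x = X $ j"
  define X0 where "X0 = X - x *s \<beta>"
  define \<Xi>0 where "\<Xi>0 = \<Xi> - (\<Xi> $ j) *s \<beta>"
  have X0j: "bdot X0 \<beta> = 0" and \<Xi>0j: "bdot \<Xi>0 \<beta> = 0"
    unfolding X0_def \<Xi>0_def x_def using \<beta>\<beta> j by simp_all
  let ?k = "\<lambda>\<omega>. exp (- 2 * x * \<omega>) * beta_moment b X (\<Xi>0 + \<omega> *s \<beta>)"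
  have hol: "?k holomorphic_on UNIV"
    by (intro holomorphic_intros beta_moment_entire_along_axis[OF \<Xi>0j \<beta>\<beta>])
  have Xc: "bdot (X0 + c *s \<beta>) \<alpha> = bdot X \<alpha>" for c unfolding X0_def using \<beta>\<alpha> by simp
  \<comment> \<open>The shift that replaces \<open>x\<close> by \<open>cnj \<omega>\<close>.\<close>
  have k2: "?k \<omega> = exp (- (2 * of_real ((norm \<omega>)\<^sup>2))) * beta_moment b (X0 + cnj \<omega> *s \<beta>) (\<Xi>0 + \<omega> *s \<beta>)" for \<omega>
  proof -
    let ?\<Xi> = "\<Xi>0 + \<omega> *s \<beta>"
    have "beta_moment b ((X0 + cnj \<omega> *s \<beta>) + (x - cnj \<omega>) *s \<beta>) ?\<Xi> = exp (2 * (x - cnj \<omega>) * bdot ?\<Xi> \<beta>) * beta_moment b (X0 + cnj \<omega> *s \<beta>) ?\<Xi>"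
    proof (rule beta_moment_shift)
      show "bdot (X0 + cnj \<omega> *s \<beta> + c *s \<beta>) \<alpha> = bdot (X0 + cnj \<omega> *s \<beta>) \<alpha>" for c using \<beta>\<alpha> by simp
      show "beta_moment (Suc b) X' ?\<Xi> = 0" if "bdot X' \<alpha> = bdot (X0 + cnj \<omega> *s \<beta>) \<alpha>" for X'
        by (rule Z) (simp only: that Xc X not_False_eq_True)
    qed
    moreover have "(X0 + cnj \<omega> *s \<beta>) + (x - cnj \<omega>) *s \<beta> = X" unfolding X0_def by (simp add: vec_eq_iff algebra_simps)
    moreover have "bdot ?\<Xi> \<beta> = \<omega>" using \<Xi>0j \<beta>\<beta> by simp
    ultimately have "?k \<omega> = exp (- 2 * x * \<omega> + 2 * (x - cnj \<omega>) * \<omega>) * beta_moment b (X0 + cnj \<omega> *s \<beta>) ?\<Xi>"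
      by (simp only: exp_add mult.assoc)
    moreover have "- 2 * x * \<omega> + 2 * (x - cnj \<omega>) * \<omega> = - (2 * of_real ((norm \<omega>)\<^sup>2))"
      unfolding complex_norm_square by (simp add: algebra_simps)
    ultimately show ?thesis by (simp only:)
  qed
  define W where "W = norm X0 + norm \<Xi>0 + 1"
  let ?K = "fact b * exp (W\<^sup>2)"
  have kb: "norm (?k \<omega>) \<le> ?K * (LINT u|lborel. Lp_density u * exp (- ((norm (u - (2 * cnj \<omega>) *s \<beta>))\<^sup>2 / 4)))" for \<omega>
  proof -
    let ?X = "X0 + cnj \<omega> *s \<beta>" and ?\<Xi> = "\<Xi>0 + \<omega> *s \<beta>"
    let ?F = "\<lambda>u. f0 u * (bdot ?\<Xi> \<beta> - bdot \<beta> (vcnj u) / 2) ^ b * exp (bdot ?X (vcnj u) + bdot ?\<Xi> u)"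
    have bd: "exp (- (2 * (norm \<omega>)\<^sup>2)) * norm (?F u) \<le> ?K * (Lp_density u * exp (- ((norm (u - (2 * cnj \<omega>) *s \<beta>))\<^sup>2 / 4)))" for u
    proof -
      \<comment> \<open>Recentre the Gaussian; the remaining linear terms do not involve \<open>\<omega>\<close>.\<close>
      define v where "v = u - (2 * cnj \<omega>) *s \<beta>"
      have u: "u = v + (2 * cnj \<omega>) *s \<beta>" by (simp add: v_def)
      have "bdot ?\<Xi> \<beta> - bdot \<beta> (vcnj u) / 2 = - (cnj (v $ j) / 2)"
        using \<Xi>0j \<beta>\<beta> j unfolding v_def by (simp add: field_simps)
      moreover have "norm (- (cnj (v $ j) / 2)) \<le> norm (v $ j)" by (simp add: norm_divide)
      ultimately have "norm (bdot ?\<Xi> \<beta> - bdot \<beta> (vcnj u) / 2) \<le> norm v"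
        using order_trans[OF _ Finite_Cartesian_Product.norm_nth_le[of v j]] by (simp only:)
      then have "norm (bdot ?\<Xi> \<beta> - bdot \<beta> (vcnj u) / 2) ^ b \<le> norm v ^ b" by (intro power_mono) auto
      also have "\<dots> \<le> fact b * exp (norm v)" using power_le_fact_exp[of 1 "norm v" b] by simp
      finally have p1: "norm (bdot ?\<Xi> \<beta> - bdot \<beta> (vcnj u) / 2) ^ b \<le> fact b * exp (norm v)" .
      have X0v: "bdot X0 (vcnj u) = bdot X0 (vcnj v)" "bdot \<Xi>0 u = bdot \<Xi>0 v"
        unfolding u using X0j \<Xi>0j j by (simp_all)
      have "Re (bdot ?X (vcnj u) + bdot ?\<Xi> u) = Re (bdot X0 (vcnj v)) + Re (bdot \<Xi>0 v) + 2 * Re (\<omega> * bdot \<beta> u)"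
        unfolding bdot_simps X0v using j by (simp add: algebra_simps)
      also have "\<dots> \<le> (norm X0 + norm \<Xi>0) * norm v + 2 * Re (\<omega> * bdot \<beta> u)"
        using order_trans[OF complex_Re_le_cmod norm_bdot_le[of X0 "vcnj v"]] order_trans[OF complex_Re_le_cmod norm_bdot_le[of \<Xi>0 v]]
        by (simp add: distrib_right)
      finally have e1: "- (2 * (norm \<omega>)\<^sup>2) + Re (bdot ?X (vcnj u) + bdot ?\<Xi> u) + norm v \<le> (norm u)\<^sup>2 / 2 + (W * norm v - (norm v)\<^sup>2 / 2)"
        using gauss_completion[OF j, of u \<omega>] unfolding v_def[symmetric] W_def by (simp add: distrib_right)
      have "0 \<le> (norm v / 2 - W)\<^sup>2" by simp
      then have "W * norm v - (norm v)\<^sup>2 / 2 \<le> W\<^sup>2 + - ((norm v)\<^sup>2 / 4)" by (simp add: power2_eq_square algebra_simps)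
      with e1 have e2: "- (2 * (norm \<omega>)\<^sup>2) + Re (bdot ?X (vcnj u) + bdot ?\<Xi> u) + norm v \<le> (norm u)\<^sup>2 / 2 + (W\<^sup>2 + - ((norm v)\<^sup>2 / 4))" by linarith
      have "exp (- (2 * (norm \<omega>)\<^sup>2)) * norm (?F u) \<le> exp (- (2 * (norm \<omega>)\<^sup>2)) * (norm (f0 u) * (fact b * exp (norm v)) * exp (Re (bdot ?X (vcnj u) + bdot ?\<Xi> u)))"
        unfolding norm_mult norm_power norm_exp_eq_Re by (intro mult_left_mono mult_right_mono p1) auto
      also have "\<dots> = norm (f0 u) * fact b * exp (- (2 * (norm \<omega>)\<^sup>2) + Re (bdot ?X (vcnj u) + bdot ?\<Xi> u) + norm v)"
        by (simp only: exp_add mult_ac)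
      also have "\<dots> \<le> norm (f0 u) * fact b * exp ((norm u)\<^sup>2 / 2 + (W\<^sup>2 + - ((norm v)\<^sup>2 / 4)))"
        using e2 by (intro mult_left_mono) auto
      also have "\<dots> = ?K * (Lp_density u * exp (- ((norm v)\<^sup>2 / 4)))" by (simp only: exp_add mult_ac)
      finally show ?thesis unfolding v_def .
    qed
    have "norm (?k \<omega>) = exp (- (2 * (norm \<omega>)\<^sup>2)) * norm (beta_moment b ?X ?\<Xi>)"
      unfolding k2 norm_mult norm_exp_eq_Re by simp
    also have "\<dots> \<le> exp (- (2 * (norm \<omega>)\<^sup>2)) * (LINT u|lborel. norm (?F u))"
      unfolding beta_moment_def by (intro mult_left_mono integral_norm_bound) simp
    also have "\<dots> = (LINT u|lborel. exp (- (2 * (norm \<omega>)\<^sup>2)) * norm (?F u))" by (rule integral_mult_right_zero[symmetric])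
    also have "\<dots> \<le> (LINT u|lborel. ?K * (Lp_density u * exp (- ((norm (u - (2 * cnj \<omega>) *s \<beta>))\<^sup>2 / 4))))"
      by (rule integral_mono'[OF integrable_mult_right[OF Lp_gauss_translate_small(2)[OF zero_less_one]] bd]) simp
    also have "\<dots> = ?K * (LINT u|lborel. Lp_density u * exp (- ((norm (u - (2 * cnj \<omega>) *s \<beta>))\<^sup>2 / 4)))" by (rule integral_mult_right_zero)
    finally show ?thesis .
  qed
  have "(?k \<longlongrightarrow> 0) at_infinity"
  proof (rule tendstoI)
    fix \<epsilon> :: real assume \<epsilon>: "\<epsilon> > 0"
    have K: "?K > 0" by simp
    have "\<epsilon> / ?K > 0" using \<epsilon> K by (rule divide_pos_pos)
    from Lp_gauss_translate_small(1)[OF this]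
    obtain B where B: "\<forall>w. norm w \<ge> B \<longrightarrow> (LINT u|lborel. Lp_density u * exp (- ((norm (u - w))\<^sup>2 / 4))) < \<epsilon> / ?K"
      by (rule exE)
    show "\<forall>\<^sub>F \<omega> in at_infinity. dist (?k \<omega>) 0 < \<epsilon>"
      unfolding eventually_at_infinity
    proof (intro exI allI impI)
      fix \<omega> :: complex assume \<omega>: "\<bar>B\<bar> \<le> norm \<omega>"
      have "((2 * cnj \<omega>) *s \<beta>) $ j = 2 * cnj \<omega>" using j by (simp add: axis_def)
      then have "norm (2 * cnj \<omega>) \<le> norm ((2 * cnj \<omega>) *s \<beta>)"
        using Finite_Cartesian_Product.norm_nth_le[of "(2 * cnj \<omega>) *s \<beta>" j] by (simp only:)
      then have "norm ((2 * cnj \<omega>) *s \<beta>) \<ge> B" using \<omega> by (simp add: norm_mult)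
      from B[rule_format, OF this] have "?K * (LINT u|lborel. Lp_density u * exp (- ((norm (u - (2 * cnj \<omega>) *s \<beta>))\<^sup>2 / 4))) < \<epsilon>"
        using K by (simp add: pos_less_divide_eq mult.commute)
      then have "norm (?k \<omega>) < \<epsilon>" using kb[of \<omega>] by linarith
      then show "dist (?k \<omega>) 0 < \<epsilon>" by (simp only: dist_norm diff_0_right)
    qed
  qed
  then have "?k (\<Xi> $ j) = 0" by (rule Liouville_weak_0[OF hol])
  then have "beta_moment b X (\<Xi>0 + (\<Xi> $ j) *s \<beta>) = 0" by simp
  then show ?thesis by (simp add: \<Xi>0_def)
qed

text \<open>The Fourier transform of \<open>f0\<close> at \<open>\<xi>\<close> is the moment of degree \<open>0\<close> at \<open>X = (\<i>/2) \<xi>\<close> and \<open>\<Xi> = (\<i>/2) cnj \<xi>\<close>.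
For \<open>s > 0\<close> the excluded set \<open>X\<cdot>\<alpha> = 0\<close> lies in a real hyperplane of the variable \<open>\<xi>\<close>.\<close>

lemma f0_vanish:
  assumes V: "\<And>\<eta> v a b. moment \<eta> v a b 0 = 0"
    and \<alpha>: "s = 0 \<or> (\<exists>i. \<alpha> = axis i 1)" and \<beta>: "t = 0 \<or> (\<exists>j. \<beta> = axis j 1)"
  shows "AE u in lborel. f0 u = 0"
proof -
  have "beta_moment (t - d) X \<Xi> = 0" if "bdot X \<alpha> ^ s \<noteq> 0" "d \<le> t" for d X \<Xi>
    using that
  proof (induction d arbitrary: X \<Xi>)
    case 0
    show ?case using beta_moment_t_vanish[OF V 0(1)] by simp
  next
    case (Suc d)
    then obtain j where j: "\<beta> = axis j 1" using \<beta> by auto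
    have e: "Suc (t - Suc d) = t - d" using Suc.prems by simp
    show ?case by (rule beta_moment_descent[OF j _ Suc.prems(1)]) (unfold e, rule Suc.IH, use Suc.prems in auto)
  qed
  from this[of _ t] have F0: "beta_moment 0 X \<Xi> = 0" if "bdot X \<alpha> ^ s \<noteq> 0" for X \<Xi> using that by simp
  have good: "AE \<xi> in lborel. bdot ((\<i> / 2) *s \<xi>) \<alpha> ^ s \<noteq> 0"
  proof (cases "s = 0")
    case False
    then obtain i where i: "\<alpha> = axis i 1" using \<alpha> by auto
    let ?N = "{\<xi> :: complex ^ 'n. axis i 1 \<bullet> \<xi> = 0}"
    have "negligible ?N" by (rule negligible_hyperplane) (simp add: axis_eq_0_iff)
    then have "?N \<in> null_sets lebesgue" by (simp add: negligible_iff_null_sets)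
    moreover have "?N \<in> sets lborel" by measurable
    ultimately have "?N \<in> null_sets lborel" by (simp add: null_sets_completion_iff)
    then have "AE \<xi> in lborel. \<xi> \<notin> ?N" by (rule AE_not_in)
    then show ?thesis
    proof eventually_elim
      case (elim \<xi>)
      then have "\<xi> $ i \<noteq> 0" by (auto simp: inner_axis' )
      then show ?case using i by simp
    qed
  qed simp
  show ?thesis
  proof (rule fourier_unique)
    show "integrable lborel f0"
      by (rule f0_mult_integrable[of _ 1 0]) auto
    show "AE \<xi> in lborel. (LINT v|lborel. f0 v * exp (\<i> * of_real (\<xi> \<bullet> v))) = 0"
      using good
    proof eventually_elim
      case (elim \<xi>)
      have e: "\<i> * of_real (\<xi> \<bullet> v) = bdot ((\<i> / 2) *s \<xi>) (vcnj v) + bdot ((\<i> / 2) *s vcnj \<xi>) v" for v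
      proof -
        have k: "complex_of_real (\<xi> $ k \<bullet> v $ k) = (\<xi> $ k * cnj (v $ k) + cnj (\<xi> $ k) * v $ k) / 2" for k
          by (simp add: complex_eq_iff inner_complex_def)
        have \<xi>v: "complex_of_real (\<xi> \<bullet> v) = (bdot \<xi> (vcnj v) + bdot (vcnj \<xi>) v) / 2"
          unfolding inner_vec_def of_real_sum k bdot_def vcnj_nth by (simp only: sum_divide_distrib[symmetric] sum.distrib)
        show ?thesis unfolding \<xi>v bdot_simps by (simp add: field_simps)
      qed
      show ?case using F0[OF elim, of "(\<i> / 2) *s vcnj \<xi>"] unfolding beta_moment_def e by simp
    qed
  qed
qed

end

section \<open>Harmonics of highest weight\<close>

definition bimonomial :: "'n \<Rightarrow> 'n \<Rightarrow> nat \<Rightarrow> nat \<Rightarrow> complex ^ 'n::finite \<Rightarrow> complex" where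
  "bimonomial i j s t w = (w $ i) ^ s * cnj (w $ j) ^ t"

lemma bimonomial_vector_derivative:
  "((\<lambda>h. c * bimonomial i j s t (x + h *\<^sub>R b)) has_vector_derivative
     c * (of_nat s * b $ i * bimonomial i j (s - 1) t x + of_nat t * cnj (b $ j) * bimonomial i j s (t - 1) x)) (at 0)"
proof -
  have p: "((\<lambda>h::real. (a + of_real h * d) ^ k) has_vector_derivative of_nat k * d * a ^ (k - 1)) (at 0)" for a d :: complex and k
  proof -
    have "((\<lambda>h. (a + h * d) ^ k) has_field_derivative of_nat k * d * a ^ (k - 1)) (at (of_real 0))"
      by (auto intro!: derivative_eq_intros)
    from has_vector_derivative_real_field[OF this] show ?thesis by simp
  qed
  have e: "c * bimonomial i j s t (x + h *\<^sub>R b) = c * ((x $ i + of_real h * b $ i) ^ s * (cnj (x $ j) + of_real h * cnj (b $ j)) ^ t)" for h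
    by (simp add: bimonomial_def scaleR_conv_of_real[where 'a = complex])
  have "((\<lambda>h. c * bimonomial i j s t (x + h *\<^sub>R b)) has_vector_derivative
     c * ((x $ i + of_real 0 * b $ i) ^ s * (of_nat t * cnj (b $ j) * cnj (x $ j) ^ (t - 1)) + (of_nat s * b $ i * (x $ i) ^ (s - 1)) * (cnj (x $ j) + of_real 0 * cnj (b $ j)) ^ t)) (at 0)"
    unfolding e by (intro has_vector_derivative_mult_right has_vector_derivative_mult p)
  then show ?thesis by (simp add: bimonomial_def algebra_simps)
qed

lemma partial_deriv_bimonomial:
  "partial_deriv b (\<lambda>w. c * bimonomial i j s t w) x
    = c * (of_nat s * b $ i * bimonomial i j (s - 1) t x + of_nat t * cnj (b $ j) * bimonomial i j s (t - 1) x)"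
  unfolding partial_deriv_def by (rule vector_derivative_at[OF bimonomial_vector_derivative])

lemma partial_deriv2_bimonomial:
  "partial_deriv b (partial_deriv b (\<lambda>w. c * bimonomial i j s t w)) x
    = c * (of_nat s * of_nat (s - 1) * (b $ i)\<^sup>2 * bimonomial i j (s - 1 - 1) t x
       + 2 * of_nat s * of_nat t * (b $ i * cnj (b $ j)) * bimonomial i j (s - 1) (t - 1) x
       + of_nat t * of_nat (t - 1) * (cnj (b $ j))\<^sup>2 * bimonomial i j s (t - 1 - 1) x)"
proof -
  have "partial_deriv b (\<lambda>w. c * bimonomial i j s t w) = (\<lambda>w. (c * of_nat s * b $ i) * bimonomial i j (s - 1) t w + (c * of_nat t * cnj (b $ j)) * bimonomial i j s (t - 1) w)"
    by (rule ext) (simp add: partial_deriv_bimonomial algebra_simps)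
  then have "partial_deriv b (partial_deriv b (\<lambda>w. c * bimonomial i j s t w)) x
    = vector_derivative (\<lambda>h. (c * of_nat s * b $ i) * bimonomial i j (s - 1) t (x + h *\<^sub>R b) + (c * of_nat t * cnj (b $ j)) * bimonomial i j s (t - 1) (x + h *\<^sub>R b)) (at 0)"
    by (simp add: partial_deriv_def[of b "\<lambda>w. _ w + _ w"])
  also have "\<dots> = (c * of_nat s * b $ i) * (of_nat (s - 1) * b $ i * bimonomial i j (s - 1 - 1) t x + of_nat t * cnj (b $ j) * bimonomial i j (s - 1) (t - 1) x)
     + (c * of_nat t * cnj (b $ j)) * (of_nat s * b $ i * bimonomial i j (s - 1) (t - 1) x + of_nat (t - 1) * cnj (b $ j) * bimonomial i j s (t - 1 - 1) x)"
    by (rule vector_derivative_at) (intro has_vector_derivative_add bimonomial_vector_derivative)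
  finally show ?thesis by (simp add: power2_eq_square algebra_simps)
qed

text \<open>The directions \<open>axis i 1\<close> and \<open>axis i \<i>\<close> cancel in the pure second derivatives, so that only the mixed
derivative in \<open>w $ i\<close> and \<open>cnj (w $ j)\<close> is left.\<close>

lemma laplacian_bimonomial:
  "laplacian (\<lambda>w. c * bimonomial i j s t w) x = (if i = j then 4 * c * of_nat s * of_nat t * bimonomial i j (s - 1) (t - 1) x else 0)"
proof -
  have "laplacian (\<lambda>w. c * bimonomial i j s t w) x = (\<Sum>k\<in>UNIV. if k = i then (if i = j then 4 * c * of_nat s * of_nat t * bimonomial i j (s - 1) (t - 1) x else 0) else 0)"
    unfolding laplacian_def sum_Basis_cvec partial_deriv2_bimonomial
    by (intro sum.cong refl) (auto simp: axis_def algebra_simps)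
  then show ?thesis by simp
qed

lemma multi_index_single_mem: "(\<lambda>k. if k = i then s else 0) \<in> multi_indices s"
  by (simp add: multi_indices_def)

lemma prod_single_index:
  fixes z :: "'n::finite \<Rightarrow> complex"
  shows "(\<Prod>k\<in>UNIV. z k ^ (if k = i then s else 0)) = z i ^ s"
proof -
  have "(\<Prod>k\<in>UNIV. z k ^ (if k = i then s else 0)) = (\<Prod>k\<in>UNIV. if k = i then z i ^ s else 1)"
    by (intro prod.cong) auto
  then show ?thesis by simp
qed

lemma bimonomial_bihomogeneous: "bimonomial i j s t \<in> bihomogeneous_polys s t"
proof -
  let ?a = "\<lambda>k. if k = i then s else 0" and ?b = "\<lambda>k. if k = j then t else 0"
  let ?c = "\<lambda>\<alpha> \<beta>. if \<alpha> = ?a \<and> \<beta> = ?b then 1 else (0::complex)"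
  have "bimonomial i j s t z = (\<Sum>\<alpha>\<in>multi_indices s. \<Sum>\<beta>\<in>multi_indices t. ?c \<alpha> \<beta> * (\<Prod>k\<in>UNIV. z $ k ^ \<alpha> k) * (\<Prod>k\<in>UNIV. cnj (z $ k) ^ \<beta> k))" for z
  proof -
    have "(\<Sum>\<alpha>\<in>multi_indices s. \<Sum>\<beta>\<in>multi_indices t. ?c \<alpha> \<beta> * (\<Prod>k\<in>UNIV. z $ k ^ \<alpha> k) * (\<Prod>k\<in>UNIV. cnj (z $ k) ^ \<beta> k))
      = (\<Sum>\<alpha>\<in>multi_indices s. if \<alpha> = ?a then (\<Sum>\<beta>\<in>multi_indices t. if \<beta> = ?b then (\<Prod>k\<in>UNIV. z $ k ^ ?a k) * (\<Prod>k\<in>UNIV. cnj (z $ k) ^ ?b k) else 0) else 0)"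
      by (intro sum.cong refl) (auto intro!: sum.cong)
    also have "\<dots> = (\<Prod>k\<in>UNIV. z $ k ^ ?a k) * (\<Prod>k\<in>UNIV. cnj (z $ k) ^ ?b k)"
      by (simp only: sum.delta finite_multi_indices multi_index_single_mem if_True)
    also have "\<dots> = bimonomial i j s t z"
      unfolding bimonomial_def prod_single_index ..
    finally show ?thesis by simp
  qed
  then show ?thesis unfolding bihomogeneous_polys_def by (intro CollectI exI[of _ ?c] ext)
qed

lemma bimonomial_harmonic:
  assumes "i \<noteq> j \<or> s = 0 \<or> t = 0"
  shows "bimonomial i j s t \<in> bigraded_harmonics s t"
  using laplacian_bimonomial[of 1 i j s t] assms bimonomial_bihomogeneous[of i j s t]
  unfolding bigraded_harmonics_def by auto

text \<open>In dimension one the bihomogeneous polynomials are the multiples of \<open>z^s cnj z^t\<close>, which is not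
harmonic when both exponents are positive.\<close>

lemma bigraded_harmonics_dim1:
  assumes one: "\<And>i j :: 'n::finite. i = j" and st: "s > 0" "t > 0"
  shows "(bigraded_harmonics s t :: (complex ^ 'n \<Rightarrow> complex) set) = {0}"
proof -
  obtain i :: 'n where True by blast
  have U: "(UNIV :: 'n set) = {i}" using one by auto
  have mi: "multi_indices k = {\<lambda>_ :: 'n. k}" for k
  proof -
    have e: "\<alpha> = (\<lambda>_. \<alpha> i)" for \<alpha> :: "'n \<Rightarrow> nat" by (rule ext, rule arg_cong[OF one])
    have "\<alpha> i = k \<longleftrightarrow> \<alpha> = (\<lambda>_. k)" for \<alpha> :: "'n \<Rightarrow> nat"
    proof
      assume "\<alpha> i = k"
      then show "\<alpha> = (\<lambda>_. k)" using e[of \<alpha>] by (rule subst)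
    qed simp
    then show ?thesis unfolding multi_indices_def U by auto
  qed
  have "P = 0" if P: "P \<in> bigraded_harmonics s t" for P :: "complex ^ 'n \<Rightarrow> complex"
  proof -
    obtain c where c: "P = (\<lambda>z. \<Sum>\<alpha>\<in>multi_indices s. \<Sum>\<beta>\<in>multi_indices t. c \<alpha> \<beta> * (\<Prod>i\<in>UNIV. z $ i ^ \<alpha> i) * (\<Prod>i\<in>UNIV. cnj (z $ i) ^ \<beta> i))"
      using P unfolding bigraded_harmonics_def bihomogeneous_polys_def by blast
    define C where "C = c (\<lambda>_. s) (\<lambda>_. t)"
    have Pe: "P = (\<lambda>z. C * bimonomial i i s t z)"
      unfolding c mi U bimonomial_def C_def by (simp add: mult.assoc)
    have "laplacian P (axis i 1) = 0" using P unfolding bigraded_harmonics_def by blast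
    then have "C = 0" unfolding Pe laplacian_bimonomial using st by (simp add: bimonomial_def)
    then show "P = 0" unfolding Pe by (simp add: fun_eq_iff)
  qed
  moreover have "(0 :: complex ^ 'n \<Rightarrow> complex) \<in> bigraded_harmonics s t"
  proof -
    have "(0 :: complex ^ 'n \<Rightarrow> complex) \<in> bihomogeneous_polys s t"
      unfolding bihomogeneous_polys_def by (auto simp: fun_eq_iff intro!: exI[of _ "\<lambda>_ _. 0"])
    moreover have "laplacian (0 :: complex ^ 'n \<Rightarrow> complex) z = 0" for z
      using laplacian_bimonomial[of 0 i i 0 0 z] by (simp add: zero_fun_def)
    ultimately show ?thesis unfolding bigraded_harmonics_def by blast
  qed
  ultimately show ?thesis by blast
qed

text \<open>When an exponent is zero the corresponding vector is taken to be \<open>0\<close>, so that the two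
vectors are orthogonal even in dimension one.\<close>

lemma highest_weight_harmonic_exists:
  assumes H: "(bigraded_harmonics s t :: (complex ^ 'n::finite \<Rightarrow> complex) set) \<noteq> {0}"
  obtains \<alpha> \<beta> :: "complex ^ 'n" where "bdot \<alpha> \<beta> = 0" "s = 0 \<or> (\<exists>i. \<alpha> = axis i 1)" "t = 0 \<or> (\<exists>j. \<beta> = axis j 1)"
    "(\<lambda>w. bdot \<alpha> w ^ s * bdot \<beta> (vcnj w) ^ t) \<in> bigraded_harmonics s t"
proof (cases "s = 0 \<or> t = 0")
  case True
  obtain i :: 'n where True by blast
  let ?\<alpha> = "if s = 0 then 0 else axis i 1 :: complex ^ 'n" and ?\<beta> = "if t = 0 then 0 else axis i 1 :: complex ^ 'n"
  have "(\<lambda>w. bdot ?\<alpha> w ^ s * bdot ?\<beta> (vcnj w) ^ t) = bimonomial i i s t"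
    by (auto simp: fun_eq_iff bimonomial_def)
  then show ?thesis using True by (intro that[of ?\<alpha> ?\<beta>]) (auto simp: bimonomial_harmonic)
next
  case False
  then obtain i j :: 'n where ij: "i \<noteq> j" using bigraded_harmonics_dim1[of s t] H by blast
  have "(\<lambda>w. bdot (axis i 1) w ^ s * bdot (axis j 1) (vcnj w) ^ t) = bimonomial i j s t"
    by (auto simp: fun_eq_iff bimonomial_def)
  moreover have "bdot (axis i 1) (axis j 1 :: complex ^ 'n) = 0"
    using ij by (subst bdot_axis(1)) (simp add: axis_def)
  ultimately show ?thesis using ij by (intro that[of "axis i 1" "axis j 1"]) (auto simp: bimonomial_harmonic)
qed

lemma bihomogeneous_continuous:
  assumes "P \<in> bihomogeneous_polys s t"
  shows "continuous_on UNIV P"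
proof -
  obtain c where c: "P = (\<lambda>z. \<Sum>\<alpha>\<in>multi_indices s. \<Sum>\<beta>\<in>multi_indices t. c \<alpha> \<beta> * (\<Prod>i\<in>UNIV. z $ i ^ \<alpha> i) * (\<Prod>i\<in>UNIV. cnj (z $ i) ^ \<beta> i))"
    using assms unfolding bihomogeneous_polys_def by blast
  show ?thesis unfolding c by (intro continuous_intros)
qed

lemma bihomogeneous_exp_bound:
  assumes "P \<in> bihomogeneous_polys s t"
  obtains K where "\<And>z. norm (P z) \<le> K * exp (norm z)"
proof -
  obtain c where c: "P = (\<lambda>z. \<Sum>\<alpha>\<in>multi_indices s. \<Sum>\<beta>\<in>multi_indices t. c \<alpha> \<beta> * (\<Prod>i\<in>UNIV. z $ i ^ \<alpha> i) * (\<Prod>i\<in>UNIV. cnj (z $ i) ^ \<beta> i))"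
    using assms unfolding bihomogeneous_polys_def by blast
  have pb: "(\<Prod>i\<in>UNIV. norm (z $ i) ^ \<alpha> i) \<le> norm z ^ k" if "\<alpha> \<in> multi_indices k" for \<alpha> k and z :: "complex ^ 'a"
  proof -
    have "(\<Prod>i\<in>UNIV. norm (z $ i) ^ \<alpha> i) \<le> (\<Prod>i\<in>UNIV. norm z ^ \<alpha> i)"
      by (intro prod_mono conjI power_mono Finite_Cartesian_Product.norm_nth_le) auto
    also have "\<dots> = norm z ^ k" using that by (simp add: power_sum[symmetric] multi_indices_def)
    finally show ?thesis .
  qed
  have "norm (P z) \<le> (\<Sum>\<alpha>\<in>multi_indices s. \<Sum>\<beta>\<in>multi_indices t. norm (c \<alpha> \<beta>)) * fact (s + t) * exp (norm z)" for z
  proof -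
    have "norm (P z) \<le> (\<Sum>\<alpha>\<in>multi_indices s. \<Sum>\<beta>\<in>multi_indices t. norm (c \<alpha> \<beta>) * norm z ^ (s + t))"
      unfolding c
    proof (intro sum_norm_le)
      fix \<alpha> \<beta> assume a: "\<alpha> \<in> (multi_indices s :: ('a \<Rightarrow> nat) set)" "\<beta> \<in> (multi_indices t :: ('a \<Rightarrow> nat) set)"
      have "norm (c \<alpha> \<beta> * (\<Prod>i\<in>UNIV. z $ i ^ \<alpha> i) * (\<Prod>i\<in>UNIV. cnj (z $ i) ^ \<beta> i)) = norm (c \<alpha> \<beta>) * (\<Prod>i\<in>UNIV. norm (z $ i) ^ \<alpha> i) * (\<Prod>i\<in>UNIV. norm (z $ i) ^ \<beta> i)"
        by (simp add: norm_mult prod_norm[symmetric] norm_power)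
      also have "\<dots> \<le> norm (c \<alpha> \<beta>) * norm z ^ s * norm z ^ t"
        using a by (intro mult_mono mult_left_mono pb) (auto intro!: prod_nonneg)
      finally show "norm (c \<alpha> \<beta> * (\<Prod>i\<in>UNIV. z $ i ^ \<alpha> i) * (\<Prod>i\<in>UNIV. cnj (z $ i) ^ \<beta> i)) \<le> norm (c \<alpha> \<beta>) * norm z ^ (s + t)"
        by (simp add: power_add)
    qed
    also have "\<dots> = (\<Sum>\<alpha>\<in>multi_indices s. \<Sum>\<beta>\<in>multi_indices t. norm (c \<alpha> \<beta>)) * norm z ^ (s + t)"
      by (simp only: sum_distrib_right)
    also have "\<dots> \<le> (\<Sum>\<alpha>\<in>multi_indices s. \<Sum>\<beta>\<in>multi_indices t. norm (c \<alpha> \<beta>)) * (fact (s + t) / 1 ^ (s + t) * exp (1 * norm z))"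
      by (intro mult_left_mono power_le_fact_exp sum_nonneg) auto
    finally show ?thesis by (simp add: mult.assoc)
  qed
  then show ?thesis by (rule that)
qed

section \<open>From twisted means to the kernel relation\<close>

lemma integral_reflect:
  fixes f :: "'a::euclidean_space \<Rightarrow> complex"
  assumes [measurable]: "f \<in> borel_measurable borel"
  shows "(LINT w|lborel. f (z - w)) = (LINT u|lborel. f u)"
    and "integrable lborel f \<Longrightarrow> integrable lborel (\<lambda>w. f (z - w))"
proof -
  have d: "lborel = distr lborel borel (\<lambda>x::'a. z + (-1) *\<^sub>R x)"
    using lborel_affine[of "-1::real" z] by (simp add: density_1)
  show "(LINT w|lborel. f (z - w)) = (LINT u|lborel. f u)"
    by (subst (2) d, subst integral_distr) auto
  show "integrable lborel (\<lambda>w. f (z - w))" if "integrable lborel f"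
    using that by (subst (asm) d, subst (asm) integrable_distr_eq) auto
qed

lemma null_sets_reflect:
  assumes N: "N \<in> null_sets (lborel :: 'a::euclidean_space measure)"
  shows "{w. z - w \<in> N} \<in> null_sets lborel"
proof -
  have [measurable]: "N \<in> sets borel" using N by auto
  have d: "lborel = distr lborel borel (\<lambda>x::'a. z + (-1) *\<^sub>R x)"
    using lborel_affine[of "-1::real" z] by (simp add: density_1)
  have "AE u in lborel. u \<notin> N" using N by (rule AE_not_in)
  then have "AE w in lborel. z + (-1) *\<^sub>R w \<notin> N"
    by (subst (asm) d, subst (asm) AE_distr_iff) auto
  then show ?thesis by (subst AE_iff_null_sets) auto
qed

text \<open>Needed because the integrand of a twisted mean is only almost everywhere equal to a Borel function.\<close>

lemma AE_eq_measurable_completion: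
  assumes g: "g \<in> borel_measurable M" and e: "AE x in M. h x = g x"
  shows "h \<in> borel_measurable (completion M)"
proof (rule measurableI)
  fix A :: "'b set" assume A: "A \<in> sets borel"
  show "h -` A \<inter> space (completion M) \<in> sets (completion M)"
  proof (rule completion.in_sets_AE)
    show "g -` A \<inter> space M \<in> sets (completion M)"
      using measurable_sets[OF g A] by (rule sets_completionI_sets)
    have "AE x in completion M. h x = g x" using e by (rule AE_completion)
    then show "AE x in completion M. (x \<in> g -` A \<inter> space M) = (x \<in> h -` A \<inter> space (completion M))"
      by eventually_elim simp
  qed auto
qed simp

lemma complex_borel_version:
  fixes f :: "'a::euclidean_space \<Rightarrow> complex"
  assumes f: "f \<in> borel_measurable lebesgue"
  obtains f' where "f' \<in> borel_measurable borel" "AE x in lborel. f x = f' x"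
proof -
  have re: "(\<lambda>x. Re (f x)) \<in> borel_measurable lebesgue" and im: "(\<lambda>x. Im (f x)) \<in> borel_measurable lebesgue"
    using f by measurable
  obtain g where g: "g \<in> borel_measurable lborel" "AE x in lborel. Re (f x) = g x"
    using completion_ex_borel_measurable_real[OF re] by blast
  obtain h where h: "h \<in> borel_measurable lborel" "AE x in lborel. Im (f x) = h x"
    using completion_ex_borel_measurable_real[OF im] by blast
  show ?thesis
  proof (rule that)
    show "(\<lambda>x. complex_of_real (g x) + \<i> * of_real (h x)) \<in> borel_measurable borel" using g(1) h(1) by measurable
    show "AE x in lborel. f x = complex_of_real (g x) + \<i> * of_real (h x)"
      using g(2) h(2) by eventually_elim (simp add: complex_eq_iff)
  qed
qed

lemma twisted_mean_eq_usphere: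
  fixes f f' :: "complex ^ 'n::finite \<Rightarrow> complex"
  assumes f': "f' \<in> borel_measurable borel" and e: "AE x in lborel. f x = f' x" and v: "v \<in> borel_measurable borel"
  shows "AE \<rho> in lborel. \<rho> > 0 \<longrightarrow> twisted_mean f \<rho> v z = (LINT w|usphere \<rho>. f' (z - w) * exp (\<i> / 2 * of_real (Im (hermitian_dot z w))) * v w)"
proof -
  obtain N where N: "{x \<in> space lborel. \<not> f x = f' x} \<subseteq> N" "N \<in> null_sets lborel"
    using e unfolding eventually_ae_filter by blast
  show ?thesis
    using null_sets_usphere_AE[OF null_sets_reflect[OF N(2), of z]]
  proof eventually_elim
    case (elim \<rho>)
    show ?case
    proof
      assume "\<rho> > 0"
      then have "AE w in usphere \<rho>. w \<notin> {w. z - w \<in> N}" using elim AE_not_in by blast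
      then have ae: "AE w in usphere \<rho>. f (z - w) = f' (z - w)"
        by eventually_elim (use N(1) in auto)
      let ?h = "\<lambda>w. f (z - w) * exp (\<i> / 2 * of_real (Im (hermitian_dot z w))) * v w"
      let ?g = "\<lambda>w. f' (z - w) * exp (\<i> / 2 * of_real (Im (hermitian_dot z w))) * v w"
      have "(\<lambda>w. exp (\<i> / 2 * of_real (Im (hermitian_dot z w)))) \<in> borel_measurable borel"
        unfolding hermitian_dot_def by (intro borel_measurable_continuous_onI continuous_intros)
      moreover have "(\<lambda>w. f' (z - w)) \<in> borel_measurable borel"
        by (rule measurable_compose[OF _ f']) measurable
      ultimately have "?g \<in> borel_measurable borel" using v by (intro borel_measurable_times)
      then have gm: "?g \<in> borel_measurable (usphere \<rho>)" by (simp cong: measurable_cong_sets)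
      have hg: "AE w in usphere \<rho>. ?h w = ?g w" using ae by eventually_elim simp
      have "twisted_mean f \<rho> v z = (LINT w|completion (usphere \<rho>). ?h w)"
        unfolding twisted_mean_def sphere_measure_eq ..
      also have "\<dots> = (LINT w|completion (usphere \<rho>). ?g w)"
        by (rule Bochner_Integration.integral_cong_AE[OF AE_eq_measurable_completion[OF gm hg] measurable_completion[OF gm] AE_completion[OF hg]])
      also have "\<dots> = (LINT w|usphere \<rho>. ?g w)" by (rule integral_completion[OF gm])
      finally show "twisted_mean f \<rho> v z = (LINT w|usphere \<rho>. ?g w)" .
    qed
  qed
qed

text \<open>No measurability in \<open>\<rho>\<close> has to be checked: an integrand that vanishes almost everywhere has integral \<open>0\<close>.\<close>

lemma polar_vanish:
  fixes F :: "'a::euclidean_space \<Rightarrow> complex"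
  assumes "integrable lborel F" and z: "AE \<rho> in lborel. \<rho> > 0 \<longrightarrow> (LINT w|usphere \<rho>. F w) = 0"
  shows "(LINT w|lborel. F w) = 0"
  unfolding polar_usphere[OF assms(1)]
proof (rule integral_eq_zero_AE)
  show "AE \<rho> in lborel. (indicat_real {0<..} \<rho> * (measure lborel (ball (0::'a) 1) * real DIM('a) * \<rho> ^ (DIM('a) - 1))) *\<^sub>R (LINT w|usphere \<rho>. F w) = 0"
    using z by eventually_elim (auto simp: indicator_def)
qed

context twisted_transform begin

text \<open>The kernel obtained from \<open>f(u) exp((\<i>/2) Im(cnj z\<cdot>u))\<close> and the radial weight
\<open>exp(-(1/4 - \<tau>/2) |z - u|^2)\<close>, up to a factor that depends on \<open>z\<close> alone; see \<open>twisted_kernel_reflect\<close>.\<close>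

definition twisted_kernel :: "real \<Rightarrow> complex ^ 'n \<Rightarrow> complex ^ 'n \<Rightarrow> complex" where
  "twisted_kernel \<tau> z u = f0 u * exp (of_real \<tau> * of_real ((norm u)\<^sup>2) / 2 + bdot (- (of_real \<tau> / 2) *s z) (vcnj u) + bdot (of_real ((1 - \<tau>) / 2) *s vcnj z) u)"

lemma twisted_kernel_measurable [measurable]: "twisted_kernel \<tau> z \<in> borel_measurable borel"
  unfolding twisted_kernel_def[abs_def] by measurable

lemma twisted_kernel_integrable:
  assumes \<tau>: "\<tau> < 1" and [measurable]: "v \<in> borel_measurable borel" and b: "\<And>w. norm (v w) \<le> K * exp (norm w)"
  shows "integrable lborel (\<lambda>u. twisted_kernel \<tau> z u * v (z - u))"
proof -
  define W where "W = norm (- (complex_of_real \<tau> / 2) *s z) + norm (complex_of_real ((1 - \<tau>) / 2) *s vcnj z)"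
  have K: "K \<ge> 0" using order_trans[OF norm_ge_zero b[of 0]] by simp
  show ?thesis
  proof (rule Bochner_Integration.integrable_bound)
    show "integrable lborel (\<lambda>u. K * exp (norm z) * (norm (f0 u) * exp (\<tau> * (norm u)\<^sup>2 / 2 + (W + 1) * norm u)))"
      by (intro integrable_mult_right integrable_f0_exp \<tau>)
    show "AE u in lborel. norm (twisted_kernel \<tau> z u * v (z - u)) \<le> norm (K * exp (norm z) * (norm (f0 u) * exp (\<tau> * (norm u)\<^sup>2 / 2 + (W + 1) * norm u)))"
    proof (rule AE_I2)
      fix u
      let ?e1 = "bdot (- (complex_of_real \<tau> / 2) *s z) (vcnj u)" and ?e2 = "bdot (complex_of_real ((1 - \<tau>) / 2) *s vcnj z) u"
      have "Re ?e1 \<le> norm (- (complex_of_real \<tau> / 2) *s z) * norm u" "Re ?e2 \<le> norm (complex_of_real ((1 - \<tau>) / 2) *s vcnj z) * norm u"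
        using order_trans[OF complex_Re_le_cmod norm_bdot_le[of "- (complex_of_real \<tau> / 2) *s z" "vcnj u"]]
          order_trans[OF complex_Re_le_cmod norm_bdot_le[of "complex_of_real ((1 - \<tau>) / 2) *s vcnj z" u]] by (simp_all only: norm_vcnj)
      then have "Re (of_real \<tau> * of_real ((norm u)\<^sup>2) / 2 + ?e1 + ?e2) \<le> \<tau> * (norm u)\<^sup>2 / 2 + W * norm u"
        unfolding plus_complex.sel W_def distrib_right by simp
      then have 1: "norm (twisted_kernel \<tau> z u) \<le> norm (f0 u) * exp (\<tau> * (norm u)\<^sup>2 / 2 + W * norm u)"
        unfolding twisted_kernel_def norm_mult norm_exp_eq_Re by (intro mult_left_mono) auto
      have "norm (v (z - u)) \<le> K * exp (norm (z - u))" by (rule b)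
      also have "\<dots> \<le> K * exp (norm z + norm u)" using K norm_triangle_ineq4[of z u] by (intro mult_left_mono) auto
      finally have 2: "norm (v (z - u)) \<le> K * exp (norm z + norm u)" .
      have "norm (twisted_kernel \<tau> z u * v (z - u)) \<le> (norm (f0 u) * exp (\<tau> * (norm u)\<^sup>2 / 2 + W * norm u)) * (K * exp (norm z + norm u))"
        unfolding norm_mult using 1 2 by (intro mult_mono) auto
      also have "\<dots> = K * exp (norm z) * (norm (f0 u) * exp (\<tau> * (norm u)\<^sup>2 / 2 + (W + 1) * norm u))"
        by (simp add: distrib_right exp_add)
      finally show "norm (twisted_kernel \<tau> z u * v (z - u)) \<le> norm (K * exp (norm z) * (norm (f0 u) * exp (\<tau> * (norm u)\<^sup>2 / 2 + (W + 1) * norm u)))"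
        unfolding real_norm_def by (rule order_trans[OF _ abs_ge_self])
    qed
  qed measurable
qed

lemma Omega_integral_ker:
  assumes \<tau>: "\<tau> < 1"
  shows "(LINT \<omega>|Omega. lifted_f0 \<omega> * exp (of_real \<tau> * (lift_xy \<omega> / 2) + bdot (- (of_real \<tau> / 2) *s z) (lift_x \<omega>) + bdot (of_real ((1 - \<tau>) / 2) *s vcnj z) (lift_y \<omega>)))
    = (- (of_real \<tau> / 2)) ^ s * of_real ((1 - \<tau>) / 2) ^ t / (fact s * fact t) * (LINT u|lborel. twisted_kernel \<tau> z u * (bdot \<alpha> (z - u) ^ s * bdot \<beta> (vcnj (z - u)) ^ t))"
proof -
  let ?c1 = "- (complex_of_real \<tau> / 2)" and ?c2 = "complex_of_real ((1 - \<tau>) / 2)"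
  have cc: "circle_coeff k 0 A B D = D ^ k / fact k" for k A B D by (simp add: circle_coeff_def)
  have D1: "bdot (?c1 *s z) \<alpha> + complex_of_real \<tau> / 2 * bdot \<alpha> u = ?c1 * bdot \<alpha> (z - u)" for u
    unfolding bdot_simps bdot_commute[of z \<alpha>] by (simp add: algebra_simps)
  have D2: "bdot (?c2 *s vcnj z) \<beta> - (1 - complex_of_real \<tau>) / 2 * bdot \<beta> (vcnj u) = ?c2 * bdot \<beta> (vcnj (z - u))" for u
    unfolding bdot_simps vcnj_simps bdot_commute[of "vcnj z" \<beta>] by (simp add: algebra_simps)
  have "Re (complex_of_real \<tau>) < 1" using \<tau> by simp
  from Omega_integral_term[OF this, of 0 0 0 0 "?c1 *s z" "?c2 *s vcnj z"]
  have "(LINT \<omega>|Omega. lifted_f0 \<omega> * exp (of_real \<tau> * (lift_xy \<omega> / 2) + bdot (?c1 *s z) (lift_x \<omega>) + bdot (?c2 *s vcnj z) (lift_y \<omega>)))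
    = (LINT u|lborel. f0 u * exp (of_real \<tau> * of_real ((norm u)\<^sup>2) / 2 + bdot (?c1 *s z) (vcnj u) + bdot (?c2 *s vcnj z) u)
        * ((?c1 * bdot \<alpha> (z - u)) ^ s / fact s) * ((?c2 * bdot \<beta> (vcnj (z - u))) ^ t / fact t))"
    unfolding cc D1 D2 by (simp only: power_0 mult_1_right)
  also have "\<dots> = (LINT u|lborel. ?c1 ^ s * ?c2 ^ t / (fact s * fact t) * (twisted_kernel \<tau> z u * (bdot \<alpha> (z - u) ^ s * bdot \<beta> (vcnj (z - u)) ^ t)))"
    unfolding twisted_kernel_def power_mult_distrib by (intro Bochner_Integration.integral_cong refl) (simp only: times_divide_eq_left times_divide_eq_right divide_divide_eq_left mult_ac)
  finally show ?thesis unfolding integral_mult_right_zero .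
qed

lemma twisted_kernel_reflect:
  assumes f': "\<And>u. f0 u = f' u * exp (- of_real ((norm u)\<^sup>2 / 4))"
  shows "f' (z - w) * exp (\<i> / 2 * of_real (Im (hermitian_dot z w))) * v w * of_real (exp (- ((1/4 - \<tau>/2) * (norm w)\<^sup>2)))
    = of_real (exp (- ((1/4 - \<tau>/2) * (norm z)\<^sup>2))) * (twisted_kernel \<tau> z (z - w) * v w)"
proof -
  let ?q = "bdot (vcnj z) w" and ?r = "complex_of_real ((norm z)\<^sup>2)" and ?\<rho> = "complex_of_real ((norm w)\<^sup>2)"
  have cq: "bdot z (vcnj w) = cnj ?q" by (simp add: cnj_bdot)
  have hd: "hermitian_dot z w = cnj ?q" unfolding cq[symmetric] by (simp add: hermitian_dot_def bdot_def)
  have nu: "complex_of_real ((norm (z - w))\<^sup>2) = ?r - ?q - cnj ?q + ?\<rho>"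
    unfolding bdot_vcnj_self(1)[symmetric] vcnj_simps bdot_simps cq[symmetric] by (simp add: bdot_commute)
  have im: "\<i> / 2 * of_real (Im (hermitian_dot z w)) = (cnj ?q - ?q) / 4"
    unfolding hd by (simp add: complex_eq_iff)
  have f1: "f' (z - w) = f0 (z - w) * exp (complex_of_real ((norm (z - w))\<^sup>2) / 4)"
    unfolding f' mult.assoc mult_exp_exp by simp
  have k: "twisted_kernel \<tau> z (z - w) = f0 (z - w) * exp (of_real \<tau> * of_real ((norm (z - w))\<^sup>2) / 2 + - (of_real \<tau> / 2) * (?r - cnj ?q) + of_real ((1 - \<tau>) / 2) * (?r - ?q))"
    unfolding twisted_kernel_def bdot_simps vcnj_simps cq bdot_vcnj_self by (simp only: right_diff_distrib)
  have E: "complex_of_real ((norm (z - w))\<^sup>2) / 4 + (cnj ?q - ?q) / 4 + of_real (- ((1/4 - \<tau>/2) * (norm w)\<^sup>2))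
     = of_real (- ((1/4 - \<tau>/2) * (norm z)\<^sup>2)) + (of_real \<tau> * of_real ((norm (z - w))\<^sup>2) / 2 + - (of_real \<tau> / 2) * (?r - cnj ?q) + of_real ((1 - \<tau>) / 2) * (?r - ?q))"
    unfolding nu by (simp add: field_simps)
  have "f' (z - w) * exp (\<i> / 2 * of_real (Im (hermitian_dot z w))) * v w * of_real (exp (- ((1/4 - \<tau>/2) * (norm w)\<^sup>2)))
    = f0 (z - w) * v w * exp (complex_of_real ((norm (z - w))\<^sup>2) / 4 + (cnj ?q - ?q) / 4 + of_real (- ((1/4 - \<tau>/2) * (norm w)\<^sup>2)))"
    unfolding f1 im exp_add exp_of_real by (simp only: mult_ac)
  also have "\<dots> = of_real (exp (- ((1/4 - \<tau>/2) * (norm z)\<^sup>2))) * (twisted_kernel \<tau> z (z - w) * v w)"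
    unfolding E k exp_add[of "complex_of_real (- ((1/4 - \<tau>/2) * (norm z)\<^sup>2))"] exp_of_real by (simp only: mult_ac)
  finally show ?thesis .
qed

text \<open>Polar coordinates around \<open>z\<close>: on each sphere the radial weight is constant and the inner integral
is a twisted mean.\<close>

lemma twisted_kernel_integral_zero:
  assumes f': "\<And>u. f0 u = f' u * exp (- of_real ((norm u)\<^sup>2 / 4))" "f' \<in> borel_measurable borel"
    and v: "v \<in> borel_measurable borel" and int: "integrable lborel (\<lambda>u. twisted_kernel \<tau> z u * v (z - u))"
    and Z: "AE \<rho> in lborel. \<rho> > 0 \<longrightarrow> (LINT w|usphere \<rho>. f' (z - w) * exp (\<i> / 2 * of_real (Im (hermitian_dot z w))) * v w) = 0"
  shows "(LINT u|lborel. twisted_kernel \<tau> z u * v (z - u)) = 0"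
proof -
  let ?F1 = "\<lambda>w. f' (z - w) * exp (\<i> / 2 * of_real (Im (hermitian_dot z w))) * v w"
  let ?e = "\<lambda>w :: complex ^ 'n. complex_of_real (exp (- ((1/4 - \<tau>/2) * (norm w)\<^sup>2)))"
  let ?\<Phi> = "\<lambda>u. twisted_kernel \<tau> z u * v (z - u)"
  have [measurable]: "(\<lambda>u. v (z - u)) \<in> borel_measurable borel" by (rule measurable_compose[OF _ v]) measurable
  have \<Phi>m: "?\<Phi> \<in> borel_measurable borel" by measurable
  have eq: "?F1 w * ?e w = ?e z * ?\<Phi> (z - w)" for w
    using twisted_kernel_reflect[OF f'(1), of z w v \<tau>] by simp
  have "(\<lambda>w. exp (\<i> / 2 * complex_of_real (Im (hermitian_dot z w)))) \<in> borel_measurable borel"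
    unfolding hermitian_dot_def by (intro borel_measurable_continuous_onI continuous_intros)
  moreover have "(\<lambda>w. f' (z - w)) \<in> borel_measurable borel"
    by (rule measurable_compose[OF _ f'(2)]) measurable
  ultimately have F1m: "?F1 \<in> borel_measurable borel" using v by (intro borel_measurable_times)
  have em: "?e \<in> borel_measurable borel" by measurable
  have "integrable lborel (\<lambda>w. ?e z * ?\<Phi> (z - w))"
    by (intro integrable_mult_right integral_reflect(2)[OF \<Phi>m int])
  then have Fint: "integrable lborel (\<lambda>w. ?F1 w * ?e w)" unfolding eq .
  have "(LINT w|lborel. ?F1 w * ?e w) = 0"
  proof (rule polar_vanish[OF Fint])
    show "AE \<rho> in lborel. \<rho> > 0 \<longrightarrow> (LINT w|usphere \<rho>. ?F1 w * ?e w) = 0"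
      using Z
    proof eventually_elim
      case (elim \<rho>)
      show ?case
      proof
        assume \<rho>: "\<rho> > 0"
        have "(LINT w|usphere \<rho>. ?F1 w * ?e w) = (LINT w|usphere \<rho>. ?F1 w * of_real (exp (- ((1/4 - \<tau>/2) * \<rho>\<^sup>2))))"
        proof (rule Bochner_Integration.integral_cong_AE)
          show "(\<lambda>w. ?F1 w * ?e w) \<in> borel_measurable (usphere \<rho>)" "(\<lambda>w. ?F1 w * of_real (exp (- ((1/4 - \<tau>/2) * \<rho>\<^sup>2)))) \<in> borel_measurable (usphere \<rho>)"
            using F1m em by (simp_all cong: measurable_cong_sets)
          show "AE w in usphere \<rho>. ?F1 w * ?e w = ?F1 w * of_real (exp (- ((1/4 - \<tau>/2) * \<rho>\<^sup>2)))"
            using norm_usphere[of \<rho>] by eventually_elim simp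
        qed
        also have "\<dots> = (LINT w|usphere \<rho>. ?F1 w) * of_real (exp (- ((1/4 - \<tau>/2) * \<rho>\<^sup>2)))" by (rule integral_mult_left_zero)
        finally show "(LINT w|usphere \<rho>. ?F1 w * ?e w) = 0" using elim \<rho> by simp
      qed
    qed
  qed
  then have "?e z * (LINT w|lborel. ?\<Phi> (z - w)) = 0" unfolding eq integral_mult_right_zero .
  moreover have "?e z \<noteq> 0" by simp
  ultimately have "(LINT w|lborel. ?\<Phi> (z - w)) = 0" using mult_eq_0_iff by blast
  then show ?thesis unfolding integral_reflect(1)[OF \<Phi>m] .
qed

end

section \<open>Injectivity of the weighted twisted means\<close>

theorem theorem1p3:
  fixes s t :: nat and R p :: real
    and P :: "nat \<Rightarrow> complex ^ 'n::finite \<Rightarrow> complex"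
    and f :: "complex ^ 'n \<Rightarrow> complex"
  assumes "(bigraded_harmonics s t :: (complex ^ 'n \<Rightarrow> complex) set) \<noteq> {0}"
    and "orthonormal_basis_harmonics s t P"
    and "R > 0"
    and "1 \<le> p"
    and "in_Lp p lebesgue (\<lambda>z. complex_of_real (exp ((norm z)\<^sup>2 / 4)) * f z)"
    and "\<And>z r j. norm z = R \<Longrightarrow> r > 0 \<Longrightarrow>
           j \<in> {1..cfun.dim (bigraded_harmonics s t :: (complex ^ 'n \<Rightarrow> complex) set)} \<Longrightarrow>
           twisted_mean f r (P j) z = 0"
  shows "AE z in lebesgue. f z = 0"
proof -
  let ?H = "bigraded_harmonics s t :: (complex ^ 'n \<Rightarrow> complex) set"
  let ?d = "cfun.dim ?H"
  let ?G = "\<lambda>z. complex_of_real (exp ((norm z)\<^sup>2 / 4)) * f z"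
  have Gm: "?G \<in> borel_measurable lebesgue" and Gp: "integrable lebesgue (\<lambda>z. norm (?G z) powr p)"
    using assms(5) unfolding in_Lp_def by auto
  have fm: "f \<in> borel_measurable lebesgue"
  proof -
    have "(\<lambda>z :: complex ^ 'n. complex_of_real (exp (- ((norm z)\<^sup>2 / 4)))) \<in> borel_measurable lborel" by measurable
    then have "(\<lambda>z. complex_of_real (exp (- ((norm z)\<^sup>2 / 4))) * ?G z) \<in> borel_measurable lebesgue"
      by (intro borel_measurable_times Gm measurable_completion)
    moreover have "complex_of_real (exp (- ((norm z)\<^sup>2 / 4))) * ?G z = f z" for z
      by (simp add: exp_minus flip: exp_of_real)
    ultimately show ?thesis by simp
  qed
  obtain f' where f'm [measurable]: "f' \<in> borel_measurable borel" and f'e: "AE x in lborel. f x = f' x"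
    using complex_borel_version[OF fm] by blast
  define f0 where "f0 u = f' u * exp (- of_real ((norm u)\<^sup>2 / 4))" for u
  have f0m: "f0 \<in> borel_measurable borel" unfolding f0_def[abs_def] by measurable
  have gp: "integrable lborel (\<lambda>u. (norm (f0 u) * exp ((norm u)\<^sup>2 / 2)) powr p)"
  proof -
    have e: "norm (f0 u) * exp ((norm u)\<^sup>2 / 2) = norm (complex_of_real (exp ((norm u)\<^sup>2 / 4)) * f' u)" for u
    proof -
      have "norm (exp (- complex_of_real ((norm u)\<^sup>2 / 4))) = exp (- ((norm u)\<^sup>2 / 4))" by (simp add: norm_exp_eq_Re)
      then have "norm (f0 u) * exp ((norm u)\<^sup>2 / 2) = norm (f' u) * (exp (- ((norm u)\<^sup>2 / 4)) * exp ((norm u)\<^sup>2 / 2))"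
        unfolding f0_def norm_mult by simp
      also have "\<dots> = norm (f' u) * exp ((norm u)\<^sup>2 / 4)" unfolding mult_exp_exp by simp
      finally show ?thesis by (simp add: norm_mult)
    qed
    have "integrable lebesgue (\<lambda>u. norm (complex_of_real (exp ((norm u)\<^sup>2 / 4)) * f' u) powr p)"
    proof (rule integrable_cong_AE_imp[OF Gp])
      show "(\<lambda>u. norm (complex_of_real (exp ((norm u)\<^sup>2 / 4)) * f' u) powr p) \<in> borel_measurable lebesgue"
        by (rule measurable_completion) measurable
      show "AE u in lebesgue. norm (?G u) powr p = norm (complex_of_real (exp ((norm u)\<^sup>2 / 4)) * f' u) powr p"
        using AE_completion[OF f'e] by eventually_elim simp
    qed
    then show ?thesis unfolding e by (subst (asm) integrable_completion) auto
  qed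
  obtain \<alpha> \<beta> :: "complex ^ 'n" where ab: "bdot \<alpha> \<beta> = 0" "s = 0 \<or> (\<exists>i. \<alpha> = axis i 1)" "t = 0 \<or> (\<exists>j. \<beta> = axis j 1)"
    and M: "(\<lambda>w. bdot \<alpha> w ^ s * bdot \<beta> (vcnj w) ^ t) \<in> ?H"
    using highest_weight_harmonic_exists[OF assms(1)] by blast
  interpret twisted_transform f0 \<alpha> \<beta> s t p
    by unfold_locales (use f0m assms(4) gp ab in auto)
  have PH: "P j \<in> ?H" if "j \<in> {1..?d}" for j
    using assms(2) that unfolding orthonormal_basis_harmonics_def Let_def by blast
  have sp: "cfun.span (P ` {1..?d}) = ?H"
    using assms(2) unfolding orthonormal_basis_harmonics_def Let_def by blast
  have K0: "(LINT u|lborel. twisted_kernel \<tau> z u * (bdot \<alpha> (z - u) ^ s * bdot \<beta> (vcnj (z - u)) ^ t)) = 0"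
    if z: "norm z = R" and \<tau>: "\<tau> < 1" for z \<tau>
  proof -
    \<comment> \<open>The relation is linear in the harmonic, so it passes from the basis to the span.\<close>
    let ?Q = "\<lambda>v. integrable lborel (\<lambda>u. twisted_kernel \<tau> z u * v (z - u)) \<and> (LINT u|lborel. twisted_kernel \<tau> z u * v (z - u)) = 0"
    have "?Q (\<lambda>w. bdot \<alpha> w ^ s * bdot \<beta> (vcnj w) ^ t)"
    proof (rule cfun.span_induct[of _ "P ` {1..?d}" ?Q])
      show "(\<lambda>w. bdot \<alpha> w ^ s * bdot \<beta> (vcnj w) ^ t) \<in> cfun.span (P ` {1..?d})" unfolding sp by (rule M)
      show "cfun.subspace (Collect ?Q)"
        unfolding cfun.subspace_def
        by (auto simp: cscale_def distrib_left mult.left_commute[of _ "_ :: complex" "_ (z - _)"])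
      fix v assume "v \<in> P ` {1..?d}"
      then obtain j where j: "j \<in> {1..?d}" "v = P j" by blast
      have vb: "v \<in> bihomogeneous_polys s t" using PH[OF j(1)] j(2) unfolding bigraded_harmonics_def by blast
      have vm: "v \<in> borel_measurable borel"
        by (rule borel_measurable_continuous_onI[OF bihomogeneous_continuous[OF vb]])
      obtain K where K: "\<And>w. norm (v w) \<le> K * exp (norm w)" using bihomogeneous_exp_bound[OF vb] by blast
      have I: "integrable lborel (\<lambda>u. twisted_kernel \<tau> z u * v (z - u))" by (rule twisted_kernel_integrable[OF \<tau> vm K])
      have "AE \<rho> in lborel. \<rho> > 0 \<longrightarrow> (LINT w|usphere \<rho>. f' (z - w) * exp (\<i> / 2 * of_real (Im (hermitian_dot z w))) * v w) = 0"
        using twisted_mean_eq_usphere[OF f'm f'e vm, of z]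
      proof eventually_elim
        case (elim \<rho>)
        then show ?case using assms(6)[OF z _ j(1), of \<rho>] j(2) by auto
      qed
      then show "?Q v" using twisted_kernel_integral_zero[OF f0_def f'm vm I] I by blast
    qed
    then show ?thesis by blast
  qed
  have cond: "(LINT \<omega>|Omega. lifted_f0 \<omega> * exp (of_real t' * (lift_xy \<omega> / 2) + bdot (- (of_real t' / 2) *s z) (lift_x \<omega>) + bdot (of_real ((1 - t') / 2) *s vcnj z) (lift_y \<omega>))) = 0"
    if "norm z = R" "0 < t'" "t' < 1" for z t'
    unfolding Omega_integral_ker[OF that(3)] K0[OF that(1,3)] by simp
  have "moment \<eta> v a b 0 = 0" for \<eta> v a b
    by (rule moment_vanish[OF assms(3) cond]) auto
  then have "AE u in lborel. f0 u = 0" by (rule f0_vanish[OF _ ab(2,3)])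
  then have "AE u in lborel. f u = 0" using f'e by eventually_elim (simp add: f0_def)
  then show ?thesis by (rule AE_completion)
qed

end
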